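(* Fix integers $1\le d<D$, reals $0<f_{min}\le f_{max}<\infty$, $\rho>0$, $0<\beta\le1$. For a suitable choice of the tuning constants $k_1,k_2,c,t,c'$ in the definition of $\hat M_{\mathtt{TDC}+}$ (see context), $\hat M_{\mathtt{TDC}+}=\hat M_{\mathtt{TDC}+}(\mathbb{X}_n)$ is a simplicial complex with vertices contained in $\mathbb{X}_n$ such that, for constants $C,C'>0$ depending only on $d,f_{min},f_{max},\rho$, when $\mathbb{X}_n$ is an i.i.d. $n$-sample from a distribution in $\mathcal{O}_{D,d,f_{min},f_{max},\rho,\beta}$ with associated submanifold $M$, $$\lim_{n\to\infty}\mathbb{P}\left(d_H(M,\hat M_{\mathtt{TDC}+})\le C\left(\frac{\log n}{\beta n}\right)^{2/d}\ \text{ and }\ M\cong\hat M_{\mathtt{TDC}+}\right)=1.$$ Moreover, for $n$ large enough, $$\sup_{P\in\mathcal{O}_{D,d,f_{min},f_{max},\rho,\beta}}\mathbb{E}_P\, d_H(M,\hat M_{\mathtt{TDC}+})\le C'\left(\frac{\log n}{\beta n}\right)^{2/d}.$$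
   Context: Notation: $\|\cdot\|$ is the Euclidean norm, $\mathcal{B}(x,r)$ the closed Euclidean ball, $d_H$ the Hausdorff distance, $d(x,A)$ the distance to a set, $\cong$ the ambient isotopy relation in $\mathbb{R}^D$ (a simplicial complex is identified with its underlying subset of $\mathbb{R}^D$). Models. $\mathrm{med}(M)=\{x:\exists a\ne b\in M,\ \|x-a\|=\|x-b\|=d(x,M)\}$ and $\mathrm{reach}(M)=\inf_{p\in M}d(p,\mathrm{med}(M))$. $\mathcal{M}_{D,d,\rho}$ is the set of compact connected $d$-dimensional submanifolds $M\subset\mathbb{R}^D$ without boundary with $\mathrm{reach}(M)\ge\rho$; $v_M$ is the $d$-dimensional Hausdorff measure restricted to $M$. $\mathcal{U}_M(f_{min},f_{max})$ is the set of probability distributions with a density $f$ with respect to $v_M$ such that $f_{min}\le f\le f_{max}$ on $M$; $\mathcal{G}_{D,d,f_{min},f_{max},\rho}=\bigcup_{M\in\mathcal{M}_{D,d,\rho}}\mathcal{U}_M(f_{min},f_{max})$. There is $C_d>0$ such that the support $M$ of every $Q\in\mathcal{G}_{D,d,f_{min},f_{max},\rho}$ has $\mathrm{diam}(M)\le K_{d,f_{min},\rho}:=C_d/(\rho^{d-1}f_{min})$; set $K_0=K_{d,f_{min},\rho}+\rho$ and $\mathcal{B}_0=\mathcal{B}(0,K_0)$. $\mathcal{O}_{D,d,f_{min},f_{max},\rho,\beta}$ is the set of mixtures $P=\beta Q+(1-\beta)U_{\mathcal{B}_0}$, with $Q\in\mathcal{G}_{D,d,f_{min},f_{max},\rho}$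 whose support $M$ (the associated submanifold) contains $0$, and $U_{\mathcal{B}_0}$ the uniform distribution on $\mathcal{B}_0$. $\mathbb{E}_P$ is expectation with respect to an i.i.d. $n$-sample $\mathbb{X}_n=\{X_1,\dots,X_n\}$ from $P$. Tangential Delaunay Complex. For a finite $\mathcal{P}\subset\mathbb{R}^D$ and a weight assignment $\omega:\mathcal{P}\to[0,\infty)$, let $d(x,p^\omega)^2=\|x-p\|^2-\omega(p)^2$, $\mathrm{Vor}^\omega(p)=\{x: d(x,p^\omega)^2\le d(x,q^\omega)^2\ \forall q\in\mathcal{P}\}$, $\mathrm{Vor}^\omega(\tau)=\bigcap_{p\in\tau}\mathrm{Vor}^\omega(p)$. $\mathrm{Del}^\omega(\mathcal{P})$ consists of the simplices $\tau\subset\mathcal P$ with $\mathrm{Vor}^\omega(\tau)\ne\emptyset$. Given a family $T=\{T_p\}_{p\in\mathcal{P}}$ of $d$-dimensional linear subspaces, identified with the affine spaces $p+T_p$, $\mathrm{Del}^\omega(\mathcal{P},T)$ is the subcomplex of simplices $\tau$ with $\mathrm{Vor}^\omega(\tau)\cap\bigcup_{p\in\tau}(p+T_p)\ne\emptyset$. $\omega_*=\omega_{*\mathcal{P},T}$ is the weight assignment of Boissonnat and Ghosh, a function of $(\mathcal{P},T)$ only, which satisfies: there are $\varepsilon_d,C_d>0$ such that for all $\rho>0$, $\varepsilon\le\varepsilon_d\rho$, $M\in\mathcal{M}_{D,d,\rho}$ and every $\mathcal{P}\subset M$ that is an $(\varepsilon,2\varepsilon)$-net of $M$ (i.e. $d(p,\mathcal{P}\setminus\{p\})\ge\varepsilon$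 for all $p\in\mathcal{P}$ and $\sup_{x\in M}d(x,\mathcal{P})\le2\varepsilon$), with $T=\{T_pM\}_{p\in\mathcal{P}}$, one has $d_H(M,\mathrm{Del}^{\omega_*}(\mathcal{P},T))\le C_d\varepsilon^2/\rho$ and $M\cong\mathrm{Del}^{\omega_*}(\mathcal{P},T)$. Tangent space estimation. For a finite point set $\mathcal{P}=\{p_1,\dots,p_r\}$ and $h>0$, $\mathtt{TSE}(\mathcal{P},h)_j$ is the span of $d$ eigenvectors associated with the $d$ largest eigenvalues of $\sum_{i\ne j}(p_i-\bar p_j)(p_i-\bar p_j)^t\mathbf{1}_{\mathcal{B}(p_j,h)}(p_i)$, where $\bar p_j$ is the barycenter of the points $p_i$, $i\ne j$, lying in $\mathcal{B}(p_j,h)$. Decluttering. For $k_1,k_2,h>0$, the slab at $x$ in direction $T$ ($d$-dimensional linear subspace) is $S(x,T,h)=\{x\}\oplus\mathcal{B}_T(0,k_1h)\oplus\mathcal{B}_{T^\perp}(0,k_2h^2)$ ($\oplus$ Minkowski sum; $\mathcal{B}_T,\mathcal{B}_{T^\perp}$ Euclidean balls in $T,T^\perp$). For a threshold $t>0$ and points $\mathcal{P}=(p_1,\dots,p_r)$ with subspaces $T_{\mathcal{P}}=(T_1,\dots,T_r)$, $\mathtt{SD}_t(\mathcal{P},T_{\mathcal{P}},h)$ is the set of those $p_j$ with $|S(p_j,T_j,h)\cap\mathcal{P}|\ge t(n-1)h^d$. Let $\gamma_0=\frac1{d+1}$, $\gamma_{k+1}=\frac{2\gamma_k+1}{d+2}$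 (so $\gamma_k=\frac1d-\frac1{d(d+1)}(\frac2{d+2})^k$), and $h_k=\left(c\frac{\log n}{\beta(n-1)}\right)^{\gamma_k}$, $h_\infty=\left(c\frac{\log n}{\beta(n-1)}\right)^{1/d}$, with $c=c_{d,f_{min},f_{max},\rho}$. Set $\mathbb{X}^{(-1)}=\mathbb{X}_n$ and $\mathbb{X}^{(k+1)}=\mathtt{SD}_t(\mathbb{X}^{(k)},\mathtt{TSE}(\mathbb{X}^{(k)},h_{k+1}),h_{k+1})$ for $k\ge-1$. Farthest point sampling of a finite set $\mathcal{P}$ with parameter $\varepsilon$: start with $\mathcal{Q}=\{p_1\}$ for one point $p_1\in\mathcal{P}$, and while $\max_{p\in\mathcal{P}}d(p,\mathcal{Q})>\varepsilon$, add to $\mathcal{Q}$ a point of $\mathcal{P}$ maximizing $d(\cdot,\mathcal{Q})$; output $\mathcal{Q}$. Estimator. Let $\hat k$ be the (random, $M$-dependent) smallest integer $k\ge0$ such that $\min\{d(X_j,M): d(X_j,M)>h_\infty^2/\rho\}>h_k^2/\rho$ (the minimum over the sample points, $+\infty$ if there is none). Let $\mathbb{Y}_n^+$ be the output of farthest point sampling on $\mathbb{X}^{(\hat k+1)}$ with parameter $\varepsilon=c'h_\infty$ ($c'=c'_{d,f_{min},f_{max}}$ large enough), and $T^+$ the restriction of $\mathtt{TSE}(\mathbb{X}^{(\hat k+1)},h_\infty)$ to $\mathbb{Y}_n^+$. Then $\hat M_{\mathtt{TDC}+}=\mathrm{Del}^{\omega_*}(\mathbb{Y}_n^+,T^+)$.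 The constants are chosen as: $k_1,k_2$ small enough, $c$ large enough, $t$ a suitable threshold. *)

theory Defs
  imports "HOL-Probability.Probability"
begin

text \<open>
  The constants of the theorem must not depend on the ambient dimension \<open>D\<close>, so \<open>D\<close> has to be
  quantified inside the statement. All spaces \<open>\<real>\<^sup>D\<close> are therefore realised as the subspaces
  \<open>Rn D\<close> (first \<open>D\<close> coordinates) of the type of finitely supported real sequences, with the
  Euclidean inner product. Notions that depend on the ambient space take \<open>D\<close> as an argument.
\<close>

typedef euc = "{x :: nat \<Rightarrow> real. finite {i. x i \<noteq> 0}}"
  morphisms coord Abs_euc
  by (rule exI[of _ "\<lambda>_. 0"]) simp

setup_lifting type_definition_euc

lemma finite_support [simp]: "finite {i. coord x i \<noteq> 0}"
  using coord[of x] by simp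

lemma euc_eqI: "(\<And>i. coord x i = coord y i) \<Longrightarrow> x = y"
  by (metis coord_inject ext)

instantiation euc :: real_vector
begin

lift_definition zero_euc :: euc is "\<lambda>_. 0" by simp

lift_definition plus_euc :: "euc \<Rightarrow> euc \<Rightarrow> euc" is "\<lambda>x y i. x i + y i"
proof -
  fix x y :: "nat \<Rightarrow> real"
  assume "finite {i. x i \<noteq> 0}" "finite {i. y i \<noteq> 0}"
  then show "finite {i. x i + y i \<noteq> 0}"
    by (rule finite_subset[rotated, OF finite_UnI]) auto
qed

lift_definition minus_euc :: "euc \<Rightarrow> euc \<Rightarrow> euc" is "\<lambda>x y i. x i - y i"
proof -
  fix x y :: "nat \<Rightarrow> real"
  assume "finite {i. x i \<noteq> 0}" "finite {i. y i \<noteq> 0}"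
  then show "finite {i. x i - y i \<noteq> 0}"
    by (rule finite_subset[rotated, OF finite_UnI]) auto
qed

lift_definition uminus_euc :: "euc \<Rightarrow> euc" is "\<lambda>x i. - x i" by simp

lift_definition scaleR_euc :: "real \<Rightarrow> euc \<Rightarrow> euc" is "\<lambda>r x i. r * x i"
  by (erule finite_subset[rotated]) auto

instance
  by standard (transfer; simp add: algebra_simps fun_eq_iff)+

end

lemma coord_simps [simp]:
  "coord 0 i = 0" "coord (x + y) i = coord x i + coord y i" "coord (x - y) i = coord x i - coord y i"
  "coord (- x) i = - coord x i" "coord (r *\<^sub>R x) i = r * coord x i"
  by (transfer; simp)+

instantiation euc :: real_inner
begin

definition inner_euc :: "euc \<Rightarrow> euc \<Rightarrow> real"
  where "inner_euc x y = (\<Sum>i | coord x i \<noteq> 0. coord x i * coord y i)"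

definition norm_euc :: "euc \<Rightarrow> real" where "norm_euc x = sqrt (inner x x)"

definition dist_euc :: "euc \<Rightarrow> euc \<Rightarrow> real" where "dist_euc x y = norm (x - y)"

definition sgn_euc :: "euc \<Rightarrow> euc" where "sgn_euc x = x /\<^sub>R norm x"

definition uniformity_euc :: "(euc \<times> euc) filter"
  where "uniformity_euc = (INF e\<in>{0<..}. principal {(x, y). dist x y < e})"

definition open_euc :: "euc set \<Rightarrow> bool"
  where "open_euc U \<longleftrightarrow> (\<forall>x\<in>U. \<forall>\<^sub>F (x', y) in uniformity. x' = x \<longrightarrow> y \<in> U)"

lemma inner_euc_eq_sum:
  assumes "finite A" "{i. coord x i \<noteq> 0} \<subseteq> A"
  shows "inner x y = (\<Sum>i\<in>A. coord x i * coord y i)"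
  unfolding inner_euc_def using assms by (intro sum.mono_neutral_left) auto

instance
proof
  fix x y z :: euc and r :: real
  show "sgn x = x /\<^sub>R norm x" "dist x y = norm (x - y)" "norm x = sqrt (inner x x)"
    by (simp_all add: sgn_euc_def dist_euc_def norm_euc_def)
  show "uniformity = (INF e\<in>{0<..}. principal {(x :: euc, y). dist x y < e})"
    by (rule uniformity_euc_def)
  show "open U \<longleftrightarrow> (\<forall>x\<in>U. \<forall>\<^sub>F (x', y) in uniformity. x' = x \<longrightarrow> y \<in> U)" for U :: "euc set"
    by (rule open_euc_def)
  let ?A = "{i. coord x i \<noteq> 0} \<union> {i. coord y i \<noteq> 0} \<union> {i. coord (x + y) i \<noteq> 0}
    \<union> {i. coord (r *\<^sub>R x) i \<noteq> 0}"
  have A: "finite ?A" by (intro finite_UnI finite_support)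
  have i: "inner w v = (\<Sum>i\<in>?A. coord w i * coord v i)" if "w \<in> {x, y, x + y, r *\<^sub>R x}" for w v
    by (rule inner_euc_eq_sum[OF A]) (use that in auto)
  show "inner x y = inner y x"
    by (simp add: i mult.commute)
  show "inner (x + y) z = inner x z + inner y z"
    by (simp add: i sum.distrib algebra_simps)
  show "inner (r *\<^sub>R x) y = r * inner x y"
    by (simp add: i sum_distrib_left algebra_simps)
  show "0 \<le> inner x x"
    by (simp add: i sum_nonneg)
  have "inner x x = 0 \<longleftrightarrow> (\<forall>i. coord x i = 0)"
    unfolding inner_euc_def by (subst sum_nonneg_eq_0_iff) auto
  then show "inner x x = 0 \<longleftrightarrow> x = 0"
    by (auto intro!: euc_eqI)
qed

end

definition Rn :: "nat \<Rightarrow> euc set"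
  where "Rn D = {x. \<forall>i\<ge>D. coord x i = 0}"

lift_definition of_coords :: "nat \<Rightarrow> (nat \<Rightarrow> real) \<Rightarrow> euc" is "\<lambda>D x i. if i < D then x i else 0"
  by (rule finite_subset[of _ "{..<_}"]) auto

definition axis_euc :: "nat \<Rightarrow> euc"
  where "axis_euc i = of_coords (Suc i) (\<lambda>j. if j = i then 1 else 0)"

lemma coord_of_coords: "coord (of_coords D x) i = (if i < D then x i else 0)"
  by (simp add: of_coords.rep_eq)

lemma coord_axis_euc: "coord (axis_euc i) j = (if j = i then 1 else 0)"
  by (simp add: axis_euc_def coord_of_coords)

lemma coord_sum [simp]: "coord (\<Sum>a\<in>A. f a) i = (\<Sum>a\<in>A. coord (f a) i)"
  by (induction A rule: infinite_finite_induct) auto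

lemma inner_Rn: "x \<in> Rn D \<Longrightarrow> inner x y = (\<Sum>i<D. coord x i * coord y i)"
  by (rule inner_euc_eq_sum) (auto simp: Rn_def not_less[symmetric])

lemma norm_Rn: "x \<in> Rn D \<Longrightarrow> norm x = L2_set (coord x) {..<D}"
  by (simp add: norm_eq_sqrt_inner inner_Rn L2_set_def power2_eq_square)

lemma coord_eq_inner: "coord x i = inner (axis_euc i) x"
proof -
  have "inner (axis_euc i) x = (\<Sum>j<Suc i. coord (axis_euc i) j * coord x j)"
    by (rule inner_Rn) (simp add: Rn_def coord_axis_euc)
  also have "\<dots> = (\<Sum>j<Suc i. if j = i then coord x j else 0)"
    by (rule sum.cong) (auto simp: coord_axis_euc)
  finally show ?thesis by simp
qed

lemma of_coords_eq_sum: "of_coords D x = (\<Sum>i<D. x i *\<^sub>R axis_euc i)"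
proof (rule euc_eqI)
  fix j
  have "(\<Sum>i<D. x i * coord (axis_euc i) j) = (\<Sum>i<D. if i = j then x i else 0)"
    by (rule sum.cong) (auto simp: coord_axis_euc)
  then show "coord (of_coords D x) j = coord (\<Sum>i<D. x i *\<^sub>R axis_euc i) j"
    by (simp add: coord_of_coords)
qed

lemma of_coords_in_Rn [simp]: "of_coords D x \<in> Rn D"
  by (simp add: Rn_def coord_of_coords)

lemma of_coords_coord: "x \<in> Rn D \<Longrightarrow> of_coords D (coord x) = x"
  by (rule euc_eqI) (auto simp: coord_of_coords Rn_def not_less)

lemma subspace_Rn: "subspace (Rn D)"
  by (auto simp: subspace_def Rn_def)

lemma dim_Rn: "dim (Rn D) = D"
proof (rule dim_unique)
  have inj: "inj_on axis_euc A" for A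
    by (rule inj_onI) (metis coord_axis_euc zero_neq_one)
  show "axis_euc ` {..<D} \<subseteq> Rn D"
    by (auto simp: Rn_def coord_axis_euc)
  show "Rn D \<subseteq> span (axis_euc ` {..<D})"
  proof
    fix x assume "x \<in> Rn D"
    then have "x = (\<Sum>i<D. coord x i *\<^sub>R axis_euc i)"
      using of_coords_eq_sum of_coords_coord by metis
    then show "x \<in> span (axis_euc ` {..<D})"
      by (metis (no_types, lifting) span_sum span_scale span_base imageI)
  qed
  have "pairwise orthogonal (axis_euc ` {..<D})"
    by (auto simp: pairwise_def orthogonal_def coord_eq_inner[symmetric] coord_axis_euc)
  moreover have "0 \<notin> axis_euc ` {..<D}"
    by (metis (no_types, lifting) coord_axis_euc coord_simps(1) imageE zero_neq_one)
  ultimately show "independent (axis_euc ` {..<D})"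
    by (rule pairwise_orthogonal_independent)
  show "card (axis_euc ` {..<D}) = D"
    by (simp add: card_image inj)
qed

lemma closed_Rn: "closed (Rn D)"
proof -
  have "Rn D = (\<Inter>i\<in>{D..}. {x. inner (axis_euc i) x = 0})"
    by (auto simp: Rn_def coord_eq_inner)
  also have "closed \<dots>"
    by (intro closed_INT ballI closed_Collect_eq continuous_intros)
  finally show ?thesis .
qed

lemma ex_Rn: "\<exists>D. x \<in> Rn D"
proof -
  obtain D where "\<forall>i\<in>{i. coord x i \<noteq> 0}. i < D"
    using finite_nat_set_iff_bounded finite_support by blast
  then show ?thesis
    by (auto simp: Rn_def not_less intro!: exI[of _ D] dest: leD)
qed

instance euc :: second_countable_topology
proof
  define S :: "euc set" where "S = range (\<lambda>qs :: rat list. of_coords (length qs) (\<lambda>i. of_rat (qs ! i)))"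
  have dense: "\<exists>s\<in>S. dist x s < e" if "e > 0" for x e
  proof -
    obtain D where x: "x \<in> Rn D" using ex_Rn by blast
    have "\<exists>q. \<bar>coord x i - of_rat q\<bar> < e / (real D + 1)" for i
    proof -
      have "coord x i - e / (real D + 1) < coord x i + e / (real D + 1)"
        using divide_pos_pos[OF that, of "real D + 1"] by linarith
      then obtain q where "coord x i - e / (real D + 1) < of_rat q" "of_rat q < coord x i + e / (real D + 1)"
        using of_rat_dense by blast
      then show ?thesis by (intro exI[of _ q]) (simp add: abs_less_iff)
    qed
    then obtain q where q: "\<And>i. \<bar>coord x i - of_rat (q i)\<bar> < e / (real D + 1)" by metis
    define s where "s = of_coords D (\<lambda>i. of_rat (q i))"
    have eq: "s = of_coords (length (map q [0..<D])) (\<lambda>i. of_rat (map q [0..<D] ! i))"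
      by (rule euc_eqI) (simp add: s_def coord_of_coords)
    have "dist x s = L2_set (coord (x - s)) {..<D}"
      unfolding dist_norm by (rule norm_Rn) (intro subspace_diff subspace_Rn x, simp add: s_def)
    also have "\<dots> \<le> (\<Sum>i<D. \<bar>coord (x - s) i\<bar>)"
      by (rule L2_set_le_sum_abs)
    also have "\<dots> \<le> (\<Sum>i<D. e / (real D + 1))"
      using q by (intro sum_mono) (auto simp: s_def coord_of_coords intro: less_imp_le)
    also have "\<dots> < e"
      using that by (simp add: field_simps)
    finally show ?thesis
      using eq unfolding S_def by blast
  qed
  have "countable S" by (simp add: S_def)
  define B where "B = (\<lambda>(s, q :: rat). ball s (of_rat q)) ` (S \<times> UNIV)"
  have "countable B" using \<open>countable S\<close> by (simp add: B_def)
  moreover have "topological_basis B"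
  proof (rule topological_basisI)
    show "open b" if "b \<in> B" for b using that by (auto simp: B_def)
    fix U and x :: euc assume "open U" "x \<in> U"
    then obtain e where e: "e > 0" "ball x e \<subseteq> U" by (auto simp: open_contains_ball)
    obtain s where s: "s \<in> S" "dist x s < e / 3" using dense[of "e / 3" x] e by auto
    obtain q where q: "e / 3 < of_rat q" "of_rat q < e / 2" using of_rat_dense[of "e / 3" "e / 2"] e by auto
    have "ball s (of_rat q) \<subseteq> ball x e"
    proof
      fix y assume "y \<in> ball s (of_rat q)"
      then show "y \<in> ball x e" using s q e dist_triangle[of x y s] by (simp add: dist_commute)
    qed
    moreover have "x \<in> ball s (of_rat q)" using s q by (simp add: dist_commute)
    moreover have "ball s (of_rat q) \<in> B" using s by (auto simp: B_def)
    ultimately show "\<exists>b\<in>B. x \<in> b \<and> b \<subseteq> U" using e by blast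
  qed
  ultimately show "\<exists>B :: euc set set. countable B \<and> open = generate_topology B"
    using topological_basis_imp_subbasis by blast
qed

definition lebesgue_Rn :: "nat \<Rightarrow> euc measure"
  where "lebesgue_Rn D = distr (\<Pi>\<^sub>M i\<in>{..<D}. lborel) borel (of_coords D)"

lemma measurable_of_coords: "of_coords D \<in> borel_measurable (\<Pi>\<^sub>M i\<in>{..<D}. lborel)"
  unfolding of_coords_eq_sum[abs_def]
proof (intro borel_measurable_sum borel_measurable_scaleR borel_measurable_const)
  fix i assume "i \<in> {..<D}"
  then show "(\<lambda>x. x i) \<in> borel_measurable (\<Pi>\<^sub>M i\<in>{..<D}. lborel)"
    using measurable_component_singleton[of i "{..<D}" "\<lambda>_. lborel"] by (simp add: measurable_lborel1)
qed

text \<open>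
  Embedded \<open>C\<^sup>1\<close> submanifolds without boundary, through local parametrisations by relatively open
  subsets of \<open>Rn d\<close>. The values of \<open>\<phi>' x\<close> outside \<open>Rn d\<close> are irrelevant.
\<close>

definition C1_submanifold :: "nat \<Rightarrow> euc set \<Rightarrow> bool" where
  "C1_submanifold d M \<longleftrightarrow>
    (\<forall>p\<in>M. \<exists>V W \<phi> \<psi> \<phi>'.
      openin (top_of_set (Rn d)) V \<and> openin (top_of_set M) W \<and> p \<in> W \<and> homeomorphism V W \<phi> \<psi> \<and>
      (\<forall>x\<in>V. (\<phi> has_derivative \<phi>' x) (at x within V) \<and> inj_on (\<phi>' x) (Rn d)) \<and>
      (\<forall>v\<in>Rn d. continuous_on V (\<lambda>x. \<phi>' x v)))"

definition tangent_space :: "euc set \<Rightarrow> euc \<Rightarrow> euc set" where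
  "tangent_space M p = {v. \<exists>\<gamma> :: real \<Rightarrow> euc. \<exists>e>0. \<gamma> 0 = p \<and> (\<forall>s. \<bar>s\<bar> < e \<longrightarrow> \<gamma> s \<in> M) \<and>
    (\<gamma> has_vector_derivative v) (at 0)}"

definition medial_axis :: "nat \<Rightarrow> euc set \<Rightarrow> euc set" where
  "medial_axis D M =
    {x\<in>Rn D. \<exists>a\<in>M. \<exists>b\<in>M. a \<noteq> b \<and> dist x a = dist x b \<and> dist x b = infdist x M}"

text \<open>Extended-real valued, so that the distance to an empty medial axis is \<open>\<infinity>\<close>.\<close>

definition reach :: "nat \<Rightarrow> euc set \<Rightarrow> ereal" where
  "reach D M = (INF p\<in>M. INF x\<in>medial_axis D M. ereal (dist p x))"

definition manifolds :: "nat \<Rightarrow> nat \<Rightarrow> real \<Rightarrow> euc set set" where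
  "manifolds D d \<rho> =
    {M. M \<noteq> {} \<and> M \<subseteq> Rn D \<and> compact M \<and> connected M \<and> C1_submanifold d M \<and> ereal \<rho> \<le> reach D M}"

text \<open>
  \<open>d\<close>-dimensional Hausdorff measure (for \<open>d \<ge> 1\<close>), normalised to agree with Lebesgue measure on
  \<open>\<real>\<^sup>d\<close>. Boundedness is required of the covering sets because \<^const>\<open>diameter\<close> is
  unspecified on unbounded sets.
\<close>

definition hausdorff_outer :: "nat \<Rightarrow> euc set \<Rightarrow> ennreal" where
  "hausdorff_outer d A =
    (SUP \<delta>\<in>{0<..}. INF U\<in>{U :: nat \<Rightarrow> euc set. A \<subseteq> (\<Union>i. U i) \<and> (\<forall>i. bounded (U i) \<and> diameter (U i) \<le> \<delta>)}.
      \<Sum>i. ennreal (unit_ball_vol (real d) * (diameter (U i) / 2) ^ d))"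

definition hausdorff_measure :: "nat \<Rightarrow> euc measure" where
  "hausdorff_measure d = measure_of UNIV (sets borel) (hausdorff_outer d)"

definition manifold_volume :: "nat \<Rightarrow> euc set \<Rightarrow> euc measure" where
  "manifold_volume d M = density (hausdorff_measure d) (indicator M)"

definition manifold_distributions :: "nat \<Rightarrow> real \<Rightarrow> real \<Rightarrow> euc set \<Rightarrow> euc measure set" where
  "manifold_distributions d fmin fmax M =
    {Q. prob_space Q \<and> (\<exists>f\<in>borel_measurable borel.
      (\<forall>x\<in>M. fmin \<le> f x \<and> f x \<le> fmax) \<and> Q = density (manifold_volume d M) (\<lambda>x. ennreal (f x)))}"

text \<open>
  \<open>Cd\<close> is an admissible constant \<open>C\<^sub>d\<close> in the bound on the diameter of \<open>M\<close>, which is the support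
  of every distribution in \<^term>\<open>manifold_distributions d fmin fmax M\<close> because \<open>fmin > 0\<close>.
\<close>

definition diameter_constant :: "nat \<Rightarrow> real \<Rightarrow> bool" where
  "diameter_constant d Cd \<longleftrightarrow> 0 < Cd \<and>
    (\<forall>D>d. \<forall>fmin>0. \<forall>fmax\<ge>fmin. \<forall>\<rho>>0. \<forall>M\<in>manifolds D d \<rho>.
      manifold_distributions d fmin fmax M \<noteq> {} \<longrightarrow> diameter M \<le> Cd / (\<rho> ^ (d - 1) * fmin))"

definition K0 :: "nat \<Rightarrow> real \<Rightarrow> real \<Rightarrow> real \<Rightarrow> real" where
  "K0 d Cd fmin \<rho> = Cd / (\<rho> ^ (d - 1) * fmin) + \<rho>"

definition B0 :: "nat \<Rightarrow> nat \<Rightarrow> real \<Rightarrow> real \<Rightarrow> real \<Rightarrow> euc set" where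
  "B0 D d Cd fmin \<rho> = cball 0 (K0 d Cd fmin \<rho>) \<inter> Rn D"

text \<open>The distributions of the outlier model, paired with their associated submanifold.\<close>

definition outlier_model ::
  "nat \<Rightarrow> nat \<Rightarrow> real \<Rightarrow> real \<Rightarrow> real \<Rightarrow> real \<Rightarrow> real \<Rightarrow> (euc measure \<times> euc set) set" where
  "outlier_model D d Cd fmin fmax \<rho> \<beta> =
    {(P, M). M \<in> manifolds D d \<rho> \<and> 0 \<in> M \<and> sets P = sets borel \<and>
      (\<exists>Q\<in>manifold_distributions d fmin fmax M. \<forall>A\<in>sets borel.
        emeasure P A = ennreal \<beta> * emeasure Q A +
          ennreal (1 - \<beta>) * emeasure (uniform_measure (lebesgue_Rn D) (B0 D d Cd fmin \<rho>)) A)}"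

abbreviation sample_measure :: "euc measure \<Rightarrow> nat \<Rightarrow> (nat \<Rightarrow> euc) measure" where
  "sample_measure P n \<equiv> (\<Pi>\<^sub>M i\<in>{..<n}. P)"

text \<open>
  The estimator involves arbitrary choices (ties between eigenvalues, farthest points), so it need
  not be measurable. Events are measured by inner probability and losses by upper expectation;
  both are the usual notions in the measurable case.
\<close>

definition inner_prob :: "'a measure \<Rightarrow> 'a set \<Rightarrow> real" where
  "inner_prob N E = (SUP A\<in>{A\<in>sets N. A \<subseteq> E}. measure N A)"

definition upper_expectation :: "'a measure \<Rightarrow> ('a \<Rightarrow> ennreal) \<Rightarrow> ennreal" where
  "upper_expectation N f =
    (INF g\<in>{g\<in>borel_measurable N. \<forall>x\<in>space N. f x \<le> g x}. \<integral>\<^sup>+x. g x \<partial>N)"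

lemma inner_prob_eq_measure:
  assumes "finite_measure N" "E \<in> sets N"
  shows "inner_prob N E = measure N E"
  unfolding inner_prob_def
proof (rule cSup_eq_maximum)
  show "measure N E \<in> measure N ` {A\<in>sets N. A \<subseteq> E}" using assms by blast
  show "m \<le> measure N E" if "m \<in> measure N ` {A\<in>sets N. A \<subseteq> E}" for m
    using that assms by (auto intro: finite_measure.finite_measure_mono)
qed

lemma upper_expectation_eq_nn_integral:
  assumes "f \<in> borel_measurable N"
  shows "upper_expectation N f = (\<integral>\<^sup>+x. f x \<partial>N)"
  unfolding upper_expectation_def
  by (rule antisym) (use assms in \<open>auto intro!: INF_lower INF_greatest nn_integral_mono\<close>)

text \<open>Meant for non-empty bounded sets only.\<close>

definition hausdist :: "'a::metric_space set \<Rightarrow> 'a set \<Rightarrow> real" where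
  "hausdist A B = max (SUP a\<in>A. infdist a B) (SUP b\<in>B. infdist b A)"

text \<open>
  Hausdorff distance between subsets of a bounded domain \<open>X\<close>, extended to the empty set by the
  usual convention that its distance to a non-empty set is the diameter of \<open>X\<close>.
\<close>

definition hausdist_in :: "'a::metric_space set \<Rightarrow> 'a set \<Rightarrow> 'a set \<Rightarrow> real" where
  "hausdist_in X A B =
    (if A = {} \<and> B = {} then 0 else if A = {} \<or> B = {} then diameter X else hausdist A B)"

definition ambient_isotopic :: "nat \<Rightarrow> euc set \<Rightarrow> euc set \<Rightarrow> bool" where
  "ambient_isotopic D A B \<longleftrightarrow>
    (\<exists>F :: real \<Rightarrow> euc \<Rightarrow> euc. continuous_on ({0..1} \<times> Rn D) (\<lambda>(s, x). F s x) \<and>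
      (\<forall>s\<in>{0..1}. \<exists>G. homeomorphism (Rn D) (Rn D) (F s) G) \<and>
      (\<forall>x\<in>Rn D. F 0 x = x) \<and> F 1 ` A = B)"

text \<open>Simplicial complexes are sets of vertex sets; \<open>carrier_of\<close> gives the underlying subset.\<close>

definition abstract_complex :: "'a set set \<Rightarrow> bool" where
  "abstract_complex K \<longleftrightarrow>
    (\<forall>\<tau>\<in>K. finite \<tau> \<and> \<tau> \<noteq> {} \<and> (\<forall>\<sigma>. \<sigma> \<subseteq> \<tau> \<and> \<sigma> \<noteq> {} \<longrightarrow> \<sigma> \<in> K))"

definition carrier_of :: "'a::real_vector set set \<Rightarrow> 'a set" where
  "carrier_of K = (\<Union>\<tau>\<in>K. convex hull \<tau>)"

definition vor :: "nat \<Rightarrow> euc set \<Rightarrow> (euc \<Rightarrow> real) \<Rightarrow> euc set \<Rightarrow> euc set" where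
  "vor D P w \<tau> =
    {x\<in>Rn D. \<forall>p\<in>\<tau>. \<forall>q\<in>P. (norm (x - p))\<^sup>2 - (w p)\<^sup>2 \<le> (norm (x - q))\<^sup>2 - (w q)\<^sup>2}"

definition delaunay :: "nat \<Rightarrow> euc set \<Rightarrow> (euc \<Rightarrow> real) \<Rightarrow> euc set set" where
  "delaunay D P w = {\<tau>. \<tau> \<subseteq> P \<and> \<tau> \<noteq> {} \<and> vor D P w \<tau> \<noteq> {}}"

text \<open>
  The subcomplex generated by the simplices \<open>\<tau>\<close> whose Voronoi face meets one of the affine spaces
  \<open>p + T p\<close>, \<open>p \<in> \<tau>\<close>. Faces are added because this condition on \<open>\<tau>\<close> is not
  inherited by faces in general; they do not change the underlying set.
\<close>

definition tangential_delaunay ::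
  "nat \<Rightarrow> euc set \<Rightarrow> (euc \<Rightarrow> real) \<Rightarrow> (euc \<Rightarrow> euc set) \<Rightarrow> euc set set" where
  "tangential_delaunay D P w T =
    {\<sigma>. \<sigma> \<noteq> {} \<and> (\<exists>\<tau>\<in>delaunay D P w. \<sigma> \<subseteq> \<tau> \<and> vor D P w \<tau> \<inter> (\<Union>p\<in>\<tau>. (+) p ` T p) \<noteq> {})}"

lemma carrier_of_tangential_delaunay:
  "carrier_of (tangential_delaunay D P w T) =
    carrier_of {\<tau>\<in>delaunay D P w. vor D P w \<tau> \<inter> (\<Union>p\<in>\<tau>. (+) p ` T p) \<noteq> {}}"
proof -
  let ?S = "{\<tau>\<in>delaunay D P w. vor D P w \<tau> \<inter> (\<Union>p\<in>\<tau>. (+) p ` T p) \<noteq> {}}"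
  have "convex hull \<sigma> \<subseteq> carrier_of ?S" if "\<sigma> \<in> tangential_delaunay D P w T" for \<sigma>
  proof -
    obtain \<tau> where \<tau>: "\<tau> \<in> ?S" "\<sigma> \<subseteq> \<tau>"
      using \<open>\<sigma> \<in> _\<close> unfolding tangential_delaunay_def by blast
    have "convex hull \<sigma> \<subseteq> convex hull \<tau>" using \<tau>(2) by (rule hull_mono)
    also have "\<dots> \<subseteq> carrier_of ?S" unfolding carrier_of_def using \<tau>(1) by (rule UN_upper)
    finally show ?thesis .
  qed
  then have "carrier_of (tangential_delaunay D P w T) \<subseteq> carrier_of ?S"
    unfolding carrier_of_def[of "tangential_delaunay D P w T"] by (rule UN_least)
  moreover have "?S \<subseteq> tangential_delaunay D P w T"
    unfolding tangential_delaunay_def delaunay_def by blast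
  then have "carrier_of ?S \<subseteq> carrier_of (tangential_delaunay D P w T)"
    unfolding carrier_of_def by (rule UN_mono) simp
  ultimately show ?thesis by (rule antisym)
qed

definition eps_net :: "real \<Rightarrow> euc set \<Rightarrow> euc set \<Rightarrow> bool" where
  "eps_net \<epsilon> M P \<longleftrightarrow> finite P \<and> P \<subseteq> M \<and> (\<forall>p\<in>P. \<forall>q\<in>P. p \<noteq> q \<longrightarrow> \<epsilon> \<le> dist p q) \<and>
    (\<forall>x\<in>M. \<exists>p\<in>P. dist x p \<le> 2 * \<epsilon>)"

text \<open>
  \<open>wt D P T\<close> is the weight assignment \<open>\<omega>\<^sub>*\<close> for \<open>P \<subseteq> \<real>\<^sup>D\<close>. Passing \<^term>\<open>restrict T P\<close>
  makes it a function of \<open>P\<close> and of the family \<open>T\<close> indexed by \<open>P\<close> only.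
\<close>

type_synonym weights = "nat \<Rightarrow> euc set \<Rightarrow> (euc \<Rightarrow> euc set) \<Rightarrow> euc \<Rightarrow> real"

definition tdc_star :: "weights \<Rightarrow> nat \<Rightarrow> euc set \<Rightarrow> (euc \<Rightarrow> euc set) \<Rightarrow> euc set set" where
  "tdc_star wt D P T = tangential_delaunay D P (wt D P (restrict T P)) T"

definition boissonnat_ghosh_weights :: "nat \<Rightarrow> weights \<Rightarrow> bool" where
  "boissonnat_ghosh_weights d wt \<longleftrightarrow>
    (\<forall>D>d. \<forall>P T. finite P \<and> P \<subseteq> Rn D \<and> (\<forall>p\<in>P. subspace (T p) \<and> T p \<subseteq> Rn D \<and> dim (T p) = d) \<longrightarrow>
      (\<forall>p\<in>P. 0 \<le> wt D P (restrict T P) p)) \<and>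
    (\<exists>\<epsilon>\<^sub>d>0. \<exists>C\<^sub>d>0. \<forall>D>d. \<forall>\<rho>>0. \<forall>\<epsilon>>0. \<epsilon> \<le> \<epsilon>\<^sub>d * \<rho> \<longrightarrow>
      (\<forall>M\<in>manifolds D d \<rho>. \<forall>P. eps_net \<epsilon> M P \<longrightarrow>
        hausdist M (carrier_of (tdc_star wt D P (tangent_space M))) \<le> C\<^sub>d * \<epsilon>\<^sup>2 / \<rho> \<and>
        ambient_isotopic D M (carrier_of (tdc_star wt D P (tangent_space M)))))"

definition neighbours :: "euc set \<Rightarrow> real \<Rightarrow> euc \<Rightarrow> euc set" where
  "neighbours P h p = (P - {p}) \<inter> cball p h"

definition barycenter :: "'a::real_vector set \<Rightarrow> 'a" where
  "barycenter N = (\<Sum>q\<in>N. q) /\<^sub>R real (card N)"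

text \<open>The covariance matrix as an operator: \<open>v v\<^sup>t x = (v \<bullet> x) v\<close>.\<close>

definition local_covariance :: "euc set \<Rightarrow> real \<Rightarrow> euc \<Rightarrow> euc \<Rightarrow> euc" where
  "local_covariance P h p x =
    (let N = neighbours P h p; b = barycenter N in \<Sum>q\<in>N. ((q - b) \<bullet> x) *\<^sub>R (q - b))"

text \<open>\<open>T\<close> is the span of the first \<open>d\<close> vectors of an orthonormal eigenbasis of \<open>\<real>\<^sup>D\<close>, sorted by
  decreasing eigenvalue. It is not unique in case of ties.\<close>

definition top_eigenspan :: "nat \<Rightarrow> nat \<Rightarrow> (euc \<Rightarrow> euc) \<Rightarrow> euc set \<Rightarrow> bool" where
  "top_eigenspan D d A T \<longleftrightarrow> (\<exists>v :: nat \<Rightarrow> euc. \<exists>l :: nat \<Rightarrow> real.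
    (\<forall>i<D. v i \<in> Rn D \<and> A (v i) = l i *\<^sub>R v i) \<and>
    (\<forall>i<D. \<forall>j<D. v i \<bullet> v j = (if i = j then 1 else 0)) \<and>
    (\<forall>i j. i \<le> j \<and> j < D \<longrightarrow> l j \<le> l i) \<and>
    T = span (v ` {..<d}))"

type_synonym tangent_estimator = "euc set \<Rightarrow> real \<Rightarrow> euc \<Rightarrow> euc set"

definition is_TSE :: "nat \<Rightarrow> nat \<Rightarrow> tangent_estimator \<Rightarrow> bool" where
  "is_TSE D d tse \<longleftrightarrow> (\<forall>P h. \<forall>p\<in>P. finite P \<and> P \<subseteq> Rn D \<longrightarrow>
    top_eigenspan D d (local_covariance P h p) (tse P h p))"

definition slab :: "nat \<Rightarrow> real \<Rightarrow> real \<Rightarrow> euc \<Rightarrow> euc set \<Rightarrow> real \<Rightarrow> euc set" where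
  "slab D k1 k2 x T h = {x + u + v | u v. u \<in> T \<and> norm u \<le> k1 * h \<and>
    v \<in> Rn D \<and> (\<forall>w\<in>T. orthogonal v w) \<and> norm v \<le> k2 * h\<^sup>2}"

definition slab_declutter ::
  "nat \<Rightarrow> nat \<Rightarrow> real \<Rightarrow> real \<Rightarrow> real \<Rightarrow> nat \<Rightarrow> euc set \<Rightarrow> (euc \<Rightarrow> euc set) \<Rightarrow> real \<Rightarrow> euc set" where
  "slab_declutter D d k1 k2 t n P T h =
    {p\<in>P. t * (real n - 1) * h ^ d \<le> real (card (slab D k1 k2 p (T p) h \<inter> P))}"

primrec rate_exp :: "nat \<Rightarrow> nat \<Rightarrow> real" where
  "rate_exp d 0 = 1 / (real d + 1)"
| "rate_exp d (Suc k) = (2 * rate_exp d k + 1) / (real d + 2)"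

definition bandwidth :: "real \<Rightarrow> real \<Rightarrow> nat \<Rightarrow> real \<Rightarrow> real" where
  "bandwidth c \<beta> n \<gamma> = (c * (ln (real n) / (\<beta> * (real n - 1)))) powr \<gamma>"

definition h_step :: "nat \<Rightarrow> real \<Rightarrow> real \<Rightarrow> nat \<Rightarrow> nat \<Rightarrow> real" where
  "h_step d c \<beta> n k = bandwidth c \<beta> n (rate_exp d k)"

definition h_inf :: "nat \<Rightarrow> real \<Rightarrow> real \<Rightarrow> nat \<Rightarrow> real" where
  "h_inf d c \<beta> n = bandwidth c \<beta> n (1 / real d)"

text \<open>
  The index is shifted by one: the value at \<open>m\<close> is \<open>X\<^sup>(\<^sup>m\<^sup>-\<^sup>1\<^sup>)\<close>, in particular the whole sample
  \<open>X\<^sup>(\<^sup>-\<^sup>1\<^sup>)\<close> for \<open>m = 0\<close>.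
\<close>

primrec decluttered ::
  "nat \<Rightarrow> nat \<Rightarrow> real \<Rightarrow> real \<Rightarrow> real \<Rightarrow> real \<Rightarrow> real \<Rightarrow> tangent_estimator \<Rightarrow> nat \<Rightarrow> (nat \<Rightarrow> euc) \<Rightarrow> nat \<Rightarrow> euc set"
where
  "decluttered D d \<beta> k1 k2 c t tse n X 0 = X ` {..<n}"
| "decluttered D d \<beta> k1 k2 c t tse n X (Suc m) =
    (let P = decluttered D d \<beta> k1 k2 c t tse n X m; h = h_step d c \<beta> n m
     in slab_declutter D d k1 k2 t n P (tse P h) h)"

inductive fps_state :: "'a::metric_space set \<Rightarrow> real \<Rightarrow> 'a set \<Rightarrow> bool" for P \<epsilon> where
  start: "p \<in> P \<Longrightarrow> fps_state P \<epsilon> {p}"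
| step: "fps_state P \<epsilon> Q \<Longrightarrow> q \<in> P \<Longrightarrow> (\<And>p. p \<in> P \<Longrightarrow> infdist p Q \<le> infdist q Q) \<Longrightarrow>
    \<epsilon> < infdist q Q \<Longrightarrow> fps_state P \<epsilon> (insert q Q)"

definition fps_output :: "'a::metric_space set \<Rightarrow> real \<Rightarrow> 'a set \<Rightarrow> bool" where
  "fps_output P \<epsilon> Q \<longleftrightarrow>
    (if P = {} then Q = {} else fps_state P \<epsilon> Q \<and> (\<forall>p\<in>P. infdist p Q \<le> \<epsilon>))"

type_synonym point_sampler = "euc set \<Rightarrow> real \<Rightarrow> euc set"

text \<open>Non-negativity of \<open>\<epsilon>\<close> is needed for termination.\<close>

definition is_FPS :: "point_sampler \<Rightarrow> bool" where
  "is_FPS fps \<longleftrightarrow> (\<forall>P \<epsilon>. finite P \<and> 0 \<le> \<epsilon> \<longrightarrow> fps_output P \<epsilon> (fps P \<epsilon>))"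

definition k_hat :: "nat \<Rightarrow> real \<Rightarrow> real \<Rightarrow> real \<Rightarrow> euc set \<Rightarrow> nat \<Rightarrow> (nat \<Rightarrow> euc) \<Rightarrow> nat" where
  "k_hat d \<rho> \<beta> c M n X =
    (LEAST k. \<forall>j<n. (h_inf d c \<beta> n)\<^sup>2 / \<rho> < infdist (X j) M \<longrightarrow>
      (h_step d c \<beta> n k)\<^sup>2 / \<rho> < infdist (X j) M)"

definition M_TDC_plus ::
  "weights \<Rightarrow> tangent_estimator \<Rightarrow> point_sampler \<Rightarrow> nat \<Rightarrow> nat \<Rightarrow> real \<Rightarrow> real \<Rightarrow>
    real \<Rightarrow> real \<Rightarrow> real \<Rightarrow> real \<Rightarrow> real \<Rightarrow> euc set \<Rightarrow> nat \<Rightarrow> (nat \<Rightarrow> euc) \<Rightarrow> euc set set"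
where
  "M_TDC_plus wt tse fps D d \<rho> \<beta> k1 k2 c t c' M n X =
    (let P = decluttered D d \<beta> k1 k2 c t tse n X (k_hat d \<rho> \<beta> c M n X + 2); h = h_inf d c \<beta> n
     in tdc_star wt D (fps P (c' * h)) (tse P h))"

end

theory Submission
  imports Defs "HOL-Real_Asymp.Real_Asymp"
begin

text \<open>
  With \<open>b = c log n / (\<beta> (n - 1))\<close> the bandwidths satisfy \<open>h\<^sub>\<infinity>\<^sup>d = b\<close>, \<open>h\<^sub>0\<^sup>d\<^sup>+\<^sup>1 = b\<close> and
  \<open>b h\<^sub>k\<^sup>2 = h\<^sub>k\<^sub>+\<^sub>1\<^sup>d\<^sup>+\<^sup>2\<close>. At scale \<open>h\<close> the sample points on \<open>M\<close> give a local covariance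
  of order \<open>\<beta> n h\<^sup>d\<^sup>+\<^sup>2\<close> in every tangent direction, so few outliers close to \<open>M\<close> disturb the top
  eigenspace by an angle of order \<open>h / \<rho>\<close> only. A decluttering step at scale \<open>h\<^sub>k\<close> therefore keeps all
  sample points on \<open>M\<close> and removes every point farther than a multiple of \<open>h\<^sub>k\<^sup>2\<close> from \<open>M\<close>; the recursion for
  \<open>h\<^sub>k\<^sub>+\<^sub>1\<close> is exactly what keeps the remaining outliers negligible at the next scale. After the step of index
  \<open>k\<close>-hat all points lie within \<open>h\<^sub>\<infinity>\<^sup>2 / \<rho>\<close> of \<open>M\<close>, with tangent spaces known up to \<open>O(h\<^sub>\<infinity> / \<rho>)\<close>.

  The subsampled points are then interpolated: adding a sum of disjointly supported bumps to the identity
  gives a diffeomorphism, isotopic to the identity and close to it, that maps \<open>M\<close> onto a manifold passing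
  through the points with exactly the estimated tangent spaces and with reach at least a constant multiple of
  \<open>\<rho>\<close>. The theorem of Boissonnat and Ghosh applies to this manifold.

  The counting assumptions behind this deterministic argument hold outside an event of probability
  \<open>O(n\<^sup>-\<^sup>3)\<close>, by exponential bounds over finite nets; the contribution of that event to the
  expectation is negligible. Sets of positive reach are handled through the two-sided rolling ball condition
  alone, without geodesics.
\<close>

subsection \<open>Finite-dimensional subspaces\<close>

text \<open>The constants c, C and C' may depend neither on D nor on \<beta>, although the number of
  outliers in a ball does. In the first decluttering step a ball of radius \<open>h 0\<close> may
  hold a multiple of log n outliers, and the resulting constants \<open>K0\<close> and
  \<open>a0\<close> do depend on D and \<beta>. From the second step on only boundedly many outliers
  interfere, against at least a multiple of log n inliers, so for large n their share in the tangent
  error drops below any fixed constant and the angle bound \<open>K / \<rho>\<close> is free of D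
  and \<beta>. What depends on them is confined to \<open>k0\<close>, the threshold t and the size
  of n. Of M only estimates up to constants are used. Balls have mass of order \<open>r ^ d\<close>
  because the projection to a tangent space is bi-Lipschitz and covers a ball near the base point,
  and this mass replaces the volume of M in all packing arguments. The reach of the interpolating
  manifold is read off from a quadratic bound on the normal part of its chords, a condition that
  survives perturbations with Lipschitz derivative.\<close>

lemma span_eq_of_independent_card:
  fixes S T :: "'a::real_vector set"
  assumes "independent S" "S \<subseteq> span T" "finite T" "card S = card T"
  shows "span S = span T"
proof (rule antisym)
  show "span S \<subseteq> span T"
    using assms(2) by (simp add: span_minimal subspace_span)
  have finS: "finite S" using independent_span_bound[OF assms(3,1,2)] by simp
  have "t \<in> span S" if "t \<in> T" for t
  proof (rule ccontr)
    assume t: "t \<notin> span S"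
    then have "independent (insert t S)" using assms(1) by (rule independent_insertI)
    moreover have "insert t S \<subseteq> span T" using that assms(2) by (auto intro: span_base)
    ultimately have "card (insert t S) \<le> card T"
      using independent_span_bound[OF assms(3)] by blast
    moreover have "t \<notin> S" using t span_base by blast
    ultimately show False using finS assms(4) by simp
  qed
  then show "span T \<subseteq> span S"
    by (simp add: span_minimal subspace_span subsetI)
qed

definition orthonormal :: "'a::real_inner set \<Rightarrow> bool" where
  "orthonormal B \<longleftrightarrow> finite B \<and> (\<forall>a\<in>B. \<forall>b\<in>B. a \<bullet> b = (if a = b then 1 else 0))"

lemma orthonormal_independent:
  assumes "orthonormal B" shows "independent B"
proof (rule pairwise_orthogonal_independent)
  show "pairwise orthogonal B"
    using assms by (auto simp: orthonormal_def pairwise_def orthogonal_def)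
  show "0 \<notin> B" using assms by (auto simp: orthonormal_def dest!: bspec[of B _ 0])
qed

text \<open>A finite orthonormal basis stands in for the dimension because the ambient type is
  infinite-dimensional. It also makes the orthogonal projection a finite sum.\<close>

definition k_subspace :: "nat \<Rightarrow> 'a::real_inner set \<Rightarrow> bool" where
  "k_subspace k T \<longleftrightarrow> (\<exists>B. orthonormal B \<and> card B = k \<and> T = span B)"

lemma k_subspace_span:
  fixes B :: "'a::real_inner set"
  assumes "independent B" "finite B"
  shows "k_subspace (card B) (span B)"
proof -
  obtain C where C: "finite C" "card C \<le> card B" "span C = span B" "pairwise orthogonal C"
    using basis_orthogonal[OF assms(2)] by blast
  have "card B \<le> card C"
    using independent_span_bound[OF C(1) assms(1)] C(3) by (simp add: span_superset)
  then have card: "card C = card B" using C(2) by simp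
  \<comment> \<open>Gram-Schmidt may return the zero vector, but dropping it would leave fewer than
    \<open>card B\<close> generators for the span of B.\<close>
  have nz: "0 \<notin> C"
  proof
    assume "0 \<in> C"
    then have "span (C - {0}) = span C"
      by (metis insert_Diff span_insert_0)
    then have "card B \<le> card (C - {0})"
      using independent_span_bound[of "C - {0}" B] assms(1) C(1,3) by (simp add: span_superset)
    moreover have "card (C - {0}) < card C"
      using \<open>0 \<in> C\<close> C(1) by (meson card_Diff1_less)
    ultimately show False using card by simp
  qed
  let ?n = "\<lambda>x::'a. x /\<^sub>R norm x"
  have orth: "?n a \<bullet> ?n b = (if a = b then 1 else 0)" if "a \<in> C" "b \<in> C" for a b
    using that C(4) nz
    by (auto simp: pairwise_def orthogonal_def dot_square_norm power2_eq_square field_simps)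
  have inj: "inj_on ?n C"
    by (rule inj_onI) (metis orth zero_neq_one)
  have "orthonormal (?n ` C)"
    unfolding orthonormal_def using C(1) orth inj by (auto simp: inj_on_eq_iff[OF inj] split: if_splits)
  moreover have "card (?n ` C) = card B" using inj card by (simp add: card_image)
  moreover have "span (?n ` C) = span B"
  proof -
    have "span (?n ` C) = span C"
    proof (rule span_eq_of_independent_card)
      show "independent (?n ` C)" using \<open>orthonormal _\<close> by (rule orthonormal_independent)
      show "?n ` C \<subseteq> span C" by (auto intro: span_scale span_base)
      show "card (?n ` C) = card C" using inj by (rule card_image)
    qed (rule C(1))
    then show ?thesis using C(3) by simp
  qed
  ultimately show ?thesis unfolding k_subspace_def by metis
qed

lemma k_subspace_subspace [simp]: "k_subspace k T \<Longrightarrow> subspace T"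
  by (auto simp: k_subspace_def)

lemma k_subspace_linear_image:
  fixes f :: "'a::real_inner \<Rightarrow> 'b::real_inner"
  assumes "k_subspace k S" "linear f" "inj_on f S"
  shows "k_subspace k (f ` S)"
proof -
  obtain B where B: "orthonormal B" "card B = k" "S = span B"
    using assms(1) by (auto simp: k_subspace_def)
  have "independent (f ` B)"
    using linear_independent_injective_image[OF assms(2) orthonormal_independent[OF B(1)]] assms(3) B(3)
    by simp
  moreover have "card (f ` B) = k"
    using B assms(3) by (metis card_image inj_on_subset span_superset)
  moreover have "f ` S = span (f ` B)" using B(3) assms(2) by (simp add: linear_span_image)
  moreover have "finite (f ` B)" using B(1) by (simp add: orthonormal_def)
  ultimately show ?thesis using k_subspace_span by metis
qed

lemma k_subspace_eq:
  fixes S T :: "'a::real_inner set"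
  assumes "k_subspace k S" "k_subspace k T" "S \<subseteq> T"
  shows "S = T"
proof -
  obtain B where B: "orthonormal B" "card B = k" "S = span B"
    using assms(1) by (auto simp: k_subspace_def)
  obtain C where C: "orthonormal C" "card C = k" "T = span C"
    using assms(2) by (auto simp: k_subspace_def)
  have "B \<subseteq> span C" using assms(3) B C span_superset by blast
  then show ?thesis
    using span_eq_of_independent_card[OF orthonormal_independent[OF B(1)], of C] B C
    by (simp add: orthonormal_def)
qed

lemma k_subspace_inj_le:
  fixes f :: "'a::real_inner \<Rightarrow> 'b::real_inner"
  assumes "k_subspace k S" "linear f" "inj_on f S" "f ` S \<subseteq> T" "k_subspace l T"
  shows "k \<le> l"
proof -
  obtain B where B: "orthonormal B" "card B = k" "f ` S = span B"
    using k_subspace_linear_image[OF assms(1-3)] by (auto simp: k_subspace_def)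
  obtain C where C: "orthonormal C" "card C = l" "T = span C"
    using assms(5) by (auto simp: k_subspace_def)
  have "B \<subseteq> span C" using assms(4) B C span_superset by blast
  then show ?thesis
    using independent_span_bound[OF _ orthonormal_independent[OF B(1)], of C] B C
    by (simp add: orthonormal_def)
qed

subsection \<open>Orthogonal projections\<close>

text \<open>Characterised by the orthogonality of the residual, so that no basis enters; the foot
  exists for every T with \<open>k_subspace k T\<close>.\<close>

definition proj :: "'a::real_inner set \<Rightarrow> 'a \<Rightarrow> 'a" where
  "proj T x = (THE p. p \<in> T \<and> (\<forall>w\<in>T. (x - p) \<bullet> w = 0))"

definition perp :: "'a::real_inner set \<Rightarrow> 'a \<Rightarrow> 'a" where
  "perp T x = x - proj T x"

lemma proj_unique:
  fixes T :: "'a::real_inner set"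
  assumes "subspace T" "p \<in> T" "\<And>w. w \<in> T \<Longrightarrow> (x - p) \<bullet> w = 0"
  shows "proj T x = p"
  unfolding proj_def
proof (rule the_equality)
  show "p \<in> T \<and> (\<forall>w\<in>T. (x - p) \<bullet> w = 0)" using assms by blast
  fix q assume q: "q \<in> T \<and> (\<forall>w\<in>T. (x - q) \<bullet> w = 0)"
  have "q - p \<in> T" using q assms by (simp add: subspace_diff)
  then have "(x - p) \<bullet> (q - p) = 0" "(x - q) \<bullet> (q - p) = 0" using assms(3) q by auto
  then have "(q - p) \<bullet> (q - p) = 0" by (simp add: inner_diff_left)
  then show "q = p" by simp
qed

lemma orthonormal_sum_orth:
  fixes B :: "'a::real_inner set"
  assumes "orthonormal B" "w \<in> span B"
  shows "(x - (\<Sum>b\<in>B. (b \<bullet> x) *\<^sub>R b)) \<bullet> w = 0"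
proof -
  have "orthogonal (x - (\<Sum>b\<in>B. (b \<bullet> x) *\<^sub>R b)) c" if c: "c \<in> B" for c
  proof -
    have "(\<Sum>b\<in>B. (b \<bullet> x) *\<^sub>R b) \<bullet> c = (\<Sum>b\<in>B. if b = c then b \<bullet> x else 0)"
      unfolding inner_sum_left using assms c by (intro sum.cong) (auto simp: orthonormal_def)
    also have "\<dots> = c \<bullet> x" using assms c by (simp add: orthonormal_def)
    finally show ?thesis by (simp add: orthogonal_def inner_diff_left inner_diff_right inner_commute)
  qed
  then show ?thesis using orthogonal_to_span[OF assms(2)] by (simp add: orthogonal_def)
qed

lemma proj_sum:
  fixes B :: "'a::real_inner set"
  assumes "orthonormal B"
  shows "proj (span B) x = (\<Sum>b\<in>B. (b \<bullet> x) *\<^sub>R b)"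
  by (rule proj_unique) (auto intro: orthonormal_sum_orth[OF assms] span_sum span_scale span_base)

context
  fixes k :: nat and T :: "'a::real_inner set"
  assumes T: "k_subspace k T"
begin

lemma proj_in_orth: "proj T x \<in> T \<and> (\<forall>w\<in>T. (x - proj T x) \<bullet> w = 0)"
proof -
  obtain B where B: "orthonormal B" "T = span B" using T by (auto simp: k_subspace_def)
  have "proj T x \<in> T" unfolding B(2) proj_sum[OF B(1)]
    by (intro span_sum span_scale span_base)
  then show ?thesis using orthonormal_sum_orth[OF B(1)] unfolding B(2) proj_sum[OF B(1)] by blast
qed

lemma proj_in [simp]: "proj T x \<in> T"
  using proj_in_orth by blast

lemma inner_perp [simp]: "w \<in> T \<Longrightarrow> perp T x \<bullet> w = 0" "w \<in> T \<Longrightarrow> w \<bullet> perp T x = 0"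
  using proj_in_orth by (auto simp: perp_def inner_commute)

lemma subsp: "subspace T" using T by simp

lemma proj_id: "x \<in> T \<Longrightarrow> proj T x = x"
  by (rule proj_unique) (auto simp: subsp)

lemma proj_zero: "(\<And>w. w \<in> T \<Longrightarrow> x \<bullet> w = 0) \<Longrightarrow> proj T x = 0"
  by (rule proj_unique) (auto simp: subsp subspace_0)

lemma proj_add: "proj T (x + y) = proj T x + proj T y"
  by (rule proj_unique)
    (use proj_in_orth in \<open>auto simp: subsp subspace_add add_diff_add inner_add_left\<close>)

lemma proj_scale: "proj T (r *\<^sub>R x) = r *\<^sub>R proj T x"
  by (rule proj_unique)
    (use proj_in_orth in \<open>auto simp: subsp subspace_scale inner_scaleR_left simp flip: scaleR_right_diff_distrib\<close>)

lemma linear_proj: "linear (proj T)"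
  by (rule linearI) (simp_all add: proj_add proj_scale)

lemma linear_perp: "linear (perp T)"
  unfolding perp_def[abs_def] by (intro linear_compose_sub linear_proj linear_ident)

lemma perp_diff: "perp T (x - y) = perp T x - perp T y"
  using linear_perp by (rule linear_diff)

lemma perp_add: "perp T (x + y) = perp T x + perp T y"
  using linear_perp by (rule linear_add)

lemma perp_scale: "perp T (r *\<^sub>R x) = r *\<^sub>R perp T x"
  using linear_perp by (rule linear_cmul)

lemma perp_eq_0: "x \<in> T \<Longrightarrow> perp T x = 0"
  by (simp add: perp_def proj_id)

lemma perp_id: "(\<And>w. w \<in> T \<Longrightarrow> x \<bullet> w = 0) \<Longrightarrow> perp T x = x"
  using proj_zero by (simp add: perp_def)

lemma proj_add_perp: "proj T x + perp T x = x"
  by (simp add: perp_def)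

lemma norm_proj_perp: "(norm x)\<^sup>2 = (norm (proj T x))\<^sup>2 + (norm (perp T x))\<^sup>2"
proof -
  have "(norm (proj T x + perp T x))\<^sup>2 = (norm (proj T x))\<^sup>2 + (norm (perp T x))\<^sup>2"
    by (rule norm_add_Pythagorean) (simp add: orthogonal_def)
  then show ?thesis by (simp add: proj_add_perp)
qed

lemma norm_proj_le: "norm (proj T x) \<le> norm x"
  by (rule power2_le_imp_le) (use norm_proj_perp[of x] in auto)

lemma norm_perp_le: "norm (perp T x) \<le> norm x"
  by (rule power2_le_imp_le) (use norm_proj_perp[of x] in auto)

lemma bounded_linear_proj: "bounded_linear (proj T)"
  by (rule bounded_linear_intro[of _ 1]) (simp_all add: proj_add proj_scale norm_proj_le)

lemma bounded_linear_perp: "bounded_linear (perp T)"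
  by (rule bounded_linear_intro[of _ 1]) (simp_all add: perp_add perp_scale norm_perp_le)

lemma norm_perp_le_dist:
  assumes "w \<in> T" shows "norm (perp T x) \<le> norm (x - w)"
proof -
  have "perp T x = perp T (x - w)" using assms by (simp add: perp_diff perp_eq_0)
  then show ?thesis using norm_perp_le by metis
qed

lemma inner_proj: "w \<in> T \<Longrightarrow> proj T x \<bullet> w = x \<bullet> w"
  using inner_perp(1)[of w x] by (simp add: perp_def inner_diff_left)

end

text \<open>The largest angle between two subspaces of the same dimension is symmetric. The bound s
  < 1 makes the projection injective on S, equal dimensions make it onto T, and so each w in T is
  the projection of some v in S.\<close>

lemma k_subspace_angle_swap:
  fixes S T :: "'a::real_inner set"
  assumes S: "k_subspace k S" and T: "k_subspace k T"
    and s: "\<And>w. w \<in> S \<Longrightarrow> norm (perp T w) \<le> s * norm w" and "0 \<le> s" "s < 1"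
  shows "proj T ` S = T" and "\<And>w. w \<in> T \<Longrightarrow> norm (perp S w) \<le> s * norm w"
proof -
  have "inj_on (proj T) S"
    unfolding linear_inj_on_iff_eq_0[OF linear_proj[OF T] subsp[OF S]]
  proof (intro ballI impI)
    fix w assume w: "w \<in> S" "proj T w = 0"
    then have "norm w \<le> s * norm w" using s[OF w(1)] by (simp add: perp_def)
    then have "(1 - s) * norm w \<le> 0" by (simp add: algebra_simps)
    then show "w = 0" using \<open>s < 1\<close> by (simp add: mult_le_0_iff)
  qed
  then have "k_subspace k (proj T ` S)"
    using k_subspace_linear_image[OF S linear_proj[OF T]] by blast
  moreover have "proj T ` S \<subseteq> T" using proj_in[OF T] by blast
  ultimately show img: "proj T ` S = T" using k_subspace_eq T by blast
  fix w assume "w \<in> T"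
  then obtain v where v: "v \<in> S" "w = proj T v" using img by blast
  show "norm (perp S w) \<le> s * norm w"
  proof (cases "w = 0")
    case True then show ?thesis using perp_eq_0[OF S, of 0] subspace_0[OF subsp[OF S]] by simp
  next
    case False
    \<comment> \<open>\<open>c *\<^sub>R v\<close> is the point of the line through v closest to w,
      since \<open>w \<bullet> v = (norm w)\<^sup>2\<close>; it lies in S.\<close>
    define c where "c = (norm w)\<^sup>2 / (norm v)\<^sup>2"
    have wv: "w \<bullet> v = (norm w)\<^sup>2"
      using inner_proj[OF T \<open>w \<in> T\<close>, of v] v(2) by (simp add: inner_commute dot_square_norm)
    have v0: "norm v > 0" using False wv by auto
    have py: "(norm v)\<^sup>2 = (norm w)\<^sup>2 + (norm (perp T v))\<^sup>2"
      using norm_proj_perp[OF T, of v] v(2) by simp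
    have "(norm (perp T v))\<^sup>2 \<le> s\<^sup>2 * (norm v)\<^sup>2"
      using power_mono[OF s[OF v(1)], of 2] by (simp add: power_mult_distrib)
    then have "(norm v)\<^sup>2 - (norm w)\<^sup>2 \<le> s\<^sup>2 * (norm v)\<^sup>2" using py by simp
    then have q: "1 - c \<le> s\<^sup>2" unfolding c_def using v0 by (simp add: field_simps)
    have "(norm (w - c *\<^sub>R v))\<^sup>2 = (norm w)\<^sup>2 - 2 * c * (w \<bullet> v) + c\<^sup>2 * (norm v)\<^sup>2"
      unfolding power2_norm_eq_inner
      by (simp add: inner_diff_left inner_diff_right inner_commute[of v w] algebra_simps power2_eq_square[of c])
    also have "c\<^sup>2 * (norm v)\<^sup>2 = c * (norm w)\<^sup>2"
    proof -
      have "c * (norm v)\<^sup>2 = (norm w)\<^sup>2" unfolding c_def using v0 by simp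
      moreover have "c\<^sup>2 * (norm v)\<^sup>2 = c * (c * (norm v)\<^sup>2)"
        by (simp only: power2_eq_square mult.assoc)
      ultimately show ?thesis by simp
    qed
    finally have "(norm (w - c *\<^sub>R v))\<^sup>2 = (1 - c) * (norm w)\<^sup>2"
      using wv by (simp add: algebra_simps)
    also have "\<dots> \<le> s\<^sup>2 * (norm w)\<^sup>2" using q by (rule mult_right_mono) simp
    finally have "norm (w - c *\<^sub>R v) \<le> s * norm w"
      using \<open>0 \<le> s\<close> by (rule_tac power2_le_imp_le) (auto simp: power_mult_distrib)
    moreover have "c *\<^sub>R v \<in> S" using v(1) subspace_scale[OF subsp[OF S]] by blast
    ultimately show ?thesis using norm_perp_le_dist[OF S, of "c *\<^sub>R v" w] by linarith
  qed
qed

subsection \<open>Principal component analysis\<close>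

lemma k_subspace_Rn: "k_subspace D (Rn D)"
proof -
  have inj: "inj_on axis_euc A" for A
    by (rule inj_onI) (metis coord_axis_euc zero_neq_one)
  have "orthonormal (axis_euc ` {..<D})"
    by (auto simp: orthonormal_def coord_eq_inner[symmetric] coord_axis_euc inj_on_eq_iff[OF inj[of UNIV]])
  moreover have "card (axis_euc ` {..<D}) = D" by (simp add: card_image inj)
  moreover have "Rn D = span (axis_euc ` {..<D})"
  proof
    show "span (axis_euc ` {..<D}) \<subseteq> Rn D"
      by (rule span_minimal) (auto simp: Rn_def coord_axis_euc subspace_Rn[unfolded Rn_def])
    show "Rn D \<subseteq> span (axis_euc ` {..<D})"
    proof
      fix x assume "x \<in> Rn D"
      then have "x = (\<Sum>i<D. coord x i *\<^sub>R axis_euc i)"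
        using of_coords_eq_sum of_coords_coord by metis
      then show "x \<in> span (axis_euc ` {..<D})"
        by (metis (no_types, lifting) span_sum span_scale span_base imageI)
    qed
  qed
  ultimately show ?thesis unfolding k_subspace_def by blast
qed

lemma orthonormal_family:
  fixes v :: "nat \<Rightarrow> 'a::real_inner"
  assumes "\<And>i j. i < n \<Longrightarrow> j < n \<Longrightarrow> v i \<bullet> v j = (if i = j then 1 else 0)"
  shows "orthonormal (v ` {..<n})" "inj_on v {..<n}" "k_subspace n (span (v ` {..<n}))"
proof -
  show inj: "inj_on v {..<n}" by (rule inj_onI) (metis assms lessThan_iff zero_neq_one)
  show "orthonormal (v ` {..<n})"
    unfolding orthonormal_def using assms inj by (auto simp: inj_on_eq_iff[OF inj])
  then show "k_subspace n (span (v ` {..<n}))"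
    unfolding k_subspace_def using card_image[OF inj] by auto
qed

lemma orthonormal_family_expand:
  fixes v :: "nat \<Rightarrow> 'a::real_inner"
  assumes o: "\<And>i j. i < n \<Longrightarrow> j < n \<Longrightarrow> v i \<bullet> v j = (if i = j then 1 else 0)"
    and "x \<in> span (v ` {..<n})"
  shows "x = (\<Sum>i<n. (v i \<bullet> x) *\<^sub>R v i)"
proof -
  have "proj (span (v ` {..<n})) x = x"
    by (rule proj_id[OF orthonormal_family(3)[OF o]]) (use assms(2) in auto)
  also have "proj (span (v ` {..<n})) x = (\<Sum>i<n. (v i \<bullet> x) *\<^sub>R v i)"
    by (subst proj_sum[OF orthonormal_family(1)[OF o]])
      (auto simp: sum.reindex[OF orthonormal_family(2)[OF o]])
  finally show ?thesis by simp
qed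

text \<open>An argument of Davis-Kahan type. The lower bound on the covariance in T0 forces the top
  d eigenvalues to be at least la, so each w in T is A z with
  \<open>norm z \<le> norm w / la\<close>. The part of A z normal to T0 is then a combination of the
  normal parts of the data y q.\<close>

lemma top_eigenspan_angle:
  fixes y :: "'i \<Rightarrow> euc" and N :: "'i set"
  defines "A \<equiv> \<lambda>x. \<Sum>q\<in>N. (y q \<bullet> x) *\<^sub>R y q"
  assumes T: "top_eigenspan D d A T" and d: "1 \<le> d" "d \<le> D"
    and T0: "k_subspace d T0" "T0 \<subseteq> Rn D"
    and lam: "0 < la" "\<And>u. u \<in> T0 \<Longrightarrow> la * (norm u)\<^sup>2 \<le> (\<Sum>q\<in>N. (y q \<bullet> u)\<^sup>2)"
  shows "k_subspace d T" "T \<subseteq> Rn D"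
    "\<And>w. w \<in> T \<Longrightarrow> norm (perp T0 w) \<le> ((\<Sum>q\<in>N. norm (perp T0 (y q)) * norm (y q)) / la) * norm w"
proof -
  obtain v l where v: "\<And>i. i < D \<Longrightarrow> v i \<in> Rn D" "\<And>i. i < D \<Longrightarrow> A (v i) = l i *\<^sub>R v i"
    and o: "\<And>i j. i < D \<Longrightarrow> j < D \<Longrightarrow> v i \<bullet> v j = (if i = j then 1 else 0)"
    and mono: "\<And>i j. i \<le> j \<Longrightarrow> j < D \<Longrightarrow> l j \<le> l i" and Tv: "T = span (v ` {..<d})"
    using T unfolding top_eigenspan_def by blast
  have od: "\<And>i j. i < d \<Longrightarrow> j < d \<Longrightarrow> v i \<bullet> v j = (if i = j then 1 else 0)" using o d by simp
  show kT: "k_subspace d T" unfolding Tv by (rule orthonormal_family(3)[OF od])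
  show "T \<subseteq> Rn D" unfolding Tv by (rule span_minimal) (use v(1) d subspace_Rn in auto)
  have full: "span (v ` {..<D}) = Rn D"
  proof (rule k_subspace_eq[OF _ k_subspace_Rn])
    show "k_subspace D (span (v ` {..<D}))" by (rule orthonormal_family(3)) (rule o)
    show "span (v ` {..<D}) \<subseteq> Rn D" by (rule span_minimal) (use v(1) subspace_Rn in auto)
  qed
  have Alin: "linear A"
    unfolding A_def by (rule linearI)
      (simp_all add: inner_add_right scaleR_add_left sum.distrib scaleR_sum_right)
  define S' where "S' = span (v ` {..<d - 1})"
  have od': "\<And>i j. i < d - 1 \<Longrightarrow> j < d - 1 \<Longrightarrow> v i \<bullet> v j = (if i = j then 1 else 0)" using od by simp
  have S': "k_subspace (d - 1) S'" unfolding S'_def by (rule orthonormal_family(3)[OF od'])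
  \<comment> \<open>Courant-Fischer by a dimension count: T0 contains a non-zero u orthogonal to the
    first d - 1 eigenvectors, and the quadratic form at u is at most \<open>l (d - 1)\<close> times
    its squared norm.\<close>
  have "\<not> inj_on (proj S') T0"
    using k_subspace_inj_le[OF T0(1) linear_proj[OF S'] _ _ S'] proj_in[OF S'] d(1) by fastforce
  then obtain u where u: "u \<in> T0" "proj S' u = 0" "u \<noteq> 0"
    using linear_inj_on_iff_eq_0[OF linear_proj[OF S'] subsp[OF T0(1)]] by blast
  have uv: "v i \<bullet> u = 0" if "i < d - 1" for i
    using inner_proj[OF S', of "v i" u] u(2) that unfolding S'_def
    by (simp add: span_base inner_commute)
  have ue: "u = (\<Sum>i<D. (v i \<bullet> u) *\<^sub>R v i)"
    by (rule orthonormal_family_expand[OF o]) (use full T0(2) u(1) in auto)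
  have "A u = (\<Sum>i<D. (v i \<bullet> u) *\<^sub>R (l i *\<^sub>R v i))"
    by (subst ue, subst linear_sum[OF Alin]) (auto simp: linear_cmul[OF Alin] v(2) intro!: sum.cong)
  then have "u \<bullet> A u = (\<Sum>i<D. l i * (v i \<bullet> u)\<^sup>2)"
    by (simp add: inner_sum_right power2_eq_square inner_commute algebra_simps)
  also have "\<dots> \<le> (\<Sum>i<D. l (d - 1) * (v i \<bullet> u)\<^sup>2)"
  proof (rule sum_mono)
    fix i assume i: "i \<in> {..<D}"
    show "l i * (v i \<bullet> u)\<^sup>2 \<le> l (d - 1) * (v i \<bullet> u)\<^sup>2"
    proof (cases "i < d - 1")
      case True then show ?thesis using uv by simp
    next
      case False then show ?thesis using mono[of "d - 1" i] i by (intro mult_right_mono) auto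
    qed
  qed
  also have "\<dots> = l (d - 1) * (norm u)\<^sup>2"
  proof -
    have "u \<bullet> u = u \<bullet> (\<Sum>i<D. (v i \<bullet> u) *\<^sub>R v i)" using ue by simp
    then have "(norm u)\<^sup>2 = (\<Sum>i<D. (v i \<bullet> u)\<^sup>2)"
      by (simp add: inner_sum_right power2_eq_square inner_commute dot_square_norm)
    then show ?thesis by (simp add: sum_distrib_left)
  qed
  finally have "u \<bullet> A u \<le> l (d - 1) * (norm u)\<^sup>2" .
  moreover have "u \<bullet> A u = (\<Sum>q\<in>N. (y q \<bullet> u)\<^sup>2)"
    unfolding A_def by (simp add: inner_sum_right power2_eq_square inner_commute)
  ultimately have "la * (norm u)\<^sup>2 \<le> l (d - 1) * (norm u)\<^sup>2" using lam(2)[OF u(1)] by simp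
  then have ld: "la \<le> l (d - 1)" using u(3) by simp
  have li: "la \<le> l i" if "i < d" for i 
  proof -
    have "l (d - 1) \<le> l i" by (rule mono) (use that d in auto)
    then show ?thesis using ld by linarith
  qed
  fix w assume w: "w \<in> T"
  \<comment> \<open>A preimage of w under A; the top eigenvalues are positive, so the divisions are
    legitimate.\<close>
  define z where "z = (\<Sum>i<d. ((v i \<bullet> w) / l i) *\<^sub>R v i)"
  have we: "w = (\<Sum>i<d. (v i \<bullet> w) *\<^sub>R v i)"
    by (rule orthonormal_family_expand[OF od]) (use w Tv in auto)
  have Az: "A z = w"
  proof -
    have "A z = (\<Sum>i<d. ((v i \<bullet> w) / l i) *\<^sub>R (l i *\<^sub>R v i))"
      unfolding z_def by (subst linear_sum[OF Alin]) (use d in \<open>auto simp: linear_cmul[OF Alin] v(2) intro!: sum.cong\<close>)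
    also have "\<dots> = (\<Sum>i<d. (v i \<bullet> w) *\<^sub>R v i)"
      by (rule sum.cong) (use li lam(1) in \<open>force+\<close>)
    finally show ?thesis using we by simp
  qed
  have norm2: "(norm (\<Sum>i<d. c i *\<^sub>R v i))\<^sup>2 = (\<Sum>i<d. (c i)\<^sup>2)" for c
  proof -
    have "norm (v i) = 1" if "i < d" for i using od[OF that that] by (simp add: norm_eq_sqrt_inner)
    then have "(\<Sum>i<d. (norm (c i *\<^sub>R v i))\<^sup>2) = (\<Sum>i<d. (c i)\<^sup>2)" by (intro sum.cong) auto
    moreover have "(norm (\<Sum>i<d. c i *\<^sub>R v i))\<^sup>2 = (\<Sum>i<d. (norm (c i *\<^sub>R v i))\<^sup>2)"
      by (rule norm_sum_Pythagorean) (auto simp: pairwise_def orthogonal_def od)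
    ultimately show ?thesis by simp
  qed
  have zn: "norm z \<le> norm w / la"
  proof (rule power2_le_imp_le)
    have "(norm z)\<^sup>2 = (\<Sum>i<d. ((v i \<bullet> w) / l i)\<^sup>2)" unfolding z_def by (rule norm2)
    also have "\<dots> \<le> (\<Sum>i<d. (v i \<bullet> w)\<^sup>2 / la\<^sup>2)"
    proof (rule sum_mono)
      fix i assume "i \<in> {..<d}"
      then have "la\<^sup>2 \<le> (l i)\<^sup>2" using li[of i] lam(1) by (intro power_mono) auto
      then show "((v i \<bullet> w) / l i)\<^sup>2 \<le> (v i \<bullet> w)\<^sup>2 / la\<^sup>2"
        unfolding power_divide using lam(1) by (intro divide_left_mono) (auto intro!: mult_pos_pos)
    qed
    also have "\<dots> = (norm w / la)\<^sup>2"
      using norm2[of "\<lambda>i. v i \<bullet> w"] we by (simp add: power_divide sum_divide_distrib)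
    finally show "(norm z)\<^sup>2 \<le> (norm w / la)\<^sup>2" .
    show "0 \<le> norm w / la" using lam(1) by simp
  qed
  have "perp T0 w = (\<Sum>q\<in>N. (y q \<bullet> z) *\<^sub>R perp T0 (y q))"
    unfolding Az[symmetric] A_def
    by (simp add: linear_sum[OF linear_perp[OF T0(1)]] perp_scale[OF T0(1)])
  also have "norm \<dots> \<le> (\<Sum>q\<in>N. norm (perp T0 (y q)) * norm (y q) * norm z)"
  proof (rule sum_norm_le)
    fix q
    have "\<bar>y q \<bullet> z\<bar> * norm (perp T0 (y q)) \<le> (norm (y q) * norm z) * norm (perp T0 (y q))"
      by (intro mult_right_mono Cauchy_Schwarz_ineq2) simp
    then show "norm ((y q \<bullet> z) *\<^sub>R perp T0 (y q)) \<le> norm (perp T0 (y q)) * norm (y q) * norm z"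
      by (simp add: algebra_simps)
  qed
  also have "\<dots> = (\<Sum>q\<in>N. norm (perp T0 (y q)) * norm (y q)) * norm z"
    by (simp add: sum_distrib_right)
  also have "\<dots> \<le> (\<Sum>q\<in>N. norm (perp T0 (y q)) * norm (y q)) * (norm w / la)"
    using zn by (intro mult_left_mono sum_nonneg) auto
  finally show "norm (perp T0 w) \<le> ((\<Sum>q\<in>N. norm (perp T0 (y q)) * norm (y q)) / la) * norm w"
    by simp
qed

subsection \<open>Compactness\<close>

text \<open>The type \<open>euc\<close> is not locally compact. Compactness comes from Tychonoff:
  bounded coordinate functions form a compact cube, and \<open>of_coords D\<close> maps it
  continuously onto a set containing S.\<close>

lemma compact_Rn:
  assumes "closed S" "bounded S" "S \<subseteq> Rn D"
  shows "compact S"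
proof -
  obtain r where r: "\<And>x. x \<in> S \<Longrightarrow> norm x \<le> r" using assms(2) bounded_iff by blast
  define C where "C = {x :: nat \<Rightarrow> real. \<forall>i. x i \<in> {-r..r}}"
  have "compact C"
  proof -
    have "compactin (product_topology (\<lambda>_. euclidean) UNIV) (\<Pi>\<^sub>E i\<in>UNIV. {-r..r::real})"
      by (subst compactin_PiE) auto
    moreover have "(\<Pi>\<^sub>E i\<in>UNIV. {-r..r::real}) = C" by (auto simp: C_def)
    ultimately show ?thesis
      by (metis compactin_euclidean_iff euclidean_product_topology)
  qed
  moreover have "continuous_on UNIV (of_coords D)"
    unfolding of_coords_eq_sum[abs_def]
    by (intro continuous_intros continuous_on_product_coordinates)
  ultimately have "compact (of_coords D ` C)"
    by (meson compact_continuous_image continuous_on_subset subset_UNIV)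
  moreover have "S \<subseteq> of_coords D ` C"
  proof
    fix x assume x: "x \<in> S"
    have "\<bar>coord x i\<bar> \<le> r" for i
    proof -
      have "\<bar>axis_euc i \<bullet> x\<bar> \<le> norm (axis_euc i) * norm x" by (rule Cauchy_Schwarz_ineq2)
      moreover have "norm (axis_euc i) = 1"
        by (simp add: norm_eq_sqrt_inner coord_eq_inner[symmetric] coord_axis_euc)
      ultimately show ?thesis using r[OF x] by (simp add: coord_eq_inner)
    qed
    then have "coord x \<in> C" by (auto simp: C_def abs_le_iff minus_le_iff)
    then show "x \<in> of_coords D ` C"
      using assms(3) x of_coords_coord by (metis image_eqI subsetD)
  qed
  ultimately show ?thesis
    using assms(1) by (metis closed_Int_compact inf.absorb1)
qed

text \<open>For Banach's fixed point theorem in \<open>isotopy\<close>; the finitely supported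
  sequences as a whole are not complete.\<close>

lemma complete_Rn: "Topological_Spaces.complete (Rn D)"
proof (rule completeI)
  fix f :: "nat \<Rightarrow> euc" assume f: "\<forall>n. f n \<in> Rn D" "Cauchy f"
  have "bounded (range f)" using f(2) by (rule cauchy_imp_bounded)
  then have b: "bounded (closure (range f))" by (rule bounded_closure)
  have s: "closure (range f) \<subseteq> Rn D" using f(1) closed_Rn by (simp add: closure_minimal image_subset_iff)
  have "seq_compact (closure (range f))"
    using compact_Rn[OF closed_closure b s] by (rule compact_imp_seq_compact)
  moreover have "\<forall>n. f n \<in> closure (range f)" by (intro allI closure_subset[THEN subsetD]) simp
  ultimately obtain l r where l: "l \<in> closure (range f)" "strict_mono (r :: nat \<Rightarrow> nat)" "(f \<circ> r) \<longlonglongrightarrow> l"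
    by (rule seq_compactE)
  show "\<exists>l\<in>Rn D. f \<longlonglongrightarrow> l" using Cauchy_converges_subseq[OF f(2) l(2,3)] s l(1) by blast
qed

subsection \<open>Tangent spaces of embedded submanifolds\<close>

lemma linear_lower_bound_Rn:
  fixes f :: "euc \<Rightarrow> euc"
  assumes "bounded_linear f" "inj_on f (Rn d)"
  obtains c where "c > 0" "\<And>v. v \<in> Rn d \<Longrightarrow> c * norm v \<le> norm (f v)"
proof (cases "sphere 0 1 \<inter> Rn d = {}")
  case True
  have "v = 0" if "v \<in> Rn d" for v
  proof (rule ccontr)
    assume "v \<noteq> 0"
    then have "v /\<^sub>R norm v \<in> sphere 0 1 \<inter> Rn d"
      using that subspace_Rn by (auto simp: subspace_scale)
    then show False using True by blast
  qed
  then have "1 * norm v \<le> norm (f v)" if "v \<in> Rn d" for v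
    using that by (metis mult_1 norm_ge_zero norm_zero)
  then show ?thesis using that[of 1] by simp
next
  case False
  have lin: "linear f" using assms(1) by (rule bounded_linear.linear)
  have "compact (sphere 0 1 \<inter> Rn d)"
    by (rule compact_Rn[of _ d]) (auto intro!: closed_Int closed_Rn closed_Collect_eq continuous_intros simp: sphere_def intro: bounded_subset[OF bounded_cball[of 0 1]])
  moreover have "continuous_on (sphere 0 1 \<inter> Rn d) (\<lambda>v. norm (f v))"
    by (intro continuous_on_norm linear_continuous_on assms)
  ultimately obtain v0 where v0: "v0 \<in> sphere 0 1 \<inter> Rn d"
    "\<And>v. v \<in> sphere 0 1 \<inter> Rn d \<Longrightarrow> norm (f v0) \<le> norm (f v)"
    using continuous_attains_inf[of "sphere 0 1 \<inter> Rn d" "\<lambda>v. norm (f v)"] False by blast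
  have "f v0 \<noteq> 0"
    using linear_inj_on_iff_eq_0[OF lin subspace_Rn, of d] assms(2) v0(1) by auto
  moreover have "norm (f v0) * norm v \<le> norm (f v)" if v: "v \<in> Rn d" for v
  proof (cases "v = 0")
    case False
    have "norm (f v0) \<le> norm (f (v /\<^sub>R norm v))"
      by (rule v0(2)) (use False v subspace_Rn in \<open>auto simp: subspace_scale\<close>)
    also have "\<dots> = norm (f v) / norm v" by (simp add: linear_cmul[OF lin] divide_inverse mult.commute)
    finally show ?thesis using False by (simp add: field_simps)
  qed simp
  ultimately show ?thesis using that[of "norm (f v0)"] by simp
qed

text \<open>Nearby points of M have nearby parameters because the inverse of the chart is continuous
  on W; this is where an embedding differs from an immersion. The injective derivative bounds the
  parameter difference by the chord, so the linearisation error is small relative to the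
  chord.\<close>

lemma chart_chord:
  fixes \<phi> :: "euc \<Rightarrow> euc"
  assumes V: "openin (top_of_set (Rn d)) V" and W: "openin (top_of_set M) W"
    and h: "homeomorphism V W \<phi> \<psi>" and x: "x \<in> V"
    and der: "(\<phi> has_derivative f) (at x within V)" and inj: "inj_on f (Rn d)" and "e > 0"
  obtains \<delta> where "\<delta> > 0"
    "\<And>m. m \<in> M \<Longrightarrow> dist m (\<phi> x) < \<delta> \<Longrightarrow> norm (perp (f ` Rn d) (m - \<phi> x)) \<le> e * norm (m - \<phi> x)"
proof -
  let ?T = "f ` Rn d"
  have bl: "bounded_linear f" using der by (rule has_derivative_bounded_linear)
  have T: "k_subspace d ?T"
    using k_subspace_linear_image[OF k_subspace_Rn bounded_linear.linear[OF bl] inj] .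
  obtain c where c: "c > 0" "\<And>v. v \<in> Rn d \<Longrightarrow> c * norm v \<le> norm (f v)"
    using linear_lower_bound_Rn[OF bl inj] by blast
  \<comment> \<open>The bound c / 2 absorbs the error and gives
    \<open>c / 2 * norm (y - x) \<le> norm (m - \<phi> x)\<close>; the second bound then turns the
    linearisation error into at most e times the chord.\<close>
  define e1 where "e1 = min (c / 2) (e * c / 2)"
  have e1: "e1 > 0" "e1 \<le> c / 2" "e1 \<le> e * c / 2" using c \<open>e > 0\<close> by (auto simp: e1_def)
  obtain \<delta>1 where d1: "\<delta>1 > 0"
    "\<And>y. y \<in> V \<Longrightarrow> norm (y - x) < \<delta>1 \<Longrightarrow> norm (\<phi> y - \<phi> x - f (y - x)) \<le> e1 * norm (y - x)"
    using der e1(1) unfolding has_derivative_within_alt by meson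
  have p: "\<phi> x \<in> W" "\<psi> (\<phi> x) = x" using h x by (auto simp: homeomorphism_def)
  have VR: "V \<subseteq> Rn d" using V openin_imp_subset by blast
  have "continuous_on W \<psi>" using h by (simp add: homeomorphism_def)
  then obtain \<delta>2 where d2: "\<delta>2 > 0" "\<And>m. m \<in> W \<Longrightarrow> dist m (\<phi> x) < \<delta>2 \<Longrightarrow> dist (\<psi> m) x < \<delta>1"
    using p d1(1) unfolding continuous_on_iff by metis
  obtain \<delta>3 where d3: "\<delta>3 > 0" "\<And>m. m \<in> M \<Longrightarrow> dist m (\<phi> x) < \<delta>3 \<Longrightarrow> m \<in> W"
    using W p(1) unfolding openin_euclidean_subtopology_iff by metis
  show ?thesis
  proof (rule that[of "min \<delta>2 \<delta>3"])
    show "min \<delta>2 \<delta>3 > 0" using d2 d3 by simp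
    fix m assume m: "m \<in> M" "dist m (\<phi> x) < min \<delta>2 \<delta>3"
    then have mW: "m \<in> W" using d3 by simp
    define y where "y = \<psi> m"
    have y: "y \<in> V" "\<phi> y = m" using h mW by (auto simp: homeomorphism_def y_def)
    have "norm (y - x) < \<delta>1" using d2(2)[OF mW] m(2) by (simp add: y_def dist_norm)
    then have b: "norm (m - \<phi> x - f (y - x)) \<le> e1 * norm (y - x)" using d1(2) y by auto
    have yx: "y - x \<in> Rn d" using y(1) x VR subspace_Rn by (meson subsetD subspace_diff)
    have "norm (f (y - x)) \<le> norm (m - \<phi> x) + norm (m - \<phi> x - f (y - x))"
      by (metis add.commute norm_triangle_sub norm_minus_commute)
    then have "c * norm (y - x) \<le> norm (m - \<phi> x) + e1 * norm (y - x)"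
      using c(2)[OF yx] b by linarith
    moreover have "e1 * norm (y - x) \<le> (c / 2) * norm (y - x)" using e1(2) by (rule mult_right_mono) simp
    ultimately have "(c / 2) * norm (y - x) \<le> norm (m - \<phi> x)" by (simp add: algebra_simps)
    then have yb: "e * (c / 2 * norm (y - x)) \<le> e * norm (m - \<phi> x)"
      using \<open>e > 0\<close> by (intro mult_left_mono) auto
    have "norm (perp ?T (m - \<phi> x)) \<le> norm (m - \<phi> x - f (y - x))"
      using norm_perp_le_dist[OF T] yx by blast
    also have "\<dots> \<le> (e * c / 2) * norm (y - x)"
      using b e1(3) by (meson mult_right_mono norm_ge_zero order_trans)
    also have "\<dots> \<le> e * norm (m - \<phi> x)" using yb by simp
    finally show "norm (perp ?T (m - \<phi> x)) \<le> e * norm (m - \<phi> x)" .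
  qed
qed

lemma vector_derivative_quotient_tendsto:
  fixes \<gamma> :: "real \<Rightarrow> 'a::real_normed_vector"
  assumes "(\<gamma> has_vector_derivative v) (at 0)"
  shows "((\<lambda>s. (\<gamma> s - \<gamma> 0) /\<^sub>R s) \<longlongrightarrow> v) (at 0)"
proof -
  have "((\<lambda>s. norm (\<gamma> s - \<gamma> 0 - s *\<^sub>R v) / norm s) \<longlongrightarrow> 0) (at 0)"
    using assms by (simp add: has_vector_derivative_def has_derivative_iff_norm)
  moreover have "\<forall>\<^sub>F s in at 0. norm (\<gamma> s - \<gamma> 0 - s *\<^sub>R v) / norm s = norm ((\<gamma> s - \<gamma> 0) /\<^sub>R s - v)"
  proof (rule eventually_mono[OF eventually_neq_at_within[of 0]])
    fix s :: real assume "s \<noteq> 0"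
    then have "(\<gamma> s - \<gamma> 0) /\<^sub>R s - v = (\<gamma> s - \<gamma> 0 - s *\<^sub>R v) /\<^sub>R s" by (simp add: algebra_simps)
    then show "norm (\<gamma> s - \<gamma> 0 - s *\<^sub>R v) / norm s = norm ((\<gamma> s - \<gamma> 0) /\<^sub>R s - v)"
      by (simp add: divide_inverse mult.commute)
  qed
  ultimately have "((\<lambda>s. norm ((\<gamma> s - \<gamma> 0) /\<^sub>R s - v)) \<longlongrightarrow> 0) (at 0)"
    by (simp add: tendsto_cong)
  then show ?thesis by (subst tendsto_dist_iff) (simp add: dist_norm)
qed

text \<open>Connects the curves that define \<open>tangent_space\<close> with charts. Images of
  straight segments realise every vector in the range of f; conversely a velocity is a limit of
  chord quotients, whose normal part is negligible by \<open>chart_chord\<close>.\<close>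

lemma chart_tangent_space:
  fixes \<phi> :: "euc \<Rightarrow> euc"
  assumes V: "openin (top_of_set (Rn d)) V" and W: "openin (top_of_set M) W"
    and h: "homeomorphism V W \<phi> \<psi>" and x: "x \<in> V"
    and der: "(\<phi> has_derivative f) (at x within V)" and inj: "inj_on f (Rn d)"
  shows "tangent_space M (\<phi> x) = f ` Rn d"
proof
  let ?T = "f ` Rn d"
  have bl: "bounded_linear f" using der by (rule has_derivative_bounded_linear)
  have T: "k_subspace d ?T"
    using k_subspace_linear_image[OF k_subspace_Rn bounded_linear.linear[OF bl] inj] .
  show "f ` Rn d \<subseteq> tangent_space M (\<phi> x)"
  proof
    fix v assume "v \<in> f ` Rn d"
    then obtain u where u: "u \<in> Rn d" "v = f u" by blast
    obtain S where S: "open S" "V = Rn d \<inter> S" using V by (auto simp: openin_open)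
    have "continuous_on UNIV (\<lambda>s::real. x + s *\<^sub>R u)" by (intro continuous_intros)
    then have "open ((\<lambda>s::real. x + s *\<^sub>R u) -` S)" using S(1) by (simp add: open_vimage)
    moreover have "0 \<in> (\<lambda>s::real. x + s *\<^sub>R u) -` S" using S x by auto
    ultimately obtain e where e: "e > 0" "ball 0 e \<subseteq> (\<lambda>s::real. x + s *\<^sub>R u) -` S"
      by (meson open_contains_ball)
    have inV: "x + s *\<^sub>R u \<in> V" if "\<bar>s\<bar> < e" for s
      using that e(2) x u(1) S subspace_Rn[of d]
      by (auto simp: subset_iff intro!: subspace_add subspace_scale)
    have "(\<phi> has_derivative f) (at (x + 0 *\<^sub>R u) within (\<lambda>s::real. x + s *\<^sub>R u) ` ball 0 e)"
      unfolding scaleR_zero_left add_0_right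
      by (rule has_derivative_subset[OF der]) (use inV in auto)
    moreover have "((\<lambda>s::real. x + s *\<^sub>R u) has_derivative (\<lambda>s. s *\<^sub>R u)) (at 0 within ball 0 e)"
      by (auto intro!: derivative_eq_intros)
    ultimately have "(\<phi> \<circ> (\<lambda>s. x + s *\<^sub>R u) has_derivative f \<circ> (\<lambda>s. s *\<^sub>R u)) (at 0 within ball 0 e)"
      by (rule diff_chain_within[rotated])
    then have "(\<phi> \<circ> (\<lambda>s. x + s *\<^sub>R u) has_derivative f \<circ> (\<lambda>s. s *\<^sub>R u)) (at 0)"
      using e(1) by (simp add: at_within_open[OF _ open_ball])
    moreover have "f \<circ> (\<lambda>s. s *\<^sub>R u) = (\<lambda>s. s *\<^sub>R v)"
      using bl by (auto simp: u(2) linear_cmul bounded_linear.linear)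
    ultimately have "(\<phi> \<circ> (\<lambda>s. x + s *\<^sub>R u) has_vector_derivative v) (at 0)"
      by (simp add: has_vector_derivative_def)
    moreover have "(\<phi> \<circ> (\<lambda>s. x + s *\<^sub>R u)) s \<in> M" if "\<bar>s\<bar> < e" for s
    proof -
      have "\<phi> (x + s *\<^sub>R u) \<in> W" using inV[OF that] h by (auto simp: homeomorphism_def)
      then show ?thesis using openin_imp_subset[OF W] by auto
    qed
    ultimately show "v \<in> tangent_space M (\<phi> x)"
      unfolding tangent_space_def mem_Collect_eq using e(1)
      by (intro exI[of _ "\<phi> \<circ> (\<lambda>s. x + s *\<^sub>R u)"] exI[of _ e]) simp
  qed
  show "tangent_space M (\<phi> x) \<subseteq> f ` Rn d"
  proof
    fix v assume "v \<in> tangent_space M (\<phi> x)"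
    then obtain \<gamma> :: "real \<Rightarrow> euc" and e where g: "e > 0" "\<gamma> 0 = \<phi> x" "\<And>s. \<bar>s\<bar> < e \<Longrightarrow> \<gamma> s \<in> M"
      "(\<gamma> has_vector_derivative v) (at 0)"
      unfolding tangent_space_def by blast
    have lim: "((\<lambda>s. (\<gamma> s - \<phi> x) /\<^sub>R s) \<longlongrightarrow> v) (at 0)"
      using vector_derivative_quotient_tendsto[OF g(4)] g(2) by simp
    have "norm (perp ?T v) \<le> \<epsilon> * norm v" if "\<epsilon> > 0" for \<epsilon>
    proof -
      obtain \<delta> where dl: "\<delta> > 0"
        "\<And>m. m \<in> M \<Longrightarrow> dist m (\<phi> x) < \<delta> \<Longrightarrow> norm (perp ?T (m - \<phi> x)) \<le> \<epsilon> * norm (m - \<phi> x)"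
        using chart_chord[OF V W h x der inj \<open>\<epsilon> > 0\<close>] by blast
      have "isCont \<gamma> 0" using g(4) by (rule has_vector_derivative_continuous)
      then have "\<forall>\<^sub>F s in at 0. dist (\<gamma> s) (\<phi> x) < \<delta>"
        using dl(1) g(2) by (auto simp: isCont_def tendsto_iff)
      moreover have "\<forall>\<^sub>F s in at (0::real). \<bar>s\<bar> < e"
        using g(1) by (auto simp: eventually_at intro!: exI[of _ e])
      ultimately have ev: "\<forall>\<^sub>F s in at 0. norm (perp ?T ((\<gamma> s - \<phi> x) /\<^sub>R s)) \<le> \<epsilon> * norm ((\<gamma> s - \<phi> x) /\<^sub>R s)"
      proof eventually_elim
        case (elim s)
        have "norm (perp ?T (\<gamma> s - \<phi> x)) \<le> \<epsilon> * norm (\<gamma> s - \<phi> x)"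
          using dl(2) g(3) elim by blast
        then have "inverse \<bar>s\<bar> * norm (perp ?T (\<gamma> s - \<phi> x)) \<le> inverse \<bar>s\<bar> * (\<epsilon> * norm (\<gamma> s - \<phi> x))"
          by (rule mult_left_mono) simp
        then show ?case
          unfolding perp_scale[OF T] norm_scaleR abs_inverse by (simp only: mult.left_commute)
      qed
      have l1: "((\<lambda>s. norm (perp ?T ((\<gamma> s - \<phi> x) /\<^sub>R s))) \<longlongrightarrow> norm (perp ?T v)) (at 0)"
        by (intro tendsto_norm bounded_linear.tendsto[OF bounded_linear_perp[OF T]] lim)
      have l2: "((\<lambda>s. \<epsilon> * norm ((\<gamma> s - \<phi> x) /\<^sub>R s)) \<longlongrightarrow> \<epsilon> * norm v) (at 0)"
        by (intro tendsto_intros lim)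
      show ?thesis by (rule tendsto_le[OF _ l2 l1 ev]) simp
    qed
      note pe = this
    have "norm (perp ?T v) \<le> 0"
    proof (rule field_le_epsilon)
      fix \<epsilon> :: real assume e0: "\<epsilon> > 0"
      have pos: "norm v + 1 > 0" by (simp add: add_nonneg_pos)
      have "norm (perp ?T v) \<le> (\<epsilon> / (norm v + 1)) * norm v" by (rule pe) (use e0 pos in simp)
      also have "\<dots> = \<epsilon> * (norm v / (norm v + 1))" by simp
      also have "\<dots> \<le> \<epsilon> * 1" by (intro mult_left_mono) (use e0 pos in auto)
      finally show "norm (perp ?T v) \<le> 0 + \<epsilon>" by simp
    qed
    then have "v = proj ?T v" by (simp add: perp_def)
    then show "v \<in> f ` Rn d" using proj_in[OF T, of v] by simp
  qed
qed

lemma C1_submanifold_tangent: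
  assumes "C1_submanifold d M" "p \<in> M"
  shows "k_subspace d (tangent_space M p)"
    and "e > 0 \<Longrightarrow> \<exists>\<delta>>0. \<forall>m\<in>M. dist m p < \<delta> \<longrightarrow> norm (perp (tangent_space M p) (m - p)) \<le> e * norm (m - p)"
proof -
  obtain V W \<phi> \<psi> \<phi>' where c: "openin (top_of_set (Rn d)) V \<and> openin (top_of_set M) W \<and> p \<in> W \<and>
    homeomorphism V W \<phi> \<psi> \<and>
    (\<forall>x\<in>V. (\<phi> has_derivative \<phi>' x) (at x within V) \<and> inj_on (\<phi>' x) (Rn d)) \<and>
    (\<forall>v\<in>Rn d. continuous_on V (\<lambda>x. \<phi>' x v))"
    using bspec[OF assms(1)[unfolded C1_submanifold_def] assms(2)] by (elim exE) (rule that)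
  have c: "openin (top_of_set (Rn d)) V" "openin (top_of_set M) W" "p \<in> W"
    "homeomorphism V W \<phi> \<psi>"
    "\<And>x. x \<in> V \<Longrightarrow> (\<phi> has_derivative \<phi>' x) (at x within V) \<and> inj_on (\<phi>' x) (Rn d)"
    using c by auto
  define x where "x = \<psi> p"
  have x: "x \<in> V" "\<phi> x = p" using c(3,4) by (auto simp: homeomorphism_def x_def)
  note cx = c(5)[OF x(1)]
  have eq: "tangent_space M p = \<phi>' x ` Rn d"
    using chart_tangent_space[OF c(1,2,4) x(1), of "\<phi>' x"] cx x(2) by simp
  show "k_subspace d (tangent_space M p)"
    unfolding eq
    by (rule k_subspace_linear_image[OF k_subspace_Rn])
      (use cx in \<open>auto dest: has_derivative_bounded_linear bounded_linear.linear\<close>)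
  show "\<exists>\<delta>>0. \<forall>m\<in>M. dist m p < \<delta> \<longrightarrow> norm (perp (tangent_space M p) (m - p)) \<le> e * norm (m - p)" if "e > 0"
    using chart_chord[OF c(1,2,4) x(1), of "\<phi>' x" e] cx that unfolding x(2) eq by metis
qed

lemma tangent_spaceE:
  assumes "w \<in> tangent_space M m"
  obtains \<gamma> :: "real \<Rightarrow> euc" and e where "e > 0" "\<gamma> 0 = m" "\<And>s. \<bar>s\<bar> < e \<Longrightarrow> \<gamma> s \<in> M"
    "(\<gamma> has_vector_derivative w) (at 0)"
  using assms unfolding tangent_space_def mem_Collect_eq by metis

lemma C1_tangent_subset_Rn:
  assumes "M \<subseteq> Rn D" shows "tangent_space M p \<subseteq> Rn D"
proof
  fix v assume "v \<in> tangent_space M p"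
  from tangent_spaceE[OF this]
  obtain \<gamma> :: "real \<Rightarrow> euc" and e where g: "e > 0" "\<gamma> 0 = p" "\<And>s. \<bar>s\<bar> < e \<Longrightarrow> \<gamma> s \<in> M"
    "(\<gamma> has_vector_derivative v) (at 0)" by metis
  show "v \<in> Rn D"
  proof (rule Lim_in_closed_set[OF closed_Rn _ _ vector_derivative_quotient_tendsto[OF g(4)]])
    have "\<forall>\<^sub>F s in at (0::real). \<bar>s\<bar> < e"
      using g(1) by (auto simp: eventually_at intro!: exI[of _ e])
    then show "\<forall>\<^sub>F s in at 0. (\<gamma> s - \<gamma> 0) /\<^sub>R s \<in> Rn D"
    proof eventually_elim
      case (elim s)
      then show ?case using g(3)[of s] g(3)[of 0] g(1) assms subspace_Rn
        by (intro subspace_scale subspace_diff) auto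
    qed
  qed simp
qed

subsection \<open>Sets of positive reach\<close>

lemma norm_diff_square:
  fixes x y :: "'a::real_inner"
  shows "(norm (x - y))\<^sup>2 = (norm x)\<^sup>2 - 2 * (x \<bullet> y) + (norm y)\<^sup>2"
  unfolding power2_norm_eq_inner
  by (simp only: inner_diff_left inner_diff_right inner_commute[of y x])

lemma infdist_attained:
  assumes "compact K" "K \<noteq> {}"
  obtains k where "k \<in> K" "dist x k = infdist x K"
proof -
  have "continuous_on K (dist x)" by (intro continuous_intros)
  then obtain k where k: "k \<in> K" "\<And>y. y \<in> K \<Longrightarrow> dist x k \<le> dist x y"
    using continuous_attains_inf[OF assms] by blast
  then have "dist x k \<le> infdist x K" using assms(2) by (auto simp: infdist_def intro: cINF_greatest)
  moreover have "infdist x K \<le> dist x k" using k(1) by (rule infdist_le)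
  ultimately show ?thesis by (intro that[OF k(1)] antisym)
qed

text \<open>First-order condition for the squared distance to z along a curve in M through
  p.\<close>

lemma nearest_orthogonal:
  fixes M :: "euc set"
  assumes p: "p \<in> M" "dist z p = infdist z M" and w: "w \<in> tangent_space M p"
  shows "(z - p) \<bullet> w = 0"
proof -
  from tangent_spaceE[OF w]
  obtain \<gamma> :: "real \<Rightarrow> euc" and e where g: "e > 0" "\<gamma> 0 = p" "\<And>s. \<bar>s\<bar> < e \<Longrightarrow> \<gamma> s \<in> M"
    "(\<gamma> has_vector_derivative w) (at 0)" by metis
  define f where "f s = (z - \<gamma> s) \<bullet> (z - \<gamma> s)" for s
  have "(f has_real_derivative - 2 * ((z - p) \<bullet> w)) (at 0)"
    unfolding f_def has_real_derivative_iff_has_vector_derivative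
    using g(4) by (auto simp: has_vector_derivative_def g(2) inner_commute algebra_simps intro!: derivative_eq_intros)
  moreover have "f 0 \<le> f s" if "\<bar>0 - s\<bar> < e" for s
  proof -
    have "norm (z - p) \<le> norm (z - \<gamma> s)" using infdist_le[OF g(3)[of s], of z] that p(2) by (simp add: dist_norm)
    then show ?thesis unfolding f_def g(2) by (simp add: dot_square_norm power_mono)
  qed
  ultimately have "- 2 * ((z - p) \<bullet> w) = 0" using g(1) by (intro DERIV_local_min[of f _ 0 e]) auto
  then show ?thesis by simp
qed

section \<open>Nearest points and the rolling ball condition\<close>

locale reach_manifold =
  fixes D d :: nat and M :: "euc set" and \<rho> :: real
  assumes manifold: "M \<in> manifolds D d \<rho>" and rho: "0 < \<rho>"
begin

lemma M_props: "M \<noteq> {}" "M \<subseteq> Rn D" "compact M" "connected M" "C1_submanifold d M" "ereal \<rho> \<le> reach D M"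
  using manifold by (auto simp: manifolds_def)

abbreviation T :: "euc \<Rightarrow> euc set" where "T \<equiv> tangent_space M"

lemma T_sub [simp]: "p \<in> M \<Longrightarrow> k_subspace d (T p)"
  using C1_submanifold_tangent(1) M_props by blast

lemma T_Rn: "T p \<subseteq> Rn D"
  using C1_tangent_subset_Rn M_props by blast

lemma closed_M: "closed M" using M_props compact_imp_closed by blast

text \<open>An arbitrary choice of nearest point; for points of \<open>Rn D\<close> at distance less
  than \<rho> it is the only one, by \<open>near_unique\<close>.\<close>

definition near :: "euc \<Rightarrow> euc" where
  "near z = (SOME p. p \<in> M \<and> dist z p = infdist z M)"

lemma near: "near z \<in> M" "dist z (near z) = infdist z M"
proof -
  obtain p where "p \<in> M" "dist z p = infdist z M"
    using infdist_attained[OF M_props(3,1)] .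
  then have "\<exists>p. p \<in> M \<and> dist z p = infdist z M" by blast
  then have "near z \<in> M \<and> dist z (near z) = infdist z M"
    unfolding near_def by (rule someI_ex)
  then show "near z \<in> M" "dist z (near z) = infdist z M" by auto
qed

lemma near_le: "m \<in> M \<Longrightarrow> dist z (near z) \<le> dist z m"
  using near(2) infdist_le by metis

lemma near_unique:
  assumes "z \<in> Rn D" "infdist z M < \<rho>" "p \<in> M" "dist z p = infdist z M"
  shows "near z = p"
proof (rule ccontr)
  assume "near z \<noteq> p"
  then have "z \<in> medial_axis D M"
    unfolding medial_axis_def mem_Collect_eq using assms near[of z] by metis
  then have "reach D M \<le> ereal (dist p z)"
    unfolding reach_def using assms(3) by (auto intro: INF_lower2)
  then have "ereal \<rho> \<le> ereal (dist p z)" using M_props(6) by (rule order_trans[rotated])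
  then show False using assms by (simp add: dist_commute)
qed

lemma near_Rn: "near z \<in> Rn D" using near(1) M_props(2) by blast

text \<open>The part of M outside the ball about the foot is compact and, the foot being unique, at
  strictly larger distance from z. A point y that moves by less than a third of this gap cannot have
  its foot there.\<close>

lemma near_continuous:
  assumes "z \<in> Rn D" "infdist z M < \<rho>" "e > 0"
  shows "\<exists>\<delta>>0. \<forall>y. dist y z < \<delta> \<longrightarrow> dist (near y) (near z) < e"
proof (cases "M - ball (near z) e = {}")
  case True
  then have "dist (near y) (near z) < e" for y using near(1)[of y] by (auto simp: dist_commute)
  then show ?thesis by (intro exI[of _ 1]) simp
next
  case False
  define K where "K = M - ball (near z) e"
  have "compact K" unfolding K_def using M_props(3) by (simp add: compact_diff)
  then obtain k where k: "k \<in> K" "infdist z K = dist z k"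
    using infdist_attained[of K z] False K_def by metis
  have "dist z k \<noteq> infdist z M"
    using near_unique[OF assms(1,2), of k] k(1) assms(3) by (auto simp: K_def)
  moreover have "infdist z M \<le> dist z k" using k(1) by (simp add: K_def infdist_le)
  ultimately have g: "dist z k - infdist z M > 0" by simp
  define \<delta> where "\<delta> = (dist z k - infdist z M) / 3"
  show ?thesis
  proof (intro exI[of _ \<delta>] conjI allI impI)
    show "\<delta> > 0" using g by (simp add: \<delta>_def)
    fix y assume y: "dist y z < \<delta>"
    show "dist (near y) (near z) < e"
    proof (rule ccontr)
      assume "\<not> ?thesis"
      then have "near y \<in> K" using near(1) by (auto simp: K_def dist_commute)
      then have "dist z k \<le> dist z (near y)" using k(2) infdist_le by metis
      also have "\<dots> \<le> dist y z + dist y (near y)" by (metis dist_commute dist_triangle)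
      also have "dist y (near y) \<le> dist y (near z)" by (rule near_le[OF near(1)])
      also have "\<dots> \<le> dist y z + infdist z M" using dist_triangle[of y "near z" z] near(2) by simp
      finally show False using y g unfolding \<delta>_def by (simp add: field_simps)
    qed
  qed
qed

text \<open>Unless \<open>w\<close> lies on the sphere, a small step from \<open>w\<close> away from its projection would
  increase the penalised distance, so that no maximiser of it is an interior point.\<close>

lemma infdist_ascent:
  assumes z: "z \<in> Rn D" "0 < infdist z M" "infdist z M + L < \<rho>" "0 < L" and e: "0 < e" "e < 1"
  shows "\<exists>w\<in>Rn D. dist w z \<le> L \<and> infdist z M + (1 - e) * L \<le> infdist w M"
proof -
  define K where "K = cball z L \<inter> Rn D"
  have K: "compact K" unfolding K_def by (rule compact_Rn[of _ D]) (auto intro!: closed_Int closed_Rn)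
  have zK: "z \<in> K" using z by (simp add: K_def)
  have "continuous_on K (\<lambda>w. infdist w M - (1 - e) * dist w z)" by (intro continuous_intros)
  then obtain w where w: "w \<in> K"
    "\<And>y. y \<in> K \<Longrightarrow> infdist y M - (1 - e) * dist y z \<le> infdist w M - (1 - e) * dist w z"
    using continuous_attains_sup[OF K, of "\<lambda>w. infdist w M - (1 - e) * dist w z"] zK by blast
  have w1: "w \<in> Rn D" "dist w z \<le> L" using w(1) by (auto simp: K_def dist_commute)
  have ge: "infdist z M \<le> infdist w M - (1 - e) * dist w z" using w(2)[OF zK] by simp
  moreover have "0 \<le> (1 - e) * dist w z" using e by simp
  ultimately have r: "0 < infdist w M" using z(2) by linarith
  have r2: "infdist w M < \<rho>" using infdist_triangle[of w M z] w1(2) z(3) by linarith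
  have "dist w z = L"
  proof (rule ccontr)
    assume "dist w z \<noteq> L"
    then have lt: "dist w z < L" using w1(2) by simp
    define q where "q = near w"
    define u where "u = (w - q) /\<^sub>R norm (w - q)"
    have q: "q \<in> M" "norm (w - q) = infdist w M" using near by (auto simp: q_def dist_norm)
    have nu: "norm u = 1" using q(2) r by (simp add: u_def)
    have uR: "u \<in> Rn D"
      unfolding u_def by (intro subspace_scale subspace_diff subspace_Rn w1(1)) (simp add: q_def near_Rn)
    \<comment> \<open>As \<open>near\<close> is continuous, the foot p of a point y slightly beyond
      w is close to q, so the unit directions from p and from q to w almost agree.\<close>
    have "((\<lambda>p. u \<bullet> ((w - p) /\<^sub>R norm (w - p))) \<longlongrightarrow> u \<bullet> ((w - q) /\<^sub>R norm (w - q))) (at q)"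
      by (intro tendsto_intros) (use q(2) r in auto)
    moreover have "u \<bullet> ((w - q) /\<^sub>R norm (w - q)) = 1"
      using nu by (simp add: u_def[symmetric] dot_square_norm)
    ultimately have "\<forall>\<^sub>F p in at q. 1 - e / 2 < u \<bullet> ((w - p) /\<^sub>R norm (w - p))"
      using e(1) by (intro order_tendstoD(1)) auto
    then obtain \<delta> where dl: "\<delta> > 0"
      "\<And>p. p \<noteq> q \<Longrightarrow> dist p q < \<delta> \<Longrightarrow> 1 - e / 2 < u \<bullet> ((w - p) /\<^sub>R norm (w - p))"
      unfolding eventually_at by auto
    have dl': "1 - e / 2 < u \<bullet> ((w - p) /\<^sub>R norm (w - p))" if "dist p q < \<delta>" for p
      using dl(2)[of p] that \<open>u \<bullet> ((w - q) /\<^sub>R norm (w - q)) = 1\<close> e(1) by (cases "p = q") auto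
    obtain \<delta>2 where d2: "\<delta>2 > 0" "\<And>y. dist y w < \<delta>2 \<Longrightarrow> dist (near y) q < \<delta>"
      using near_continuous[OF w1(1) r2 dl(1)] unfolding q_def by blast
    define \<eta> where "\<eta> = min (\<delta>2 / 2) (L - dist w z)"
    have eta: "\<eta> > 0" "\<eta> < \<delta>2" "\<eta> \<le> L - dist w z" using d2(1) lt by (auto simp: \<eta>_def)
    define y where "y = w + \<eta> *\<^sub>R u"
    have yw: "dist y w = \<eta>" using nu eta(1) by (simp add: y_def dist_norm)
    have yz: "dist y z \<le> dist w z + \<eta>" using dist_triangle[of y z w] yw by simp
    have yK: "y \<in> K"
      using yz eta(3) w1(1) uR subspace_Rn by (auto simp: K_def y_def dist_commute intro!: subspace_add subspace_scale)
    define p where "p = near y"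
    define u' where "u' = (w - p) /\<^sub>R norm (w - p)"
    have up: "1 - e / 2 < u \<bullet> u'" unfolding u'_def using dl'[OF d2(2)[of y]] yw eta by (simp add: p_def)
    have pM: "p \<in> M" by (simp add: p_def near)
    have wp: "norm (w - p) \<ge> infdist w M" using infdist_le[OF pM, of w] by (simp add: dist_norm)
    have wp0: "norm (w - p) \<noteq> 0" using wp r by linarith
    have nu': "norm u' = 1" unfolding u'_def norm_scaleR using wp0 by simp
    have "infdist w M + \<eta> * (1 - e / 2) \<le> norm (w - p) + \<eta> * (u \<bullet> u')"
      using wp up eta(1) by (intro add_mono mult_left_mono) auto
    also have "norm (w - p) = (w - p) \<bullet> u'"
      using wp0 by (simp add: u'_def dot_square_norm power2_eq_square)
    also have "(w - p) \<bullet> u' + \<eta> * (u \<bullet> u') = (y - p) \<bullet> u'"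
      by (simp add: y_def inner_add_left inner_diff_left)
    also have "\<dots> \<le> norm (y - p)" using norm_cauchy_schwarz[of "y - p" u'] nu' by simp
    also have "\<dots> = infdist y M" using near(2)[of y] by (simp add: p_def dist_norm)
    finally have "infdist w M + \<eta> * (1 - e / 2) \<le> infdist y M" .
    moreover have "(1 - e) * dist y z \<le> (1 - e) * (dist w z + \<eta>)"
      using yz e by (intro mult_left_mono) auto
    ultimately have "\<eta> * (1 - e / 2) \<le> (1 - e) * \<eta>" using w(2)[OF yK] by (simp add: algebra_simps)
    then have "\<eta> * e \<le> 0" by (simp add: algebra_simps)
    then show False using mult_pos_pos[OF eta(1) e(1)] by simp
  qed
  then show ?thesis using ge w1 by (auto intro!: bexI[of _ w])
qed

text \<open>The distance to M grows with slope one along the normal ray up to the reach. By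
  \<open>infdist_ascent\<close> a maximiser w over the ball of radius L is at distance at least
  \<open>infdist z M + L\<close>, so the triangle inequality through z is an equality and w lies on
  the ray.\<close>

lemma infdist_extend:
  assumes z: "z \<in> Rn D" "0 < infdist z M" "infdist z M + L < \<rho>" "0 < L"
  shows "infdist (z + L *\<^sub>R ((z - near z) /\<^sub>R norm (z - near z))) M = infdist z M + L"
proof -
  define K where "K = cball z L \<inter> Rn D"
  have K: "compact K" unfolding K_def by (rule compact_Rn[of _ D]) (auto intro!: closed_Int closed_Rn)
  have zK: "z \<in> K" using z by (simp add: K_def)
  obtain w where w: "w \<in> K" "\<And>y. y \<in> K \<Longrightarrow> infdist y M \<le> infdist w M"
    using continuous_attains_sup[OF K, of "\<lambda>w. infdist w M"] zK
      continuous_on_infdist[OF continuous_on_id, of K M] by blast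
  have ge: "infdist z M + L \<le> infdist w M"
  proof (rule field_le_epsilon)
    fix e :: real assume "0 < e"
    define e' where "e' = min (1 / 2) (e / L)"
    have e': "0 < e'" "e' < 1" "e' * L \<le> e" using \<open>0 < e\<close> z(4) by (auto simp: e'_def field_simps min_def)
    obtain y where "y \<in> Rn D" "dist y z \<le> L" "infdist z M + (1 - e') * L \<le> infdist y M"
      using infdist_ascent[OF z e'(1,2)] by blast
    moreover from this have "infdist y M \<le> infdist w M"
      by (intro w(2)) (auto simp: K_def dist_commute)
    ultimately show "infdist z M + L \<le> infdist w M + e" using e'(3) by (simp add: algebra_simps)
  qed
  define q where "q = near z"
  have q: "norm (z - q) = infdist z M" "q \<in> M" using near by (auto simp: q_def dist_norm)
  have wz: "norm (w - z) \<le> L" using w(1) by (simp add: K_def dist_norm norm_minus_commute)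
  have "infdist w M \<le> norm (w - q)" using infdist_le[OF q(2)] by (simp add: dist_norm)
  moreover have tri: "norm (w - q) \<le> norm (w - z) + norm (z - q)"
    using norm_triangle_ineq[of "w - z" "z - q"] by simp
  ultimately have eq: "norm ((w - z) + (z - q)) = norm (w - z) + norm (z - q)" "norm (w - z) = L"
    "infdist w M = infdist z M + L"
    using ge wz q(1) by auto
  have "norm (w - z) *\<^sub>R (z - q) = norm (z - q) *\<^sub>R (w - z)"
    using eq(1) by (simp only: norm_triangle_eq)
  then have "L *\<^sub>R ((z - q) /\<^sub>R norm (z - q)) = w - z"
    using eq(2) q(1) z(2) by (metis (no_types, lifting) less_irrefl scaleR_left_commute scaleR_one scaleR_scaleR left_inverse)
  then show ?thesis using eq(3) by (simp add: q_def)
qed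

text \<open>Balls of radius t < \<rho> that touch M at the foot of z and are centred on the ray
  through z contain no point of M in their interior. Expanding the squared distance from m to the
  centre and letting t tend to \<rho> gives the inequality.\<close>

lemma near_normal_ineq:
  assumes z: "z \<in> Rn D" "infdist z M < \<rho>" and m: "m \<in> M"
  shows "(m - near z) \<bullet> (z - near z) \<le> norm (z - near z) * (norm (m - near z))\<^sup>2 / (2 * \<rho>)"
proof (cases "infdist z M = 0")
  case True then show ?thesis using near(2)[of z] by simp
next
  case False
  then have pos: "0 < infdist z M" using infdist_nonneg[of z M] by simp
  define q where "q = near z"
  define r where "r = infdist z M"
  define u where "u = (z - q) /\<^sub>R norm (z - q)"
  have q: "norm (z - q) = r" "q \<in> M" using near by (auto simp: q_def dist_norm r_def)
  have nu: "norm u = 1" using q(1) pos by (simp add: u_def r_def)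
  have zu: "z - q = r *\<^sub>R u" using q(1) pos by (simp add: u_def r_def)
  have b: "2 * t * ((m - q) \<bullet> u) \<le> (norm (m - q))\<^sup>2" if t: "r < t" "t < \<rho>" for t
  proof -
    have "infdist (z + (t - r) *\<^sub>R u) M = t"
      using infdist_extend[of z "t - r"] z pos t by (simp add: u_def q_def r_def)
    moreover have "z + (t - r) *\<^sub>R u = q + t *\<^sub>R u"
      using zu by (simp add: algebra_simps)
    ultimately have "t \<le> norm (q + t *\<^sub>R u - m)" using infdist_le[OF m, of "q + t *\<^sub>R u"] by (simp add: dist_norm)
    then have "t\<^sup>2 \<le> (norm (t *\<^sub>R u - (m - q)))\<^sup>2"
      using t pos by (intro power_mono) (auto simp: r_def algebra_simps)
    also have "\<dots> = t\<^sup>2 - 2 * t * ((m - q) \<bullet> u) + (norm (m - q))\<^sup>2"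
      using nu by (simp add: norm_diff_square power_mult_distrib inner_commute)
    finally show ?thesis by simp
  qed
  have "((m - q) \<bullet> u) * (2 * \<rho>) \<le> (norm (m - q))\<^sup>2"
  proof (rule tendsto_upperbound[where F = "at_left \<rho>" and f = "\<lambda>t. ((m - q) \<bullet> u) * (2 * t)"])
    show "((\<lambda>t. ((m - q) \<bullet> u) * (2 * t)) \<longlongrightarrow> ((m - q) \<bullet> u) * (2 * \<rho>)) (at_left \<rho>)"
      by (intro tendsto_intros)
    have "r < \<rho>" using z by (simp add: r_def)
    then show "\<forall>\<^sub>F t in at_left \<rho>. ((m - q) \<bullet> u) * (2 * t) \<le> (norm (m - q))\<^sup>2"
      unfolding eventually_at_left[OF \<open>r < \<rho>\<close>] using b by (intro exI[of _ r]) (auto simp: algebra_simps)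
  qed simp
  then have "(m - q) \<bullet> u \<le> (norm (m - q))\<^sup>2 / (2 * \<rho>)" using rho by (simp add: field_simps)
  then have "r * ((m - q) \<bullet> u) \<le> r * ((norm (m - q))\<^sup>2 / (2 * \<rho>))"
    using pos by (intro mult_left_mono) (auto simp: r_def)
  then show ?thesis unfolding q_def[symmetric] zu using nu pos by (simp add: r_def)
qed

text \<open>In contrast to \<open>near_normal_ineq\<close>, v is any unit normal at x and is not
  known to point to a point with foot x. The foot p of \<open>x + \<epsilon> *\<^sub>R v\<close>
  differs from x only by a small multiple of \<epsilon>, because M is differentiable at x, so the
  inequality at p may be divided by \<epsilon> before passing to the limit.\<close>

lemma rolling_ball:
  assumes x: "x \<in> M" and v: "v \<in> Rn D" "norm v = 1" "\<And>w. w \<in> T x \<Longrightarrow> v \<bullet> w = 0" and m: "m \<in> M"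
  shows "(m - x) \<bullet> v \<le> (norm (m - x))\<^sup>2 / (2 * \<rho>)"
proof (rule field_le_epsilon)
  fix g :: real assume g: "0 < g"
  define R where "R = norm (m - x)"
  define \<kappa> where "\<kappa> = g / (4 * (R + 2))"
  have R: "R \<ge> 0" by (simp add: R_def)
  then have k: "\<kappa> > 0" "2 * \<kappa> * (R + 2) = g / 2" using g by (auto simp: \<kappa>_def field_simps)
  obtain \<delta> where dl: "\<delta> > 0"
    "\<And>p. p \<in> M \<Longrightarrow> dist p x < \<delta> \<Longrightarrow> norm (perp (T x) (p - x)) \<le> \<kappa> * norm (p - x)"
    using C1_submanifold_tangent(2)[OF M_props(5) x k(1)] by blast
  \<comment> \<open>Q collects the coefficients of \<epsilon> in the errors at the end of the
    proof.\<close>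
  define Q where "Q = (4 * R + 4) / (2 * \<rho>) + 2"
  have Q: "Q > 0" using R rho by (auto simp: Q_def intro!: add_nonneg_pos)
  define \<epsilon> where "\<epsilon> = min (min 1 (\<rho> / 2)) (min (\<delta> / 3) (g / 2 / Q))"
  have e: "0 < \<epsilon>" "\<epsilon> \<le> 1" "\<epsilon> \<le> \<rho> / 2" "2 * \<epsilon> < \<delta>" "\<epsilon> * Q \<le> g / 2"
  proof -
    show "0 < \<epsilon>" using dl g Q rho by (simp add: \<epsilon>_def)
    show "\<epsilon> \<le> 1" "\<epsilon> \<le> \<rho> / 2" by (auto simp: \<epsilon>_def)
    have "\<epsilon> \<le> \<delta> / 3" by (auto simp: \<epsilon>_def)
    then show "2 * \<epsilon> < \<delta>" using dl by simp
    have "\<epsilon> \<le> g / 2 / Q" by (auto simp: \<epsilon>_def)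
    then show "\<epsilon> * Q \<le> g / 2" using Q by (simp add: field_simps)
  qed
  define y where "y = x + \<epsilon> *\<^sub>R v"
  define p where "p = near y"
  have yR: "y \<in> Rn D" using x v M_props subspace_Rn by (auto simp: y_def intro!: subspace_add subspace_scale)
  have pM: "p \<in> M" by (simp add: p_def near)
  have yp: "norm (y - p) \<le> \<epsilon>"
    using near_le[OF x, of y] e v(2) by (simp add: p_def dist_norm y_def)
  have "infdist y M = norm (y - p)" using near(2)[of y] by (simp add: p_def dist_norm)
  then have iy: "infdist y M < \<rho>" using yp e rho by simp
  have eq: "y - p = \<epsilon> *\<^sub>R v + (x - p)" by (simp add: y_def)
  have "norm (x - p) \<le> norm (y - p) + norm (\<epsilon> *\<^sub>R v)" unfolding eq
    by (metis add.commute norm_triangle_sub norm_minus_commute add_diff_cancel_left' eq norm_triangle_ineq4 diff_add_cancel)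
  then have xp: "norm (x - p) \<le> 2 * \<epsilon>" using yp v(2) e by simp
  have vp: "v \<bullet> (p - x) \<le> \<kappa> * norm (p - x)"
  proof -
    have "v \<bullet> (p - x) = v \<bullet> perp (T x) (p - x)"
      using v(3)[OF proj_in[OF T_sub[OF x]]] by (simp add: perp_def inner_diff_right)
    also have "\<dots> \<le> norm (perp (T x) (p - x))" using norm_cauchy_schwarz[of v] v(2) by (metis mult_1)
    also have "\<dots> \<le> \<kappa> * norm (p - x)" using dl(2)[OF pM] xp e(4) by (simp add: dist_norm norm_minus_commute)
    finally show ?thesis .
  qed
  \<comment> \<open>The inequality at p bounds \<open>(x - p) \<bullet> (y - p)\<close> from above
    by a quarter of the squared distance from x to p, and expanding y bounds it from below;
    comparing the two makes that distance of order \<kappa> times \<epsilon>.\<close>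
  have small: "norm (x - p) \<le> 2 * \<kappa> * \<epsilon>"
  proof (cases "x = p")
    case True then show ?thesis using k e by simp
  next
    case False
    have "(x - p) \<bullet> (y - p) \<le> norm (y - p) * (norm (x - p))\<^sup>2 / (2 * \<rho>)"
      using near_normal_ineq[OF yR iy x] by (simp add: p_def)
    also have "\<dots> \<le> \<epsilon> * (norm (x - p))\<^sup>2 / (2 * \<rho>)"
      using yp rho by (intro divide_right_mono mult_right_mono) auto
    also have "\<dots> \<le> (norm (x - p))\<^sup>2 / 4"
    proof -
      have "\<epsilon> * (norm (x - p))\<^sup>2 \<le> (\<rho> / 2) * (norm (x - p))\<^sup>2" using e(3) by (rule mult_right_mono) simp
      then show ?thesis using rho by (simp add: field_simps)
    qed
    finally have "(x - p) \<bullet> (y - p) \<le> (norm (x - p))\<^sup>2 / 4" .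
    moreover have "(x - p) \<bullet> (y - p) = (norm (x - p))\<^sup>2 - \<epsilon> * (v \<bullet> (p - x))"
    proof -
      have "(x - p) \<bullet> v = - (v \<bullet> (p - x))" by (simp add: inner_diff_left inner_diff_right inner_commute)
      then show ?thesis unfolding eq inner_add_right inner_scaleR_right dot_square_norm by simp
    qed
    moreover have "\<epsilon> * (v \<bullet> (p - x)) \<le> \<epsilon> * (\<kappa> * norm (p - x))" using vp e by (intro mult_left_mono) auto
    ultimately have "(norm (x - p))\<^sup>2 * (3 / 4) \<le> \<epsilon> * \<kappa> * norm (x - p)" by (simp add: norm_minus_commute)
    then have "norm (x - p) * (norm (x - p) * (3 / 4)) \<le> norm (x - p) * (\<epsilon> * \<kappa>)"
      by (simp add: power2_eq_square algebra_simps)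
    then have "norm (x - p) * (3 / 4) \<le> \<epsilon> * \<kappa>" using False by simp
    moreover have "0 \<le> \<epsilon> * \<kappa>" using k e by simp
    ultimately show ?thesis unfolding mult.assoc mult.commute[of \<kappa>] by linarith
  qed
  have mp: "norm (m - p) \<le> R + 2 * \<epsilon>" using xp norm_triangle_ineq[of "m - x" "x - p"] by (simp add: R_def)
  have "(m - p) \<bullet> (y - p) \<le> norm (y - p) * (norm (m - p))\<^sup>2 / (2 * \<rho>)"
    using near_normal_ineq[OF yR iy m] by (simp add: p_def)
  also have "\<dots> \<le> \<epsilon> * (R + 2 * \<epsilon>)\<^sup>2 / (2 * \<rho>)"
    using yp rho mp e by (intro divide_right_mono mult_mono power_mono) auto
  finally have "\<epsilon> * ((m - p) \<bullet> v) + (m - p) \<bullet> (x - p) \<le> \<epsilon> * (R + 2 * \<epsilon>)\<^sup>2 / (2 * \<rho>)"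
    unfolding eq by (simp add: inner_add_right)
  moreover have "- ((m - p) \<bullet> (x - p)) \<le> (R + 2 * \<epsilon>) * (2 * \<kappa> * \<epsilon>)"
  proof -
    have "- ((m - p) \<bullet> (x - p)) \<le> norm (m - p) * norm (x - p)"
      using Cauchy_Schwarz_ineq2[of "m - p" "x - p"] by linarith
    also have "\<dots> \<le> (R + 2 * \<epsilon>) * (2 * \<kappa> * \<epsilon>)" using mp small e R by (intro mult_mono) auto
    finally show ?thesis .
  qed
  ultimately have "\<epsilon> * ((m - p) \<bullet> v) \<le> \<epsilon> * ((R + 2 * \<epsilon>)\<^sup>2 / (2 * \<rho>) + (R + 2 * \<epsilon>) * (2 * \<kappa>))"
    by (simp add: algebra_simps)
  then have main: "(m - p) \<bullet> v \<le> (R + 2 * \<epsilon>)\<^sup>2 / (2 * \<rho>) + (R + 2 * \<epsilon>) * (2 * \<kappa>)" using e by simp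
  have "(m - x) \<bullet> v = (m - p) \<bullet> v + (p - x) \<bullet> v" by (simp add: inner_diff_left)
  moreover have "(p - x) \<bullet> v \<le> 2 * \<epsilon>"
    using norm_cauchy_schwarz[of "p - x" v] v(2) xp by (simp add: norm_minus_commute)
  moreover have "(R + 2 * \<epsilon>)\<^sup>2 / (2 * \<rho>) \<le> R\<^sup>2 / (2 * \<rho>) + \<epsilon> * ((4 * R + 4) / (2 * \<rho>))"
  proof -
    have "\<epsilon> * \<epsilon> \<le> \<epsilon> * 1" using e by (intro mult_left_mono) auto
    then have "(R + 2 * \<epsilon>)\<^sup>2 \<le> R\<^sup>2 + \<epsilon> * (4 * R + 4)" by (simp add: power2_eq_square algebra_simps)
    then have "(R + 2 * \<epsilon>)\<^sup>2 / (2 * \<rho>) \<le> (R\<^sup>2 + \<epsilon> * (4 * R + 4)) / (2 * \<rho>)"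
      using rho by (intro divide_right_mono) auto
    then show ?thesis unfolding add_divide_distrib[of "R\<^sup>2"] times_divide_eq_right .
  qed
  moreover have "(R + 2 * \<epsilon>) * (2 * \<kappa>) \<le> g / 2"
  proof -
    have "(R + 2 * \<epsilon>) * (2 * \<kappa>) \<le> (R + 2) * (2 * \<kappa>)" using e k by (intro mult_right_mono) auto
    then show ?thesis using k(2) by (simp add: algebra_simps)
  qed
  moreover have "\<epsilon> * ((4 * R + 4) / (2 * \<rho>)) + 2 * \<epsilon> \<le> g / 2"
    using e(5) by (simp add: Q_def algebra_simps)
  ultimately show "(m - x) \<bullet> v \<le> (norm (m - x))\<^sup>2 / (2 * \<rho>) + g"
    using main unfolding R_def[symmetric] by linarith
qed

text \<open>Federer's chord bound: the rolling ball condition in the direction of the normal part of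
  the chord itself.\<close>

lemma perp_tangent_le:
  assumes x: "x \<in> M" and m: "m \<in> M"
  shows "norm (perp (T x) (m - x)) \<le> (norm (m - x))\<^sup>2 / (2 * \<rho>)"
proof (cases "perp (T x) (m - x) = 0")
  case True then show ?thesis using rho by simp
next
  case False
  note T = T_sub[OF x]
  let ?p = "perp (T x) (m - x)"
  define v where "v = ?p /\<^sub>R norm ?p"
  have "m - x \<in> Rn D" using x m M_props(2) subspace_Rn by (meson subsetD subspace_diff)
  then have "?p \<in> Rn D"
    unfolding perp_def using proj_in[OF T, of "m - x"] T_Rn subspace_Rn by (meson subsetD subspace_diff)
  then have v: "v \<in> Rn D" "norm v = 1" "\<And>w. w \<in> T x \<Longrightarrow> v \<bullet> w = 0"
    using False inner_perp(1)[OF T] subspace_Rn by (auto simp: v_def subspace_scale)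
  have "(m - x) \<bullet> v \<le> (norm (m - x))\<^sup>2 / (2 * \<rho>)" by (rule rolling_ball[OF x v m])
  moreover have "(m - x) \<bullet> ?p = ?p \<bullet> ?p"
    using inner_perp(2)[OF T proj_in[OF T], of "m - x" "m - x"] by (simp add: perp_def inner_diff_left)
  then have "(m - x) \<bullet> v = norm ?p"
    using False by (simp add: v_def dot_square_norm power2_eq_square)
  ultimately show ?thesis by simp
qed

end

section \<open>Variation of the distance function and comparison of tangent spaces\<close>

lemma norm_diff_add_le:
  fixes a b c :: "'a::real_normed_vector"
  shows "norm (a - b + c) \<le> norm a + norm b + norm c"
  using norm_triangle_ineq[of "a - b" c] norm_triangle_ineq4[of a b] by linarith

context reach_manifold
begin

text \<open>An envelope argument: the foot of z is a competitor for the moved point and the foot of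
  the moved point is one for z. This traps the difference quotient up to a multiple of
  \<open>norm (p s - p 0)\<close>, which tends to 0 by continuity of \<open>near\<close>.\<close>

lemma DERIV_infdist_square:
  assumes z: "z \<in> Rn D" "infdist z M < \<rho>" and w: "w \<in> Rn D"
  shows "((\<lambda>s. (infdist (z + s *\<^sub>R w) M)\<^sup>2) has_real_derivative 2 * ((z - near z) \<bullet> w)) (at 0)"
proof -
  define E where "E s = (infdist (z + s *\<^sub>R w) M)\<^sup>2" for s
  define p where "p s = near (z + s *\<^sub>R w)" for s
  have Ep: "E s = (norm (z + s *\<^sub>R w - p s))\<^sup>2" for s
    using near(2)[of "z + s *\<^sub>R w"] by (simp add: E_def p_def dist_norm)
  have up: "E s \<le> (norm (z + s *\<^sub>R w - q))\<^sup>2" if "q \<in> M" for s q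
    using infdist_le[OF that, of "z + s *\<^sub>R w"] unfolding E_def
    by (intro power_mono) (auto simp: dist_norm infdist_nonneg)
  have exp: "(norm (z + s *\<^sub>R w - q))\<^sup>2 = (norm (z - q))\<^sup>2 + 2 * s * ((z - q) \<bullet> w) + s\<^sup>2 * (norm w)\<^sup>2" for s q
    using norm_diff_square[of "z - q" "(- s) *\<^sub>R w"] by (simp add: power_mult_distrib algebra_simps)
  have pM: "p s \<in> M" for s by (simp add: p_def near)
  have p0: "p 0 = near z" by (simp add: p_def)
  have E0: "E 0 = (norm (z - p 0))\<^sup>2" using Ep[of 0] by simp
  have bnd: "\<bar>(E s - E 0) / s - 2 * ((z - p 0) \<bullet> w)\<bar> \<le> \<bar>s\<bar> * (norm w)\<^sup>2 + 2 * norm (p s - p 0) * norm w" if "s \<noteq> 0" for s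
  proof -
    have a: "E s - E 0 - 2 * s * ((z - p 0) \<bullet> w) \<le> s\<^sup>2 * (norm w)\<^sup>2"
      using up[OF pM[of 0], of s] exp[of s "p 0"] E0 by simp
    have "E 0 \<le> (norm (z - p s))\<^sup>2" using up[OF pM[of s], of 0] by simp
    then have "2 * s * ((z - p s) \<bullet> w) + s\<^sup>2 * (norm w)\<^sup>2 \<le> E s - E 0" using Ep[of s] exp[of s "p s"] by simp
    moreover have "2 * s * ((z - p s) \<bullet> w) = 2 * s * ((z - p 0) \<bullet> w) - 2 * s * ((p s - p 0) \<bullet> w)"
      by (simp add: inner_diff_left algebra_simps)
    moreover have "0 \<le> s\<^sup>2 * (norm w)\<^sup>2" by simp
    ultimately have b: "- (2 * s * ((p s - p 0) \<bullet> w)) \<le> E s - E 0 - 2 * s * ((z - p 0) \<bullet> w)"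
      by linarith
    have "\<bar>2 * s * ((p s - p 0) \<bullet> w)\<bar> \<le> 2 * \<bar>s\<bar> * (norm (p s - p 0) * norm w)"
      using Cauchy_Schwarz_ineq2[of "p s - p 0" w] by (simp add: abs_mult mult_left_mono)
    moreover have "0 \<le> s\<^sup>2 * (norm w)\<^sup>2" "0 \<le> 2 * \<bar>s\<bar> * (norm (p s - p 0) * norm w)" by auto
    ultimately have "\<bar>E s - E 0 - 2 * s * ((z - p 0) \<bullet> w)\<bar> \<le> s\<^sup>2 * (norm w)\<^sup>2 + 2 * \<bar>s\<bar> * (norm (p s - p 0) * norm w)"
      using a b by linarith
    also have "\<dots> = \<bar>s\<bar> * (\<bar>s\<bar> * (norm w)\<^sup>2 + 2 * norm (p s - p 0) * norm w)"
      by (simp add: algebra_simps power2_eq_square)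
    finally have "\<bar>E s - E 0 - 2 * s * ((z - p 0) \<bullet> w)\<bar> / \<bar>s\<bar> \<le> \<bar>s\<bar> * (norm w)\<^sup>2 + 2 * norm (p s - p 0) * norm w"
      using that by (simp add: field_simps)
    moreover have "(E s - E 0) / s - 2 * ((z - p 0) \<bullet> w) = (E s - E 0 - 2 * s * ((z - p 0) \<bullet> w)) / s"
      using that by (simp add: field_simps)
    ultimately show ?thesis by simp
  qed
  have pc: "((\<lambda>s. norm (p s - p 0)) \<longlongrightarrow> 0) (at 0)"
  proof (rule tendstoI)
    fix e :: real assume "0 < e"
    then obtain \<delta> where d: "\<delta> > 0" "\<And>y. dist y z < \<delta> \<Longrightarrow> dist (near y) (near z) < e"
      using near_continuous[OF z] by blast
    have "((\<lambda>s. z + s *\<^sub>R w) \<longlongrightarrow> z + 0 *\<^sub>R w) (at 0)" by (intro tendsto_intros)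
    then have "\<forall>\<^sub>F s in at 0. dist (z + s *\<^sub>R w) z < \<delta>" using d(1) by (simp add: tendsto_iff)
    then show "\<forall>\<^sub>F s in at 0. dist (norm (p s - p 0)) 0 < e"
      by eventually_elim (use d(2) in \<open>simp add: p_def dist_norm\<close>)
  qed
  have "((\<lambda>s. (E s - E 0) / s - 2 * ((z - p 0) \<bullet> w)) \<longlongrightarrow> 0) (at 0)"
  proof (rule Lim_null_comparison)
    show "\<forall>\<^sub>F s in at 0. norm ((E s - E 0) / s - 2 * ((z - p 0) \<bullet> w)) \<le> \<bar>s\<bar> * (norm w)\<^sup>2 + 2 * norm (p s - p 0) * norm w"
      using bnd by (auto intro!: eventually_mono[OF eventually_neq_at_within])
    have "((\<lambda>s. \<bar>s\<bar> * (norm w)\<^sup>2 + 2 * norm (p s - p 0) * norm w) \<longlongrightarrow> \<bar>0\<bar> * (norm w)\<^sup>2 + 2 * 0 * norm w) (at 0)"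
      by (intro tendsto_intros pc)
    then show "((\<lambda>s. \<bar>s\<bar> * (norm w)\<^sup>2 + 2 * norm (p s - p 0) * norm w) \<longlongrightarrow> 0) (at 0)" by simp
  qed
  then have "((\<lambda>s. (E s - E 0) / s) \<longlongrightarrow> 2 * ((z - p 0) \<bullet> w)) (at 0)" using Lim_null by blast
  then show ?thesis
    unfolding DERIV_def E_def[symmetric] p0[symmetric] by simp
qed

text \<open>With \<open>e = d(y, M)\<close> for \<open>y = m + \<tau> w\<close>, the two-sided rolling ball condition at the projection of
  \<open>y\<close>, applied to \<open>m\<close>, bounds the derivative of \<open>e\<^sup>2/\<tau>\<^sup>2\<close>.\<close>

lemma tangent_near_manifold:
  assumes m: "m \<in> M" and w: "w \<in> T m" "norm w = 1" and t: "0 < \<tau>" "\<tau> < \<rho>"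
  shows "infdist (m + \<tau> *\<^sub>R w) M \<le> 2 * \<tau>\<^sup>2 / \<rho>"
proof -
  have wR: "w \<in> Rn D" using T_Rn w(1) by blast
  have mR: "m \<in> Rn D" using m M_props(2) by blast
  define y where "y s = m + s *\<^sub>R w" for s
  have yR: "y s \<in> Rn D" for s using mR wR subspace_Rn by (auto simp: y_def intro!: subspace_add subspace_scale)
  define E where "E s = (infdist (y s) M)\<^sup>2" for s
  define G where "G s = E s / s\<^sup>2" for s
  define E' where "E' s = 2 * ((y s - near (y s)) \<bullet> w)" for s
  have iy: "infdist (y s) M \<le> \<bar>s\<bar>" for s
    using infdist_le[OF m, of "y s"] w(2) by (simp add: y_def dist_norm)
  have dE: "(E has_real_derivative E' s) (at s)" if "0 < s" "s < \<rho>" for s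
  proof -
    have "((\<lambda>h. (infdist (y s + h *\<^sub>R w) M)\<^sup>2) has_real_derivative E' s) (at 0)"
      unfolding E'_def by (rule DERIV_infdist_square[OF yR _ wR]) (use iy[of s] that in simp)
    moreover have "(\<lambda>h. (infdist (y s + h *\<^sub>R w) M)\<^sup>2) = (\<lambda>h. E (h + s))"
      by (simp add: fun_eq_iff E_def y_def algebra_simps)
    ultimately have "((\<lambda>h. E (h + s)) has_real_derivative E' s) (at 0)" by simp
    then show ?thesis using DERIV_shift[of E "E' s" 0 s] by simp
  qed
  have key: "s * E' s - 2 * E s \<le> 4 * infdist (y s) M * s\<^sup>2 / \<rho>" if s: "0 < s" "s < \<rho>" for s
  proof -
    define q where "q = near (y s)"
    have q: "q \<in> M" "norm (y s - q) = infdist (y s) M" using near by (auto simp: q_def dist_norm)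
    have "(y s - q) \<bullet> proj (T q) (m - q) = 0"
      by (rule nearest_orthogonal) (use q proj_in[OF T_sub[OF q(1)]] in \<open>auto simp: dist_norm\<close>)
    then have "(y s - q) \<bullet> (m - q) = (y s - q) \<bullet> perp (T q) (m - q)"
      by (simp add: perp_def inner_diff_right)
    then have "\<bar>(y s - q) \<bullet> (m - q)\<bar> \<le> infdist (y s) M * norm (perp (T q) (m - q))"
      using Cauchy_Schwarz_ineq2[of "y s - q" "perp (T q) (m - q)"] q(2) by simp
    also have "\<dots> \<le> infdist (y s) M * (2 * s\<^sup>2 / \<rho>)"
    proof (intro mult_left_mono infdist_nonneg)
      have "norm (m - q) \<le> norm (m - y s) + norm (y s - q)"
        using norm_triangle_ineq[of "m - y s" "y s - q"] by simp
      also have "\<dots> \<le> 2 * s" using iy[of s] q(2) w(2) s by (simp add: y_def)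
      finally have "(norm (m - q))\<^sup>2 \<le> (2 * s)\<^sup>2" by (rule power_mono) simp
      then have "(norm (m - q))\<^sup>2 / (2 * \<rho>) \<le> (2 * s)\<^sup>2 / (2 * \<rho>)" using rho by (intro divide_right_mono) auto
      then show "norm (perp (T q) (m - q)) \<le> 2 * s\<^sup>2 / \<rho>"
        using perp_tangent_le[OF q(1) m] by (simp add: power_mult_distrib)
    qed
    finally have "\<bar>(y s - q) \<bullet> (m - q)\<bar> \<le> infdist (y s) M * (2 * s\<^sup>2 / \<rho>)" .
    moreover have "m - q = (y s - q) - s *\<^sub>R w" by (simp add: y_def)
    then have "(y s - q) \<bullet> (m - q) = (y s - q) \<bullet> (y s - q) - s * ((y s - q) \<bullet> w)"
      by (metis inner_diff_right inner_scaleR_right)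
    then have "(y s - q) \<bullet> (m - q) = E s - s * E' s / 2"
      unfolding E'_def q_def[symmetric] E_def q(2)[symmetric] by (simp add: dot_square_norm)
    ultimately have "s * E' s / 2 - E s \<le> infdist (y s) M * (2 * s\<^sup>2 / \<rho>)" by linarith
    then show ?thesis by simp
  qed
  have dG: "(G has_real_derivative (s * E' s - 2 * E s) / s ^ 3) (at s)" if s: "0 < s" "s < \<rho>" for s
  proof -
    have "(G has_real_derivative (E' s * s\<^sup>2 - E s * (2 * s)) / (s\<^sup>2 * s\<^sup>2)) (at s)"
      unfolding G_def by (rule derivative_eq_intros dE s refl | use s in simp)+
    also have "(E' s * s\<^sup>2 - E s * (2 * s)) / (s\<^sup>2 * s\<^sup>2) = (s * E' s - 2 * E s) / s ^ 3"
      using s by (simp add: power2_eq_square power3_eq_cube divide_simps) (simp add: algebra_simps)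
    finally show ?thesis .
  qed
  have G0: "G s \<ge> 0" for s by (simp add: G_def E_def)
  have sG: "sqrt (G s) = infdist (y s) M / s" if "0 < s" for s
    using that by (simp add: G_def E_def real_sqrt_divide infdist_nonneg)
  \<comment> \<open>The positive \<eta> keeps the square root differentiable where
    \<open>y s\<close> lies on M.\<close>
  have mono: "sqrt (G \<tau> + \<eta>) - 2 * \<tau> / \<rho> \<le> sqrt (G \<sigma> + \<eta>) - 2 * \<sigma> / \<rho>" if "0 < \<eta>" "0 < \<sigma>" "\<sigma> \<le> \<tau>" for \<eta> \<sigma>
  proof (rule DERIV_nonpos_imp_nonincreasing[OF that(3)])
    fix s assume s: "\<sigma> \<le> s" "s \<le> \<tau>"
    then have s': "0 < s" "s < \<rho>" using that t by auto
    let ?D = "(s * E' s - 2 * E s) / s ^ 3 * inverse (2 * sqrt (G s + \<eta>)) - 2 / \<rho>"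
    have pos: "G s + \<eta> > 0" using G0[of s] that by linarith
    have "((\<lambda>s. sqrt (G s + \<eta>) - 2 * s / \<rho>) has_real_derivative ?D) (at s)"
      by (rule derivative_eq_intros dG s' refl | use pos rho in \<open>simp add: field_simps\<close>)+
    moreover have "?D \<le> 0"
    proof -
      have "(s * E' s - 2 * E s) / s ^ 3 \<le> (4 * infdist (y s) M * s\<^sup>2 / \<rho>) / s ^ 3"
        using key[OF s'] s' by (intro divide_right_mono) auto
      also have "\<dots> = 4 / \<rho> * sqrt (G s)"
        unfolding sG[OF s'(1)] using s' rho by (simp add: power2_eq_square power3_eq_cube)
      also have "\<dots> \<le> 4 / \<rho> * sqrt (G s + \<eta>)" using rho that by (intro mult_left_mono) auto
      finally have "(s * E' s - 2 * E s) / s ^ 3 * inverse (2 * sqrt (G s + \<eta>))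
          \<le> 4 / \<rho> * sqrt (G s + \<eta>) * inverse (2 * sqrt (G s + \<eta>))"
        using pos by (intro mult_right_mono) auto
      also have "\<dots> = 2 / \<rho>" using pos by simp
      finally show ?thesis by simp
    qed
    ultimately show "\<exists>D. ((\<lambda>s. sqrt (G s + \<eta>) - 2 * s / \<rho>) has_real_derivative D) (at s) \<and> D \<le> 0" by blast
  qed
  \<comment> \<open>The initial value for the differential inequality: w is the velocity of a curve
    in M, so the distance from \<open>y s\<close> to M is small compared with s.\<close>
  have small: "\<exists>\<sigma>>0. \<sigma> \<le> \<tau> \<and> G \<sigma> \<le> \<eta>" if eta: "0 < \<eta>" for \<eta>
  proof -
    obtain \<gamma> :: "real \<Rightarrow> euc" and e where g: "e > 0" "\<gamma> 0 = m" "\<And>s. \<bar>s\<bar> < e \<Longrightarrow> \<gamma> s \<in> M"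
      "(\<gamma> has_vector_derivative w) (at 0)" using tangent_spaceE[OF w(1)] by metis
    have "\<forall>\<^sub>F s in at 0. dist ((\<gamma> s - \<gamma> 0) /\<^sub>R s) w < sqrt \<eta>"
      using vector_derivative_quotient_tendsto[OF g(4)] eta by (auto simp: tendsto_iff)
    then obtain \<delta> where d: "\<delta> > 0" "\<And>s. s \<noteq> 0 \<Longrightarrow> \<bar>s\<bar> < \<delta> \<Longrightarrow> norm ((\<gamma> s - m) /\<^sub>R s - w) < sqrt \<eta>"
      unfolding eventually_at g(2) by (auto simp: dist_norm)
    define \<sigma> where "\<sigma> = min \<tau> (min (e / 2) (\<delta> / 2))"
    have s: "\<sigma> > 0" "\<sigma> \<le> \<tau>" "\<sigma> < e" "\<sigma> < \<delta>" using t g(1) d(1) by (auto simp: \<sigma>_def)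
    have "infdist (y \<sigma>) M \<le> norm (y \<sigma> - \<gamma> \<sigma>)"
      using infdist_le[OF g(3)[of \<sigma>], of "y \<sigma>"] s by (simp add: dist_norm)
    also have "y \<sigma> - \<gamma> \<sigma> = - (\<sigma> *\<^sub>R ((\<gamma> \<sigma> - m) /\<^sub>R \<sigma> - w))"
      using s by (simp add: y_def algebra_simps)
    also have "norm \<dots> \<le> \<sigma> * sqrt \<eta>"
      unfolding norm_minus_cancel norm_scaleR using d(2)[of \<sigma>] s by simp
    finally have "sqrt (G \<sigma>) \<le> sqrt \<eta>" unfolding sG[OF s(1)] using s by (simp add: field_simps)
    then show ?thesis using s by auto
  qed
  have fin: "sqrt (G \<tau>) \<le> 2 * \<tau> / \<rho>"
  proof (rule field_le_epsilon)
    fix e :: real assume e: "0 < e"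
    define \<eta> where "\<eta> = e\<^sup>2 / 2"
    have eta: "\<eta> > 0" using e by (simp add: \<eta>_def)
    obtain \<sigma> where s: "\<sigma> > 0" "\<sigma> \<le> \<tau>" "G \<sigma> \<le> \<eta>" using small[OF eta] by blast
    have "sqrt (G \<tau>) \<le> sqrt (G \<tau> + \<eta>)" using eta by simp
    also have "\<dots> \<le> sqrt (G \<sigma> + \<eta>) - 2 * \<sigma> / \<rho> + 2 * \<tau> / \<rho>" using mono[OF eta s(1,2)] by linarith
    also have "\<dots> \<le> sqrt (\<eta> + \<eta>) + 2 * \<tau> / \<rho>"
    proof -
      have "sqrt (G \<sigma> + \<eta>) \<le> sqrt (\<eta> + \<eta>)" using s(3) by simp
      moreover have "0 \<le> 2 * \<sigma> / \<rho>" using s(1) rho by simp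
      ultimately show ?thesis by linarith
    qed
    also have "sqrt (\<eta> + \<eta>) = e" using e by (simp add: \<eta>_def)
    finally show "sqrt (G \<tau>) \<le> 2 * \<tau> / \<rho> + e" by simp
  qed
  show ?thesis
    using fin unfolding sG[OF t(1)] y_def[symmetric] using t(1) by (simp add: field_simps power2_eq_square)
qed

lemma tangent_point:
  assumes "m \<in> M" "w \<in> T m" "norm w = 1" "0 < \<tau>" "\<tau> < \<rho>"
  obtains m' where "m' \<in> M" "norm (m + \<tau> *\<^sub>R w - m') \<le> 2 * \<tau>\<^sup>2 / \<rho>"
  using tangent_near_manifold[OF assms] near[of "m + \<tau> *\<^sub>R w"] that by (metis dist_norm)

text \<open>The unit direction v at m is realised by a point m' of M at distance about r from m. The
  chord bounds at x for m' and for m and the error of m' bound the normal part of r v by 8, 1/2 and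
  2 times \<open>r\<^sup>2 / \<rho>\<close>.\<close>

lemma tangent_angle:
  assumes x: "x \<in> M" and m: "m \<in> M" and r: "norm (m - x) \<le> r" "0 < r" "r < \<rho>" and w: "w \<in> T m"
  shows "norm (perp (T x) w) \<le> 11 * r / \<rho> * norm w"
proof (cases "w = 0")
  case True then show ?thesis using perp_eq_0[OF T_sub[OF x] subspace_0] T_sub[OF x] by simp
next
  case False
  note Tx = T_sub[OF x]
  define v where "v = w /\<^sub>R norm w"
  have v: "v \<in> T m" "norm v = 1"
    using False w subsp[OF T_sub[OF m]] by (auto simp: v_def subspace_scale)
  obtain m' where m': "m' \<in> M" "norm (m + r *\<^sub>R v - m') \<le> 2 * r\<^sup>2 / \<rho>"
    using tangent_point[OF m v r(2,3)] by blast
  have rr: "2 * r\<^sup>2 / \<rho> \<le> 2 * r" using r rho by (simp add: power2_eq_square field_simps)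
  have "norm (m' - x) \<le> norm (m - x) + norm (m + r *\<^sub>R v - m') + norm (r *\<^sub>R v)"
    using norm_diff_add_le[of "m - x" "m + r *\<^sub>R v - m'" "r *\<^sub>R v"] by simp
  then have "norm (m' - x) \<le> 4 * r" using r m' v rr by simp
  then have "(norm (m' - x))\<^sup>2 / (2 * \<rho>) \<le> (4 * r)\<^sup>2 / (2 * \<rho>)"
    using rho by (intro divide_right_mono power_mono) auto
  then have a: "norm (perp (T x) (m' - x)) \<le> 8 * r\<^sup>2 / \<rho>"
    using perp_tangent_le[OF x m'(1)] by (simp add: power_mult_distrib)
  have "(norm (m - x))\<^sup>2 / (2 * \<rho>) \<le> r\<^sup>2 / (2 * \<rho>)"
    using rho r by (intro divide_right_mono power_mono) auto
  then have b: "norm (perp (T x) (m - x)) \<le> r\<^sup>2 / \<rho> / 2"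
    using perp_tangent_le[OF x m] by simp
  have c: "norm (perp (T x) (m + r *\<^sub>R v - m')) \<le> 2 * r\<^sup>2 / \<rho>"
    using norm_perp_le[OF Tx, of "m + r *\<^sub>R v - m'"] m'(2) by linarith
  have "r *\<^sub>R v = (m' - x) - (m - x) + (m + r *\<^sub>R v - m')" by simp
  then have "r *\<^sub>R perp (T x) v = perp (T x) (m' - x) - perp (T x) (m - x) + perp (T x) (m + r *\<^sub>R v - m')"
    by (metis perp_add[OF Tx] perp_diff[OF Tx] perp_scale[OF Tx])
  then have "norm (r *\<^sub>R perp (T x) v) \<le> norm (perp (T x) (m' - x)) + norm (perp (T x) (m - x)) + norm (perp (T x) (m + r *\<^sub>R v - m'))"
    by (simp only: norm_diff_add_le)
  moreover have "0 \<le> r\<^sup>2 / \<rho>" using rho by simp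
  moreover have "norm (r *\<^sub>R perp (T x) v) = r * norm (perp (T x) v)" using r by simp
  moreover define q where "q = r\<^sup>2 / \<rho>"
  have "norm (perp (T x) (m' - x)) \<le> 8 * q" "norm (perp (T x) (m - x)) \<le> q / 2"
    "norm (perp (T x) (m + r *\<^sub>R v - m')) \<le> 2 * q"
    using a b c by (simp_all add: q_def)
  ultimately have "r * norm (perp (T x) v) \<le> 11 * q"
    unfolding q_def[symmetric] by linarith
  then have "r * norm (perp (T x) v) \<le> r * (11 * r / \<rho>)" by (simp add: power2_eq_square q_def mult.left_commute)
  then have "norm (perp (T x) v) \<le> 11 * r / \<rho>" using r(2) by (rule mult_left_le_imp_le)
  moreover have "perp (T x) w = norm w *\<^sub>R perp (T x) v"
    using False by (simp add: perp_scale[OF Tx, symmetric] v_def)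
  ultimately show ?thesis
    using mult_right_mono[of "norm (perp (T x) v)" "11 * r / \<rho>" "norm w"] by (simp only: norm_scaleR abs_norm_cancel mult.commute) simp
qed

text \<open>The distance from the projected chord to y is minimised over a compact piece of M. A
  minimiser cannot lie on the bounding sphere, where the projection is too long. At an interior
  minimiser the residual g is orthogonal to all projected tangent vectors, which forces g = 0 for
  tangent spaces this close.\<close>

lemma proj_surj:
  assumes x: "x \<in> M" and s: "0 < s" "s \<le> \<rho> / 50" and y: "y \<in> T x" "norm y \<le> s / 4"
  obtains m where "m \<in> M" "norm (m - x) \<le> s" "proj (T x) (m - x) = y"
proof -
  note Tx = T_sub[OF x]
  define K where "K = M \<inter> cball x s"
  have "compact K" unfolding K_def using M_props(3) by (simp add: compact_Int_closed)
  moreover have xK: "x \<in> K" using x s by (simp add: K_def)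
  moreover have "continuous_on K (\<lambda>m. norm (proj (T x) (m - x) - y))"
    by (intro continuous_intros bounded_linear.continuous_on[OF bounded_linear_proj[OF Tx]])
  ultimately obtain m where m: "m \<in> K"
    "\<And>m'. m' \<in> K \<Longrightarrow> norm (proj (T x) (m - x) - y) \<le> norm (proj (T x) (m' - x) - y)"
    using continuous_attains_inf[of K "\<lambda>m. norm (proj (T x) (m - x) - y)"] by blast
  have mM: "m \<in> M" "norm (m - x) \<le> s" using m(1) by (auto simp: K_def dist_norm norm_minus_commute)
  define g where "g = proj (T x) (m - x) - y"
  have "proj (T x) 0 = 0" using linear_0[OF linear_proj[OF Tx]] .
  then have g1: "norm g \<le> s / 4" using m(2)[OF xK] y(2) by (simp add: g_def)
  have "norm (m - x) \<noteq> s"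
  proof
    assume a: "norm (m - x) = s"
    have "norm (perp (T x) (m - x)) \<le> s\<^sup>2 / (2 * \<rho>)" using perp_tangent_le[OF x mM(1)] a by simp
    also have "\<dots> \<le> s / 100" using s rho by (simp add: power2_eq_square field_simps)
    finally have p: "norm (perp (T x) (m - x)) \<le> s / 100" .
    have "m - x = g + y + perp (T x) (m - x)" by (simp add: g_def perp_def)
    then have "s \<le> norm g + norm y + norm (perp (T x) (m - x))"
      using a by (metis norm_triangle_ineq add_right_mono order_trans)
    then show False using g1 p y(2) s(1) by simp
  qed
  then have lt: "norm (m - x) < s" using mM by simp
  have "g = 0"
  proof (rule ccontr)
    assume g0: "g \<noteq> 0"
    note Tm = T_sub[OF mM(1)]
    have gT: "g \<in> T x" unfolding g_def using y(1) proj_in[OF Tx] subsp[OF Tx] by (simp add: subspace_diff)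
    have "norm (perp (T m) g) \<le> 11 * s / \<rho> * norm g"
      by (rule tangent_angle[OF mM(1) x _ s(1)]) (use mM s rho gT in \<open>auto simp: norm_minus_commute\<close>)
    also have "\<dots> \<le> (1 / 2) * norm g" using s rho by (intro mult_right_mono) (auto simp: field_simps)
    finally have pg: "norm (perp (T m) g) \<le> norm g / 2" by simp
    \<comment> \<open>A curve in M with this velocity changes the squared residual at first order,
      at speed twice the squared norm of w.\<close>
    define w where "w = proj (T m) g"
    have wT: "w \<in> T m" using proj_in[OF Tm] by (simp add: w_def)
    have "w \<noteq> 0"
    proof
      assume "w = 0" then have "perp (T m) g = g" by (simp add: w_def perp_def)
      then show False using pg g0 by simp
    qed
    obtain \<gamma> :: "real \<Rightarrow> euc" and e where c: "e > 0" "\<gamma> 0 = m" "\<And>s. \<bar>s\<bar> < e \<Longrightarrow> \<gamma> s \<in> M"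
      "(\<gamma> has_vector_derivative w) (at 0)" using tangent_spaceE[OF wT] by metis
    have "isCont \<gamma> 0" using c(4) by (rule has_vector_derivative_continuous)
    then have "\<forall>\<^sub>F s' in at 0. dist (\<gamma> s') m < s - norm (m - x)"
      using lt c(2) by (auto simp: isCont_def tendsto_iff)
    then obtain \<delta> where d: "\<delta> > 0" "\<And>s'. s' \<noteq> 0 \<Longrightarrow> \<bar>s'\<bar> < \<delta> \<Longrightarrow> dist (\<gamma> s') m < s - norm (m - x)"
      unfolding eventually_at by (auto simp: dist_norm)
    define f where "f s' = (proj (T x) (\<gamma> s' - x) - y) \<bullet> (proj (T x) (\<gamma> s' - x) - y)" for s'
    have dp: "((\<lambda>s'. proj (T x) (\<gamma> s' - x)) has_vector_derivative proj (T x) w) (at 0)"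
      by (rule bounded_linear.has_vector_derivative[OF bounded_linear_proj[OF Tx]])
        (use c(4) in \<open>auto intro!: derivative_eq_intros\<close>)
    have "(f has_real_derivative 2 * (g \<bullet> proj (T x) w)) (at 0)"
      unfolding f_def has_real_derivative_iff_has_vector_derivative
      using dp by (auto simp: has_vector_derivative_def c(2) g_def inner_commute algebra_simps intro!: derivative_eq_intros)
    moreover have "f 0 \<le> f s'" if "\<bar>0 - s'\<bar> < min e \<delta>" for s'
    proof (cases "s' = 0")
      case False
      have "norm (\<gamma> s' - x) \<le> norm (\<gamma> s' - m) + norm (m - x)"
        using norm_triangle_ineq[of "\<gamma> s' - m" "m - x"] by simp
      then have "\<gamma> s' \<in> K" using d(2)[of s'] c(3)[of s'] that False by (simp add: K_def dist_norm norm_minus_commute)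
      then show ?thesis using m(2) unfolding f_def c(2) by (simp add: dot_square_norm power_mono)
    qed simp
    ultimately have "2 * (g \<bullet> proj (T x) w) = 0" using c(1) d(1) by (intro DERIV_local_min[of f _ 0 "min e \<delta>"]) auto
    moreover have "g \<bullet> proj (T x) w = w \<bullet> g" using inner_proj[OF Tx gT, of w] by (simp add: inner_commute)
    moreover have "w \<bullet> g = w \<bullet> w" using inner_proj[OF Tm wT, of g] by (simp add: w_def inner_commute)
    ultimately show False using \<open>w \<noteq> 0\<close> by simp
  qed
  then show ?thesis using that[of m] mM by (simp add: g_def)
qed

text \<open>A chord is almost tangent at its end b, and the tangent space at b is close to the one
  at x. The errors 1/50 and 11/50 leave less than half of the chord in the normal direction.\<close>

lemma proj_bilipschitz:
  assumes x: "x \<in> M" and s: "0 < s" "s \<le> \<rho> / 50"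
    and a: "a \<in> M" "norm (a - x) \<le> s" and b: "b \<in> M" "norm (b - x) \<le> s"
  shows "norm (a - b) \<le> 2 * norm (proj (T x) (a - b))"
proof -
  note Tx = T_sub[OF x] and Tb = T_sub[OF b(1)]
  have ab: "norm (a - b) \<le> 2 * s" using norm_triangle_ineq4[of "a - x" "b - x"] a(2) b(2) by simp
  have "norm (perp (T x) (proj (T b) (a - b))) \<le> 11 * s / \<rho> * norm (proj (T b) (a - b))"
    by (rule tangent_angle[OF x b(1) b(2) s(1)]) (use s rho proj_in[OF Tb] in auto)
  also have "\<dots> \<le> (11 / 50) * norm (a - b)"
    using s rho norm_proj_le[OF Tb] by (intro mult_mono) (auto simp: field_simps)
  finally have 1: "norm (perp (T x) (proj (T b) (a - b))) \<le> (11 / 50) * norm (a - b)" .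
  have "norm (perp (T x) (perp (T b) (a - b))) \<le> norm (perp (T b) (a - b))" by (rule norm_perp_le[OF Tx])
  also have "\<dots> \<le> (norm (a - b))\<^sup>2 / (2 * \<rho>)" by (rule perp_tangent_le[OF b(1) a(1)])
  also have "\<dots> \<le> (1 / 50) * norm (a - b)"
  proof -
    have "norm (a - b) * norm (a - b) \<le> (2 * s) * norm (a - b)" using ab by (intro mult_right_mono) auto
    also have "\<dots> \<le> (\<rho> / 25) * norm (a - b)" using s by (intro mult_right_mono) auto
    finally show ?thesis using rho by (simp add: power2_eq_square field_simps)
  qed
  finally have 2: "norm (perp (T x) (perp (T b) (a - b))) \<le> (1 / 50) * norm (a - b)" .
  have "perp (T x) (a - b) = perp (T x) (proj (T b) (a - b)) + perp (T x) (perp (T b) (a - b))"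
    by (simp add: perp_add[OF Tx, symmetric] proj_add_perp[OF Tb])
  then have "norm (perp (T x) (a - b)) = norm (perp (T x) (proj (T b) (a - b)) + perp (T x) (perp (T b) (a - b)))"
    by simp
  then have "norm (perp (T x) (a - b)) \<le> (1 / 2) * norm (a - b)"
    using norm_triangle_ineq[of "perp (T x) (proj (T b) (a - b))" "perp (T x) (perp (T b) (a - b))"] 1 2
      norm_ge_zero[of "a - b"] by linarith
  moreover have "norm (a - b) \<le> norm (proj (T x) (a - b)) + norm (perp (T x) (a - b))"
    using norm_triangle_ineq[of "proj (T x) (a - b)" "perp (T x) (a - b)"] proj_add_perp[OF Tx] by simp
  ultimately show ?thesis by linarith
qed

end

subsection \<open>Hausdorff measure of balls\<close>

lemma emeasure_PiM_lborel_box: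
  assumes "\<And>i. i < d \<Longrightarrow> a i \<le> b i"
  shows "emeasure (\<Pi>\<^sub>M i\<in>{..<d::nat}. lborel) (\<Pi>\<^sub>E i\<in>{..<d}. {a i..b i::real}) = ennreal (\<Prod>i<d. b i - a i)"
proof -
  interpret product_sigma_finite "\<lambda>_. lborel :: real measure" by standard
  have "emeasure (\<Pi>\<^sub>M i\<in>{..<d}. lborel) (\<Pi>\<^sub>E i\<in>{..<d}. {a i..b i}) = (\<Prod>i<d. emeasure lborel {a i..b i})"
    by (rule emeasure_PiM) auto
  also have "\<dots> = (\<Prod>i<d. ennreal (b i - a i))" using assms by (intro prod.cong) auto
  also have "\<dots> = ennreal (\<Prod>i<d. b i - a i)" using assms by (intro prod_ennreal) auto
  finally show ?thesis .
qed

lemma k_subspace_coordinates: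
  fixes T :: "'a::real_inner set"
  assumes "k_subspace d T"
  obtains e :: "nat \<Rightarrow> 'a" where "\<And>i j. i < d \<Longrightarrow> j < d \<Longrightarrow> e i \<bullet> e j = (if i = j then 1 else 0)" "T = span (e ` {..<d})"
proof -
  obtain B where B: "orthonormal B" "card B = d" "T = span B" using assms by (auto simp: k_subspace_def)
  then have "finite B" by (simp add: orthonormal_def)
  then obtain e where e: "bij_betw e {..<d} B" using B(2) ex_bij_betw_nat_finite[of B] by (auto simp: atLeast0LessThan)
  then have "B = e ` {..<d}" "inj_on e {..<d}" by (auto simp: bij_betw_def)
  then show ?thesis using B by (intro that[of e]) (auto simp: orthonormal_def inj_on_eq_iff)
qed

text \<open>The volume of a ball of radius 1/(8 d). In \<open>hausdorff_lower\<close> a tangent cube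
  of half-side s/(4 d) is covered by boxes of side twice the diameter of a covering set, and passing
  from this side to half the diameter costs another \<open>4 ^ d\<close>.\<close>

definition ball_lower :: "nat \<Rightarrow> real" where
  "ball_lower d = unit_ball_vol (real d) * (1 / (8 * real d)) ^ d"

text \<open>From the \<open>N ^ d\<close> cells of diameter at most 2 d \<eta>, where N \<eta> = 2
  s, in \<open>hausdorff_upper\<close>.\<close>

definition ball_upper :: "nat \<Rightarrow> real" where
  "ball_upper d = unit_ball_vol (real d) * (2 * real d) ^ d"

lemma ball_lower_pos: "1 \<le> d \<Longrightarrow> 0 < ball_lower d"
  by (simp add: ball_lower_def)

lemma ball_upper_pos: "1 \<le> d \<Longrightarrow> 0 < ball_upper d"
  by (simp add: ball_upper_def)

context reach_manifold
begin

text \<open>By \<open>proj_surj\<close> a tangent cube lies in the projection of the piece of M, so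
  every cover of the piece yields a cover of the cube by boxes. Lebesgue measure then bounds the sum
  of the weights from below.\<close>

lemma hausdorff_lower:
  assumes d: "1 \<le> d" and x: "x \<in> M" and s: "0 < s" "s \<le> \<rho> / 50"
  shows "ennreal (ball_lower d * s ^ d) \<le> hausdorff_outer d (M \<inter> cball x s)"
proof -
  let ?A = "M \<inter> cball x s" and ?c = "unit_ball_vol (real d)"
  let ?L = "\<Pi>\<^sub>M i\<in>{..<d}. (lborel :: real measure)"
  obtain e where o: "\<And>i j. i < d \<Longrightarrow> j < d \<Longrightarrow> e i \<bullet> e j = (if i = j then 1 else 0)" and Te: "T x = span (e ` {..<d})"
    using k_subspace_coordinates[OF T_sub[OF x]] by metis
  have ne: "norm (e i) = 1" if "i < d" for i using o[OF that that] by (simp add: norm_eq_sqrt_inner)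
  define \<eta> where "\<eta> = s / (4 * real d)"
  have eta: "\<eta> > 0" using s d by (simp add: \<eta>_def)
  have bound: "ennreal (ball_lower d * s ^ d) \<le> (\<Sum>i. ennreal (?c * (diameter (U i) / 2) ^ d))"
    if U: "?A \<subseteq> (\<Union>i. U i)" "\<And>i. bounded (U i)" for U :: "nat \<Rightarrow> euc set"
  proof -
    define u where "u i = (SOME z. z \<in> U i)" for i
    define Bx where "Bx i = (if U i = {} then {} else (\<Pi>\<^sub>E j\<in>{..<d}. {e j \<bullet> (u i - x) - diameter (U i)..e j \<bullet> (u i - x) + diameter (U i)}))" for i
    have dn: "diameter (U i) \<ge> 0" for i using U(2) by (rule diameter_ge_0)
    have Bm: "Bx i \<in> sets ?L" for i unfolding Bx_def by (auto intro!: sets_PiM_I_finite)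
    have Be: "emeasure ?L (Bx i) \<le> ennreal ((2 * diameter (U i)) ^ d)" for i
    proof (cases "U i = {}")
      case False
      then have "emeasure ?L (Bx i) = ennreal (\<Prod>j<d. (e j \<bullet> (u i - x) + diameter (U i)) - (e j \<bullet> (u i - x) - diameter (U i)))"
        unfolding Bx_def using dn[of i] by (simp only: if_False) (rule emeasure_PiM_lborel_box, simp)
      also have "\<dots> = ennreal ((2 * diameter (U i)) ^ d)" by simp
      finally show ?thesis by simp
    qed (simp add: Bx_def)
    have sub: "(\<Pi>\<^sub>E j\<in>{..<d}. {-\<eta>..\<eta>}) \<subseteq> (\<Union>i. Bx i)"
    proof
      fix y assume y: "y \<in> (\<Pi>\<^sub>E j\<in>{..<d}. {-\<eta>..\<eta>})"
      define w where "w = (\<Sum>j<d. y j *\<^sub>R e j)"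
      have wT: "w \<in> T x" unfolding w_def Te by (intro span_sum span_scale span_base) auto
      have "norm w \<le> (\<Sum>j<d. norm (y j *\<^sub>R e j))" unfolding w_def by (rule norm_sum)
      also have "\<dots> \<le> (\<Sum>j<d. \<eta>)"
      proof (rule sum_mono)
        fix j assume j: "j \<in> {..<d}"
        then have "y j \<in> {-\<eta>..\<eta>}" using y by (auto simp: PiE_def Pi_def)
        then show "norm (y j *\<^sub>R e j) \<le> \<eta>" using ne[of j] j by auto
      qed
      also have "\<dots> = s / 4" using d by (simp add: \<eta>_def)
      finally obtain m where m: "m \<in> M" "norm (m - x) \<le> s" "proj (T x) (m - x) = w"
        using proj_surj[OF x s wT] by blast
      then have "m \<in> ?A" by (simp add: dist_norm norm_minus_commute)
      then obtain i where i: "m \<in> U i" using U(1) by blast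
      then have ui: "u i \<in> U i" unfolding u_def by (rule someI)
      have yj: "y j = e j \<bullet> (m - x)" if j: "j < d" for j
      proof -
        have "e j \<bullet> w = (\<Sum>k<d. if k = j then y k else 0)"
          unfolding w_def inner_sum_right using o[OF j] by (intro sum.cong) auto
        then have "e j \<bullet> w = y j" using j by simp
        moreover have "proj (T x) (m - x) \<bullet> e j = (m - x) \<bullet> e j"
          by (rule inner_proj[OF T_sub[OF x]]) (use j in \<open>simp add: Te span_base\<close>)
        ultimately show ?thesis using m(3) by (simp add: inner_commute)
      qed
      have "y \<in> Bx i"
      proof -
        have "y j \<in> {e j \<bullet> (u i - x) - diameter (U i)..e j \<bullet> (u i - x) + diameter (U i)}" if j: "j < d" for j
        proof -
          have "\<bar>e j \<bullet> (m - u i)\<bar> \<le> norm (e j) * norm (m - u i)" by (rule Cauchy_Schwarz_ineq2)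
          also have "\<dots> \<le> diameter (U i)"
            using diameter_bounded_bound[OF U(2) i ui] ne[OF j] by (simp add: dist_norm)
          finally have "\<bar>e j \<bullet> (m - u i)\<bar> \<le> diameter (U i)" .
          moreover have "e j \<bullet> (m - u i) = y j - e j \<bullet> (u i - x)" unfolding yj[OF j] by (simp add: inner_diff_right)
          ultimately show ?thesis by auto
        qed
        then show ?thesis using i y by (auto simp: Bx_def PiE_def Pi_def)
      qed
      then show "y \<in> (\<Union>i. Bx i)" by blast
    qed
    have "ennreal ((2 * \<eta>) ^ d) = emeasure ?L (\<Pi>\<^sub>E j\<in>{..<d}. {-\<eta>..\<eta>})"
      using eta by (subst emeasure_PiM_lborel_box) auto
    also have "\<dots> \<le> emeasure ?L (\<Union>i. Bx i)" using sub Bm by (intro emeasure_mono) auto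
    also have "\<dots> \<le> (\<Sum>i. emeasure ?L (Bx i))" using Bm by (intro emeasure_subadditive_countably) auto
    also have "\<dots> \<le> (\<Sum>i. ennreal ((2 * diameter (U i)) ^ d))" using Be by (intro suminf_le) auto
    finally have main: "ennreal ((2 * \<eta>) ^ d) \<le> (\<Sum>i. ennreal ((2 * diameter (U i)) ^ d))" .
    have c: "?c / 4 ^ d \<ge> 0" by simp
    have "ball_lower d * s ^ d = (?c / 4 ^ d) * (2 * \<eta>) ^ d"
      unfolding ball_lower_def \<eta>_def by (simp add: power_divide power_mult_distrib field_simps)
        (simp add: power_mult_distrib[symmetric] mult.assoc[symmetric] del: power_mult_distrib)?
    then have "ennreal (ball_lower d * s ^ d) = ennreal (?c / 4 ^ d) * ennreal ((2 * \<eta>) ^ d)"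
      using c eta by (simp only:, intro ennreal_mult) auto
    also have "\<dots> \<le> ennreal (?c / 4 ^ d) * (\<Sum>i. ennreal ((2 * diameter (U i)) ^ d))"
      using main by (intro mult_left_mono) auto
    also have "\<dots> = (\<Sum>i. ennreal (?c / 4 ^ d) * ennreal ((2 * diameter (U i)) ^ d))" by simp
    also have "\<dots> = (\<Sum>i. ennreal (?c * (diameter (U i) / 2) ^ d))"
    proof (rule suminf_cong)
      fix i
      have "?c / 4 ^ d * (2 * diameter (U i)) ^ d = ?c * ((2 * diameter (U i)) / 4) ^ d"
        unfolding power_divide by simp
      also have "(2 * diameter (U i)) / 4 = diameter (U i) / 2" by simp
      finally show "ennreal (?c / 4 ^ d) * ennreal ((2 * diameter (U i)) ^ d) = ennreal (?c * (diameter (U i) / 2) ^ d)"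
        using c dn[of i] by (simp add: ennreal_mult[symmetric])
    qed
    finally show ?thesis .
  qed
  \<comment> \<open>The bound holds for every cover, so a single mesh size in the supremum, here 1,
    gives the claim.\<close>
  have "ennreal (ball_lower d * s ^ d) \<le>
      (INF U\<in>{U :: nat \<Rightarrow> euc set. ?A \<subseteq> (\<Union>i. U i) \<and> (\<forall>i. bounded (U i) \<and> diameter (U i) \<le> 1)}.
      \<Sum>i. ennreal (?c * (diameter (U i) / 2) ^ d))"
    by (rule INF_greatest) (use bound in auto)
  also have "\<dots> \<le> hausdorff_outer d ?A" unfolding hausdorff_outer_def by (rule SUP_upper) simp
  finally show ?thesis .
qed

text \<open>The projection to the tangent space is bi-Lipschitz on the piece, so the preimages of
  the cells of a cubic grid form covers of arbitrarily small mesh with controlled total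
  weight.\<close>

lemma hausdorff_upper:
  assumes d: "1 \<le> d" and x: "x \<in> M" and s: "0 < s" "s \<le> \<rho> / 50"
  shows "hausdorff_outer d (M \<inter> cball x s) \<le> ennreal (ball_upper d * s ^ d)"
  unfolding hausdorff_outer_def
proof (rule SUP_least)
  let ?A = "M \<inter> cball x s" and ?c = "unit_ball_vol (real d)"
  fix \<delta> :: real assume "\<delta> \<in> {0<..}"
  then have \<delta>: "\<delta> > 0" by simp
  obtain e where o: "\<And>i j. i < d \<Longrightarrow> j < d \<Longrightarrow> e i \<bullet> e j = (if i = j then 1 else 0)" and Te: "T x = span (e ` {..<d})"
    using k_subspace_coordinates[OF T_sub[OF x]] by metis
  have ne: "norm (e i) = 1" if "i < d" for i using o[OF that that] by (simp add: norm_eq_sqrt_inner)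
  obtain N :: nat where N: "real N > 4 * real d * s / \<delta>" using reals_Archimedean2 by blast
  moreover have "4 * real d * s / \<delta> \<ge> 0" using s \<delta> by simp
  ultimately have N0: "N > 0" by (metis less_le_not_le of_nat_0 of_nat_0_less_iff order_le_less_trans)
  define \<eta> where "\<eta> = 2 * s / real N"
  have eta: "\<eta> > 0" using s N0 by (simp add: \<eta>_def)
  define I where "I = (\<Pi>\<^sub>E j\<in>{..<d}. {..<N})"
  have fI: "finite I" and cI: "card I = N ^ d" by (auto simp: I_def finite_PiE card_PiE)
  \<comment> \<open>The second alternative puts the extreme coordinate value into the last cell; the
    floor would give the index N, which is outside the grid.\<close>
  define c where "c k = {m \<in> ?A. \<forall>j<d. \<lfloor>(e j \<bullet> (m - x) + s) / \<eta>\<rfloor> = int (k j) \<or> (e j \<bullet> (m - x) + s = 2 * s \<and> k j = N - 1)}" for k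
  have cd: "dist a b \<le> 2 * real d * \<eta>" if ab: "a \<in> c k" "b \<in> c k" for a b k
  proof -
    have cell: "real (k j) * \<eta> \<le> e j \<bullet> (m - x) + s \<and> e j \<bullet> (m - x) + s \<le> (real (k j) + 1) * \<eta>" if m: "m \<in> c k" and j: "j < d" for m j
    proof -
      from m j consider "\<lfloor>(e j \<bullet> (m - x) + s) / \<eta>\<rfloor> = int (k j)" | "e j \<bullet> (m - x) + s = 2 * s" "k j = N - 1"
        by (auto simp: c_def)
      then show ?thesis
      proof cases
        case 1
        then have "real (k j) \<le> (e j \<bullet> (m - x) + s) / \<eta>" "(e j \<bullet> (m - x) + s) / \<eta> \<le> real (k j) + 1"
          by linarith+
        then show ?thesis using eta by (simp add: field_simps)
      next
        case 2
        have "(real (k j) + 1) * \<eta> = 2 * s" using 2(2) N0 by (simp add: \<eta>_def of_nat_diff)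
        then show ?thesis using 2 eta by (simp add: algebra_simps)
      qed
    qed
    have A: "a \<in> M" "norm (a - x) \<le> s" "b \<in> M" "norm (b - x) \<le> s"
      using ab by (auto simp: c_def dist_norm norm_minus_commute)
    have "proj (T x) (a - b) = (\<Sum>j<d. (e j \<bullet> (a - b)) *\<^sub>R e j)"
    proof -
      have "proj (T x) (a - b) = (\<Sum>j<d. (e j \<bullet> proj (T x) (a - b)) *\<^sub>R e j)"
        by (rule orthonormal_family_expand[OF o]) (use proj_in[OF T_sub[OF x]] Te in auto)
      moreover have "e j \<bullet> proj (T x) (a - b) = e j \<bullet> (a - b)" if "j < d" for j
        using inner_proj[OF T_sub[OF x], of "e j" "a - b"] that by (simp add: Te span_base inner_commute)
      ultimately show ?thesis by simp
    qed
    then have "norm (proj (T x) (a - b)) \<le> (\<Sum>j<d. norm ((e j \<bullet> (a - b)) *\<^sub>R e j))"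
      by (simp only: norm_sum)
    also have "\<dots> \<le> (\<Sum>j<d. \<eta>)"
    proof (rule sum_mono)
      fix j assume j: "j \<in> {..<d}"
      have "e j \<bullet> (a - b) = (e j \<bullet> (a - x) + s) - (e j \<bullet> (b - x) + s)" by (simp add: inner_diff_right)
      then have "\<bar>e j \<bullet> (a - b)\<bar> \<le> \<eta>" using cell[OF ab(1), of j] cell[OF ab(2), of j] j by (auto simp: algebra_simps)
      then show "norm ((e j \<bullet> (a - b)) *\<^sub>R e j) \<le> \<eta>" using ne[of j] j by simp
    qed
    finally have "norm (proj (T x) (a - b)) \<le> real d * \<eta>" by simp
    then show ?thesis using proj_bilipschitz[OF x s A] by (simp add: dist_norm)
  qed
  have cov: "?A \<subseteq> (\<Union>k\<in>I. c k)"
  proof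
    fix m assume m: "m \<in> ?A"
    have nm: "norm (m - x) \<le> s" using m by (simp add: dist_norm norm_minus_commute)
    define k where "k = (\<lambda>j\<in>{..<d}. if e j \<bullet> (m - x) + s = 2 * s then N - 1 else nat \<lfloor>(e j \<bullet> (m - x) + s) / \<eta>\<rfloor>)"
    have rng: "0 \<le> e j \<bullet> (m - x) + s" "e j \<bullet> (m - x) + s \<le> 2 * s" if "j < d" for j
      using Cauchy_Schwarz_ineq2[of "e j" "m - x"] ne[OF that] nm by auto
    have "k \<in> I"
      unfolding I_def
    proof (rule PiE_I)
      fix j assume j: "j \<in> {..<d}"
      show "k j \<in> {..<N}"
      proof (cases "e j \<bullet> (m - x) + s = 2 * s")
        case True then show ?thesis using N0 j by (simp add: k_def)
      next
        case False
        then have "e j \<bullet> (m - x) + s < real N * \<eta>" using rng(2)[of j] j N0 by (simp add: \<eta>_def)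
        then have "(e j \<bullet> (m - x) + s) / \<eta> < real N" using eta by (simp add: field_simps)
        then have "\<lfloor>(e j \<bullet> (m - x) + s) / \<eta>\<rfloor> < int N" by (simp add: floor_less_iff)
        then show ?thesis using False j N0 by (simp add: k_def)
      qed
    qed (simp add: k_def)
    moreover have "m \<in> c k"
    proof -
      have "\<lfloor>(e j \<bullet> (m - x) + s) / \<eta>\<rfloor> = int (k j) \<or> (e j \<bullet> (m - x) + s = 2 * s \<and> k j = N - 1)" if j: "j < d" for j
        using j rng(1)[OF j] eta by (simp add: k_def)
      then show ?thesis using m by (simp add: c_def)
    qed
    ultimately show "m \<in> (\<Union>k\<in>I. c k)" by blast
  qed
  obtain f where f: "bij_betw f {..<card I} I" using ex_bij_betw_nat_finite[OF fI] by (auto simp: atLeast0LessThan)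
  define U where "U i = (if i < card I then c (f i) else {})" for i
  have bU: "bounded (U i)" for i
    by (rule bounded_subset[OF bounded_cball[of x s]]) (auto simp: U_def c_def)
  have dU: "diameter (U i) \<le> 2 * real d * \<eta>" for i
    by (rule diameter_le) (use cd eta in \<open>auto simp: U_def dist_norm split: if_splits\<close>)
  have "(INF U\<in>{U :: nat \<Rightarrow> euc set. ?A \<subseteq> (\<Union>i. U i) \<and> (\<forall>i. bounded (U i) \<and> diameter (U i) \<le> \<delta>)}.
      \<Sum>i. ennreal (?c * (diameter (U i) / 2) ^ d)) \<le> (\<Sum>i. ennreal (?c * (diameter (U i) / 2) ^ d))"
  proof (rule INF_lower, safe)
    fix m assume "m \<in> M" "m \<in> cball x s"
    then obtain k where "k \<in> I" "m \<in> c k" using cov by blast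
    then obtain i where "i < card I" "f i = k" using f by (metis bij_betw_def imageE lessThan_iff)
    then show "m \<in> (\<Union>i. U i)" using \<open>m \<in> c k\<close> by (auto simp: U_def)
  next
    fix i
    show "bounded (U i)" by (rule bU)
    have "2 * real d * \<eta> \<le> \<delta>" using N N0 \<delta> s by (simp add: \<eta>_def field_simps)
    then show "diameter (U i) \<le> \<delta>" using dU[of i] by linarith
  qed
  also have "\<dots> = (\<Sum>i<card I. ennreal (?c * (diameter (U i) / 2) ^ d))"
    by (rule suminf_finite) (use d in \<open>auto simp: U_def\<close>)
  also have "\<dots> \<le> (\<Sum>i<card I. ennreal (?c * (real d * \<eta>) ^ d))"
  proof (intro sum_mono ennreal_leI mult_left_mono power_mono)
    fix i show "diameter (U i) / 2 \<le> real d * \<eta>" using dU[of i] by simp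
    show "0 \<le> diameter (U i) / 2" using diameter_ge_0[OF bU] by simp
  qed simp
  also have "\<dots> = ennreal (real (N ^ d) * (?c * (real d * \<eta>) ^ d))"
    unfolding cI[symmetric] using eta by (simp add: ennreal_mult ennreal_of_nat_eq_real_of_nat)
  also have "real (N ^ d) * (?c * (real d * \<eta>) ^ d) = ?c * (real N * (real d * \<eta>)) ^ d"
    by (simp add: power_mult_distrib)
  also have "real N * (real d * \<eta>) = 2 * real d * s" using N0 by (simp add: \<eta>_def)
  also have "?c * (2 * real d * s) ^ d = ball_upper d * s ^ d"
    by (simp add: ball_upper_def power_mult_distrib)
  finally show "(INF U\<in>{U :: nat \<Rightarrow> euc set. ?A \<subseteq> (\<Union>i. U i) \<and> (\<forall>i. bounded (U i) \<and> diameter (U i) \<le> \<delta>)}.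
      \<Sum>i. ennreal (?c * (diameter (U i) / 2) ^ d)) \<le> ennreal (ball_upper d * s ^ d)" .
qed

end

lemma manifold_distribution_bounds:
  assumes Q: "Q \<in> manifold_distributions d fmin fmax M" and M: "closed M" and f: "0 < fmin" "fmin \<le> fmax"
  shows "prob_space Q" "sets Q = sets borel" "emeasure Q (- M) = 0"
    "A \<in> sets borel \<Longrightarrow> ennreal fmin * hausdorff_outer d (M \<inter> A) \<le> emeasure Q A"
    "A \<in> sets borel \<Longrightarrow> emeasure Q A \<le> ennreal fmax * hausdorff_outer d (M \<inter> A)"
proof -
  let ?H = "hausdorff_measure d"
  obtain f where p: "prob_space Q" and fb: "f \<in> borel_measurable borel"
    and fm: "\<And>x. x \<in> M \<Longrightarrow> fmin \<le> f x \<and> f x \<le> fmax" and Qf: "Q = density (manifold_volume d M) (\<lambda>x. ennreal (f x))"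
    using Q by (auto simp: manifold_distributions_def)
  have sH: "sets ?H = sets borel" unfolding hausdorff_measure_def
    using sets_measure_of[of "sets borel" UNIV "hausdorff_outer d"] sets.sigma_sets_eq[of "borel :: euc measure"] by simp
  have Mb: "M \<in> sets borel" using M by simp
  have Qe: "emeasure Q A = (\<integral>\<^sup>+x. ennreal (f x) * indicator (M \<inter> A) x \<partial>?H)" if A: "A \<in> sets borel" for A
  proof -
    have m1: "(\<lambda>x. ennreal (f x)) \<in> borel_measurable ?H"
      using fb by (simp add: measurable_cong_sets[OF sH refl])
    have m2: "(indicator M :: euc \<Rightarrow> ennreal) \<in> borel_measurable ?H" using Mb sH by simp
    have "emeasure Q A = (\<integral>\<^sup>+x. ennreal (f x) * indicator A x \<partial>manifold_volume d M)"
      unfolding Qf using A m1 sH by (intro emeasure_density) (auto simp: manifold_volume_def)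
    also have "\<dots> = (\<integral>\<^sup>+x. indicator M x * (ennreal (f x) * indicator A x) \<partial>?H)"
      unfolding manifold_volume_def using m1 m2 A sH by (intro nn_integral_density) auto
    also have "\<dots> = (\<integral>\<^sup>+x. ennreal (f x) * indicator (M \<inter> A) x \<partial>?H)"
      by (intro nn_integral_cong) (auto simp: indicator_def)
    finally show ?thesis .
  qed
  show "prob_space Q" by (rule p)
  show sQ: "sets Q = sets borel" unfolding Qf manifold_volume_def using sH by simp
  show "emeasure Q (- M) = 0" using Mb by (subst Qe) auto
  \<comment> \<open>If \<open>hausdorff_outer\<close> failed to be a measure on the Borel sets,
    \<open>measure_of\<close> would default to the null measure, and Q could not have total mass
    1.\<close>
  have ms: "measure_space UNIV (sigma_sets UNIV (sets borel)) (hausdorff_outer d)"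
  proof (rule ccontr)
    assume no: "\<not> ?thesis"
    then have z: "emeasure ?H A = 0" for A
      unfolding hausdorff_measure_def by (simp add: emeasure_measure_of_conv)
    have "AE x in ?H. False" unfolding eventually_ae_filter null_sets_def using z sets.top[of ?H] by auto
    then have "(\<integral>\<^sup>+x. ennreal (f x) * indicator (M \<inter> UNIV) x \<partial>?H) = (\<integral>\<^sup>+x. 0 \<partial>?H)"
      by (intro nn_integral_cong_AE) auto
    then have "emeasure Q UNIV = 0" using Qe[of UNIV] by simp
    moreover have "emeasure Q (space Q) = 1" using p by (rule prob_space.emeasure_space_1)
    moreover have "space Q = UNIV" using sQ sets_eq_imp_space_eq[of Q borel] by simp
    ultimately show False by simp
  qed
  have H: "emeasure ?H A = hausdorff_outer d A" if "A \<in> sets borel" for A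
    unfolding hausdorff_measure_def using ms that by (simp add: emeasure_measure_of_conv sigma_sets.Basic)
  show "ennreal fmin * hausdorff_outer d (M \<inter> A) \<le> emeasure Q A" if A: "A \<in> sets borel"
  proof -
    have "ennreal fmin * hausdorff_outer d (M \<inter> A) = (\<integral>\<^sup>+x. ennreal fmin * indicator (M \<inter> A) x \<partial>?H)"
      using Mb A sH by (subst nn_integral_cmult_indicator) (auto simp: H)
    also have "\<dots> \<le> emeasure Q A" unfolding Qe[OF A]
      using fm by (intro nn_integral_mono) (auto simp: indicator_def intro!: ennreal_leI)
    finally show ?thesis .
  qed
  show "emeasure Q A \<le> ennreal fmax * hausdorff_outer d (M \<inter> A)" if A: "A \<in> sets borel"
  proof -
    have "emeasure Q A \<le> (\<integral>\<^sup>+x. ennreal fmax * indicator (M \<inter> A) x \<partial>?H)" unfolding Qe[OF A]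
      using fm by (intro nn_integral_mono) (auto simp: indicator_def intro!: ennreal_leI)
    also have "\<dots> = ennreal fmax * hausdorff_outer d (M \<inter> A)"
      using Mb A sH by (subst nn_integral_cmult_indicator) (auto simp: H)
    finally show ?thesis .
  qed
qed

lemma manifold_distribution_ball:
  assumes Q: "Q \<in> manifold_distributions d fmin fmax M" and M: "M \<in> manifolds D d \<rho>" "0 < \<rho>" "1 \<le> d"
    and f: "0 < fmin" "fmin \<le> fmax" and x: "x \<in> M" and s: "0 < s" "s \<le> \<rho> / 50"
  shows "fmin * ball_lower d * s ^ d \<le> measure Q (cball x s)" "measure Q (cball x s) \<le> fmax * ball_upper d * s ^ d"
proof -
  interpret reach_manifold D d M \<rho> using M by unfold_locales
  note b = manifold_distribution_bounds[OF Q closed_M f]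
  interpret Q: prob_space Q by (rule b)
  have "ennreal (fmin * ball_lower d * s ^ d) = ennreal fmin * ennreal (ball_lower d * s ^ d)"
    using f s by (subst mult.assoc, intro ennreal_mult) (auto simp: ball_lower_def)
  also have "\<dots> \<le> ennreal fmin * hausdorff_outer d (M \<inter> cball x s)"
    by (intro mult_left_mono hausdorff_lower M x s) simp
  also have "\<dots> \<le> emeasure Q (cball x s)" by (rule b(4)) simp
  finally show "fmin * ball_lower d * s ^ d \<le> measure Q (cball x s)"
    by (simp add: Q.emeasure_eq_measure)
  have "emeasure Q (cball x s) \<le> ennreal fmax * hausdorff_outer d (M \<inter> cball x s)" by (rule b(5)) simp
  also have "\<dots> \<le> ennreal fmax * ennreal (ball_upper d * s ^ d)"
    by (intro mult_left_mono hausdorff_upper M x s) simp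
  also have "\<dots> = ennreal (fmax * ball_upper d * s ^ d)"
    using f s by (subst mult.assoc, intro ennreal_mult[symmetric]) (auto simp: ball_upper_def)
  finally show "measure Q (cball x s) \<le> fmax * ball_upper d * s ^ d"
    using f s by (simp add: Q.emeasure_eq_measure ball_upper_def)
qed

subsection \<open>Perturbations of the identity\<close>

text \<open>The converse of \<open>perp_tangent_le\<close>. At a medial point z with nearest points
  a and b, z - a is normal at a, and equal distances mean that the squared chord is twice
  \<open>(z - a) \<bullet> (b - a)\<close>; only the normal part of the chord enters, which forces
  \<open>norm (z - a) \<ge> R\<close>.\<close>

lemma reach_criterion:
  assumes "M \<subseteq> Rn D" "0 < R" and sub: "\<And>a. a \<in> M \<Longrightarrow> k_subspace d (tangent_space M a)"
    and le: "\<And>a b. a \<in> M \<Longrightarrow> b \<in> M \<Longrightarrow> norm (perp (tangent_space M a) (b - a)) \<le> (norm (b - a))\<^sup>2 / (2 * R)"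
  shows "ereal R \<le> reach D M"
  unfolding reach_def
proof (intro INF_greatest)
  fix p z assume p: "p \<in> M" and "z \<in> medial_axis D M"
  then obtain a b where ab: "a \<in> M" "b \<in> M" "a \<noteq> b" "dist z a = dist z b" "dist z b = infdist z M"
    by (auto simp: medial_axis_def)
  let ?T = "tangent_space M a"
  note T = sub[OF ab(1)]
  define r where "r = norm (z - a)"
  have "(z - a) \<bullet> proj ?T (b - a) = 0"
    by (rule nearest_orthogonal[OF ab(1) _ proj_in[OF T]]) (use ab in simp)
  then have "(z - a) \<bullet> (b - a) = (z - a) \<bullet> perp ?T (b - a)" by (simp add: perp_def inner_diff_right)
  also have "\<dots> \<le> r * norm (perp ?T (b - a))" unfolding r_def by (rule norm_cauchy_schwarz)
  also have "\<dots> \<le> r * ((norm (b - a))\<^sup>2 / (2 * R))" using le[OF ab(1,2)] by (intro mult_left_mono) (auto simp: r_def)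
  finally have 1: "(z - a) \<bullet> (b - a) \<le> r * ((norm (b - a))\<^sup>2 / (2 * R))" .
  have "(norm (z - b))\<^sup>2 = (norm ((z - a) - (b - a)))\<^sup>2" by simp
  also have "\<dots> = (norm (z - a))\<^sup>2 - 2 * ((z - a) \<bullet> (b - a)) + (norm (b - a))\<^sup>2" by (rule norm_diff_square)
  finally have "(norm (b - a))\<^sup>2 = 2 * ((z - a) \<bullet> (b - a))" using ab(4) by (simp add: dist_norm)
  then have "(norm (b - a))\<^sup>2 * R \<le> (norm (b - a))\<^sup>2 * r" using 1 \<open>0 < R\<close> by (simp add: field_simps)
  moreover have "(norm (b - a))\<^sup>2 > 0" using ab(3) by simp
  ultimately have "R \<le> r" by (simp only: mult_le_cancel_left_pos)
  also have "r \<le> dist p z" using ab(4,5) infdist_le[OF p, of z] by (simp add: r_def dist_norm norm_minus_commute)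
  finally show "ereal R \<le> ereal (dist p z)" by simp
qed

text \<open>Both isotopies run over the same time interval and are composed at equal times, so no
  continuous families have to be glued.\<close>

lemma ambient_isotopic_trans:
  assumes "ambient_isotopic D A B" "ambient_isotopic D B C"
  shows "ambient_isotopic D A C"
proof -
  obtain F where F: "continuous_on ({0..1} \<times> Rn D) (\<lambda>(s, x). F s x)"
    "\<And>s::real. s \<in> {0..1} \<Longrightarrow> \<exists>G. homeomorphism (Rn D) (Rn D) (F s) G"
    "\<And>x. x \<in> Rn D \<Longrightarrow> F 0 x = x" "F 1 ` A = B"
    using assms(1) unfolding ambient_isotopic_def by blast
  obtain G where G: "continuous_on ({0..1} \<times> Rn D) (\<lambda>(s, x). G s x)"
    "\<And>s::real. s \<in> {0..1} \<Longrightarrow> \<exists>H. homeomorphism (Rn D) (Rn D) (G s) H"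
    "\<And>x. x \<in> Rn D \<Longrightarrow> G 0 x = x" "G 1 ` B = C"
    using assms(2) unfolding ambient_isotopic_def by blast
  have FR: "F s x \<in> Rn D" if "s \<in> {0..1}" "x \<in> Rn D" for s x
    using F(2)[OF that(1)] that(2) by (auto simp: homeomorphism_def)
  have "continuous_on ({0..1} \<times> Rn D) ((\<lambda>(s, x). G s x) \<circ> (\<lambda>(s, x). (s, F s x)))"
  proof (rule continuous_on_compose)
    show "continuous_on ({0..1} \<times> Rn D) (\<lambda>(s, x). (s, F s x))"
      using F(1) by (auto simp: case_prod_beta' intro!: continuous_on_Pair continuous_on_fst)
    show "continuous_on ((\<lambda>(s, x). (s, F s x)) ` ({0..1} \<times> Rn D)) (\<lambda>(s, x). G s x)"
      by (rule continuous_on_subset[OF G(1)]) (auto intro: FR)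
  qed
  then have "continuous_on ({0..1} \<times> Rn D) (\<lambda>(s, x). G s (F s x))"
    by (simp add: o_def case_prod_beta')
  moreover have "\<exists>H. homeomorphism (Rn D) (Rn D) (\<lambda>x. G s (F s x)) H" if s: "s \<in> {0..1}" for s
  proof -
    obtain H1 H2 where "homeomorphism (Rn D) (Rn D) (F s) H1" "homeomorphism (Rn D) (Rn D) (G s) H2"
      using F(2)[OF s] G(2)[OF s] by blast
    from homeomorphism_compose[OF this] show ?thesis by (auto simp: o_def)
  qed
  moreover have "G 0 (F 0 x) = x" if "x \<in> Rn D" for x using F(3) G(3) that by simp
  moreover have "(\<lambda>x. G 1 (F 1 x)) ` A = C" using F(4) G(4) by (metis image_image)
  ultimately show ?thesis unfolding ambient_isotopic_def by (intro exI[of _ "\<lambda>s x. G s (F s x)"]) blast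
qed

text \<open>The Lipschitz constant 1/2 of G makes id + s G invertible for all s between 0 and 1; the
  Lipschitz constant L of the derivative controls the reach of the image.\<close>

locale perturbation =
  fixes D :: nat and G :: "euc \<Rightarrow> euc" and G' :: "euc \<Rightarrow> euc \<Rightarrow> euc" and L :: real
  assumes der: "\<And>x. (G has_derivative G' x) (at x)"
    and G'_le: "\<And>x v. norm (G' x v) \<le> 1 / 2 * norm v"
    and G'_lip: "\<And>x y v. norm (G' x v - G' y v) \<le> L * norm (x - y) * norm v"
    and G_Rn: "\<And>x. x \<in> Rn D \<Longrightarrow> G x \<in> Rn D" and L0: "0 \<le> L"
begin

definition \<Phi> :: "euc \<Rightarrow> euc" where "\<Phi> x = x + G x"
definition \<Phi>' :: "euc \<Rightarrow> euc \<Rightarrow> euc" where "\<Phi>' x v = v + G' x v"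

lemma G_lip: "norm (G x - G y) \<le> 1 / 2 * norm (x - y)"
proof (rule differentiable_bound[of UNIV])
  show "onorm (G' z) \<le> 1 / 2" for z by (rule onorm_bound) (simp, rule G'_le)
qed (use der in auto)

lemma bl_G': "bounded_linear (G' x)" using der by (rule has_derivative_bounded_linear)

lemma bl_\<Phi>': "bounded_linear (\<Phi>' x)"
  unfolding \<Phi>'_def[abs_def] by (intro bounded_linear_add bounded_linear_ident bl_G')

lemma \<Phi>_der: "(\<Phi> has_derivative \<Phi>' x) (at x)"
  unfolding \<Phi>_def[abs_def] \<Phi>'_def[abs_def] by (intro has_derivative_add has_derivative_ident der)

lemma cont_G: "continuous_on S G"
  using der has_derivative_continuous by (blast intro: continuous_at_imp_continuous_on)

lemma cont_\<Phi>: "continuous_on S \<Phi>"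
  unfolding \<Phi>_def[abs_def] by (intro continuous_intros cont_G)

lemma \<Phi>_lower: "norm (x - y) \<le> 2 * norm (\<Phi> x - \<Phi> y)"
proof -
  have "x - y = (\<Phi> x - \<Phi> y) - (G x - G y)" by (simp add: \<Phi>_def)
  then have "norm (x - y) \<le> norm (\<Phi> x - \<Phi> y) + norm (G x - G y)"
    by (metis norm_triangle_ineq4)
  then show ?thesis using G_lip[of x y] by simp
qed

lemma inj_\<Phi>: "inj_on \<Phi> S"
proof (rule inj_onI)
  fix x y assume "\<Phi> x = \<Phi> y"
  then show "x = y" using \<Phi>_lower[of x y] by simp
qed

lemma \<Phi>'_inj: "inj_on (\<Phi>' x) S"
proof (rule inj_onI)
  fix v w assume "\<Phi>' x v = \<Phi>' x w"
  then have "\<Phi>' x (v - w) = 0" using bl_\<Phi>' by (simp add: linear_diff bounded_linear.linear)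
  then have "norm (v - w) = norm (G' x (v - w))" unfolding \<Phi>'_def by (metis add_eq_0_iff norm_minus_cancel)
  then show "v = w" using G'_le[of x "v - w"] by simp
qed

lemma \<Phi>_Rn: "x \<in> Rn D \<Longrightarrow> \<Phi> x \<in> Rn D"
  using G_Rn subspace_Rn by (simp add: \<Phi>_def subspace_add)

lemma isotopy: "ambient_isotopic D A (\<Phi> ` A)"
  unfolding ambient_isotopic_def
proof (intro exI[of _ "\<lambda>s x. x + s *\<^sub>R G x"] conjI ballI)
  have "continuous_on ({0..1} \<times> Rn D) (\<lambda>p. snd p + fst p *\<^sub>R G (snd p))"
    by (intro continuous_intros continuous_on_compose2[OF cont_G[of UNIV]]) auto
  then show "continuous_on ({0..1::real} \<times> Rn D) (\<lambda>(s, x). x + s *\<^sub>R G x)" by (simp add: case_prod_beta')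
  fix s :: real assume s: "s \<in> {0..1}"
  define f where "f x = x + s *\<^sub>R G x" for x
  have sG: "norm (s *\<^sub>R G x - s *\<^sub>R G y) \<le> 1 / 2 * norm (x - y)" for x y
  proof -
    have "norm (s *\<^sub>R G x - s *\<^sub>R G y) = s * norm (G x - G y)"
      using s by (simp add: scaleR_right_diff_distrib[symmetric])
    also have "\<dots> \<le> 1 * norm (G x - G y)" using s by (intro mult_right_mono) auto
    finally show ?thesis using G_lip[of x y] by linarith
  qed
  have fl: "norm (x - y) \<le> 2 * norm (f x - f y)" for x y
  proof -
    have "x - y = (f x - f y) - (s *\<^sub>R G x - s *\<^sub>R G y)" by (simp add: f_def)
    then have "norm (x - y) \<le> norm (f x - f y) + norm (s *\<^sub>R G x - s *\<^sub>R G y)" by (metis norm_triangle_ineq4)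
    then show ?thesis using sG[of x y] by simp
  qed
  have finj: "inj_on f (Rn D)"
  proof (rule inj_onI)
    fix x y assume "f x = f y"
    then show "x = y" using fl[of x y] by simp
  qed
  have fR: "f x \<in> Rn D" if "x \<in> Rn D" for x
    using that G_Rn subspace_Rn by (simp add: f_def subspace_add subspace_scale)
  have fsurj: "\<exists>x\<in>Rn D. f x = y" if y: "y \<in> Rn D" for y
  proof -
    \<comment> \<open>The solutions of f x = y are the fixed points of the contraction that sends x
      to y - s G x.\<close>
    have "\<exists>!x. x \<in> Rn D \<and> y - s *\<^sub>R G x = x"
    proof (rule Banach_fix[OF complete_Rn, of D "1/2"])
      show "Rn D \<noteq> {}" using y by blast
      show "(\<lambda>x. y - s *\<^sub>R G x) ` Rn D \<subseteq> Rn D"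
        using y G_Rn subspace_Rn by (auto intro!: subspace_diff subspace_scale)
      fix x x' assume "x \<in> Rn D" "x' \<in> Rn D"
      show "dist (y - s *\<^sub>R G x) (y - s *\<^sub>R G x') \<le> 1 / 2 * dist x x'"
        using sG[of x' x] by (simp add: dist_norm norm_minus_commute)
    qed auto
    then obtain x where "x \<in> Rn D" "y - s *\<^sub>R G x = x" by blast
    then show ?thesis by (intro bexI[of _ x]) (auto simp: f_def algebra_simps)
  qed
  define g where "g = inv_into (Rn D) f"
  have img: "f ` Rn D = Rn D" using fR fsurj by blast
  have gf: "g (f x) = x" if "x \<in> Rn D" for x using inv_into_f_f[OF finj that] by (simp add: g_def)
  have fg: "f (g y) = y" "g y \<in> Rn D" if "y \<in> Rn D" for y
    using f_inv_into_f[of y f "Rn D"] inv_into_into[of y f "Rn D"] img that by (auto simp: g_def)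
  have "continuous_on (Rn D) f"
    unfolding f_def by (intro continuous_intros cont_G)
  moreover have "continuous_on (Rn D) g"
  proof (rule continuous_onI)
    fix y e :: real and y0 :: euc assume y0: "y0 \<in> Rn D" "e > 0"
    show "\<exists>d>0. \<forall>x'\<in>Rn D. dist x' y0 < d \<longrightarrow> dist (g x') (g y0) \<le> e"
    proof (intro exI[of _ "e / 2"] conjI ballI impI)
      fix x' assume x': "x' \<in> Rn D" "dist x' y0 < e / 2"
      show "dist (g x') (g y0) \<le> e" using fl[of "g x'" "g y0"] x' y0 fg(1) by (simp add: dist_norm)
    qed (use y0 in simp)
  qed
  moreover have "g ` Rn D = Rn D" using fg(2) gf fR by force
  ultimately have "homeomorphism (Rn D) (Rn D) f g"
    unfolding homeomorphism_def using img gf fg by blast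
  then show "\<exists>G'. homeomorphism (Rn D) (Rn D) (\<lambda>x. x + s *\<^sub>R G x) G'" unfolding f_def[abs_def] by blast
next
  show "(\<lambda>x. x + 1 *\<^sub>R G x) ` A = \<Phi> ` A" by (simp add: \<Phi>_def)
qed simp

lemma taylor: "norm (G b - G a - G' a (b - a)) \<le> L * (norm (b - a))\<^sup>2"
proof -
  have "norm (G b - G a - G' a (b - a)) \<le> norm (b - a) * (L * norm (b - a))"
  proof (rule differentiable_bound_linearization[where S = "closed_segment a b" and f = G and f' = G' and ?x0.0 = a])
    show "a + t *\<^sub>R (b - a) \<in> closed_segment a b" if "t \<in> {0..1}" for t
      using that by (auto simp: in_segment algebra_simps intro!: exI[of _ t])
    show "(G has_derivative G' x) (at x within closed_segment a b)" for x
      using der has_derivative_at_withinI by blast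
    show "onorm (G' x - G' a) \<le> L * norm (b - a)" if "x \<in> closed_segment a b" for x
    proof (rule onorm_bound)
      show "0 \<le> L * norm (b - a)" using L0 by simp
      fix v
      have "norm ((G' x - G' a) v) \<le> L * norm (x - a) * norm v" using G'_lip[of x v a] by simp
      also have "norm (x - a) \<le> norm (b - a)" using segment_bound1[OF that] .
      finally show "norm ((G' x - G' a) v) \<le> L * norm (b - a) * norm v"
        using L0 by (simp add: mult_left_mono mult_right_mono)
    qed
  qed simp
  then show ?thesis by (simp add: power2_eq_square algebra_simps)
qed

lemma homeo_image:
  obtains \<Psi> where "homeomorphism S (\<Phi> ` S) \<Phi> \<Psi>"
proof
  define \<Psi> where "\<Psi> = inv_into S \<Phi>"
  have "continuous_on (\<Phi> ` S) \<Psi>"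
  proof (rule continuous_onI)
    fix y0 :: euc and e :: real assume y0: "y0 \<in> \<Phi> ` S" "e > 0"
    show "\<exists>d>0. \<forall>x'\<in>\<Phi> ` S. dist x' y0 < d \<longrightarrow> dist (\<Psi> x') (\<Psi> y0) \<le> e"
    proof (intro exI[of _ "e / 2"] conjI ballI impI)
      fix x' assume x': "x' \<in> \<Phi> ` S" "dist x' y0 < e / 2"
      show "dist (\<Psi> x') (\<Psi> y0) \<le> e"
        using \<Phi>_lower[of "\<Psi> x'" "\<Psi> y0"] x' y0 f_inv_into_f[of x' \<Phi> S] f_inv_into_f[of y0 \<Phi> S]
        by (simp add: dist_norm \<Psi>_def)
    qed (use y0 in simp)
  qed
  moreover have "\<Psi> ` \<Phi> ` S = S" using inv_into_f_f[OF inj_\<Phi>[of S]] by (force simp: \<Psi>_def image_image)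
  ultimately show "homeomorphism S (\<Phi> ` S) \<Phi> \<Psi>"
    unfolding homeomorphism_def using cont_\<Phi> inv_into_f_f[OF inj_\<Phi>[of S]]
    by (auto simp: \<Psi>_def f_inv_into_f)
qed

lemma image_chart:
  assumes V: "openin (top_of_set (Rn d)) V" and W: "openin (top_of_set M) W"
    and h: "homeomorphism V W \<phi> \<psi>" and x: "x \<in> V"
    and der': "(\<phi> has_derivative f) (at x within V)" and inj: "inj_on f (Rn d)"
  shows "(\<Phi> \<circ> \<phi> has_derivative (\<lambda>v. \<Phi>' (\<phi> x) (f v))) (at x within V)" "inj_on (\<lambda>v. \<Phi>' (\<phi> x) (f v)) (Rn d)"
    "tangent_space (\<Phi> ` M) (\<Phi> (\<phi> x)) = \<Phi>' (\<phi> x) ` tangent_space M (\<phi> x)"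
proof -
  show d1: "(\<Phi> \<circ> \<phi> has_derivative (\<lambda>v. \<Phi>' (\<phi> x) (f v))) (at x within V)"
    using diff_chain_within[OF der' has_derivative_at_withinI[OF \<Phi>_der]] by (simp add: o_def)
  show i1: "inj_on (\<lambda>v. \<Phi>' (\<phi> x) (f v)) (Rn d)"
    using comp_inj_on[OF inj \<Phi>'_inj] by (simp add: o_def)
  obtain \<Psi> where P: "homeomorphism M (\<Phi> ` M) \<Phi> \<Psi>" using homeo_image by blast
  obtain \<Psi>2 where P2: "homeomorphism W (\<Phi> ` W) \<Phi> \<Psi>2" using homeo_image by blast
  have "tangent_space (\<Phi> ` M) ((\<Phi> \<circ> \<phi>) x) = (\<lambda>v. \<Phi>' (\<phi> x) (f v)) ` Rn d"
    by (rule chart_tangent_space[OF V homeomorphism_imp_open_map[OF P W] homeomorphism_compose[OF h P2] x d1 i1])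
  then show "tangent_space (\<Phi> ` M) (\<Phi> (\<phi> x)) = \<Phi>' (\<phi> x) ` tangent_space M (\<phi> x)"
    unfolding chart_tangent_space[OF V W h x der' inj] by (simp add: image_image)
qed

lemma C1_chartE:
  assumes "C1_submanifold d M" "p \<in> M"
  obtains V W \<phi> \<psi> \<phi>' where "openin (top_of_set (Rn d)) V" "openin (top_of_set M) W" "p \<in> W"
    "homeomorphism V W \<phi> \<psi>" "\<And>x. x \<in> V \<Longrightarrow> (\<phi> has_derivative \<phi>' x) (at x within V)"
    "\<And>x. x \<in> V \<Longrightarrow> inj_on (\<phi>' x) (Rn d)" "\<And>v. v \<in> Rn d \<Longrightarrow> continuous_on V (\<lambda>x. \<phi>' x v)"
proof -
  obtain V W \<phi> \<psi> \<phi>' where "openin (top_of_set (Rn d)) V \<and> openin (top_of_set M) W \<and> p \<in> W \<and>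
    homeomorphism V W \<phi> \<psi> \<and>
    (\<forall>x\<in>V. (\<phi> has_derivative \<phi>' x) (at x within V) \<and> inj_on (\<phi>' x) (Rn d)) \<and>
    (\<forall>v\<in>Rn d. continuous_on V (\<lambda>x. \<phi>' x v))"
    using bspec[OF assms(1)[unfolded C1_submanifold_def] assms(2)] by (elim exE) (rule that)
  then show ?thesis by (intro that[of V W \<phi> \<psi> \<phi>']) auto
qed

lemma tangent_image:
  assumes M: "C1_submanifold d M" and p: "p \<in> M"
  shows "tangent_space (\<Phi> ` M) (\<Phi> p) = \<Phi>' p ` tangent_space M p"
proof -
  obtain V W \<phi> \<psi> \<phi>' where c: "openin (top_of_set (Rn d)) V" "openin (top_of_set M) W" "p \<in> W"
    "homeomorphism V W \<phi> \<psi>" "\<And>x. x \<in> V \<Longrightarrow> (\<phi> has_derivative \<phi>' x) (at x within V)"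
    "\<And>x. x \<in> V \<Longrightarrow> inj_on (\<phi>' x) (Rn d)" "\<And>v. v \<in> Rn d \<Longrightarrow> continuous_on V (\<lambda>x. \<phi>' x v)"
    using C1_chartE[OF M p] by metis
  have x: "\<psi> p \<in> V" "\<phi> (\<psi> p) = p" using c(3,4) by (auto simp: homeomorphism_def)
  show ?thesis using image_chart(3)[OF c(1,2,4) x(1) c(5)[OF x(1)] c(6)[OF x(1)]] x(2) by simp
qed

lemma C1_image:
  assumes M: "C1_submanifold d M"
  shows "C1_submanifold d (\<Phi> ` M)"
  unfolding C1_submanifold_def
proof
  fix y assume "y \<in> \<Phi> ` M"
  then obtain p where p: "p \<in> M" "y = \<Phi> p" by blast
  obtain V W \<phi> \<psi> \<phi>' where c: "openin (top_of_set (Rn d)) V" "openin (top_of_set M) W" "p \<in> W"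
    "homeomorphism V W \<phi> \<psi>" "\<And>x. x \<in> V \<Longrightarrow> (\<phi> has_derivative \<phi>' x) (at x within V)"
    "\<And>x. x \<in> V \<Longrightarrow> inj_on (\<phi>' x) (Rn d)" "\<And>v. v \<in> Rn d \<Longrightarrow> continuous_on V (\<lambda>x. \<phi>' x v)"
    using C1_chartE[OF M p(1)] by metis
  obtain \<Psi> where P: "homeomorphism M (\<Phi> ` M) \<Phi> \<Psi>" using homeo_image by blast
  obtain \<Psi>2 where P2: "homeomorphism W (\<Phi> ` W) \<Phi> \<Psi>2" using homeo_image by blast
  have ic: "(\<Phi> \<circ> \<phi> has_derivative (\<lambda>v. \<Phi>' (\<phi> x) (\<phi>' x v))) (at x within V) \<and> inj_on (\<lambda>v. \<Phi>' (\<phi> x) (\<phi>' x v)) (Rn d)"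
    if x: "x \<in> V" for x
    using image_chart(1,2)[OF c(1,2,4) x c(5)[OF x] c(6)[OF x]] by blast
  have cont: "continuous_on V (\<lambda>x. \<Phi>' (\<phi> x) (\<phi>' x v))" if v: "v \<in> Rn d" for v
  proof -
    have c\<phi>: "continuous_on V \<phi>" using c(4) by (simp add: homeomorphism_def)
    have "continuous_on V (\<lambda>x. G' (\<phi> x) (\<phi>' x v))"
      unfolding continuous_on_def
    proof
      fix x0 assume x0: "x0 \<in> V"
      have l1: "((\<lambda>x. \<phi> x) \<longlongrightarrow> \<phi> x0) (at x0 within V)" using c\<phi> x0 by (simp add: continuous_on_def)
      have l2: "((\<lambda>x. \<phi>' x v) \<longlongrightarrow> \<phi>' x0 v) (at x0 within V)" using c(7)[OF v] x0 by (simp add: continuous_on_def)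
      have a: "((\<lambda>x. G' (\<phi> x) (\<phi>' x v) - G' (\<phi> x0) (\<phi>' x v)) \<longlongrightarrow> 0) (at x0 within V)"
      proof (rule Lim_null_comparison)
        show "\<forall>\<^sub>F x in at x0 within V. norm (G' (\<phi> x) (\<phi>' x v) - G' (\<phi> x0) (\<phi>' x v)) \<le> L * norm (\<phi> x - \<phi> x0) * norm (\<phi>' x v)"
          by (simp add: G'_lip)
        have "((\<lambda>x. L * norm (\<phi> x - \<phi> x0) * norm (\<phi>' x v)) \<longlongrightarrow> L * norm (\<phi> x0 - \<phi> x0) * norm (\<phi>' x0 v)) (at x0 within V)"
          by (intro tendsto_intros l1 l2)
        then show "((\<lambda>x. L * norm (\<phi> x - \<phi> x0) * norm (\<phi>' x v)) \<longlongrightarrow> 0) (at x0 within V)" by simp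
      qed
      have "((\<lambda>x. (G' (\<phi> x) (\<phi>' x v) - G' (\<phi> x0) (\<phi>' x v)) + G' (\<phi> x0) (\<phi>' x v)) \<longlongrightarrow> 0 + G' (\<phi> x0) (\<phi>' x0 v)) (at x0 within V)"
        by (intro tendsto_add a bounded_linear.tendsto[OF bl_G'] l2)
      then show "((\<lambda>x. G' (\<phi> x) (\<phi>' x v)) \<longlongrightarrow> G' (\<phi> x0) (\<phi>' x0 v)) (at x0 within V)" by simp
    qed
    then show ?thesis unfolding \<Phi>'_def by (intro continuous_intros c(7)[OF v])
  qed
  show "\<exists>V W \<phi> \<psi> \<phi>'. openin (top_of_set (Rn d)) V \<and> openin (top_of_set (\<Phi> ` M)) W \<and> y \<in> W \<and>
      homeomorphism V W \<phi> \<psi> \<and> (\<forall>x\<in>V. (\<phi> has_derivative \<phi>' x) (at x within V) \<and> inj_on (\<phi>' x) (Rn d)) \<and>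
      (\<forall>v\<in>Rn d. continuous_on V (\<lambda>x. \<phi>' x v))"
    using c(1) homeomorphism_imp_open_map[OF P c(2)] c(3) p(2) homeomorphism_compose[OF c(4) P2] ic cont
    by (intro exI[of _ V] exI[of _ "\<Phi> ` W"] exI[of _ "\<Phi> \<circ> \<phi>"] exI[of _ "\<psi> \<circ> \<Psi>2"] exI[of _ "\<lambda>x v. \<Phi>' (\<phi> x) (\<phi>' x v)"]) blast
qed

text \<open>By \<open>reach_criterion\<close>. The chord of the image is compared with the image
  under \<Phi>' of the tangential part of the chord of M: the Taylor error contributes L and the
  normal part 3/(4 \<rho>), each times the squared chord. Since \<Phi> may halve a chord, the sum is
  multiplied by 4, and 4 L + 3/\<rho> is 1/(2 R).\<close>

lemma image_manifold:
  assumes M: "M \<in> manifolds D d \<rho>" and rho: "0 < \<rho>"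
  shows "\<Phi> ` M \<in> manifolds D d (\<rho> / (6 + 8 * L * \<rho>))"
proof -
  interpret reach_manifold D d M \<rho> using M rho by unfold_locales
  have C1: "C1_submanifold d (\<Phi> ` M)" using C1_image M_props by blast
  have sub: "\<Phi> ` M \<subseteq> Rn D" using \<Phi>_Rn M_props by blast
  define R where "R = \<rho> / (6 + 8 * L * \<rho>)"
  have pos: "6 + 8 * L * \<rho> > 0" using L0 rho by (intro add_pos_nonneg) auto
  have "ereal R \<le> reach D (\<Phi> ` M)"
  proof (rule reach_criterion[OF sub])
    show "0 < R" using rho pos by (simp add: R_def)
    show "k_subspace d (tangent_space (\<Phi> ` M) a)" if "a \<in> \<Phi> ` M" for a
      using C1_submanifold_tangent(1)[OF C1 that] .
    fix a' b' assume "a' \<in> \<Phi> ` M" "b' \<in> \<Phi> ` M"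
    then obtain a b where a: "a \<in> M" "a' = \<Phi> a" and b: "b \<in> M" "b' = \<Phi> b" by blast
    define t where "t = proj (T a) (b - a)"
    have T': "k_subspace d (tangent_space (\<Phi> ` M) a')" using C1_submanifold_tangent(1)[OF C1] a by blast
    have tT: "\<Phi>' a t \<in> tangent_space (\<Phi> ` M) a'"
      unfolding a(2) tangent_image[OF M_props(5) a(1)] t_def using proj_in[OF T_sub[OF a(1)]] by blast
    have "b' - a' - \<Phi>' a t = (G b - G a - G' a (b - a)) + \<Phi>' a (perp (T a) (b - a))"
      unfolding a(2) b(2) \<Phi>_def \<Phi>'_def t_def perp_def
      using linear_diff[OF bounded_linear.linear[OF bl_G'[of a]], of "b - a" "proj (T a) (b - a)"] by simp
    then have "norm (b' - a' - \<Phi>' a t) \<le> norm (G b - G a - G' a (b - a)) + norm (\<Phi>' a (perp (T a) (b - a)))"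
      by (metis norm_triangle_ineq)
    also have "norm (\<Phi>' a (perp (T a) (b - a))) \<le> 3 / 2 * norm (perp (T a) (b - a))"
      unfolding \<Phi>'_def using norm_triangle_ineq[of "perp (T a) (b - a)" "G' a (perp (T a) (b - a))"] G'_le[of a "perp (T a) (b - a)"]
      by linarith
    also have "norm (perp (T a) (b - a)) \<le> (norm (b - a))\<^sup>2 / (2 * \<rho>)" by (rule perp_tangent_le[OF a(1) b(1)])
    finally have "norm (b' - a' - \<Phi>' a t) \<le> L * (norm (b - a))\<^sup>2 + 3 / 2 * ((norm (b - a))\<^sup>2 / (2 * \<rho>))"
      using taylor[of b a] by linarith
    also have "\<dots> = (L + 3 / (4 * \<rho>)) * (norm (b - a))\<^sup>2" by (simp add: algebra_simps)
    also have "\<dots> \<le> (L + 3 / (4 * \<rho>)) * (2 * norm (b' - a'))\<^sup>2"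
      using \<Phi>_lower[of b a] L0 rho unfolding a(2) b(2) by (intro mult_left_mono power_mono) auto
    also have "\<dots> = (norm (b' - a'))\<^sup>2 * (4 * L + 3 / \<rho>)" by (simp add: power_mult_distrib algebra_simps)
    also have "4 * L + 3 / \<rho> = 1 / (2 * R)" unfolding R_def using rho pos by (simp add: field_simps)
    finally have "norm (b' - a' - \<Phi>' a t) \<le> (norm (b' - a'))\<^sup>2 / (2 * R)" by simp
    then show "norm (perp (tangent_space (\<Phi> ` M) a') (b' - a')) \<le> (norm (b' - a'))\<^sup>2 / (2 * R)"
      using norm_perp_le_dist[OF T' tT, of "b' - a'"] by linarith
  qed
  then show ?thesis
    unfolding manifolds_def R_def using M_props C1 sub cont_\<Phi>
    by (auto intro: compact_continuous_image connected_continuous_image)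
qed

end

subsection \<open>Interpolating a point cloud with prescribed tangent spaces\<close>

text \<open>Squares of these hats are the bumps: they are only \<open>C\<^sup>1\<close> with Lipschitz derivative, which is all
  that the reach of a perturbed manifold depends on.\<close>

definition hat :: "real \<Rightarrow> 'a::real_inner \<Rightarrow> real" where
  "hat \<eta> u = max 0 (1 - (norm u)\<^sup>2 / \<eta>\<^sup>2)"

lemma hat_bounds: "0 \<le> hat \<eta> u" "hat \<eta> u \<le> 1"
  by (auto simp: hat_def)

lemma hat_zero:
  assumes "0 < \<eta>" "\<eta> \<le> norm u" shows "hat \<eta> u = 0"
proof -
  have "\<eta>\<^sup>2 \<le> (norm u)\<^sup>2" using assms by (intro power_mono) auto
  then show ?thesis using assms by (simp add: hat_def field_simps)
qed

lemma hat_lip_aux: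
  assumes "0 < \<eta>" "norm u \<le> \<eta>"
  shows "\<bar>hat \<eta> u - hat \<eta> v\<bar> \<le> 2 / \<eta> * norm (u - v)"
proof (cases "norm v \<le> \<eta>")
  case True
  have h: "hat \<eta> w = 1 - (norm w)\<^sup>2 / \<eta>\<^sup>2" if "norm w \<le> \<eta>" for w :: 'a
  proof -
    have "(norm w)\<^sup>2 \<le> \<eta>\<^sup>2" using that by (intro power_mono) auto
    then show ?thesis using assms(1) by (simp add: hat_def)
  qed
  have "\<bar>hat \<eta> u - hat \<eta> v\<bar> = \<bar>(norm v)\<^sup>2 - (norm u)\<^sup>2\<bar> / \<eta>\<^sup>2"
    unfolding h[OF assms(2)] h[OF True] using assms(1) by (simp add: diff_divide_distrib[symmetric] abs_divide)
  also have "(norm v)\<^sup>2 - (norm u)\<^sup>2 = (norm v + norm u) * (norm v - norm u)"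
    by (simp add: power2_eq_square algebra_simps)
  also have "\<bar>\<dots>\<bar> / \<eta>\<^sup>2 \<le> (2 * \<eta>) * norm (u - v) / \<eta>\<^sup>2"
    unfolding abs_mult using assms True norm_triangle_ineq3[of v u]
    by (intro divide_right_mono mult_mono) (auto simp: norm_minus_commute)
  also have "\<dots> = 2 / \<eta> * norm (u - v)" using assms(1) by (simp add: power2_eq_square)
  finally show ?thesis .
next
  case False
  have "\<bar>hat \<eta> u - hat \<eta> v\<bar> = hat \<eta> u"
    using hat_zero[of \<eta> v] hat_bounds(1)[of \<eta> u] assms(1) False by simp
  also have "\<dots> = 1 - (norm u)\<^sup>2 / \<eta>\<^sup>2"
    using assms power_mono[OF assms(2) norm_ge_zero, of 2] by (simp add: hat_def)
  also have "\<dots> = (\<eta> - norm u) * (\<eta> + norm u) / \<eta>\<^sup>2"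
    using assms(1) by (simp add: power2_eq_square field_simps)
  also have "\<dots> \<le> norm (u - v) * (2 * \<eta>) / \<eta>\<^sup>2"
    using assms False norm_triangle_ineq2[of v u]
    by (intro divide_right_mono mult_mono) (auto simp: norm_minus_commute)
  also have "\<dots> = 2 / \<eta> * norm (u - v)" using assms(1) by (simp add: power2_eq_square)
  finally show ?thesis .
qed

lemma hat_square_derivative:
  assumes "0 < \<eta>"
  shows "((\<lambda>x. (hat \<eta> (x - c))\<^sup>2) has_derivative (\<lambda>v. - 4 / \<eta>\<^sup>2 * hat \<eta> (x - c) * ((x - c) \<bullet> v))) (at (x::'a::real_inner))"
proof -
  have pd: "((\<lambda>r. (max 0 (1 - r))\<^sup>2) has_real_derivative - 2 * max 0 (1 - r)) (at r)" for r :: real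
  proof (cases "r < 1")
    case True
    have "((\<lambda>r. (1 - r)\<^sup>2) has_real_derivative - 2 * (1 - r)) (at r)"
      by (auto intro!: derivative_eq_intros)
    then have "((\<lambda>r. (max 0 (1 - r))\<^sup>2) has_real_derivative - 2 * (1 - r)) (at r)"
      by (rule DERIV_cong_ev[THEN iffD1, rotated 3])
        (use True in \<open>auto intro!: eventually_mono[OF order_tendstoD(2)[OF tendsto_ident_at True]] simp: eventually_nhds_conv_at\<close>)
    then show ?thesis using True by simp
  next
    case False
    show ?thesis
    proof (cases "r = 1")
      case True
      \<comment> \<open>Squaring removes the kink of the positive part: the difference quotient at 1
        is at most the distance of s from 1.\<close>
      have "\<bar>(max 0 (1 - s))\<^sup>2\<bar> \<le> \<bar>s - 1\<bar> * \<bar>s - 1\<bar>" for s :: real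
        using power_mono[of "max 0 (1 - s)" "\<bar>s - 1\<bar>" 2] by (auto simp: power2_eq_square)
      then have b: "norm ((max 0 (1 - s))\<^sup>2 / (s - 1)) \<le> \<bar>s - 1\<bar>" for s :: real
        by (cases "s = 1") (auto simp: abs_divide pos_divide_le_eq)
      have "((\<lambda>s::real. (max 0 (1 - s))\<^sup>2 / (s - 1)) \<longlongrightarrow> 0) (at 1)"
      proof (rule Lim_null_comparison)
        show "\<forall>\<^sub>F s::real in at 1. norm ((max 0 (1 - s))\<^sup>2 / (s - 1)) \<le> \<bar>s - 1\<bar>" using b by simp
        have "((\<lambda>s::real. \<bar>s - 1\<bar>) \<longlongrightarrow> \<bar>1 - 1\<bar>) (at 1)" by (intro tendsto_intros)
        then show "((\<lambda>s::real. \<bar>s - 1\<bar>) \<longlongrightarrow> 0) (at 1)" by simp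
      qed
      then show ?thesis using True by (simp add: has_field_derivative_iff)
    next
      case neq: False
      then have gt: "1 < r" using False by simp
      have "((\<lambda>r. 0) has_real_derivative 0) (at r)" by simp
      then have "((\<lambda>r. (max 0 (1 - r))\<^sup>2) has_real_derivative 0) (at r)"
        by (rule DERIV_cong_ev[THEN iffD1, rotated 3])
          (use gt in \<open>auto intro!: eventually_mono[OF order_tendstoD(1)[OF tendsto_ident_at gt]] simp: eventually_nhds_conv_at\<close>)
      then show ?thesis using gt by simp
    qed
  qed
  have id: "((\<lambda>x. ((x - c) \<bullet> (x - c)) / \<eta>\<^sup>2) has_derivative (\<lambda>v. 2 * ((x - c) \<bullet> v) / \<eta>\<^sup>2)) (at x)"
    by (rule bounded_linear.has_derivative[OF bounded_linear_divide])
      (auto intro!: derivative_eq_intros simp: inner_commute)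
  have "((\<lambda>x. (max 0 (1 - (((x - c) \<bullet> (x - c)) / \<eta>\<^sup>2)))\<^sup>2) has_derivative
      (\<lambda>v. (- 2 * max 0 (1 - ((x - c) \<bullet> (x - c)) / \<eta>\<^sup>2)) * (2 * ((x - c) \<bullet> v) / \<eta>\<^sup>2))) (at x)"
    using has_derivative_compose[OF id pd[unfolded has_field_derivative_def]] .
  then show ?thesis
    by (simp add: hat_def power2_norm_eq_inner algebra_simps)
qed

text \<open>At its centre c the bump has value w and derivative A, because there the squared hat is
  1 with derivative 0; it vanishes outside the ball of radius \<eta>.\<close>

definition bump :: "real \<Rightarrow> euc \<Rightarrow> (euc \<Rightarrow> euc) \<Rightarrow> euc \<Rightarrow> euc \<Rightarrow> euc" where
  "bump \<eta> c A w x = (hat \<eta> (x - c))\<^sup>2 *\<^sub>R (A (x - c) + w)"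

definition bump' :: "real \<Rightarrow> euc \<Rightarrow> (euc \<Rightarrow> euc) \<Rightarrow> euc \<Rightarrow> euc \<Rightarrow> euc \<Rightarrow> euc" where
  "bump' \<eta> c A w x v = (- 4 / \<eta>\<^sup>2 * hat \<eta> (x - c) * ((x - c) \<bullet> v)) *\<^sub>R (A (x - c) + w) + (hat \<eta> (x - c))\<^sup>2 *\<^sub>R A v"

section \<open>Bounds for a single bump\<close>

context
  fixes \<eta> \<theta> \<Theta> :: real and c w :: euc and A :: "euc \<Rightarrow> euc"
  assumes eta: "0 < \<eta>" and A: "linear A" "\<And>v. norm (A v) \<le> \<theta> * norm v"
    and w: "norm w \<le> (\<Theta> - \<theta>) * \<eta>" and th: "0 \<le> \<theta>"
begin

lemma blA: "bounded_linear A"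
  using A by (intro bounded_linear_intro[of A \<theta>]) (auto simp: linear_add linear_cmul mult.commute)

lemma Theta: "\<theta> \<le> \<Theta>"
proof -
  have "0 \<le> (\<Theta> - \<theta>) * \<eta>" using w norm_ge_zero order_trans by blast
  then show ?thesis using eta by (simp add: zero_le_mult_iff)
qed

lemma bump_derivative: "(bump \<eta> c A w has_derivative bump' \<eta> c A w x) (at x)"
  unfolding bump_def[abs_def] bump'_def[abs_def]
proof -
  have "((\<lambda>x. A (x - c) + w) has_derivative A) (at x)"
    by (auto intro!: derivative_eq_intros bounded_linear.has_derivative[OF blA] simp: o_def)
  from has_derivative_scaleR[OF hat_square_derivative[OF eta] this]
  show "((\<lambda>x. (hat \<eta> (x - c))\<^sup>2 *\<^sub>R (A (x - c) + w)) has_derivative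
     (\<lambda>v. (- 4 / \<eta>\<^sup>2 * hat \<eta> (x - c) * ((x - c) \<bullet> v)) *\<^sub>R (A (x - c) + w) + (hat \<eta> (x - c))\<^sup>2 *\<^sub>R A v)) (at x)"
    by (simp add: add.commute)
qed

lemma bump_zero: "\<eta> \<le> norm (x - c) \<Longrightarrow> bump \<eta> c A w x = 0 \<and> bump' \<eta> c A w x v = 0"
  using hat_zero[OF eta, of "x - c"] by (simp add: bump_def bump'_def)

lemma affine_le:
  assumes "norm u \<le> \<eta>" shows "norm (A u + w) \<le> \<Theta> * \<eta>"
proof -
  have "norm (A u) \<le> \<theta> * \<eta>" using A(2)[of u] assms th mult_left_mono[OF assms th] by linarith
  then show ?thesis using norm_triangle_ineq[of "A u" w] w by (simp add: algebra_simps)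
qed

lemma bump_le: "norm (bump \<eta> c A w x) \<le> \<Theta> * \<eta>"
proof (cases "norm (x - c) \<le> \<eta>")
  case True
  have "(hat \<eta> (x - c))\<^sup>2 \<le> 1" using hat_bounds[of \<eta> "x - c"] by (simp add: power_le_one)
  then have "norm (bump \<eta> c A w x) \<le> 1 * norm (A (x - c) + w)"
    unfolding bump_def norm_scaleR by (intro mult_right_mono) auto
  then show ?thesis using affine_le[OF True] by simp
next
  case False
  then show ?thesis using bump_zero[of x] Theta th eta by simp
qed

lemma bump'_le: "norm (bump' \<eta> c A w x v) \<le> 5 * \<Theta> * norm v"
proof (cases "norm (x - c) \<le> \<eta>")
  case True
  let ?h = "hat \<eta> (x - c)" and ?u = "x - c"
  have h: "0 \<le> ?h" "?h \<le> 1" by (rule hat_bounds)+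
  have "\<bar>4 / \<eta>\<^sup>2 * ?h * (?u \<bullet> v)\<bar> \<le> 4 / \<eta>\<^sup>2 * 1 * (\<eta> * norm v)"
    unfolding abs_mult
  proof (intro mult_mono)
    show "\<bar>?u \<bullet> v\<bar> \<le> \<eta> * norm v"
      using Cauchy_Schwarz_ineq2[of ?u v] mult_right_mono[OF True norm_ge_zero[of v]] by linarith
  qed (use h in auto)
  also have "\<dots> = 4 / \<eta> * norm v" using eta by (simp add: power2_eq_square)
  finally have a: "\<bar>- 4 / \<eta>\<^sup>2 * ?h * (?u \<bullet> v)\<bar> \<le> 4 / \<eta> * norm v" by simp
  have "norm (bump' \<eta> c A w x v) \<le> \<bar>- 4 / \<eta>\<^sup>2 * ?h * (?u \<bullet> v)\<bar> * norm (A ?u + w) + ?h\<^sup>2 * norm (A v)"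
    unfolding bump'_def using norm_triangle_ineq by (metis abs_power2 norm_scaleR)
  also have "\<dots> \<le> (4 / \<eta> * norm v) * (\<Theta> * \<eta>) + 1 * (\<Theta> * norm v)"
  proof (intro add_mono mult_mono a affine_le True)
    show "?h\<^sup>2 \<le> 1" using h by (simp add: power_le_one)
    show "norm (A v) \<le> \<Theta> * norm v" using A(2)[of v] mult_right_mono[OF Theta norm_ge_zero[of v]] by linarith
  qed (use eta in auto)
  also have "\<dots> = 5 * \<Theta> * norm v" using eta by simp
  finally show ?thesis .
next
  case False
  then show ?thesis using bump_zero[of x v] Theta th by simp
qed

text \<open>Differencing one factor at a time gives the constants 2, 1 and 1 for P, hence 16
  \<Theta> / \<eta> after the prefactor \<open>4 / \<eta>\<^sup>2\<close>; the term with A v adds 4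
  \<Theta> / \<eta>.\<close>

lemma bump'_lip_aux:
  assumes "norm (x - c) \<le> \<eta>"
  shows "norm (bump' \<eta> c A w x v - bump' \<eta> c A w y v) \<le> 20 * \<Theta> / \<eta> * norm (x - y) * norm v"
proof -
  define u u' where "u = x - c" and "u' = y - c"
  define k k' where "k = hat \<eta> u" and "k' = hat \<eta> u'"
  define N where "N = norm (x - y) * norm v"
  have uu: "u - u' = x - y" by (simp add: u_def u'_def)
  have kk: "\<bar>k - k'\<bar> \<le> 2 / \<eta> * norm (x - y)"
    using hat_lip_aux[OF eta assms, of "y - c"] by (simp add: k_def k'_def u_def u'_def)
  have kb: "0 \<le> k" "k \<le> 1" "0 \<le> k'" "k' \<le> 1" by (auto simp: k_def k'_def hat_bounds)
  have uv: "\<bar>u \<bullet> v\<bar> \<le> \<eta> * norm v"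
    using Cauchy_Schwarz_ineq2[of u v] mult_right_mono[OF assms norm_ge_zero[of v]] unfolding u_def by linarith
  have lu: "norm (A u + w) \<le> \<Theta> * \<eta>" using affine_le assms by (simp add: u_def)
  have N0: "0 \<le> N" by (simp add: N_def)
  define P where "P = (k * (u \<bullet> v)) *\<^sub>R (A u + w) - (k' * (u' \<bullet> v)) *\<^sub>R (A u' + w)"
  have Pb: "norm P \<le> 4 * \<Theta> * \<eta> * N"
  proof -
    have p1: "norm (((k - k') * (u \<bullet> v)) *\<^sub>R (A u + w)) \<le> 2 * \<Theta> * \<eta> * N"
    proof -
      have "norm (((k - k') * (u \<bullet> v)) *\<^sub>R (A u + w)) \<le> (2 / \<eta> * norm (x - y)) * (\<eta> * norm v) * (\<Theta> * \<eta>)"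
        unfolding norm_scaleR abs_mult by (intro mult_mono kk uv lu) (use eta in auto)
      also have "\<dots> = 2 * \<Theta> * \<eta> * N" using eta by (simp add: N_def)
      finally show ?thesis .
    qed
    show ?thesis
    proof (cases "norm u' \<le> \<eta>")
      case False
      then have "k' = 0" unfolding k'_def using hat_zero[OF eta, of u'] by simp
      then have "norm P \<le> 2 * \<Theta> * \<eta> * N" using p1 by (simp add: P_def)
      moreover have "0 \<le> \<Theta> * \<eta> * N" using Theta th eta N0 by simp
      ultimately show ?thesis by simp
    next
      case True
      have "P = ((k - k') * (u \<bullet> v)) *\<^sub>R (A u + w) + (k' * ((u - u') \<bullet> v)) *\<^sub>R (A u + w) + (k' * (u' \<bullet> v)) *\<^sub>R A (u - u')"
        unfolding P_def linear_diff[OF A(1)] by (simp add: algebra_simps inner_diff_left)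
      then have "norm P \<le> norm (((k - k') * (u \<bullet> v)) *\<^sub>R (A u + w)) + norm ((k' * ((u - u') \<bullet> v)) *\<^sub>R (A u + w)) + norm ((k' * (u' \<bullet> v)) *\<^sub>R A (u - u'))"
        by (simp only: norm_triangle_le norm_triangle_ineq add_mono order_refl)
      also have "norm ((k' * ((u - u') \<bullet> v)) *\<^sub>R (A u + w)) \<le> (1 * N) * (\<Theta> * \<eta>)"
        unfolding norm_scaleR abs_mult N_def uu[symmetric]
        by (intro mult_mono Cauchy_Schwarz_ineq2 lu) (use kb in auto)
      also have "norm ((k' * (u' \<bullet> v)) *\<^sub>R A (u - u')) \<le> (1 * (\<eta> * norm v)) * (\<Theta> * norm (x - y))"
        unfolding norm_scaleR abs_mult
      proof (intro mult_mono)
        show "\<bar>u' \<bullet> v\<bar> \<le> \<eta> * norm v"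
          using Cauchy_Schwarz_ineq2[of u' v] mult_right_mono[OF True norm_ge_zero[of v]] by linarith
        show "norm (A (u - u')) \<le> \<Theta> * norm (x - y)"
          using A(2)[of "u - u'"] mult_right_mono[OF Theta norm_ge_zero[of "u - u'"]] unfolding uu by linarith
      qed (use kb eta in auto)
      finally show ?thesis using p1 by (simp add: N_def algebra_simps)
    qed
  qed
  have Qb: "norm ((k\<^sup>2 - k'\<^sup>2) *\<^sub>R A v) \<le> 4 * \<Theta> / \<eta> * N"
  proof -
    have "k\<^sup>2 - k'\<^sup>2 = (k - k') * (k + k')" by (simp add: power2_eq_square algebra_simps)
    then have "norm ((k\<^sup>2 - k'\<^sup>2) *\<^sub>R A v) = \<bar>k - k'\<bar> * \<bar>k + k'\<bar> * norm (A v)" by (simp add: abs_mult)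
    also have "\<dots> \<le> (2 / \<eta> * norm (x - y)) * 2 * (\<Theta> * norm v)"
    proof (intro mult_mono kk)
      show "norm (A v) \<le> \<Theta> * norm v" using A(2)[of v] mult_right_mono[OF Theta norm_ge_zero[of v]] by linarith
    qed (use kb eta in auto)
    finally show ?thesis by (simp add: N_def algebra_simps)
  qed
  have "bump' \<eta> c A w x v - bump' \<eta> c A w y v = (- 4 / \<eta>\<^sup>2) *\<^sub>R P + (k\<^sup>2 - k'\<^sup>2) *\<^sub>R A v"
    unfolding bump'_def P_def u_def[symmetric] u'_def[symmetric] k_def[symmetric] k'_def[symmetric]
    by (simp add: scaleR_right_diff_distrib scaleR_left_diff_distrib mult.assoc)
  then have "norm (bump' \<eta> c A w x v - bump' \<eta> c A w y v) \<le> norm ((- 4 / \<eta>\<^sup>2) *\<^sub>R P) + norm ((k\<^sup>2 - k'\<^sup>2) *\<^sub>R A v)"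
    by (simp only: norm_triangle_ineq)
  also have "norm ((- 4 / \<eta>\<^sup>2) *\<^sub>R P) = 4 / \<eta>\<^sup>2 * norm P" by simp
  also have "4 / \<eta>\<^sup>2 * norm P \<le> 4 / \<eta>\<^sup>2 * (4 * \<Theta> * \<eta> * N)" using Pb by (intro mult_left_mono) auto
  also have "\<dots> = 16 * \<Theta> / \<eta> * N" using eta by (simp add: power2_eq_square)
  finally show ?thesis using Qb by (simp add: N_def mult.assoc)
qed

lemma bump'_lip: "norm (bump' \<eta> c A w x v - bump' \<eta> c A w y v) \<le> 20 * \<Theta> / \<eta> * norm (x - y) * norm v"
proof -
  consider "norm (x - c) \<le> \<eta>" | "norm (y - c) \<le> \<eta>" | "\<eta> \<le> norm (x - c)" "\<eta> \<le> norm (y - c)" by linarith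
  then show ?thesis
  proof cases
    case 1 then show ?thesis by (rule bump'_lip_aux)
  next
    case 2 then show ?thesis using bump'_lip_aux[of y v x] by (simp add: norm_minus_commute)
  next
    case 3
    then show ?thesis using bump_zero[of x v] bump_zero[of y v] Theta th eta by simp
  qed
qed

end

text \<open>For sums of bumps: at each point at most one of them is non-zero, so the bounds do not
  grow with the number of data points.\<close>

lemma norm_sum_few_le:
  fixes F :: "'i \<Rightarrow> 'a::real_normed_vector"
  assumes "finite Y" "finite S" "card S \<le> m" "\<And>i. i \<in> Y \<Longrightarrow> i \<notin> S \<Longrightarrow> F i = 0" "\<And>i. i \<in> Y \<Longrightarrow> norm (F i) \<le> B" "0 \<le> B"
  shows "norm (\<Sum>i\<in>Y. F i) \<le> real m * B"
proof -
  have "(\<Sum>i\<in>Y. F i) = (\<Sum>i\<in>Y \<inter> S. F i)"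
    using assms(1,4) by (intro sum.mono_neutral_right) auto
  also have "norm \<dots> \<le> (\<Sum>i\<in>Y \<inter> S. B)" using assms(5) by (intro sum_norm_le) auto
  also have "\<dots> = real (card (Y \<inter> S)) * B" by simp
  also have "\<dots> \<le> real m * B"
    using card_mono[OF assms(2), of "Y \<inter> S"] assms(3,6) by (intro mult_right_mono) auto
  finally show ?thesis .
qed

text \<open>The centres c y will be the nearest points of M to the data; their separation keeps the
  open supporting balls disjoint. The bound 1/10 on \<Theta> makes the derivative of the sum at most
  5/10.\<close>

locale bump_family =
  fixes D :: nat and Y :: "euc set" and \<eta> \<theta> \<Theta> :: real and c w :: "euc \<Rightarrow> euc" and A :: "euc \<Rightarrow> euc \<Rightarrow> euc"
  assumes Y: "finite Y" and eta: "0 < \<eta>" and th: "0 \<le> \<theta>" and Th: "\<theta> \<le> \<Theta>" "\<Theta> \<le> 1 / 10"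
    and A: "\<And>y. y \<in> Y \<Longrightarrow> linear (A y)" "\<And>y v. y \<in> Y \<Longrightarrow> norm (A y v) \<le> \<theta> * norm v"
    and w: "\<And>y. y \<in> Y \<Longrightarrow> norm (w y) \<le> (\<Theta> - \<theta>) * \<eta>"
    and sep: "\<And>y z. y \<in> Y \<Longrightarrow> z \<in> Y \<Longrightarrow> y \<noteq> z \<Longrightarrow> 2 * \<eta> \<le> dist (c y) (c z)"
    and Rn: "\<And>y. y \<in> Y \<Longrightarrow> c y \<in> Rn D" "\<And>y. y \<in> Y \<Longrightarrow> w y \<in> Rn D" "\<And>y v. y \<in> Y \<Longrightarrow> v \<in> Rn D \<Longrightarrow> A y v \<in> Rn D"
begin

definition G :: "euc \<Rightarrow> euc" where "G x = (\<Sum>y\<in>Y. bump \<eta> (c y) (A y) (w y) x)"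
definition G' :: "euc \<Rightarrow> euc \<Rightarrow> euc" where "G' x v = (\<Sum>y\<in>Y. bump' \<eta> (c y) (A y) (w y) x v)"

definition active :: "euc \<Rightarrow> euc set" where "active x = {y\<in>Y. dist x (c y) < \<eta>}"

lemma active: "finite (active x)" "card (active x) \<le> 1"
proof -
  show f: "finite (active x)" using Y by (simp add: active_def)
  have "y = z" if "y \<in> active x" "z \<in> active x" for y z
    using sep[of y z] that dist_triangle[of "c y" "c z" x] by (force simp: active_def dist_commute)
  then show "card (active x) \<le> 1" using f by (auto simp: card_le_Suc0_iff_eq)
qed

lemma inactive: "y \<in> Y \<Longrightarrow> y \<notin> active x \<Longrightarrow> bump \<eta> (c y) (A y) (w y) x = 0 \<and> bump' \<eta> (c y) (A y) (w y) x v = 0"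
  by (rule bump_zero[OF eta A(1) A(2) w th]) (auto simp: active_def dist_norm)

lemma G_le: "norm (G x) \<le> \<Theta> * \<eta>"
proof -
  have "norm (G x) \<le> real 1 * (\<Theta> * \<eta>)"
    unfolding G_def using Th th eta
    by (intro norm_sum_few_le[OF Y active(1)[of x] active(2)] bump_le[OF eta A(1) A(2) w th])
      (auto dest: inactive)
  then show ?thesis by simp
qed

lemma G'_le': "norm (G' x v) \<le> 5 * \<Theta> * norm v"
proof -
  have "norm (G' x v) \<le> real 1 * (5 * \<Theta> * norm v)"
    unfolding G'_def using Th th
    by (intro norm_sum_few_le[OF Y active(1)[of x] active(2)] bump'_le[OF eta A(1) A(2) w th])
      (auto dest: inactive)
  then show ?thesis by simp
qed

text \<open>40 is twice 20: two points to be compared meet at most two bumps.\<close>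

sublocale perturbation D G G' "40 * \<Theta> / \<eta>"
proof
  show "(G has_derivative G' x) (at x)" for x
    unfolding G_def[abs_def] G'_def[abs_def]
    by (intro has_derivative_sum bump_derivative[OF eta A(1) A(2) w th])
  show "norm (G' x v) \<le> 1 / 2 * norm v" for x v
  proof -
    have "5 * \<Theta> * norm v \<le> 1 / 2 * norm v" using Th by (intro mult_right_mono) auto
    then show ?thesis using G'_le'[of x v] by linarith
  qed
  show "norm (G' x v - G' y v) \<le> 40 * \<Theta> / \<eta> * norm (x - y) * norm v" for x y v
  proof -
    have "G' x v - G' y v = (\<Sum>z\<in>Y. bump' \<eta> (c z) (A z) (w z) x v - bump' \<eta> (c z) (A z) (w z) y v)"
      by (simp add: G'_def sum_subtractf)
    also have "norm \<dots> \<le> real 2 * (20 * \<Theta> / \<eta> * norm (x - y) * norm v)"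
    proof (rule norm_sum_few_le[OF Y, of "active x \<union> active y"])
      show "card (active x \<union> active y) \<le> 2" using card_Un_le[of "active x" "active y"] active[of x] active[of y] by linarith
    qed (use inactive bump'_lip[OF eta A(1) A(2) w th] Th th eta active in auto)
    finally show ?thesis by simp
  qed
  show "G x \<in> Rn D" if "x \<in> Rn D" for x
    unfolding G_def bump_def
    by (intro subspace_sum subspace_scale subspace_add Rn subspace_diff subspace_Rn that)
  show "0 \<le> 40 * \<Theta> / \<eta>" using Th th eta by simp
qed

lemma at_center:
  assumes y: "y \<in> Y"
  shows "G (c y) = w y" "G' (c y) v = A y v"
proof -
  have z: "z \<notin> active (c y)" if "z \<in> Y" "z \<noteq> y" for z
    using sep[OF y that(1)] that(2) eta by (auto simp: active_def)
  have "G (c y) = bump \<eta> (c y) (A y) (w y) (c y)"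
    unfolding G_def using y Y z inactive by (subst sum.remove[OF Y y]) (auto intro!: sum.neutral)
  then show "G (c y) = w y" using A(1)[OF y] by (simp add: bump_def hat_def linear_0)
  have "G' (c y) v = bump' \<eta> (c y) (A y) (w y) (c y) v"
    unfolding G'_def using y Y z inactive by (subst sum.remove[OF Y y]) (auto intro!: sum.neutral)
  then show "G' (c y) v = A y v" by (simp add: bump'_def hat_def)
qed

end

subsection \<open>Tangential Delaunay complexes of perturbed nets\<close>

lemma tdc_star_cong:
  assumes "\<And>p. p \<in> P \<Longrightarrow> T1 p = T2 p"
  shows "tdc_star wt D P T1 = tdc_star wt D P T2"
proof -
  have "restrict T1 P = restrict T2 P" using assms by (rule restrict_ext)
  moreover have "(\<Union>p\<in>\<tau>. (+) p ` T1 p) = (\<Union>p\<in>\<tau>. (+) p ` T2 p)" if "\<tau> \<in> delaunay D P w" for \<tau> w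
    using assms that by (auto simp: delaunay_def)
  ultimately show ?thesis unfolding tdc_star_def tangential_delaunay_def by auto
qed

lemma infdist_bdd_above:
  assumes "bounded A" "S \<noteq> {}" shows "bdd_above ((\<lambda>a. infdist a S) ` A)"
proof -
  obtain s where s: "s \<in> S" using assms(2) by blast
  obtain e where "\<And>a. a \<in> A \<Longrightarrow> dist s a \<le> e" using assms(1) unfolding bounded_any_center[of _ s] by blast
  then have "infdist a S \<le> e" if "a \<in> A" for a using infdist_le[OF s, of a] that by (metis dist_commute order_trans)
  then show ?thesis by (auto intro!: bdd_aboveI2)
qed

lemma hausdist_perturb:
  fixes M S :: "'a::metric_space set"
  assumes M: "M \<noteq> {}" "bounded M" and S: "S \<noteq> {}" "bounded S" and f: "\<And>x. x \<in> M \<Longrightarrow> dist x (f x) \<le> \<tau>"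
    and fM: "bounded (f ` M)"
  shows "hausdist M S \<le> \<tau> + hausdist (f ` M) S"
proof -
  have ne: "f ` M \<noteq> {}" using M by simp
  have "infdist x S \<le> \<tau> + hausdist (f ` M) S" if x: "x \<in> M" for x
  proof -
    have "infdist x S \<le> infdist (f x) S + dist x (f x)" by (rule infdist_triangle)
    moreover have "infdist (f x) S \<le> (SUP a\<in>f ` M. infdist a S)"
      by (rule cSUP_upper) (use x infdist_bdd_above[OF fM S(1)] in auto)
    ultimately show ?thesis using f[OF x] unfolding hausdist_def by linarith
  qed
  moreover have "infdist b M \<le> \<tau> + hausdist (f ` M) S" if b: "b \<in> S" for b
  proof -
    have "infdist b M - \<tau> \<le> dist b z" if zM: "z \<in> f ` M" for z
    proof -
      obtain x where x: "x \<in> M" "z = f x" using zM by blast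
      have "infdist b M \<le> dist b x" using x(1) by (rule infdist_le)
      also have "\<dots> \<le> dist b (f x) + dist x (f x)" by (metis dist_commute dist_triangle)
      finally show ?thesis using f[OF x(1)] x(2) by simp
    qed
    then have "infdist b M - \<tau> \<le> infdist b (f ` M)" using ne by (auto simp: infdist_def intro!: cINF_greatest)
    moreover have "infdist b (f ` M) \<le> (SUP b\<in>S. infdist b (f ` M))"
      by (rule cSUP_upper[OF b infdist_bdd_above[OF S(2) ne]])
    ultimately show ?thesis unfolding hausdist_def by linarith
  qed
  ultimately show ?thesis unfolding hausdist_def[of M S] using M(1) S(1) by (auto intro!: cSUP_least)
qed

text \<open>\<open>hausdist\<close> is meaningful for non-empty bounded sets only; the complex
  inherits both properties from M.\<close>

lemma ambient_isotopic_props: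
  assumes "ambient_isotopic D M S" "M \<subseteq> Rn D" "compact M" "M \<noteq> {}"
  shows "compact S" "S \<noteq> {}"
proof -
  obtain F where F: "continuous_on ({0..1} \<times> Rn D) (\<lambda>(s::real, x). F s x)" "F 1 ` M = S"
    using assms(1) unfolding ambient_isotopic_def by blast
  have "continuous_on M ((\<lambda>(s, x). F s x) \<circ> (\<lambda>x. (1, x)))"
    by (rule continuous_on_compose) (auto intro!: continuous_intros continuous_on_subset[OF F(1)] subsetD[OF assms(2)])
  then have "continuous_on M (F 1)" by (simp add: o_def)
  then show "compact S" "S \<noteq> {}" using F(2) assms(3,4) compact_continuous_image by blast+
qed

text \<open>The hypothesis \<open>wt\<close> is applied to the perturbed manifold M', of which Y is
  a net with exact tangent spaces. Passing back to M costs the displacement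
  \<open>\<Theta> * \<eta>\<close>, and the bracket in the last summand is \<rho> divided by the
  reach bound for M'.\<close>

theorem tdc_of_perturbed_net:
  fixes wt :: weights
  assumes wt: "\<And>D \<rho> \<epsilon> M P. d < D \<Longrightarrow> 0 < \<rho> \<Longrightarrow> 0 < \<epsilon> \<Longrightarrow> \<epsilon> \<le> \<epsilon>\<^sub>d * \<rho> \<Longrightarrow> M \<in> manifolds D d \<rho> \<Longrightarrow> eps_net \<epsilon> M P \<Longrightarrow>
        hausdist M (carrier_of (tdc_star wt D P (tangent_space M))) \<le> C\<^sub>d * \<epsilon>\<^sup>2 / \<rho> \<and>
        ambient_isotopic D M (carrier_of (tdc_star wt D P (tangent_space M)))"
    and D: "d < D" and M: "M \<in> manifolds D d \<rho>" and rho: "0 < \<rho>"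
    and Y: "finite Y" "Y \<subseteq> Rn D" and eps: "0 < \<epsilon>"
    and close: "\<And>y. y \<in> Y \<Longrightarrow> infdist y M \<le> \<delta>" and delta: "0 \<le> \<delta>" "\<delta> < \<rho>" "4 * \<delta> \<le> \<epsilon>"
    and sep: "\<And>p q. p \<in> Y \<Longrightarrow> q \<in> Y \<Longrightarrow> p \<noteq> q \<Longrightarrow> \<epsilon> \<le> dist p q"
    and cover: "\<And>x. x \<in> M \<Longrightarrow> \<exists>y\<in>Y. dist x y \<le> 3 / 2 * \<epsilon>"
    and Tf: "\<And>y. y \<in> Y \<Longrightarrow> k_subspace d (Tf y) \<and> Tf y \<subseteq> Rn D"
    and angle: "\<And>y x v. y \<in> Y \<Longrightarrow> x \<in> M \<Longrightarrow> dist y x = infdist y M \<Longrightarrow> v \<in> tangent_space M x \<Longrightarrow> norm (perp (Tf y) v) \<le> \<theta> * norm v"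
    and th: "0 \<le> \<theta>" "\<theta> + 4 * \<delta> / \<epsilon> \<le> 1 / 10"
    and small: "\<epsilon> * (6 + 1280 * (\<theta> + 4 * \<delta> / \<epsilon>) / \<epsilon> * \<rho>) \<le> \<epsilon>\<^sub>d * \<rho>"
  shows "hausdist M (carrier_of (tdc_star wt D Y Tf)) \<le>
      \<theta> * \<epsilon> + \<delta> + C\<^sub>d * \<epsilon>\<^sup>2 * (6 + 1280 * (\<theta> + 4 * \<delta> / \<epsilon>) / \<epsilon> * \<rho>) / \<rho>"
    "ambient_isotopic D M (carrier_of (tdc_star wt D Y Tf))"
proof -
  interpret reach_manifold D d M \<rho> using M rho by unfold_locales
  \<comment> \<open>Points of Y are \<epsilon> apart and at most \<epsilon> / 4 from their feet, so
    the feet are at least \<epsilon> / 2 = 2 \<eta> apart.\<close>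
  define \<eta> where "\<eta> = \<epsilon> / 4"
  define \<Theta> where "\<Theta> = \<theta> + \<delta> / \<eta>"
  define w where "w y = y - near y" for y
  \<comment> \<open>On the tangent space at the foot, identity plus \<open>A y\<close> is the
    projection onto \<open>Tf y\<close>; the inner projection extends this to all vectors without
    increasing the norm.\<close>
  define A where "A y v = - perp (Tf y) (proj (T (near y)) v)" for y v
  have eta: "\<eta> > 0" using eps by (simp add: \<eta>_def)
  have Th_eq: "\<Theta> = \<theta> + 4 * \<delta> / \<epsilon>" using eps by (simp add: \<Theta>_def \<eta>_def)
  have wy: "norm (w y) \<le> \<delta>" if "y \<in> Y" for y
    using close[OF that] near[of y] by (simp add: w_def dist_norm)
  have nM: "near y \<in> M" for y by (rule near(1))
  have bf: "bump_family D Y \<eta> \<theta> \<Theta> near w A"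
  proof (rule bump_family.intro)
    show "\<Theta> \<le> 1 / 10" using th by (simp add: Th_eq)
    show "\<theta> \<le> \<Theta>" using delta eta by (simp add: \<Theta>_def)
    fix y assume y: "y \<in> Y"
    note Ty = Tf[OF y, THEN conjunct1] and Tn = T_sub[OF nM[of y]]
    show "linear (A y)"
      unfolding A_def[abs_def]
      using linear_compose_neg[OF linear_compose[OF linear_proj[OF Tn] linear_perp[OF Ty]]] by (simp add: o_def)
    show "norm (w y) \<le> (\<Theta> - \<theta>) * \<eta>" using wy[OF y] eta by (simp add: \<Theta>_def)
    show "near y \<in> Rn D" "w y \<in> Rn D"
      using near_Rn Y(2) y subspace_Rn by (auto simp: w_def intro: subspace_diff)
    show "norm (A y v) \<le> \<theta> * norm v" for v
    proof -
      have "norm (A y v) \<le> \<theta> * norm (proj (T (near y)) v)"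
        unfolding A_def norm_minus_cancel
        by (rule angle[OF y nM near(2) proj_in[OF Tn]])
      also have "\<dots> \<le> \<theta> * norm v" using th norm_proj_le[OF Tn] by (intro mult_left_mono) auto
      finally show ?thesis .
    qed
    show "A y v \<in> Rn D" if "v \<in> Rn D" for v
    proof -
      have "proj (T (near y)) v \<in> Rn D" using proj_in[OF Tn] T_Rn by blast
      moreover have "proj (Tf y) (proj (T (near y)) v) \<in> Rn D" using proj_in[OF Ty] Tf[OF y] by blast
      ultimately show ?thesis unfolding A_def perp_def using subspace_Rn by (simp add: subspace_diff)
    qed
    show "2 * \<eta> \<le> dist (near y) (near z)" if z: "z \<in> Y" "y \<noteq> z" for z
    proof -
      have "dist y z \<le> dist y (near y) + dist (near y) (near z) + dist (near z) z"
        using dist_triangle[of y z "near y"] dist_triangle[of "near y" z "near z"] by linarith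
      then show ?thesis
        using sep[OF y z] wy[OF y] wy[OF z(1)] delta by (simp add: w_def dist_norm norm_minus_commute \<eta>_def)
    qed
  qed (use Y eta th in auto)
  then interpret bf: bump_family D Y \<eta> \<theta> \<Theta> near w A .
  define M' where "M' = bf.\<Phi> ` M"
  define R where "R = \<rho> / (6 + 8 * (40 * \<Theta> / \<eta>) * \<rho>)"
  have M': "M' \<in> manifolds D d R" unfolding M'_def R_def by (rule bf.image_manifold[OF M rho])
  \<comment> \<open>1280 is 8 times 40 times 4, the last factor from \<eta> = \<epsilon> /
    4.\<close>
  have R_eq: "R = \<rho> / (6 + 1280 * \<Theta> / \<epsilon> * \<rho>)" by (simp add: R_def \<eta>_def)
  have Th0: "0 \<le> \<Theta>" using th delta eps by (simp add: Th_eq)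
  have den: "6 + 1280 * \<Theta> / \<epsilon> * \<rho> > 0" using Th0 eps rho by (intro add_pos_nonneg) auto
  have R: "R > 0" using rho den by (simp add: R_eq)
  have eR: "\<epsilon> \<le> \<epsilon>\<^sub>d * R" using small den unfolding R_eq Th_eq[symmetric] by (simp add: field_simps)
  have move: "norm (bf.\<Phi> x - x) \<le> \<Theta> * \<eta>" for x using bf.G_le[of x] by (simp add: bf.\<Phi>_def)
  have cy: "bf.\<Phi> (near y) = y" if "y \<in> Y" for y using bf.at_center(1)[OF that] by (simp add: bf.\<Phi>_def w_def)
  have net: "eps_net \<epsilon> M' Y"
    unfolding eps_net_def
  proof (intro conjI ballI impI)
    show "Y \<subseteq> M'" using cy nM unfolding M'_def by (metis image_eqI subsetI)
    fix x' assume "x' \<in> M'"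
    then obtain x where x: "x \<in> M" "x' = bf.\<Phi> x" unfolding M'_def by blast
    obtain y where y: "y \<in> Y" "dist x y \<le> 3 / 2 * \<epsilon>" using cover[OF x(1)] by blast
    \<comment> \<open>The displacement is at most \<epsilon> / 40, so the covering radius 3/2
      \<epsilon> stays below 2 \<epsilon>.\<close>
    have "\<Theta> * \<eta> \<le> (1 / 10) * \<eta>" using th eta by (intro mult_right_mono) (auto simp: Th_eq)
    then have "dist x' x \<le> \<epsilon> / 40" using move[of x] by (simp add: x(2) dist_norm \<eta>_def)
    then show "\<exists>p\<in>Y. dist x' p \<le> 2 * \<epsilon>"
      using y dist_triangle[of x' y x] eps by (intro bexI[of _ y]) auto
  qed (use Y sep in auto)
  have tan: "tangent_space M' y = Tf y" if y: "y \<in> Y" for y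
  proof -
    note Ty = Tf[OF y, THEN conjunct1] and Tn = T_sub[OF nM[of y]]
    have "tangent_space M' y = bf.\<Phi>' (near y) ` T (near y)"
      using bf.tangent_image[OF M_props(5) nM[of y]] by (simp add: cy[OF y] M'_def)
    also have "\<dots> = proj (Tf y) ` T (near y)"
    proof (rule image_cong[OF refl])
      fix v assume v: "v \<in> T (near y)"
      show "bf.\<Phi>' (near y) v = proj (Tf y) v"
        unfolding bf.\<Phi>'_def bf.at_center(2)[OF y] A_def proj_id[OF Tn v] by (simp add: perp_def)
    qed
    also have "\<dots> = Tf y"
    proof (rule k_subspace_angle_swap(1)[OF Tn Ty])
      have "0 \<le> 4 * \<delta> / \<epsilon>" using delta eps by simp
      then show "\<theta> < 1" using th by linarith
      show "norm (perp (Tf y) v) \<le> \<theta> * norm v" if "v \<in> T (near y)" for v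
        by (rule angle[OF y nM near(2) that])
    qed (rule th(1))
    finally show ?thesis .
  qed
  define S where "S = carrier_of (tdc_star wt D Y Tf)"
  have eqS: "carrier_of (tdc_star wt D Y (tangent_space M')) = S"
    unfolding S_def using tdc_star_cong[of Y "tangent_space M'" Tf] tan by metis
  note res = wt[OF D R eps eR M' net, unfolded eqS]
  have "ambient_isotopic D M M'" unfolding M'_def by (rule bf.isotopy)
  then show iso: "ambient_isotopic D M (carrier_of (tdc_star wt D Y Tf))"
    unfolding S_def[symmetric] by (rule ambient_isotopic_trans) (rule conjunct2[OF res])
  have S: "compact S" "S \<noteq> {}" using ambient_isotopic_props[OF iso M_props(2,3,1)] by (auto simp: S_def)
  have "hausdist M S \<le> \<Theta> * \<eta> + hausdist (bf.\<Phi> ` M) S"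
  proof (rule hausdist_perturb)
    show "dist x (bf.\<Phi> x) \<le> \<Theta> * \<eta>" for x using move[of x] by (simp add: dist_norm norm_minus_commute)
    have "compact M'" using M' by (simp add: manifolds_def)
    then show "bounded (bf.\<Phi> ` M)" unfolding M'_def by (rule compact_imp_bounded)
  qed (simp_all add: M_props S compact_imp_bounded)
  also have "hausdist (bf.\<Phi> ` M) S \<le> C\<^sub>d * \<epsilon>\<^sup>2 / R"
    using conjunct1[OF res] unfolding M'_def .
  also have "C\<^sub>d * \<epsilon>\<^sup>2 / R = C\<^sub>d * \<epsilon>\<^sup>2 * (6 + 1280 * (\<theta> + 4 * \<delta> / \<epsilon>) / \<epsilon> * \<rho>) / \<rho>"
    unfolding R_eq Th_eq by simp
  also have "\<Theta> * \<eta> \<le> \<theta> * \<epsilon> + \<delta>"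
  proof -
    have "\<Theta> * \<eta> = \<theta> * \<eta> + \<delta>" using eta by (simp add: \<Theta>_def algebra_simps)
    moreover have "\<theta> * \<eta> \<le> \<theta> * \<epsilon>" using th eps by (intro mult_left_mono) (auto simp: \<eta>_def)
    ultimately show ?thesis by simp
  qed
  finally show "hausdist M (carrier_of (tdc_star wt D Y Tf)) \<le>
      \<theta> * \<epsilon> + \<delta> + C\<^sub>d * \<epsilon>\<^sup>2 * (6 + 1280 * (\<theta> + 4 * \<delta> / \<epsilon>) / \<epsilon> * \<rho>) / \<rho>" unfolding S_def by simp
qed

subsection \<open>Farthest point sampling\<close>

lemma fps_state_props:
  assumes "fps_state P \<epsilon> Q" "0 \<le> \<epsilon>"
  shows "Q \<subseteq> P \<and> Q \<noteq> {} \<and> finite Q \<and> (\<forall>p\<in>Q. \<forall>q\<in>Q. p \<noteq> q \<longrightarrow> \<epsilon> \<le> dist p q)"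
  using assms
proof (induction rule: fps_state.induct)
  case (step Q q)
  have "\<epsilon> \<le> dist q p" if "p \<in> Q" for p
    using step(4) infdist_le[OF that, of q] by simp
  then show ?case using step by (auto simp: dist_commute)
qed auto

lemma finite_infdist_attained:
  fixes Q :: "'a::metric_space set"
  assumes "finite Q" "Q \<noteq> {}"
  shows "\<exists>q\<in>Q. dist x q = infdist x Q"
proof -
  have "infdist x Q = Min (dist x ` Q)"
    using assms by (simp add: infdist_def cInf_eq_Min)
  moreover have "Min (dist x ` Q) \<in> dist x ` Q" using assms by (intro Min_in) auto
  ultimately show ?thesis by auto
qed

lemma fps_output_props:
  assumes "fps_output P \<epsilon> Q" "0 \<le> \<epsilon>" "finite P"
  shows "Q \<subseteq> P" "finite Q" "\<And>p q. p \<in> Q \<Longrightarrow> q \<in> Q \<Longrightarrow> p \<noteq> q \<Longrightarrow> \<epsilon> \<le> dist p q"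
    "\<And>p. p \<in> P \<Longrightarrow> \<exists>q\<in>Q. dist p q \<le> \<epsilon>"
proof -
  have *: "Q \<subseteq> P \<and> finite Q \<and> (\<forall>p\<in>Q. \<forall>q\<in>Q. p \<noteq> q \<longrightarrow> \<epsilon> \<le> dist p q) \<and> (\<forall>p\<in>P. \<exists>q\<in>Q. dist p q \<le> \<epsilon>)"
  proof (cases "P = {}")
    case True then show ?thesis using assms(1) by (simp add: fps_output_def)
  next
    case False
    then have f: "fps_state P \<epsilon> Q" "\<And>p. p \<in> P \<Longrightarrow> infdist p Q \<le> \<epsilon>"
      using assms(1) by (auto simp: fps_output_def)
    note g = fps_state_props[OF f(1) assms(2)]
    have c: "\<forall>p\<in>P. \<exists>q\<in>Q. dist p q \<le> \<epsilon>"
    proof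
      fix p assume p: "p \<in> P"
      have "\<exists>q\<in>Q. dist p q = infdist p Q" by (rule finite_infdist_attained) (use g in auto)
      then obtain q where "q \<in> Q" "dist p q = infdist p Q" by blast
      then show "\<exists>q\<in>Q. dist p q \<le> \<epsilon>" using f(2)[OF p] by (intro bexI[of _ q]) auto
    qed
    from g have "Q \<subseteq> P" "finite Q" "\<forall>p\<in>Q. \<forall>q\<in>Q. p \<noteq> q \<longrightarrow> \<epsilon> \<le> dist p q" by auto
    then show ?thesis using c by (intro conjI)
  qed
  show "Q \<subseteq> P" "finite Q" using * by auto
  show "\<epsilon> \<le> dist p q" if "p \<in> Q" "q \<in> Q" "p \<noteq> q" for p q using * that by auto
  show "\<exists>q\<in>Q. dist p q \<le> \<epsilon>" if "p \<in> P" for p using * that by auto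
qed

subsection \<open>The bandwidths\<close>

text \<open>The recursion is an affine contraction with fixed point 1 / d and factor 2 / (d + 2);
  the initial gap is 1 / (d (d + 1)).\<close>

lemma rate_exp_gap: "1 \<le> d \<Longrightarrow> 1 / real d - rate_exp d m = (2 / (real d + 2)) ^ m * (1 / (real d * (real d + 1)))"
proof (induction m)
  case 0
  then show ?case by (simp add: field_simps)
next
  case (Suc m)
  have "1 / real d - rate_exp d (Suc m) = (2 / (real d + 2)) * (1 / real d - rate_exp d m)"
    using Suc.prems by (simp add: field_simps)
  then show ?case using Suc by simp
qed

lemma rate_exp_less: "1 \<le> d \<Longrightarrow> rate_exp d m < 1 / real d"
proof -
  assume d: "1 \<le> d"
  have "0 < (2 / (real d + 2)) ^ m * (1 / (real d * (real d + 1)))" using d by (intro mult_pos_pos) auto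
  then show ?thesis using rate_exp_gap[OF d, of m] by linarith
qed

lemma rate_exp_mono: "1 \<le> d \<Longrightarrow> rate_exp d m \<le> rate_exp d (Suc m)"
proof -
  assume d: "1 \<le> d"
  have "rate_exp d m * real d \<le> 1" using rate_exp_less[OF d, of m] d by (simp add: field_simps)
  then show ?thesis using d by (simp add: field_simps)
qed

lemma rate_exp_ge: "1 \<le> d \<Longrightarrow> 1 / (real d + 1) \<le> rate_exp d m"
proof (induction m)
  case (Suc m)
  then show ?case using rate_exp_mono[of d m] by linarith
qed simp

lemma rate_exp_lim: "1 \<le> d \<Longrightarrow> (\<lambda>m. rate_exp d m) \<longlonglongrightarrow> 1 / real d"
proof -
  assume d: "1 \<le> d"
  have lt: "2 / (real d + 2) < 1" and ge: "0 \<le> 2 / (real d + 2)" using d by (simp_all add: field_simps)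
  have "(\<lambda>m. (2 / (real d + 2)) ^ m) \<longlonglongrightarrow> 0" by (rule LIMSEQ_realpow_zero[OF ge lt])
  then have "(\<lambda>m. 1 / real d - (2 / (real d + 2)) ^ m * (1 / (real d * (real d + 1)))) \<longlonglongrightarrow> 1 / real d - 0 * (1 / (real d * (real d + 1)))"
    by (intro tendsto_diff tendsto_mult tendsto_const)
  moreover have "rate_exp d m = 1 / real d - (2 / (real d + 2)) ^ m * (1 / (real d * (real d + 1)))" for m
    using rate_exp_gap[OF d, of m] by simp
  ultimately show ?thesis by simp
qed

locale bandwidths =
  fixes d :: nat and b :: real
  assumes d1: "1 \<le> d" and b: "0 < b" "b < 1"
begin

definition h :: "nat \<Rightarrow> real" where "h m = b powr rate_exp d m"
definition hinf :: real where "hinf = b powr (1 / real d)"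

lemma h_pos: "0 < h m" and hinf_pos: "0 < hinf"
  using b by (auto simp: h_def hinf_def)

lemma hinf_le: "hinf \<le> h m"
  unfolding hinf_def h_def using b rate_exp_less[OF d1, of m] by (intro powr_mono') auto

lemma h_Suc: "h (Suc m) \<le> h m"
  unfolding h_def using b rate_exp_mono[OF d1, of m] by (intro powr_mono') auto

lemma h_antimono: "m \<le> k \<Longrightarrow> h k \<le> h m"
  by (rule lift_Suc_antimono_le[of h]) (rule h_Suc)

lemma h_0: "h 0 ^ (d + 1) = b"
  unfolding h_def using b by (simp add: powr_realpow[symmetric] powr_powr del: power_Suc)
    (simp add: field_simps)

lemma hinf_d: "hinf ^ d = b"
  unfolding hinf_def using b d1 by (simp add: powr_realpow[symmetric] powr_powr)

lemma h_rec: "b * (h m)\<^sup>2 = h (Suc m) ^ (d + 2)"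
proof -
  have "h (Suc m) ^ (d + 2) = b powr (rate_exp d (Suc m) * (real d + 2))"
    unfolding h_def using b by (simp add: powr_realpow[symmetric] powr_powr add.commute del: rate_exp.simps power_Suc)
  also have "rate_exp d (Suc m) * (real d + 2) = 1 + rate_exp d m * 2"
    by (simp add: add_eq_0_iff)
  also have "b powr (1 + rate_exp d m * 2) = b * (h m)\<^sup>2"
    unfolding h_def using b by (simp add: powr_add powr_realpow[symmetric] powr_powr)
  finally show ?thesis by simp
qed

text \<open>Twice \<open>rate_exp d m\<close> exceeds \<open>rate_exp d (Suc m)\<close> by at least
  1 / (d + 2), because the exponents start at 1 / (d + 1). Hence a tube of width of order
  \<open>(h m)\<^sup>2\<close>, as left by one step, is thin compared with the next
  bandwidth.\<close>

lemma h_square_le: "(h m)\<^sup>2 \<le> b powr (1 / (real d + 2)) * h (Suc m)"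
proof -
  have "(h m)\<^sup>2 = b powr (rate_exp d m * 2)" unfolding h_def using b by (simp add: powr_realpow[symmetric] powr_powr)
  also have "\<dots> \<le> b powr (1 / (real d + 2) + rate_exp d (Suc m))"
  proof (rule powr_mono')
    have "1 \<le> rate_exp d m * (real d + 1)" using rate_exp_ge[OF d1, of m] by (simp add: field_simps)
    then show "1 / (real d + 2) + rate_exp d (Suc m) \<le> rate_exp d m * 2" by (simp add: field_simps)
  qed (use b in auto)
  also have "\<dots> = b powr (1 / (real d + 2)) * h (Suc m)" unfolding h_def by (simp add: powr_add)
  finally show ?thesis .
qed

lemma h_lim: "h \<longlonglongrightarrow> hinf"
  unfolding h_def hinf_def using b rate_exp_lim[OF d1] by (intro tendsto_powr) auto

lemma b_le_h: "b \<le> h m ^ d"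
  using power_mono[OF hinf_le[of m], of d] hinf_pos hinf_d by simp

end

subsection \<open>Local principal component analysis near a manifold\<close>

lemma norm_barycenter_diff_le:
  fixes N :: "euc set"
  assumes "finite N" "N \<noteq> {}" "\<And>q. q \<in> N \<Longrightarrow> dist p q \<le> h"
  shows "dist p (barycenter N) \<le> h"
proof -
  have "barycenter N = (\<Sum>q\<in>N. (1 / real (card N)) *\<^sub>R q)"
    by (simp add: barycenter_def scaleR_right.sum[symmetric] divide_inverse)
  also have "\<dots> \<in> cball p h"
    by (rule convex_sum[OF assms(1) convex_cball]) (use assms in auto)
  finally show ?thesis by simp
qed

lemma perp_barycenter:
  fixes N :: "euc set"
  assumes T: "k_subspace k T" and "finite N" "N \<noteq> {}"
  shows "real (card N) * norm (perp T (barycenter N - x)) \<le> (\<Sum>q\<in>N. norm (perp T (q - x)))"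
proof -
  have "real (card N) *\<^sub>R (barycenter N - x) = (\<Sum>q\<in>N. q - x)"
    using assms(2,3) by (simp add: barycenter_def sum_subtractf algebra_simps sum_constant_scaleR)
  then have "real (card N) *\<^sub>R perp T (barycenter N - x) = (\<Sum>q\<in>N. perp T (q - x))"
    using perp_scale[OF T] linear_sum[OF linear_perp[OF T]] by metis
  then have "real (card N) * norm (perp T (barycenter N - x)) = norm (\<Sum>q\<in>N. perp T (q - x))"
    by (metis abs_of_nat norm_scaleR)
  also have "\<dots> \<le> (\<Sum>q\<in>N. norm (perp T (q - x)))" by (rule norm_sum)
  finally show ?thesis .
qed

context reach_manifold
begin

text \<open>The covariance in a unit direction v of T x is bounded below by the sample points around
  a point of M close to x + (h/2) v, whose coordinate along v is at least 3/8 h. It remains to sum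
  the normal parts of all neighbours, which are at most \<open>h\<^sup>2 / \<rho>\<close> for
  inliers and r' for outliers.\<close>

lemma TSE_angle:
  assumes D: "1 \<le> d" "d \<le> D" and tse: "is_TSE D d tse"
    and P: "finite P" "P \<subseteq> Rn D" and p: "p \<in> P" and h: "0 < h" "h \<le> \<rho> / 16" and near_p: "infdist p M \<le> h / 8"
    and x: "x \<in> M" "dist p x = infdist p M"
    and Nl: "0 < Nl" "\<And>m. m \<in> M \<Longrightarrow> Nl \<le> real (card (P \<inter> M \<inter> cball m (h / 16)))"
    and Nu: "real (card (P \<inter> M \<inter> cball p h)) \<le> Nu"
    and out: "real (card ((P - M) \<inter> cball p h)) \<le> no" "\<And>q. q \<in> P - M \<Longrightarrow> dist p q \<le> h \<Longrightarrow> norm (perp (T x) (q - x)) \<le> r'" "0 \<le> r'"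
  shows "k_subspace d (tse P h p)" "tse P h p \<subseteq> Rn D"
    "\<And>w. w \<in> tse P h p \<Longrightarrow> norm (perp (T x) w) \<le> 30 / (h * Nl) * (Nu * (h\<^sup>2 / \<rho>) + no * r') * norm w"
proof -
  note Tx = T_sub[OF x(1)]
  define N where "N = neighbours P h p"
  define bc where "bc = barycenter N"
  define y where "y q = q - bc" for q
  \<comment> \<open>9/64 is the square of 3/8.\<close>
  define la where "la = (9 / 64) * h\<^sup>2 * Nl"
  have fN: "finite N" using P by (simp add: N_def neighbours_def)
  have Nd: "q \<in> N \<longleftrightarrow> q \<in> P \<and> q \<noteq> p \<and> dist p q \<le> h" for q by (auto simp: N_def neighbours_def)
  have top: "top_eigenspan D d (\<lambda>x. \<Sum>q\<in>N. (y q \<bullet> x) *\<^sub>R y q) (tse P h p)"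
  proof -
    have "top_eigenspan D d (local_covariance P h p) (tse P h p)"
      using tse P p unfolding is_TSE_def by blast
    then show ?thesis by (simp add: local_covariance_def[abs_def] Let_def y_def bc_def N_def)
  qed
  have orth: "(p - x) \<bullet> v = 0" if "v \<in> T x" for v by (rule nearest_orthogonal[OF x that])
  have half: "\<exists>F\<subseteq>N. Nl \<le> real (card F) \<and> (\<forall>q\<in>F. (q - x) \<bullet> v \<ge> 3 / 8 * h)" if v: "v \<in> T x" "norm v = 1" for v
  proof -
    obtain m where m: "m \<in> M" "norm (x + (h / 2) *\<^sub>R v - m) \<le> 2 * (h / 2)\<^sup>2 / \<rho>"
      using tangent_point[OF x(1) v, of "h / 2"] h rho by auto
    have "2 * (h / 2)\<^sup>2 / \<rho> = (h / 2) * (h / \<rho>)" by (simp add: power2_eq_square)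
    also have "\<dots> \<le> (h / 2) * (1 / 16)" using h rho by (intro mult_left_mono) (auto simp: field_simps)
    finally have mn: "norm (x + (h / 2) *\<^sub>R v - m) \<le> h / 32" using m(2) by simp
    define F where "F = P \<inter> M \<inter> cball m (h / 16)"
    have F: "q \<in> N \<and> (q - x) \<bullet> v \<ge> 3 / 8 * h" if q: "q \<in> F" for q
    proof -
      have qm: "norm (q - m) \<le> h / 16" using q by (auto simp: F_def dist_norm norm_minus_commute)
      define e where "e = (q - m) - (x + (h / 2) *\<^sub>R v - m)"
      have en: "norm e \<le> 3 / 32 * h" unfolding e_def using norm_triangle_ineq4[of "q - m" "x + (h / 2) *\<^sub>R v - m"] qm mn by linarith
      have qx: "q - x = (h / 2) *\<^sub>R v + e" by (simp add: e_def)
      have "e \<bullet> v \<ge> - (3 / 32 * h)" using Cauchy_Schwarz_ineq2[of e v] v(2) en by simp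
      then have ge: "(q - x) \<bullet> v \<ge> 3 / 8 * h" unfolding qx using v(2) h by (simp add: inner_add_left dot_square_norm)
      have "norm (q - x) \<le> norm ((h / 2) *\<^sub>R v) + norm e" unfolding qx by (rule norm_triangle_ineq)
      then have "norm (q - x) \<le> h / 2 + 3 / 32 * h" using v(2) en h by simp
      then have "dist p q \<le> h" using dist_triangle[of p q x] x(2) near_p h by (simp add: dist_norm norm_minus_commute)
      \<comment> \<open>A point is not among its own neighbours; p is not counted here since p - x
        is normal, whereas q has a large tangential coordinate.\<close>
      moreover have "q \<noteq> p" using ge orth[OF v(1)] h by auto
      ultimately show ?thesis using ge q by (auto simp: Nd F_def)
    qed
    then show ?thesis using Nl(2)[OF m(1)] by (intro exI[of _ F]) (auto simp: F_def)
  qed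
  have lam: "la * (norm u)\<^sup>2 \<le> (\<Sum>q\<in>N. (y q \<bullet> u)\<^sup>2)" if u: "u \<in> T x" for u
  proof (cases "u = 0")
    case False
    define v0 where "v0 = u /\<^sub>R norm u"
    have v0: "v0 \<in> T x" "norm v0 = 1" using u False subsp[OF Tx] by (auto simp: v0_def subspace_scale)
    \<comment> \<open>The barycenter is not under control, but its coordinate is non-positive along
      v0 or along - v0. In that direction subtracting it can only increase the coordinates of the
      points in F.\<close>
    obtain v where v: "v \<in> T x" "norm v = 1" "v = v0 \<or> v = - v0" "(bc - x) \<bullet> v \<le> 0"
    proof (cases "(bc - x) \<bullet> v0 \<le> 0")
      case True then show ?thesis using that[of v0] v0 by simp
    next
      case False then show ?thesis using that[of "- v0"] v0 subsp[OF Tx] by (simp add: subspace_neg)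
    qed
    obtain F where F: "F \<subseteq> N" "Nl \<le> real (card F)" "\<And>q. q \<in> F \<Longrightarrow> (q - x) \<bullet> v \<ge> 3 / 8 * h"
      using half[OF v(1,2)] by blast
    have sq: "(3 / 8 * h)\<^sup>2 \<le> (y q \<bullet> v0)\<^sup>2" if "q \<in> F" for q
    proof -
      have "y q \<bullet> v = (q - x) \<bullet> v - (bc - x) \<bullet> v" by (simp add: y_def inner_diff_left)
      then have "3 / 8 * h \<le> y q \<bullet> v" using F(3)[OF that] v(4) by linarith
      then have "(3 / 8 * h)\<^sup>2 \<le> (y q \<bullet> v)\<^sup>2" using h by (intro power_mono) auto
      then show ?thesis using v(3) by auto
    qed
    have "la = Nl * (3 / 8 * h)\<^sup>2" by (simp add: la_def power_mult_distrib power2_eq_square)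
    also have "\<dots> \<le> real (card F) * (3 / 8 * h)\<^sup>2" using F(2) by (rule mult_right_mono) simp
    also have "\<dots> = (\<Sum>q\<in>F. (3 / 8 * h)\<^sup>2)" by simp
    also have "\<dots> \<le> (\<Sum>q\<in>F. (y q \<bullet> v0)\<^sup>2)" by (rule sum_mono) (rule sq)
    also have "\<dots> \<le> (\<Sum>q\<in>N. (y q \<bullet> v0)\<^sup>2)" using fN F(1) by (intro sum_mono2) auto
    finally have "la * (norm u)\<^sup>2 \<le> (\<Sum>q\<in>N. (y q \<bullet> v0)\<^sup>2) * (norm u)\<^sup>2" by (rule mult_right_mono) simp
    also have "\<dots> = (\<Sum>q\<in>N. (y q \<bullet> u)\<^sup>2)"
    proof -
      have "u = norm u *\<^sub>R v0" using False by (simp add: v0_def)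
      then have "y q \<bullet> u = norm u * (y q \<bullet> v0)" for q by (metis inner_scaleR_right)
      then show ?thesis by (simp add: power_mult_distrib sum_distrib_left mult.commute)
    qed
    finally show ?thesis .
  qed simp
  have la: "0 < la" using h Nl by (simp add: la_def)
  note angle = top_eigenspan_angle[OF top D Tx T_Rn la lam]
  show "k_subspace d (tse P h p)" "tse P h p \<subseteq> Rn D" by (rule angle(1), assumption) (rule angle(2), assumption)
  fix w assume w: "w \<in> tse P h p"
  have Nne: "N \<noteq> {}"
  proof (cases "\<exists>v\<in>T x. v \<noteq> 0")
    case True
    then obtain v where v: "v \<in> T x" "v \<noteq> 0" by blast
    have "v /\<^sub>R norm v \<in> T x" "norm (v /\<^sub>R norm v) = 1" using v subsp[OF Tx] by (auto simp: subspace_scale)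
    then obtain F where "F \<subseteq> N" "Nl \<le> real (card F)" using half by blast
    then show ?thesis using Nl(1) by auto
  next
    case False
    then have "T x \<subseteq> {0}" by blast
    moreover obtain B where B: "orthonormal B" "card B = d" "T x = span B" using Tx by (auto simp: k_subspace_def)
    moreover have "0 \<notin> B" using B(1) by (auto simp: orthonormal_def dest!: bspec[of B _ 0])
    ultimately have "B = {}" using span_superset[of B] by blast
    then show ?thesis using B(2) D by simp
  qed
  define S where "S = (\<Sum>q\<in>N. norm (perp (T x) (q - x)))"
  have ynorm: "norm (y q) \<le> 2 * h" if "q \<in> N" for q
  proof -
    have "dist p bc \<le> h" unfolding bc_def by (rule norm_barycenter_diff_le[OF fN Nne]) (simp add: Nd)
    moreover have "dist p q \<le> h" using that by (simp add: Nd)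
    ultimately show ?thesis using dist_triangle[of q bc p] by (simp add: y_def dist_norm norm_minus_commute)
  qed
  have "(\<Sum>q\<in>N. norm (perp (T x) (y q)) * norm (y q)) \<le> (\<Sum>q\<in>N. (norm (perp (T x) (q - x)) + norm (perp (T x) (bc - x))) * (2 * h))"
  proof (intro sum_mono mult_mono ynorm)
    fix q
    have "y q = (q - x) - (bc - x)" by (simp add: y_def)
    then have "perp (T x) (y q) = perp (T x) (q - x) - perp (T x) (bc - x)" by (metis perp_diff[OF Tx])
    then show "norm (perp (T x) (y q)) \<le> norm (perp (T x) (q - x)) + norm (perp (T x) (bc - x))"
      by (metis norm_triangle_ineq4)
  qed auto
  also have "\<dots> = (S + real (card N) * norm (perp (T x) (bc - x))) * (2 * h)"
    by (simp add: S_def sum_distrib_right[symmetric] sum.distrib)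
  \<comment> \<open>Centring costs at most another S, because the normal part of the barycenter is
    the mean of those of the neighbours.\<close>
  also have "\<dots> \<le> (S + S) * (2 * h)"
    using perp_barycenter[OF Tx fN Nne, of x] h by (intro mult_right_mono) (auto simp: S_def bc_def)
  finally have sum_le: "(\<Sum>q\<in>N. norm (perp (T x) (y q)) * norm (y q)) \<le> 4 * h * S" by (simp add: algebra_simps)
  have Sb: "S \<le> Nu * (h\<^sup>2 / \<rho>) + no * r'"
  proof -
    have "S = (\<Sum>q\<in>N \<inter> M. norm (perp (T x) (q - x))) + (\<Sum>q\<in>N - M. norm (perp (T x) (q - x)))"
      unfolding S_def using sum.Int_Diff[OF fN] by blast
    moreover have "(\<Sum>q\<in>N \<inter> M. norm (perp (T x) (q - x))) \<le> Nu * (h\<^sup>2 / \<rho>)"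
    proof -
      have "norm (perp (T x) (q - x)) \<le> h\<^sup>2 / \<rho>" if q: "q \<in> N \<inter> M" for q
      proof -
        have "norm (q - x) \<le> 9 / 8 * h" using q x(2) near_p dist_triangle[of q x p] by (simp add: Nd dist_norm norm_minus_commute)
        then have "(norm (q - x))\<^sup>2 \<le> (9 / 8 * h)\<^sup>2" by (rule power_mono) simp
        also have "\<dots> \<le> 2 * h\<^sup>2" by (simp add: power_mult_distrib power2_eq_square)
        finally have "(norm (q - x))\<^sup>2 / (2 * \<rho>) \<le> h\<^sup>2 / \<rho>" using rho by (simp add: field_simps)
        then show ?thesis using perp_tangent_le[OF x(1), of q] q by simp
      qed
      then have "(\<Sum>q\<in>N \<inter> M. norm (perp (T x) (q - x))) \<le> real (card (N \<inter> M)) * (h\<^sup>2 / \<rho>)"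
        using sum_bounded_above[of "N \<inter> M" "\<lambda>q. norm (perp (T x) (q - x))" "h\<^sup>2 / \<rho>"] by simp
      also have "real (card (N \<inter> M)) * (h\<^sup>2 / \<rho>) \<le> Nu * (h\<^sup>2 / \<rho>)"
      proof -
        have "card (N \<inter> M) \<le> card (P \<inter> M \<inter> cball p h)" using P(1) by (intro card_mono) (auto simp: Nd)
        then have "real (card (N \<inter> M)) \<le> Nu" using Nu by linarith
        then show ?thesis using rho by (intro mult_right_mono) auto
      qed
      finally show ?thesis .
    qed
    moreover have "(\<Sum>q\<in>N - M. norm (perp (T x) (q - x))) \<le> no * r'"
    proof -
      have "(\<Sum>q\<in>N - M. norm (perp (T x) (q - x))) \<le> real (card (N - M)) * r'"
        using sum_bounded_above[of "N - M" "\<lambda>q. norm (perp (T x) (q - x))" r'] out(2) by (simp add: Nd)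
      also have "real (card (N - M)) * r' \<le> no * r'"
      proof -
        have "card (N - M) \<le> card ((P - M) \<inter> cball p h)" using P(1) by (intro card_mono) (auto simp: Nd)
        then have "real (card (N - M)) \<le> no" using out(1) by linarith
        then show ?thesis using out(3) by (rule mult_right_mono)
      qed
      finally show ?thesis .
    qed
    ultimately show ?thesis by linarith
  qed
  define B where "B = Nu * (h\<^sup>2 / \<rho>) + no * r'"
  have B0: "0 \<le> B" using Sb sum_nonneg[of N "\<lambda>q. norm (perp (T x) (q - x))"] by (simp add: B_def S_def)
  have "(\<Sum>q\<in>N. norm (perp (T x) (y q)) * norm (y q)) / la \<le> (4 * h * B) / la"
    using sum_le Sb h la by (intro divide_right_mono order_trans[OF sum_le] mult_left_mono) (auto simp: B_def)
  \<comment> \<open>256/9 is 4 divided by 9/64.\<close>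
  also have "\<dots> = 256 / 9 / (h * Nl) * B" using h Nl by (simp add: la_def power2_eq_square)
  also have "\<dots> \<le> 30 / (h * Nl) * B" using h Nl B0 by (intro mult_right_mono divide_right_mono) auto
  finally have "(\<Sum>q\<in>N. norm (perp (T x) (y q)) * norm (y q)) / la * norm w \<le> 30 / (h * Nl) * B * norm w"
    by (rule mult_right_mono) simp
  then show "norm (perp (T x) w) \<le> 30 / (h * Nl) * (Nu * (h\<^sup>2 / \<rho>) + no * r') * norm w"
    using angle(3)[OF _ w] unfolding B_def by force
qed

subsection \<open>Slabs\<close>

lemma slab_subset_cball:
  assumes "0 \<le> h" "(k1 + k2 * h) * h \<le> r"
  shows "slab D k1 k2 p U h \<subseteq> cball p r"
proof
  fix q assume "q \<in> slab D k1 k2 p U h"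
  then obtain u v where q: "q = p + u + v" "norm u \<le> k1 * h" "norm v \<le> k2 * h\<^sup>2" by (auto simp: slab_def)
  have "dist p q = norm (u + v)" unfolding q(1) dist_norm by (metis add.assoc add_diff_cancel_left' norm_minus_commute)
  also have "\<dots> \<le> norm u + norm v" by (rule norm_triangle_ineq)
  also have "\<dots> \<le> (k1 + k2 * h) * h" using q by (simp add: algebra_simps power2_eq_square)
  finally show "q \<in> cball p r" using assms(2) by simp
qed

text \<open>A point of M within k h of p has normal part of order \<open>h\<^sup>2\<close> with
  respect to U: the curvature of M contributes \<open>k\<^sup>2 / (2 * \<rho>)\<close> and the tilt
  of U contributes K k.\<close>

lemma slab_contains:
  assumes p: "p \<in> M" and U: "k_subspace d U" "U \<subseteq> Rn D" and angle: "\<And>w. w \<in> U \<Longrightarrow> norm (perp (T p) w) \<le> K * h * norm w"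
    and K: "0 \<le> K" "K * h < 1" and h: "0 < h" and k: "0 \<le> k" "k \<le> k1" "k\<^sup>2 / (2 * \<rho>) + K * k \<le> k2"
  shows "M \<inter> cball p (k * h) \<subseteq> slab D k1 k2 p U h"
proof
  fix q assume q: "q \<in> M \<inter> cball p (k * h)"
  note Tp = T_sub[OF p]
  have qp: "norm (q - p) \<le> k * h" using q by (simp add: dist_norm norm_minus_commute)
  have qR: "q - p \<in> Rn D" using q p M_props(2) subspace_Rn by (meson IntD1 subsetD subspace_diff)
  define u v where "u = proj U (q - p)" and "v = perp U (q - p)"
  have u: "u \<in> U" "norm u \<le> k1 * h"
  proof -
    show "u \<in> U" unfolding u_def by (rule proj_in[OF U(1)])
    have "k * h \<le> k1 * h" using k h by (intro mult_right_mono) auto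
    then show "norm u \<le> k1 * h" using norm_proj_le[OF U(1), of "q - p"] qp by (simp add: u_def)
  qed
  have sw: "norm (perp U w) \<le> K * h * norm w" if "w \<in> T p" for w
    using k_subspace_angle_swap(2)[OF U(1) Tp angle _ K(2) that] K(1) h by simp
  have "norm v \<le> norm (perp U (proj (T p) (q - p))) + norm (perp U (perp (T p) (q - p)))"
    unfolding v_def using norm_triangle_ineq by (metis perp_add[OF U(1)] proj_add_perp[OF Tp])
  also have "norm (perp U (proj (T p) (q - p))) \<le> K * h * (k * h)"
  proof -
    have "norm (perp U (proj (T p) (q - p))) \<le> K * h * norm (proj (T p) (q - p))" by (rule sw) (rule proj_in[OF Tp])
    also have "\<dots> \<le> K * h * (k * h)" using norm_proj_le[OF Tp, of "q - p"] qp K h by (intro mult_left_mono) auto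
    finally show ?thesis .
  qed
  also have "norm (perp U (perp (T p) (q - p))) \<le> (k * h)\<^sup>2 / (2 * \<rho>)"
  proof -
    have "norm (perp U (perp (T p) (q - p))) \<le> norm (perp (T p) (q - p))" by (rule norm_perp_le[OF U(1)])
    also have "\<dots> \<le> (norm (q - p))\<^sup>2 / (2 * \<rho>)" using perp_tangent_le[OF p] q by blast
    also have "\<dots> \<le> (k * h)\<^sup>2 / (2 * \<rho>)" using qp rho by (intro divide_right_mono power_mono) auto
    finally show ?thesis .
  qed
  finally have "norm v \<le> (k\<^sup>2 / (2 * \<rho>) + K * k) * h\<^sup>2" by (simp add: power2_eq_square algebra_simps)
  also have "\<dots> \<le> k2 * h\<^sup>2" using k by (intro mult_right_mono) auto
  finally have vn: "norm v \<le> k2 * h\<^sup>2" .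
  have "v \<in> Rn D" unfolding v_def perp_def using qR proj_in[OF U(1), of "q - p"] U(2) subspace_Rn by (meson subsetD subspace_diff)
  moreover have "\<forall>w\<in>U. orthogonal v w" using inner_perp[OF U(1)] by (simp add: v_def orthogonal_def)
  moreover have "q = p + u + v" by (simp add: u_def v_def perp_def)
  ultimately show "q \<in> slab D k1 k2 p U h" unfolding slab_def mem_Collect_eq using u vn by blast
qed

text \<open>A common point q of the slab and M would have normal part at x at least \<delta> - (K k1
  + k2) \<open>h\<^sup>2\<close>, because p - x is normal and the slab is nearly tangent. The chord
  bound for q absorbs at most half of \<delta>, as \<delta> is small against \<rho>, so \<delta>
  would be of order \<open>h\<^sup>2\<close>.\<close>

lemma slab_avoids:
  assumes x: "x \<in> M" "dist p x = infdist p M" and angle: "\<And>w. w \<in> U \<Longrightarrow> norm (perp (T x) w) \<le> K * h * norm w"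
    and h: "0 < h" "h \<le> \<rho>" and near_p: "infdist p M \<le> h / 8" and K: "0 \<le> K" "0 \<le> k1" "0 \<le> k2" "k1 + k2 * h \<le> 1 / 8"
    and far: "2 * ((1 / 8)\<^sup>2 / \<rho> + K * k1 + k2) * h\<^sup>2 < infdist p M"
  shows "slab D k1 k2 p U h \<inter> M = {}"
proof (rule ccontr)
  assume "\<not> ?thesis"
  then obtain q where q: "q \<in> slab D k1 k2 p U h" "q \<in> M" by blast
  then obtain u v where uv: "q = p + u + v" "u \<in> U" "norm u \<le> k1 * h" "norm v \<le> k2 * h\<^sup>2" by (auto simp: slab_def)
  note Tx = T_sub[OF x(1)]
  define \<delta> where "\<delta> = infdist p M"
  have d: "norm (p - x) = \<delta>" "0 \<le> \<delta>" using x(2) infdist_nonneg by (auto simp: \<delta>_def dist_norm)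
  have "perp (T x) (p - x) = p - x" by (rule perp_id[OF Tx]) (rule nearest_orthogonal[OF x])
  moreover have "q - x = (p - x) + u + v" using uv by simp
  ultimately have "perp (T x) (q - x) = (p - x) + perp (T x) u + perp (T x) v"
    by (metis perp_add[OF Tx])
  then have "p - x = perp (T x) (q - x) - (perp (T x) u + perp (T x) v)" by simp
  then have "\<delta> \<le> norm (perp (T x) (q - x)) + norm (perp (T x) u + perp (T x) v)"
    using d(1) norm_triangle_ineq4 by metis
  also have "norm (perp (T x) u + perp (T x) v) \<le> norm (perp (T x) u) + norm (perp (T x) v)" by (rule norm_triangle_ineq)
  also have "norm (perp (T x) u) \<le> K * h * (k1 * h)"
    using angle[OF uv(2)] mult_left_mono[OF uv(3), of "K * h"] K h by simp
  also have "norm (perp (T x) v) \<le> k2 * h\<^sup>2" using norm_perp_le[OF Tx, of v] uv(4) by simp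
  also have "norm (perp (T x) (q - x)) \<le> \<delta> / 2 + (1 / 8)\<^sup>2 / \<rho> * h\<^sup>2"
  proof -
    have "q \<in> cball p (h / 8)" using slab_subset_cball[of h k1 k2 "h / 8" p U] K(4) h(1) q(1) mult_right_mono[OF K(4), of h] by auto
    then have "norm (q - x) \<le> \<delta> + h / 8"
      using d(1) norm_triangle_ineq[of "q - p" "p - x"] by (simp add: dist_norm norm_minus_commute)
    then have "(norm (q - x))\<^sup>2 \<le> (\<delta> + h / 8)\<^sup>2" by (rule power_mono) simp
    also have "\<dots> \<le> 2 * \<delta>\<^sup>2 + 2 * (h / 8)\<^sup>2"
      using zero_le_power2[of "\<delta> - h / 8"] by (simp add: power2_eq_square algebra_simps)
    finally have "(norm (q - x))\<^sup>2 / (2 * \<rho>) \<le> (2 * \<delta>\<^sup>2 + 2 * (h / 8)\<^sup>2) / (2 * \<rho>)"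
      using rho by (intro divide_right_mono) auto
    also have "\<dots> = \<delta> * (\<delta> / \<rho>) + (1 / 8)\<^sup>2 / \<rho> * h\<^sup>2"
      using rho by (simp add: power2_eq_square field_simps)
    also have "\<delta> * (\<delta> / \<rho>) \<le> \<delta> * (1 / 2)"
      using near_p h rho d(2) by (intro mult_left_mono) (auto simp: \<delta>_def field_simps)
    finally show ?thesis using perp_tangent_le[OF x(1) q(2)] by simp
  qed
  finally have "\<delta> \<le> 2 * ((1 / 8)\<^sup>2 / \<rho> + K * k1 + k2) * h\<^sup>2"
    by (simp add: power2_eq_square algebra_simps)
  then show False using far by (simp add: \<delta>_def)
qed

end

subsection \<open>Decluttering of a good sample\<close>

text \<open>What the deterministic argument uses of the sample. \<open>cl\<close> and
  \<open>cu\<close> are density constants of the inliers; \<open>out0\<close> bounds the outliers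
  per ball in the first step and \<open>out1\<close> those near M in later steps. \<open>K0\<close>,
  \<open>a0\<close> and \<open>k0\<close> are the first-step analogues of K / \<rho>, 1 / \<rho> and
  \<open>k1\<close>. As \<open>b * (\<beta> * (real n - 1))\<close> equals c log n, the smallness
  conditions compare outlier counts with log n.\<close>

locale good_sample = reach_manifold D d M \<rho> + bandwidths d b
  for D d M \<rho> b +
  fixes n :: nat and \<beta> c :: real and X :: "nat \<Rightarrow> euc" and tse :: tangent_estimator
    and cl cu \<sigma> k0 k1 k2 t K K0 a0 out0 out1 :: real
  assumes D: "d \<le> D" and tse: "is_TSE D d tse" and b_eq: "b = c * (ln (real n) / (\<beta> * (real n - 1)))"
    and beta: "0 < \<beta>" and n: "1 < n"
    and cl: "0 < cl" and cu: "0 < cu" and sigma: "0 < \<sigma>" "\<sigma> \<le> 1 / 16" "\<sigma> \<le> k1"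
    and k2: "0 < k2" and k0: "0 < k0" "k0 \<le> k1" and K_eq: "K = 30 * 32 ^ d * (cu / cl) + 1"
    and X_Rn: "\<And>i. i < n \<Longrightarrow> X i \<in> Rn D"
    and lower: "\<And>x r. x \<in> M \<Longrightarrow> \<sigma> * hinf \<le> r \<Longrightarrow> r \<le> 2 * h 0 \<Longrightarrow>
      cl * (\<beta> * (real n - 1)) * r ^ d \<le> real (card (X ` {..<n} \<inter> M \<inter> cball x r))"
    and upper: "\<And>x r. x \<in> M \<Longrightarrow> \<sigma> * hinf \<le> r \<Longrightarrow> r \<le> 2 * h 0 \<Longrightarrow>
      real (card (X ` {..<n} \<inter> M \<inter> cball x r)) \<le> cu * (\<beta> * (real n - 1)) * r ^ d"
    and out0: "\<And>p. p \<in> Rn D \<Longrightarrow> real (card ((X ` {..<n} - M) \<inter> cball p (h 0))) \<le> out0"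
    and out1: "\<And>x. x \<in> M \<Longrightarrow> real (card {q \<in> X ` {..<n} - M. dist q x \<le> 2 * h 1 \<and> infdist q M \<le> a0 * (h 0)\<^sup>2}) \<le> out1"
    and a0: "1 / \<rho> \<le> a0" "a0 * b powr (1 / (real d + 2)) \<le> 1 / 8" and h0: "h 0 \<le> \<rho> / 16"
    and K0: "30 * 32 ^ d * (cu / cl) / \<rho> + 60 * 16 ^ d * out0 / (cl * (b * (\<beta> * (real n - 1)))) \<le> K0" "K0 * h 0 < 1"
    and out1_small: "30 * 16 ^ d * out1 * (a0 + 3 / \<rho>) / (cl * (b * (\<beta> * (real n - 1)))) \<le> 1 / \<rho>"
    and K_small: "K / \<rho> * h 0 < 1"
    and slab: "k1 + k2 * h 0 \<le> 1 / 8" "2 * ((1 / 8)\<^sup>2 / \<rho> + K0 * k1 + k2) \<le> a0"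
      "2 * ((1 / 8)\<^sup>2 / \<rho> + K / \<rho> * k1 + k2) \<le> 1 / \<rho>"
      "k1\<^sup>2 / (2 * \<rho>) + K / \<rho> * k1 \<le> k2" "k0\<^sup>2 / (2 * \<rho>) + K0 * k0 \<le> k2"
    and t: "0 < t" "t \<le> \<beta> * cl * k0 ^ d" "out0 < t * (real n - 1) * h 0 ^ d" "out1 < t * (real n - 1) * hinf ^ d"
      "\<sigma> * hinf \<le> k0 * h 0"
begin

abbreviation S :: "euc set" where "S \<equiv> X ` {..<n}"
abbreviation W :: real where "W \<equiv> \<beta> * (real n - 1)"

definition P :: "nat \<Rightarrow> euc set" where "P = decluttered D d \<beta> k1 k2 c t tse n X"

lemma W_pos: "0 < W" using beta n by simp

lemma h_step: "h_step d c \<beta> n m = h m"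
  unfolding h_step_def bandwidth_def h_def b_eq[symmetric] ..

lemma h_inf: "h_inf d c \<beta> n = hinf"
  unfolding h_inf_def bandwidth_def hinf_def b_eq[symmetric] ..

lemma P_Suc: "P (Suc m) = {p \<in> P m. t * (real n - 1) * h m ^ d \<le>
    real (card (slab D k1 k2 p (tse (P m) (h m) p) (h m) \<inter> P m))}"
  by (simp add: P_def slab_declutter_def Let_def h_step)

lemma P_0: "P 0 = S" by (simp add: P_def)

lemma P_sub: "P m \<subseteq> S"
  by (induction m) (auto simp: P_0 P_Suc)

lemma S: "finite S" "S \<subseteq> Rn D" using X_Rn by auto

lemma P_fin: "finite (P m)" "P m \<subseteq> Rn D"
  using P_sub S finite_subset by blast+

lemma rho_h: "h m \<le> \<rho> / 16" using h_antimono[of 0 m] h0 by simp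

text \<open>Common to all steps. The ball of radius g about p lies in the ball of radius 2 g about
  x, and the lower bound uses balls of radius g / 16; the ratio of the radii gives
  \<open>32 ^ d\<close>.\<close>

lemma tangent_estimate:
  assumes Q: "S \<inter> M \<subseteq> Q" "Q \<subseteq> S" and p: "p \<in> Q" and g: "hinf \<le> g" "g \<le> h 0"
    and near_p: "infdist p M \<le> g / 8" and x: "x \<in> M" "dist p x = infdist p M"
    and out: "real (card ((Q - M) \<inter> cball p g)) \<le> no" "\<forall>q\<in>Q - M. dist p q \<le> g \<longrightarrow> norm (perp (T x) (q - x)) \<le> r'" "0 \<le> r'"
  shows "k_subspace d (tse Q g p)" "tse Q g p \<subseteq> Rn D"
    "\<And>w. w \<in> tse Q g p \<Longrightarrow> norm (perp (T x) w) \<le>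
      (30 * 32 ^ d * (cu / cl) * (g / \<rho>) + 30 * 16 ^ d * (no * r') / (cl * W * g ^ (d + 1))) * norm w"
proof -
  have gp: "0 < g" using g hinf_pos by simp
  define Nl where "Nl = cl * W * (g / 16) ^ d"
  define Nu where "Nu = cu * W * (2 * g) ^ d"
  have QM: "Q \<inter> M = S \<inter> M" using Q by blast
  have Qf: "finite Q" "Q \<subseteq> Rn D" using Q S finite_subset by blast+
  have sg: "\<sigma> * hinf \<le> g / 16"
    using mult_mono[OF sigma(2) g(1)] sigma(1) hinf_pos by simp
  have Nl: "0 < Nl" using cl W_pos gp by (simp add: Nl_def)
  have low: "Nl \<le> real (card (Q \<inter> M \<inter> cball m (g / 16)))" if "m \<in> M" for m
    unfolding QM Nl_def by (rule lower) (use that sg g gp in auto)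
  have up: "real (card (Q \<inter> M \<inter> cball p g)) \<le> Nu"
  proof -
    have "cball p g \<subseteq> cball x (2 * g)"
    proof
      fix q assume "q \<in> cball p g"
      then show "q \<in> cball x (2 * g)" using dist_triangle[of x q p] x(2) near_p gp by (simp add: dist_commute)
    qed
    then have "card (Q \<inter> M \<inter> cball p g) \<le> card (S \<inter> M \<inter> cball x (2 * g))"
      unfolding QM using S(1) by (intro card_mono) auto
    also have "real \<dots> \<le> Nu" unfolding Nu_def by (rule upper[OF x(1)]) (use sg g gp in auto)
    finally show ?thesis by simp
  qed
  have g16: "g \<le> \<rho> / 16" using g h0 by simp
  have out2: "norm (perp (T x) (q - x)) \<le> r'" if "q \<in> Q - M" "dist p q \<le> g" for q using out(2) that by blast
  show "k_subspace d (tse Q g p)" "tse Q g p \<subseteq> Rn D"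
    using TSE_angle(1,2)[OF d1 D tse Qf p gp g16 near_p x Nl _ up out(1) _ out(3)] low out2 by auto
  fix w assume w: "w \<in> tse Q g p"
  have "30 / (g * Nl) * (Nu * (g\<^sup>2 / \<rho>) + no * r') = 30 * (Nu / Nl) * (g / \<rho>) + 30 * (no * r') / (g * Nl)"
    using gp Nl rho by (simp add: field_simps power2_eq_square)
  also have "Nu / Nl = 32 ^ d * (cu / cl)"
  proof -
    have "(2 * g) ^ d = (32 * (g / 16)) ^ d" by simp
    also have "\<dots> = 32 ^ d * (g / 16) ^ d" by (rule power_mult_distrib)
    finally have "Nu / Nl = (cu * (W * (g / 16) ^ d) * 32 ^ d) / (cl * (W * (g / 16) ^ d))"
      by (simp add: Nu_def Nl_def mult_ac)
    moreover have "W * (g / 16) ^ d > 0" using gp by (intro mult_pos_pos[OF W_pos]) auto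
    then have "W * (g / 16) ^ d \<noteq> 0" by linarith
    ultimately show ?thesis using cl by (simp only: mult.assoc) (simp add: field_simps)
  qed
  also have "30 * (no * r') / (g * Nl) = 30 * 16 ^ d * (no * r') / (cl * W * g ^ (d + 1))"
  proof -
    have "g * Nl = cl * W * g ^ (d + 1) / 16 ^ d" by (simp add: Nl_def power_divide)
    then show ?thesis by (simp only: divide_divide_eq_right mult_ac)
  qed
  also have "30 * (32 ^ d * (cu / cl)) * (g / \<rho>) = 30 * 32 ^ d * (cu / cl) * (g / \<rho>)" by (simp only: mult.assoc)
  finally have "30 / (g * Nl) * (Nu * (g\<^sup>2 / \<rho>) + no * r') =
      30 * 32 ^ d * (cu / cl) * (g / \<rho>) + 30 * 16 ^ d * (no * r') / (cl * W * g ^ (d + 1))" .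
  then show "norm (perp (T x) w) \<le>
      (30 * 32 ^ d * (cu / cl) * (g / \<rho>) + 30 * 16 ^ d * (no * r') / (cl * W * g ^ (d + 1))) * norm w"
    using TSE_angle(3)[OF d1 D tse Qf p gp g16 near_p x Nl _ up out(1) _ out(3) w] low out2 by simp
qed

lemma out_nonneg: "0 \<le> out0" "0 \<le> out1"
proof -
  obtain x where x: "x \<in> M" using M_props(1) by blast
  show "0 \<le> out1" using order_trans[OF _ out1[OF x]] by simp
  show "0 \<le> out0" using order_trans[OF _ out0[of x]] x M_props(2) by auto
qed

text \<open>For an outlier in the ball no better bound than 2 h 0 is available. The identity
  \<open>h 0 ^ (d + 1) = b\<close> still makes the contribution of all of them proportional to h 0,
  with a constant that involves \<open>out0\<close>.\<close>

lemma tangent_estimate_0: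
  assumes p: "p \<in> S" "infdist p M \<le> h 0 / 8" and x: "x \<in> M" "dist p x = infdist p M"
  shows "k_subspace d (tse S (h 0) p)" "tse S (h 0) p \<subseteq> Rn D"
    "\<And>w. w \<in> tse S (h 0) p \<Longrightarrow> norm (perp (T x) w) \<le> K0 * h 0 * norm w"
proof -
  have pR: "p \<in> Rn D" using p S by blast
  have r': "\<forall>q\<in>S - M. dist p q \<le> h 0 \<longrightarrow> norm (perp (T x) (q - x)) \<le> 2 * h 0"
  proof (intro ballI impI)
    fix q assume that: "dist p q \<le> h 0"
    have "norm (perp (T x) (q - x)) \<le> norm (q - x)" by (rule norm_perp_le[OF T_sub[OF x(1)]])
    also have "\<dots> \<le> 2 * h 0" using dist_triangle[of q x p] that p(2) x(2) h_pos[of 0] by (simp add: dist_norm norm_minus_commute)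
    finally show "norm (perp (T x) (q - x)) \<le> 2 * h 0" .
  qed
  have h2: "0 \<le> 2 * h 0" using h_pos[of 0] by simp
  note E = tangent_estimate[OF Int_lower1 order_refl p(1) hinf_le order_refl p(2) x out0[OF pR] r' h2]
  show "k_subspace d (tse S (h 0) p)" "tse S (h 0) p \<subseteq> Rn D" by (rule E(1), rule E(2))
  fix w assume w: "w \<in> tse S (h 0) p"
  have "60 * 16 ^ d * out0 / (cl * (b * W)) * h 0 = 60 * 16 ^ d * out0 / (cl * (h 0 ^ (d + 1) * W)) * h 0"
    by (simp only: h_0)
  then have eq: "30 * 16 ^ d * (out0 * (2 * h 0)) / (cl * W * h 0 ^ (d + 1)) = 60 * 16 ^ d * out0 / (cl * (b * W)) * h 0"
    by (simp add: mult_ac)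
  have "30 * 32 ^ d * (cu / cl) * (h 0 / \<rho>) + 30 * 16 ^ d * (out0 * (2 * h 0)) / (cl * W * h 0 ^ (d + 1))
      = (30 * 32 ^ d * (cu / cl) / \<rho> + 60 * 16 ^ d * out0 / (cl * (b * W))) * h 0"
    unfolding eq by (simp add: algebra_simps)
  also have "\<dots> \<le> K0 * h 0" using K0(1) h_pos[of 0] by (intro mult_right_mono) auto
  finally have "30 * 32 ^ d * (cu / cl) * (h 0 / \<rho>) + 30 * 16 ^ d * (out0 * (2 * h 0)) / (cl * W * h 0 ^ (d + 1)) \<le> K0 * h 0" .
  then show "norm (perp (T x) w) \<le> K0 * h 0 * norm w"
    by (intro order_trans[OF E(3)[OF w]] mult_right_mono) auto
qed

text \<open>An outlier within r of M has normal part at most r plus the chord bound for its foot.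
  The hypothesis on b r turns the share of the outliers into g times a multiple of
  \<open>out1 / (b * W)\<close>, a bounded number over c log n, which \<open>out1_small\<close>
  keeps below 1 / \<rho>. The scale g is left free because the final tangent spaces are taken at
  \<open>hinf\<close>.\<close>

lemma tangent_estimate_1:
  assumes Q: "S \<inter> M \<subseteq> Q" "Q \<subseteq> S" and p: "p \<in> Q" and g: "hinf \<le> g" "g \<le> h 1"
    and x: "x \<in> M" "dist p x = infdist p M"
    and r: "\<forall>q\<in>Q. infdist q M \<le> r" "r \<le> g / 8" "r \<le> a0 * (h 0)\<^sup>2" "b * r \<le> a0 * g ^ (d + 2)" "0 \<le> r"
  shows "real (card ((Q - M) \<inter> cball p g)) \<le> out1" "k_subspace d (tse Q g p)" "tse Q g p \<subseteq> Rn D"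
    "\<And>w. w \<in> tse Q g p \<Longrightarrow> norm (perp (T x) w) \<le> K / \<rho> * g * norm w"
proof -
  note Tx = T_sub[OF x(1)]
  have gp: "0 < g" using g hinf_pos by simp
  have g0: "g \<le> h 0" using g h_antimono[of 0 1] by simp
  have pr: "infdist p M \<le> g / 8" using bspec[OF r(1) p] r(2) by simp
  show oc: "real (card ((Q - M) \<inter> cball p g)) \<le> out1"
  proof -
    have "(Q - M) \<inter> cball p g \<subseteq> {q \<in> S - M. dist q x \<le> 2 * h 1 \<and> infdist q M \<le> a0 * (h 0)\<^sup>2}"
    proof safe
      fix q assume q: "q \<in> Q" "q \<in> cball p g" "q \<notin> M"
      show "infdist q M \<le> a0 * (h 0)\<^sup>2" using bspec[OF r(1) q(1)] r(3) by simp
      show "dist q x \<le> 2 * h 1" using dist_triangle[of q x p] q x(2) pr g gp by (simp add: dist_commute)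
    qed (use Q in auto)
    then have "card ((Q - M) \<inter> cball p g) \<le> card {q \<in> S - M. dist q x \<le> 2 * h 1 \<and> infdist q M \<le> a0 * (h 0)\<^sup>2}"
      by (intro card_mono) (use S in auto)
    then show ?thesis using out1[OF x(1)] by linarith
  qed
  have r': "\<forall>q\<in>Q - M. dist p q \<le> g \<longrightarrow> norm (perp (T x) (q - x)) \<le> r + 3 * (g\<^sup>2 / \<rho>)"
  proof (intro ballI impI)
    fix q assume q: "q \<in> Q - M" "dist p q \<le> g"
    have iq: "infdist q M \<le> r" using r(1) q(1) by blast
    have "q - x = (q - near q) + (near q - x)" by simp
    then have "perp (T x) (q - x) = perp (T x) (q - near q) + perp (T x) (near q - x)" by (metis perp_add[OF Tx])
    then have "norm (perp (T x) (q - x)) \<le> norm (perp (T x) (q - near q)) + norm (perp (T x) (near q - x))"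
      by (metis norm_triangle_ineq)
    also have "norm (perp (T x) (q - near q)) \<le> r"
      using norm_perp_le[OF Tx, of "q - near q"] near(2)[of q] iq by (simp add: dist_norm)
    also have "norm (perp (T x) (near q - x)) \<le> 3 * (g\<^sup>2 / \<rho>)"
    proof -
      have "dist (near q) x \<le> dist (near q) q + dist q p + dist p x"
        using dist_triangle[of "near q" x q] dist_triangle[of q x p] by linarith
      then have "norm (near q - x) \<le> 2 * g"
        using near(2)[of q] iq r(2) q pr x(2) gp by (simp add: dist_norm norm_minus_commute)
      then have "(norm (near q - x))\<^sup>2 \<le> (2 * g)\<^sup>2" by (rule power_mono) simp
      then have "(norm (near q - x))\<^sup>2 / (2 * \<rho>) \<le> (2 * g)\<^sup>2 / (2 * \<rho>)" using rho by (intro divide_right_mono) auto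
      also have "\<dots> = 2 * (g\<^sup>2 / \<rho>)" by (simp add: power_mult_distrib)
      also have "\<dots> \<le> 3 * (g\<^sup>2 / \<rho>)" using rho by (intro mult_right_mono) auto
      finally show ?thesis using perp_tangent_le[OF x(1) near(1)[of q]] by linarith
    qed
    finally show "norm (perp (T x) (q - x)) \<le> r + 3 * (g\<^sup>2 / \<rho>)" by simp
  qed
  have r'0: "0 \<le> r + 3 * (g\<^sup>2 / \<rho>)" using r(5) rho by simp
  note E = tangent_estimate[OF Q p g(1) g0 pr x oc r' r'0]
  show "k_subspace d (tse Q g p)" "tse Q g p \<subseteq> Rn D" by (rule E(1), rule E(2))
  fix w assume w: "w \<in> tse Q g p"
  have bg: "b \<le> g ^ d" using power_mono[OF g(1), of d] hinf_pos hinf_d by simp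
  have "30 * 16 ^ d * (out1 * (r + 3 * (g\<^sup>2 / \<rho>))) / (cl * W * g ^ (d + 1)) \<le> 1 / \<rho> * g"
  proof -
    have "b * (r + 3 * (g\<^sup>2 / \<rho>)) \<le> a0 * g ^ (d + 2) + g ^ d * (3 * (g\<^sup>2 / \<rho>))"
      unfolding distrib_left using r(4) bg rho by (intro add_mono mult_right_mono) auto
    also have "\<dots> = (a0 + 3 / \<rho>) * g * g ^ (d + 1)" by (simp add: power_add power2_eq_square algebra_simps)
    finally have 1: "b * (r + 3 * (g\<^sup>2 / \<rho>)) \<le> (a0 + 3 / \<rho>) * g * g ^ (d + 1)" .
    have cW: "0 < cl * (b * W)" using cl W_pos b by simp
    have "30 * 16 ^ d * (out1 * (r + 3 * (g\<^sup>2 / \<rho>))) / (cl * W * g ^ (d + 1))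
        = 30 * 16 ^ d * out1 * (b * (r + 3 * (g\<^sup>2 / \<rho>))) / (cl * (b * W) * g ^ (d + 1))"
      using b gp by (simp add: divide_simps)
    also have "\<dots> \<le> 30 * 16 ^ d * out1 * ((a0 + 3 / \<rho>) * g * g ^ (d + 1)) / (cl * (b * W) * g ^ (d + 1))"
      using 1 out_nonneg cW gp by (intro divide_right_mono mult_left_mono) auto
    also have "\<dots> = 30 * 16 ^ d * out1 * (a0 + 3 / \<rho>) / (cl * (b * W)) * g"
      using gp by simp
    also have "\<dots> \<le> 1 / \<rho> * g" using out1_small gp by (intro mult_right_mono) auto
    finally show ?thesis .
  qed
  then have "30 * 32 ^ d * (cu / cl) * (g / \<rho>) + 30 * 16 ^ d * (out1 * (r + 3 * (g\<^sup>2 / \<rho>))) / (cl * W * g ^ (d + 1)) \<le> K / \<rho> * g"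
    unfolding K_eq by (simp add: add_divide_distrib algebra_simps)
  then show "norm (perp (T x) w) \<le> K / \<rho> * g * norm w"
    by (intro order_trans[OF E(3)[OF w]] mult_right_mono) auto
qed

lemma K_pos: "1 \<le> K" using cu cl by (simp add: K_eq)

lemma K0_nonneg: "0 \<le> K0"
proof -
  have "0 \<le> 30 * 32 ^ d * (cu / cl) / \<rho> + 60 * 16 ^ d * out0 / (cl * (b * W))"
    using cu cl rho out_nonneg b W_pos by (intro add_nonneg_nonneg) auto
  then show ?thesis using K0(1) by linarith
qed

text \<open>After \<open>m\<close> steps all remaining points lie within \<open>r m\<close> of \<open>M\<close>. The first step has a worse constant because
  a ball of radius \<open>h 0\<close> may contain of the order of \<open>log n\<close> outliers. From then on the outliers that can still
  interfere lie in a thin tube around \<open>M\<close>, where their number per ball is bounded.\<close>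

definition r :: "nat \<Rightarrow> real" where
  "r m = (if m = 1 then a0 * (h 0)\<^sup>2 else (h (m - 1))\<^sup>2 / \<rho>)"

lemma a0_pos: "0 < a0" using a0(1) rho by (meson divide_pos_pos less_le_trans zero_less_one)

lemma r_props:
  assumes "1 \<le> m"
  shows "r m \<le> h m / 8" "r m \<le> a0 * (h 0)\<^sup>2" "b * r m \<le> a0 * h m ^ (d + 2)" "0 \<le> r m"
proof -
  obtain k where k: "m = Suc k" using assms by (cases m) auto
  have r1: "r m \<le> a0 * (h k)\<^sup>2"
    using mult_right_mono[OF a0(1), of "(h k)\<^sup>2"] by (auto simp: r_def k)
  have "a0 * (h k)\<^sup>2 \<le> (a0 * b powr (1 / (real d + 2))) * h m"
    using mult_left_mono[OF h_square_le[of k], of a0] a0_pos by (simp add: k mult.assoc)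
  also have "\<dots> \<le> 1 / 8 * h m" using a0(2) h_pos[of m] by (intro mult_right_mono) auto
  finally show "r m \<le> h m / 8" using r1 by simp
  have "(h k)\<^sup>2 \<le> (h 0)\<^sup>2" using h_antimono[of 0 k] h_pos[of k] by (intro power_mono) auto
  then show "r m \<le> a0 * (h 0)\<^sup>2" using r1 mult_left_mono[of "(h k)\<^sup>2" "(h 0)\<^sup>2" a0] a0_pos by linarith
  have "b * r m \<le> b * (a0 * (h k)\<^sup>2)" using r1 b by (intro mult_left_mono) auto
  also have "\<dots> = a0 * h m ^ (d + 2)" using h_rec[of k] by (simp add: k mult.left_commute)
  finally show "b * r m \<le> a0 * h m ^ (d + 2)" .
  show "0 \<le> r m" using a0_pos rho by (simp add: r_def)
qed

section \<open>Which points survive a decluttering step\<close>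

lemma threshold_le:
  assumes "0 < k" "k0 \<le> k" "0 < g"
  shows "t * (real n - 1) * g ^ d \<le> cl * W * (k * g) ^ d"
proof -
  have "t \<le> \<beta> * cl * k ^ d"
  proof -
    have "\<beta> * cl * k0 ^ d \<le> \<beta> * cl * k ^ d"
      using power_mono[OF assms(2), of d] k0(1) beta cl by (intro mult_left_mono) auto
    then show ?thesis using t(2) by linarith
  qed
  then have "t * ((real n - 1) * g ^ d) \<le> (\<beta> * cl * k ^ d) * ((real n - 1) * g ^ d)"
    using n assms(3) by (intro mult_right_mono) auto
  then show ?thesis by (simp add: power_mult_distrib mult_ac)
qed

lemma slab_small: "k1 + k2 * h m \<le> 1 / 8"
  using slab(1) mult_left_mono[OF h_antimono[of 0 m], of k2] k2 by linarith

lemma slab_cball: "slab D k1 k2 p U (h m) \<subseteq> cball p (h m)" "slab D k1 k2 p U (h m) \<subseteq> cball p (h m / 8)"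
proof -
  have "(k1 + k2 * h m) * h m \<le> 1 / 8 * h m" using slab_small[of m] h_pos[of m] by (intro mult_right_mono) auto
  then show "slab D k1 k2 p U (h m) \<subseteq> cball p (h m / 8)" "slab D k1 k2 p U (h m) \<subseteq> cball p (h m)"
    using h_pos[of m] by (intro slab_subset_cball; linarith)+
qed

text \<open>The radius factor k is \<open>k0\<close> in the first step, where the angle constant is
  worse, and \<open>k1\<close> afterwards; t is calibrated to the smaller value \<open>k0\<close>
  and so serves both.\<close>

lemma keep_point:
  assumes Q: "S \<inter> M \<subseteq> Q" "Q \<subseteq> S" and p: "p \<in> S \<inter> M"
    and U: "k_subspace d U" "U \<subseteq> Rn D" and angle: "\<And>w. w \<in> U \<Longrightarrow> norm (perp (T p) w) \<le> K' * h m * norm w"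
    and K': "0 \<le> K'" "K' * h m < 1" and k: "0 < k" "k0 \<le> k" "k \<le> k1" "k\<^sup>2 / (2 * \<rho>) + K' * k \<le> k2" "\<sigma> * hinf \<le> k * h m"
  shows "t * (real n - 1) * h m ^ d \<le> real (card (slab D k1 k2 p U (h m) \<inter> Q))"
proof -
  have sub: "M \<inter> cball p (k * h m) \<subseteq> slab D k1 k2 p U (h m)"
    by (rule slab_contains[OF _ U angle K' h_pos]) (use p k in auto)
  have "k * h m \<le> 2 * h 0"
  proof -
    have "k \<le> 2" using k(3) slab(1) k2 mult_pos_pos[OF k2 h_pos[of 0]] by linarith
    then have "k * h m \<le> 2 * h 0" using h_antimono[of 0 m] h_pos[of m] k(1) by (intro mult_mono) auto
    then show ?thesis .
  qed
  then have "cl * W * (k * h m) ^ d \<le> real (card (S \<inter> M \<inter> cball p (k * h m)))"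
    using lower[of p "k * h m"] p k(5) by auto
  also have "\<dots> \<le> real (card (slab D k1 k2 p U (h m) \<inter> Q))"
    using sub Q S(1) finite_subset[OF Q(2)] by (intro of_nat_mono card_mono) auto
  finally show ?thesis using threshold_le[OF k(1,2) h_pos[of m]] by linarith
qed

lemma drop_point:
  assumes avoid: "slab D k1 k2 p U (h m) \<inter> M = {}" and Q: "Q \<subseteq> S" and out: "real (card ((Q - M) \<inter> cball p (h m))) < t * (real n - 1) * h m ^ d"
  shows "\<not> t * (real n - 1) * h m ^ d \<le> real (card (slab D k1 k2 p U (h m) \<inter> Q))"
proof -
  have "slab D k1 k2 p U (h m) \<inter> Q \<subseteq> (Q - M) \<inter> cball p (h m)" using avoid slab_cball(1)[of p U m] by blast
  then have "card (slab D k1 k2 p U (h m) \<inter> Q) \<le> card ((Q - M) \<inter> cball p (h m))"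
    using finite_subset[OF Q] S(1) by (intro card_mono) auto
  then show ?thesis using out by linarith
qed

lemma first_step: "S \<inter> M \<subseteq> P 1" "p \<in> P 1 \<Longrightarrow> infdist p M \<le> r 1"
proof -
  show "S \<inter> M \<subseteq> P 1"
  proof
    fix p assume p: "p \<in> S \<inter> M"
    then have p': "p \<in> S" "p \<in> M" by auto
    have i: "infdist p M \<le> h 0 / 8" "dist p p = infdist p M" using p h_pos[of 0] by (auto simp: less_imp_le)
    note te = tangent_estimate_0[OF p'(1) i(1) p'(2) i(2)]
    have "t * (real n - 1) * h 0 ^ d \<le> real (card (slab D k1 k2 p (tse S (h 0) p) (h 0) \<inter> S))"
      by (rule keep_point[OF _ _ p te K0_nonneg K0(2) k0(1) order_refl k0(2) slab(5) t(5)]) auto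
    then show "p \<in> P 1" using p by (simp add: P_Suc[of 0, simplified] P_0)
  qed
  show "infdist p M \<le> r 1" if p: "p \<in> P 1" for p
  proof (rule ccontr)
    assume far: "\<not> ?thesis"
    have pS: "p \<in> S" and ret: "t * (real n - 1) * h 0 ^ d \<le> real (card (slab D k1 k2 p (tse S (h 0) p) (h 0) \<inter> S))"
      using p by (auto simp: P_Suc[of 0, simplified] P_0)
    \<comment> \<open>Far from M no tangent estimate is available, but the slab lies within h 0 / 8
      of p and misses M for that reason alone.\<close>
    have "slab D k1 k2 p (tse S (h 0) p) (h 0) \<inter> M = {}"
    proof (cases "infdist p M \<le> h 0 / 8")
      case True
      note te = tangent_estimate_0[OF pS True near]
      show ?thesis
      proof (rule slab_avoids[OF near te(3) h_pos _ True K0_nonneg _ _ slab(1)])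
        have "2 * ((1 / 8)\<^sup>2 / \<rho> + K0 * k1 + k2) * (h 0)\<^sup>2 \<le> a0 * (h 0)\<^sup>2" using slab(2) by (intro mult_right_mono) auto
        then show "2 * ((1 / 8)\<^sup>2 / \<rho> + K0 * k1 + k2) * (h 0)\<^sup>2 < infdist p M" using far by (simp add: r_def)
      qed (use h0 rho k0 k2 in auto)
    next
      case False
      show ?thesis
      proof (rule ccontr)
        assume "slab D k1 k2 p (tse S (h 0) p) (h 0) \<inter> M \<noteq> {}"
        then obtain q where "q \<in> M" "q \<in> cball p (h 0 / 8)" using slab_cball(2)[of p _ 0] by blast
        then show False using infdist_le[of q M p] False by simp
      qed
    qed
    moreover have "p \<in> Rn D" using pS S by blast
    ultimately show False
      using drop_point[of p _ 0 S] ret out0[of p] t(3) by auto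
  qed
qed

lemma next_step:
  assumes m: "1 \<le> m" and I: "S \<inter> M \<subseteq> P m" "\<And>p. p \<in> P m \<Longrightarrow> infdist p M \<le> r m"
  shows "S \<inter> M \<subseteq> P (Suc m)" "p \<in> P (Suc m) \<Longrightarrow> infdist p M \<le> r (Suc m)"
proof -
  have hm1: "h m \<le> h 1" using m by (rule h_antimono)
  have Km: "K / \<rho> * h m < 1"
  proof -
    have "K / \<rho> * h m \<le> K / \<rho> * h 0" using h_antimono[of 0 m] K_pos rho by (intro mult_left_mono) auto
    then show ?thesis using K_small by linarith
  qed
  have K0': "0 \<le> K / \<rho>" using K_pos rho by simp
  have I2: "\<forall>p\<in>P m. infdist p M \<le> r m" using I(2) by blast
  note te = tangent_estimate_1[OF I(1) P_sub _ hinf_le hm1 _ _ I2 r_props[OF m]]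
  show "S \<inter> M \<subseteq> P (Suc m)"
  proof
    fix p assume p: "p \<in> S \<inter> M"
    then have pM: "p \<in> M" "dist p p = infdist p M" and pP: "p \<in> P m" using I by auto
    have sg: "\<sigma> * hinf \<le> k1 * h m" using sigma hinf_le[of m] hinf_pos by (intro mult_mono) auto
    have "t * (real n - 1) * h m ^ d \<le> real (card (slab D k1 k2 p (tse (P m) (h m) p) (h m) \<inter> P m))"
      by (rule keep_point[OF I(1) P_sub p te(2,3,4)[OF pP pM] K0' Km _ k0(2) order_refl slab(4) sg])
        (use k0 in auto)
    then show "p \<in> P (Suc m)" using pP by (simp add: P_Suc)
  qed
  show "infdist p M \<le> r (Suc m)" if p: "p \<in> P (Suc m)" for p
  proof (rule ccontr)
    assume far: "\<not> ?thesis"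
    have pP: "p \<in> P m" and ret: "t * (real n - 1) * h m ^ d \<le> real (card (slab D k1 k2 p (tse (P m) (h m) p) (h m) \<inter> P m))"
      using p by (auto simp: P_Suc)
    note te = te[OF pP near]
    have "slab D k1 k2 p (tse (P m) (h m) p) (h m) \<inter> M = {}"
    proof (rule slab_avoids[OF near te(4) h_pos _ _ K0' _ _ slab_small])
      show "infdist p M \<le> h m / 8" using I(2)[OF pP] r_props(1)[OF m] by simp
      have "2 * ((1 / 8)\<^sup>2 / \<rho> + K / \<rho> * k1 + k2) * (h m)\<^sup>2 \<le> 1 / \<rho> * (h m)\<^sup>2" using slab(3) by (intro mult_right_mono) auto
      also have "\<dots> = r (Suc m)" using m by (simp add: r_def)
      finally show "2 * ((1 / 8)\<^sup>2 / \<rho> + K / \<rho> * k1 + k2) * (h m)\<^sup>2 < infdist p M" using far by simp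
    qed (use rho_h[of m] rho k0 k2 in auto)
    moreover have "real (card ((P m - M) \<inter> cball p (h m))) < t * (real n - 1) * h m ^ d"
    proof -
      \<comment> \<open>\<open>hinf\<close> lies below all bandwidths, so a single condition on the
        threshold covers every later step.\<close>
      have "t * (real n - 1) * hinf ^ d \<le> t * (real n - 1) * h m ^ d"
        using power_mono[OF hinf_le[of m], of d] hinf_pos t(1) n by (intro mult_left_mono) auto
      then show ?thesis using te(1) t(4) by linarith
    qed
    ultimately show False using drop_point[OF _ P_sub] ret by blast
  qed
qed

lemma decluttered_invariant: "S \<inter> M \<subseteq> P (Suc m) \<and> (\<forall>p\<in>P (Suc m). infdist p M \<le> r (Suc m))"
proof (induction m)
  case 0
  then show ?case using first_step by simp
next
  case (Suc m)
  then show ?case using next_step[of "Suc m"] by auto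
qed

section \<open>The index k-hat and the final point cloud\<close>

definition kh :: nat where "kh = k_hat d \<rho> \<beta> c M n X"

text \<open>The least index exists: the bandwidths decrease to \<open>hinf\<close>, and finitely
  many strict inequalities at the limit already hold for some large k.\<close>

lemma k_hat_gap: "i < n \<Longrightarrow> hinf\<^sup>2 / \<rho> < infdist (X i) M \<Longrightarrow> (h kh)\<^sup>2 / \<rho> < infdist (X i) M"
proof -
  let ?Pr = "\<lambda>k. \<forall>j<n. (h_inf d c \<beta> n)\<^sup>2 / \<rho> < infdist (X j) M \<longrightarrow> (h_step d c \<beta> n k)\<^sup>2 / \<rho> < infdist (X j) M"
  have "\<forall>\<^sub>F k in sequentially. (h k)\<^sup>2 / \<rho> < infdist (X j) M" if "hinf\<^sup>2 / \<rho> < infdist (X j) M" for j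
  proof -
    have "(\<lambda>k. (h k)\<^sup>2 / \<rho>) \<longlonglongrightarrow> hinf\<^sup>2 / \<rho>" by (intro tendsto_intros h_lim) (use rho in simp)
    then show ?thesis using that by (rule order_tendstoD(2))
  qed
  then have "\<forall>\<^sub>F k in sequentially. \<forall>j\<in>{j. j < n \<and> hinf\<^sup>2 / \<rho> < infdist (X j) M}. (h k)\<^sup>2 / \<rho> < infdist (X j) M"
    by (intro eventually_ball_finite) auto
  then obtain k where "\<forall>j\<in>{j. j < n \<and> hinf\<^sup>2 / \<rho> < infdist (X j) M}. (h k)\<^sup>2 / \<rho> < infdist (X j) M"
    using eventually_happens' sequentially_bot by blast
  then have "?Pr k" by (simp add: h_step h_inf)
  then have "?Pr (LEAST k. ?Pr k)" by (rule LeastI)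
  then show "i < n \<Longrightarrow> hinf\<^sup>2 / \<rho> < infdist (X i) M \<Longrightarrow> (h kh)\<^sup>2 / \<rho> < infdist (X i) M"
    unfolding kh_def k_hat_def[symmetric] by (simp add: h_step h_inf)
qed

text \<open>\<open>P (kh + 2)\<close> lies within \<open>(h (Suc kh))\<^sup>2 / \<rho>\<close> of M,
  hence within \<open>(h kh)\<^sup>2 / \<rho>\<close>. By the choice of k-hat no sample point has
  distance above \<open>hinf\<^sup>2 / \<rho>\<close> and at most that value.\<close>

lemma final_points: "S \<inter> M \<subseteq> P (kh + 2)" "p \<in> P (kh + 2) \<Longrightarrow> infdist p M \<le> hinf\<^sup>2 / \<rho>"
proof -
  show "S \<inter> M \<subseteq> P (kh + 2)" using decluttered_invariant[of "kh + 1"] by simp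
  assume p: "p \<in> P (kh + 2)"
  then have i: "infdist p M \<le> r (kh + 2)" using decluttered_invariant[of "kh + 1"] by simp
  have "r (kh + 2) = (h (Suc kh))\<^sup>2 / \<rho>" by (simp add: r_def)
  also have "\<dots> \<le> (h kh)\<^sup>2 / \<rho>" using h_Suc[of kh] h_pos[of "Suc kh"] rho by (intro divide_right_mono power_mono) auto
  finally have le: "infdist p M \<le> (h kh)\<^sup>2 / \<rho>" using i by simp
  obtain j where "j < n" "p = X j" using p P_sub by blast
  then show "infdist p M \<le> hinf\<^sup>2 / \<rho>" using k_hat_gap[of j] le by force
qed

text \<open>The angle is stated for true tangent vectors against the estimated space, the direction
  in which the bumps tilt M; \<open>k_subspace_angle_swap\<close> reverses the PCA bound.\<close>

lemma final_tangent:
  assumes p: "p \<in> P (kh + 2)" and x: "x \<in> M" "dist p x = infdist p M"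
  shows "k_subspace d (tse (P (kh + 2)) hinf p)" "tse (P (kh + 2)) hinf p \<subseteq> Rn D"
    "\<And>v. v \<in> T x \<Longrightarrow> norm (perp (tse (P (kh + 2)) hinf p) v) \<le> K / \<rho> * hinf * norm v"
proof -
  have r: "hinf\<^sup>2 / \<rho> \<le> hinf / 8"
  proof -
    have "hinf * (hinf / \<rho>) \<le> hinf * (1 / 16)" using hinf_le[of 0] h0 hinf_pos rho
      by (intro mult_left_mono) (auto simp: field_simps)
    then have "hinf\<^sup>2 / \<rho> \<le> hinf / 16" by (simp add: power2_eq_square)
    then show ?thesis using hinf_pos by linarith
  qed
  have r2: "hinf\<^sup>2 / \<rho> \<le> a0 * (h 0)\<^sup>2"
    using mult_mono[OF a0(1) power_mono[OF hinf_le[of 0], of 2]] hinf_pos a0_pos by simp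
  have r3: "b * (hinf\<^sup>2 / \<rho>) \<le> a0 * hinf ^ (d + 2)"
  proof -
    have "0 \<le> b * hinf\<^sup>2" using b by simp
    then show ?thesis using mult_right_mono[OF a0(1), of "b * hinf\<^sup>2"] unfolding power_add hinf_d by simp
  qed
  have r4: "0 \<le> hinf\<^sup>2 / \<rho>" using rho by simp
  have fp: "\<forall>p\<in>P (kh + 2). infdist p M \<le> hinf\<^sup>2 / \<rho>" using final_points(2) by blast
  note te = tangent_estimate_1[OF final_points(1) P_sub p order_refl hinf_le x fp r r2 r3 r4]
  show k: "k_subspace d (tse (P (kh + 2)) hinf p)" "tse (P (kh + 2)) hinf p \<subseteq> Rn D" using te(2,3) by auto
  have "K / \<rho> * hinf \<le> K / \<rho> * h 0" using hinf_le[of 0] K_pos rho by (intro mult_left_mono) auto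
  then have lt: "K / \<rho> * hinf < 1" using K_small by linarith
  have ge: "0 \<le> K / \<rho> * hinf" using K_pos rho hinf_pos by simp
  show "norm (perp (tse (P (kh + 2)) hinf p) v) \<le> K / \<rho> * hinf * norm v" if "v \<in> T x" for v
    by (rule k_subspace_angle_swap(2)[OF k(1) T_sub[OF x(1)] te(4) ge lt that])
qed

text \<open>The sampling parameter is \<open>hinf\<close> itself, that is c' = 1: the inliers are
  \<open>\<sigma> * hinf\<close>-dense in M and the sampler adds at most \<open>hinf\<close>, which
  together stays below 3/2 \<open>hinf\<close>.\<close>

theorem recovery:
  fixes wt :: weights
  assumes wt: "\<And>D \<rho> \<epsilon> M P. d < D \<Longrightarrow> 0 < \<rho> \<Longrightarrow> 0 < \<epsilon> \<Longrightarrow> \<epsilon> \<le> \<epsilon>\<^sub>d * \<rho> \<Longrightarrow> M \<in> manifolds D d \<rho> \<Longrightarrow> eps_net \<epsilon> M P \<Longrightarrow>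
        hausdist M (carrier_of (tdc_star wt D P (tangent_space M))) \<le> C\<^sub>d * \<epsilon>\<^sup>2 / \<rho> \<and>
        ambient_isotopic D M (carrier_of (tdc_star wt D P (tangent_space M)))"
    and dD: "d < D" and fps: "is_FPS fps" and small: "(K + 4) * hinf / \<rho> \<le> 1 / 10" "hinf * (6 + 1280 * (K + 4)) \<le> \<epsilon>\<^sub>d * \<rho>"
  defines "S' \<equiv> carrier_of (M_TDC_plus wt tse fps D d \<rho> \<beta> k1 k2 c t 1 M n X)"
  shows "hausdist M S' \<le> (K + 1 + C\<^sub>d * (6 + 1280 * (K + 4))) / \<rho> * hinf\<^sup>2" "ambient_isotopic D M S'"
proof -
  let ?Q = "P (kh + 2)"
  define Y where "Y = fps ?Q hinf"
  define Tf where "Tf = tse ?Q hinf"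
  have fo: "fps_output ?Q hinf Y" using fps P_fin(1) hinf_pos unfolding is_FPS_def Y_def by (simp add: less_imp_le)
  note f = fps_output_props[OF fo less_imp_le[OF hinf_pos] P_fin(1)]
  have S'_eq: "S' = carrier_of (tdc_star wt D Y Tf)"
    by (simp add: S'_def M_TDC_plus_def Let_def Y_def Tf_def P_def kh_def h_inf)
  define \<theta> where "\<theta> = K / \<rho> * hinf"
  define \<delta> where "\<delta> = hinf\<^sup>2 / \<rho>"
  have td: "\<theta> + 4 * \<delta> / hinf = (K + 4) * hinf / \<rho>"
    using hinf_pos by (simp add: \<theta>_def \<delta>_def power2_eq_square add_divide_distrib algebra_simps)
  \<comment> \<open>Tilt and relative displacement are both proportional to the mesh
    \<open>hinf\<close>, so the mesh and \<rho> cancel and the perturbed reach is a fixed fraction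
    of \<rho>.\<close>
  have eq: "1280 * (\<theta> + 4 * \<delta> / hinf) / hinf * \<rho> = 1280 * (K + 4)"
    unfolding td using hinf_pos rho by simp
  have hr: "hinf \<le> \<rho> / 16" using hinf_le[of 0] h0 by simp
  have d0: "0 \<le> \<delta>" using rho by (simp add: \<delta>_def)
  have d4: "\<delta> \<le> hinf / 16"
  proof -
    have "hinf * hinf \<le> hinf * (\<rho> / 16)" using hr hinf_pos by (intro mult_left_mono) auto
    then show ?thesis using rho by (simp add: \<delta>_def power2_eq_square field_simps)
  qed
  have cover: "\<exists>y\<in>Y. dist x y \<le> 3 / 2 * hinf" if x: "x \<in> M" for x
  proof -
    have sh: "\<sigma> * hinf \<le> hinf / 16" using sigma hinf_pos by simp
    have "0 < cl * W * (\<sigma> * hinf) ^ d" using cl W_pos sigma hinf_pos by simp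
    also have "\<dots> \<le> real (card (S \<inter> M \<inter> cball x (\<sigma> * hinf)))"
      using lower[OF x order_refl] sh hinf_le[of 0] hinf_pos by simp
    finally have "S \<inter> M \<inter> cball x (\<sigma> * hinf) \<noteq> {}" by (intro notI) simp
    then obtain q where "q \<in> S \<inter> M \<inter> cball x (\<sigma> * hinf)" by blast
    then have q: "q \<in> S \<inter> M" "dist x q \<le> \<sigma> * hinf" by auto
    then obtain y where y: "y \<in> Y" "dist q y \<le> hinf" using f(4) final_points(1) by blast
    then have "dist x y \<le> 3 / 2 * hinf" using q(2) sh hinf_pos dist_triangle[of x y q] by linarith
    then show ?thesis using y(1) by blast
  qed
  have YQ: "y \<in> ?Q" if "y \<in> Y" for y using that f(1) by blast
  have prem: "Y \<subseteq> Rn D" "\<And>y. y \<in> Y \<Longrightarrow> infdist y M \<le> \<delta>" "\<delta> < \<rho>" "4 * \<delta> \<le> hinf"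
    "\<And>y. y \<in> Y \<Longrightarrow> k_subspace d (Tf y) \<and> Tf y \<subseteq> Rn D"
    "\<And>y x v. y \<in> Y \<Longrightarrow> x \<in> M \<Longrightarrow> dist y x = infdist y M \<Longrightarrow> v \<in> T x \<Longrightarrow> norm (perp (Tf y) v) \<le> \<theta> * norm v"
    "0 \<le> \<theta>" "\<theta> + 4 * \<delta> / hinf \<le> 1 / 10"
    "hinf * (6 + 1280 * (\<theta> + 4 * \<delta> / hinf) / hinf * \<rho>) \<le> \<epsilon>\<^sub>d * \<rho>"
  proof -
    show "Y \<subseteq> Rn D" using f(1) P_fin(2) by blast
    show "infdist y M \<le> \<delta>" if "y \<in> Y" for y using final_points(2)[OF YQ[OF that]] by (simp add: \<delta>_def)
    show "\<delta> < \<rho>" "4 * \<delta> \<le> hinf" using d4 hr rho hinf_pos by auto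
    show "k_subspace d (Tf y) \<and> Tf y \<subseteq> Rn D" if "y \<in> Y" for y
      using final_tangent(1,2)[OF YQ[OF that] near] by (simp add: Tf_def)
    show "norm (perp (Tf y) v) \<le> \<theta> * norm v" if "y \<in> Y" "x \<in> M" "dist y x = infdist y M" "v \<in> T x" for y x v
      using final_tangent(3)[OF YQ[OF that(1)] that(2,3,4)] by (simp add: Tf_def \<theta>_def)
    show "0 \<le> \<theta>" using K_pos rho hinf_pos by (simp add: \<theta>_def)
    show "\<theta> + 4 * \<delta> / hinf \<le> 1 / 10" unfolding td by (rule small)
    show "hinf * (6 + 1280 * (\<theta> + 4 * \<delta> / hinf) / hinf * \<rho>) \<le> \<epsilon>\<^sub>d * \<rho>" unfolding eq by (rule small(2))
  qed
  have "hausdist M S' \<le> \<theta> * hinf + \<delta> + C\<^sub>d * hinf\<^sup>2 * (6 + 1280 * (K + 4)) / \<rho>"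
    unfolding S'_eq eq[symmetric]
    by (rule tdc_of_perturbed_net(1)[where \<epsilon> = hinf and \<delta> = \<delta> and Tf = Tf and \<theta> = \<theta> and ?C\<^sub>d = C\<^sub>d and ?\<epsilon>\<^sub>d = \<epsilon>\<^sub>d])
      (fact wt dD manifold rho f(2,3) hinf_pos d0 cover prem)+
  also have "\<dots> = (K + 1 + C\<^sub>d * (6 + 1280 * (K + 4))) / \<rho> * hinf\<^sup>2"
    by (simp add: \<theta>_def \<delta>_def power2_eq_square add_divide_distrib algebra_simps)
  finally show "hausdist M S' \<le> (K + 1 + C\<^sub>d * (6 + 1280 * (K + 4))) / \<rho> * hinf\<^sup>2" .
  show "ambient_isotopic D M S'"
    unfolding S'_eq
    by (rule tdc_of_perturbed_net(2)[where \<epsilon> = hinf and \<delta> = \<delta> and Tf = Tf and \<theta> = \<theta> and ?C\<^sub>d = C\<^sub>d and ?\<epsilon>\<^sub>d = \<epsilon>\<^sub>d])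
      (fact wt dD manifold rho f(2,3) hinf_pos d0 cover prem)+
qed

end

subsection \<open>Counting sample points\<close>

text \<open>Counts indices, so repeated sample values count repeatedly. Under the product measure
  this is a sum of independent indicators, unlike the number of sample values in A.\<close>

definition cnt :: "nat \<Rightarrow> 'a set \<Rightarrow> (nat \<Rightarrow> 'a) \<Rightarrow> nat" where
  "cnt n A X = card {i\<in>{..<n}. X i \<in> A}"

locale iid_sample = P: prob_space P for P :: "euc measure" + fixes n :: nat
begin

abbreviation "N \<equiv> sample_measure P n"

sublocale N: prob_space N
  by (rule prob_space_PiM) (rule P.prob_space_axioms)

lemma component_measurable: "i < n \<Longrightarrow> (\<lambda>X. X i) \<in> measurable N P"
  by (rule measurable_component_singleton) simp

lemma cnt_eq_sum: "real (cnt n A X) = (\<Sum>i<n. indicator A (X i))"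
proof -
  have "(\<Sum>i<n. indicator A (X i) :: real) = real (card ({..<n} \<inter> {i. X i \<in> A}))"
    by (simp add: indicator_def sum.If_cases)
  also have "{..<n} \<inter> {i. X i \<in> A} = {i\<in>{..<n}. X i \<in> A}" by auto
  finally show ?thesis by (simp add: cnt_def)
qed

lemma cnt_measurable [measurable]:
  assumes "A \<in> sets P" shows "(\<lambda>X. real (cnt n A X)) \<in> borel_measurable N"
  unfolding cnt_eq_sum
proof (rule borel_measurable_sum)
  fix i assume "i \<in> {..<n}"
  then show "(\<lambda>X. indicator A (X i) :: real) \<in> borel_measurable N"
    using measurable_compose[OF component_measurable borel_measurable_indicator[OF assms]] by simp
qed

text \<open>The generating function of a binomial count, bounded through 1 + x \<le> exp x. It
  serves both tails: z > 1 for the upper and z < 1 for the lower one.\<close>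

lemma cnt_exp:
  assumes A: "A \<in> sets P" and z: "0 < z"
  shows "(\<integral>\<^sup>+X. ennreal (z ^ cnt n A X) \<partial>N) \<le> ennreal (exp ((z - 1) * (real n * measure P A)))"
proof -
  interpret product_sigma_finite "\<lambda>_::nat. P" by standard
  define g where "g x = ennreal (if x \<in> A then z else 1)" for x
  have gm: "g \<in> borel_measurable P" unfolding g_def using A by measurable
  have "ennreal (z ^ cnt n A X) = (\<Prod>i<n. g (X i))" for X
  proof -
    have "(\<Prod>i<n. g (X i)) = ennreal (\<Prod>i<n. if X i \<in> A then z else 1)"
      unfolding g_def using z by (intro prod_ennreal) auto
    also have "(\<Prod>i<n. if X i \<in> A then z else 1) = z ^ card {i\<in>{..<n}. X i \<in> A}"
      by (simp add: prod.If_cases Int_def)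
    finally show ?thesis by (simp add: cnt_def)
  qed
  then have "(\<integral>\<^sup>+X. ennreal (z ^ cnt n A X) \<partial>N) = (\<Prod>i<n. \<integral>\<^sup>+x. g x \<partial>P)"
    using product_nn_integral_prod[of "{..<n}" "\<lambda>_. g"] gm by simp
  also have "(\<integral>\<^sup>+x. g x \<partial>P) = ennreal (1 + (z - 1) * measure P A)"
  proof -
    have "g x = ennreal z * indicator A x + indicator (space P - A) x" if "x \<in> space P" for x
      using that by (auto simp: g_def indicator_def)
    then have "(\<integral>\<^sup>+x. g x \<partial>P) = (\<integral>\<^sup>+x. ennreal z * indicator A x + indicator (space P - A) x \<partial>P)"
      by (rule nn_integral_cong)
    also have "\<dots> = ennreal z * emeasure P A + emeasure P (space P - A)"
      using A by (simp add: nn_integral_add nn_integral_cmult)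
    also have "\<dots> = ennreal (z * measure P A + (1 - measure P A))"
      using A z P.prob_compl[OF A] by (simp add: P.emeasure_eq_measure ennreal_mult)
    finally show ?thesis by (simp add: algebra_simps)
  qed
  also have "(\<Prod>i<n. ennreal (1 + (z - 1) * measure P A)) = ennreal ((1 + (z - 1) * measure P A) ^ n)"
  proof -
    have "0 \<le> z * measure P A + (1 - measure P A)" using z P.prob_le_1[of A] by (intro add_nonneg_nonneg) auto
    then show ?thesis by (simp add: ennreal_power algebra_simps)
  qed
  also have "\<dots> \<le> ennreal (exp ((z - 1) * (real n * measure P A)))"
  proof (rule ennreal_leI)
    have "0 \<le> z * measure P A + (1 - measure P A)" using z P.prob_le_1[of A] by (intro add_nonneg_nonneg) auto
    then have "(1 + (z - 1) * measure P A) ^ n \<le> exp ((z - 1) * measure P A) ^ n"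
      using exp_ge_add_one_self[of "(z - 1) * measure P A"] by (intro power_mono) (auto simp: algebra_simps)
    also have "\<dots> = exp (real n * ((z - 1) * measure P A))" by (simp add: exp_of_nat_mult)
    finally show "(1 + (z - 1) * measure P A) ^ n \<le> exp ((z - 1) * (real n * measure P A))" by (simp add: mult_ac)
  qed
  finally show ?thesis .
qed

lemma cnt_markov:
  assumes A: "A \<in> sets P" and z: "0 < z"
  shows "measure N {X\<in>space N. z powr m \<le> z ^ cnt n A X} \<le> exp ((z - 1) * (real n * measure P A)) * z powr (- m)"
proof -
  have [measurable]: "(\<lambda>X. z ^ cnt n A X) \<in> borel_measurable N"
  proof -
    have "(\<lambda>X. z powr real (cnt n A X)) \<in> borel_measurable N" using A by measurable
    then show ?thesis using z by (simp add: powr_realpow)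
  qed
  have "emeasure N {X\<in>space N. 1 \<le> ennreal (z powr (- m)) * ennreal (z ^ cnt n A X)}
      \<le> ennreal (z powr (- m)) * (\<integral>\<^sup>+X. ennreal (z ^ cnt n A X) * indicator (space N) X \<partial>N)"
    by (rule nn_integral_Markov_inequality) auto
  also have "(\<integral>\<^sup>+X. ennreal (z ^ cnt n A X) * indicator (space N) X \<partial>N) = (\<integral>\<^sup>+X. ennreal (z ^ cnt n A X) \<partial>N)"
    by (rule nn_integral_cong) simp
  also have "ennreal (z powr (- m)) * \<dots> \<le> ennreal (z powr (- m)) * ennreal (exp ((z - 1) * (real n * measure P A)))"
    using cnt_exp[OF A z] by (rule mult_left_mono) simp
  also have "\<dots> = ennreal (exp ((z - 1) * (real n * measure P A)) * z powr (- m))"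
    by (simp add: ennreal_mult[symmetric] mult.commute)
  also have "{X\<in>space N. 1 \<le> ennreal (z powr (- m)) * ennreal (z ^ cnt n A X)} = {X\<in>space N. z powr m \<le> z ^ cnt n A X}"
  proof -
    have "1 \<le> ennreal (z powr (- m)) * ennreal (z ^ k) \<longleftrightarrow> z powr m \<le> z ^ k" for k
    proof -
      have "ennreal (z powr (- m)) * ennreal (z ^ k) = ennreal (z powr (- m) * z ^ k)"
        using z by (simp add: ennreal_mult)
      moreover have "1 \<le> ennreal (z powr (- m) * z ^ k) \<longleftrightarrow> 1 \<le> z powr (- m) * z ^ k"
        using z by (metis ennreal_1 ennreal_le_iff less_eq_real_def mult_nonneg_nonneg powr_ge_zero zero_le_power)
      moreover have "1 \<le> z powr (- m) * z ^ k \<longleftrightarrow> z powr m \<le> z ^ k"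
        using z by (simp add: powr_minus field_simps)
      ultimately show ?thesis by simp
    qed
    then show ?thesis by simp
  qed
  finally show ?thesis by (simp add: N.emeasure_eq_measure)
qed

lemma cnt_upper:
  assumes A: "A \<in> sets P" and q: "measure P A \<le> q" and z: "1 < z"
  shows "measure N {X\<in>space N. m \<le> real (cnt n A X)} \<le> exp ((z - 1) * (real n * q)) * z powr (- m)"
proof -
  have "{X\<in>space N. m \<le> real (cnt n A X)} = {X\<in>space N. z powr m \<le> z ^ cnt n A X}"
    using z by (simp add: powr_realpow[symmetric])
  then have "measure N {X\<in>space N. m \<le> real (cnt n A X)} \<le> exp ((z - 1) * (real n * measure P A)) * z powr (- m)"
    using cnt_markov[OF A, of z m] z by simp
  also have "\<dots> \<le> exp ((z - 1) * (real n * q)) * z powr (- m)"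
    using q z by (intro mult_right_mono) (auto intro!: mult_left_mono)
  finally show ?thesis .
qed

text \<open>With z = 1/2 the exponent is at most - n q / 2 + (n q / 4) ln 2, and ln 2 < 1.\<close>

lemma cnt_lower:
  assumes A: "A \<in> sets P" and q: "q \<le> measure P A" "0 \<le> q"
  shows "measure N {X\<in>space N. real (cnt n A X) \<le> real n * q / 4} \<le> exp (- (real n * q / 4))"
proof -
  let ?m = "real n * q / 4"
  have "{X\<in>space N. real (cnt n A X) \<le> ?m} = {X\<in>space N. (1 / 2) powr ?m \<le> (1 / 2) ^ cnt n A X}"
  proof -
    have "(1 / 2) powr x = 2 powr (- x)" for x :: real by (simp add: powr_def ln_div)
    then have "real k \<le> ?m \<longleftrightarrow> (1 / 2) powr ?m \<le> (1 / 2) ^ k" for k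
      by (simp add: powr_realpow[symmetric] del: powr_half_sqrt)
    then show ?thesis by simp
  qed
  then have "measure N {X\<in>space N. real (cnt n A X) \<le> ?m} \<le> exp ((1 / 2 - 1) * (real n * measure P A)) * (1 / 2) powr (- ?m)"
    using cnt_markov[OF A, of "1 / 2" ?m] by simp
  also have "(1 / 2) powr (- ?m) = exp (?m * ln 2)"
    by (simp add: powr_def ln_div)
  also have "exp ((1 / 2 - 1) * (real n * measure P A)) * exp (?m * ln 2) = exp ((1 / 2 - 1) * (real n * measure P A) + ?m * ln 2)"
    by (rule exp_add[symmetric])
  also have "\<dots> \<le> exp (- ?m)"
  proof -
    have "real n * q \<le> real n * measure P A" using q by (intro mult_left_mono) auto
    moreover have "?m * ln 2 \<le> ?m * 1" using ln_2_less_1 q by (intro mult_left_mono) auto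
    ultimately show ?thesis by simp
  qed
  finally show ?thesis .
qed

lemma union_bound:
  assumes "finite I" "\<And>i. i \<in> I \<Longrightarrow> E i \<in> sets N" "\<And>i. i \<in> I \<Longrightarrow> measure N (E i) \<le> e" "real (card I) \<le> k" "0 \<le> e"
  shows "measure N (\<Union>i\<in>I. E i) \<le> k * e"
proof -
  have "measure N (\<Union>i\<in>I. E i) \<le> (\<Sum>i\<in>I. measure N (E i))"
    using assms(1,2) by (intro N.finite_measure_subadditive_finite) auto
  also have "\<dots> \<le> (\<Sum>i\<in>I. e)" by (rule sum_mono) (rule assms(3))
  also have "\<dots> \<le> k * e" using assms(4,5) by (simp add: mult_right_mono)
  finally show ?thesis .
qed

end

subsection \<open>Lebesgue measure of Euclidean balls\<close>

lemma lebesgue_Rn_vimage: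
  assumes "A \<in> sets borel"
  shows "emeasure (lebesgue_Rn D) A = emeasure (\<Pi>\<^sub>M i\<in>{..<D}. lborel) (of_coords D -` A \<inter> (\<Pi>\<^sub>E i\<in>{..<D}. UNIV))"
  unfolding lebesgue_Rn_def using assms measurable_of_coords
  by (subst emeasure_distr) (auto simp: space_PiM)

lemma lebesgue_cball_le:
  assumes "0 \<le> r"
  shows "emeasure (lebesgue_Rn D) (cball x r) \<le> ennreal ((2 * r) ^ D)"
proof -
  let ?L = "\<Pi>\<^sub>M i\<in>{..<D}. (lborel :: real measure)"
  have "of_coords D -` cball x r \<inter> (\<Pi>\<^sub>E i\<in>{..<D}. UNIV) \<subseteq> (\<Pi>\<^sub>E i\<in>{..<D}. {coord x i - r..coord x i + r})"
  proof
    fix y assume y: "y \<in> of_coords D -` cball x r \<inter> (\<Pi>\<^sub>E i\<in>{..<D}. UNIV)"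
    have "\<bar>y i - coord x i\<bar> \<le> r" if "i < D" for i
    proof -
      have "y i - coord x i = axis_euc i \<bullet> (of_coords D y - x)"
        using that by (simp add: coord_eq_inner[symmetric] coord_of_coords)
      also have "\<bar>\<dots>\<bar> \<le> norm (axis_euc i) * norm (of_coords D y - x)" by (rule Cauchy_Schwarz_ineq2)
      also have "norm (axis_euc i) = 1"
        by (simp add: norm_eq_sqrt_inner coord_eq_inner[symmetric] coord_axis_euc)
      finally show ?thesis using y by (simp add: dist_norm norm_minus_commute)
    qed
    then show "y \<in> (\<Pi>\<^sub>E i\<in>{..<D}. {coord x i - r..coord x i + r})"
      using y by (auto simp: PiE_def Pi_def abs_le_iff algebra_simps)
  qed
  then have "emeasure (lebesgue_Rn D) (cball x r) \<le> emeasure ?L (\<Pi>\<^sub>E i\<in>{..<D}. {coord x i - r..coord x i + r})"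
    unfolding lebesgue_Rn_vimage[OF borel_closed[OF closed_cball]] by (intro emeasure_mono sets_PiM_I_finite) auto
  also have "\<dots> = ennreal ((2 * r) ^ D)" using assms by (subst emeasure_PiM_lborel_box) auto
  finally show ?thesis .
qed

lemma lebesgue_cball_ge:
  assumes "0 \<le> r" "x \<in> Rn D" "1 \<le> D"
  shows "ennreal ((2 * r / real D) ^ D) \<le> emeasure (lebesgue_Rn D) (cball x r \<inter> Rn D)"
proof -
  let ?L = "\<Pi>\<^sub>M i\<in>{..<D}. (lborel :: real measure)" and ?s = "r / real D"
  have s: "0 \<le> ?s" using assms by simp
  have b: "cball x r \<inter> Rn D \<in> sets borel" by (intro sets.Int borel_closed closed_cball closed_Rn)
  have sub: "(\<Pi>\<^sub>E i\<in>{..<D}. {coord x i - ?s..coord x i + ?s}) \<subseteq> of_coords D -` (cball x r \<inter> Rn D) \<inter> (\<Pi>\<^sub>E i\<in>{..<D}. UNIV)"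
  proof
    fix y assume y: "y \<in> (\<Pi>\<^sub>E i\<in>{..<D}. {coord x i - ?s..coord x i + ?s})"
    have "norm (x - of_coords D y) = L2_set (coord (x - of_coords D y)) {..<D}"
      by (rule norm_Rn) (intro subspace_diff subspace_Rn assms of_coords_in_Rn)
    also have "\<dots> \<le> (\<Sum>i<D. \<bar>coord (x - of_coords D y) i\<bar>)" by (rule L2_set_le_sum_abs)
    also have "\<dots> \<le> (\<Sum>i<D. ?s)"
    proof (rule sum_mono)
      fix i assume i: "i \<in> {..<D}"
      then have "y i \<in> {coord x i - ?s..coord x i + ?s}" using y by (auto simp: PiE_def Pi_def)
      then have "\<bar>coord x i - y i\<bar> \<le> ?s" unfolding atLeastAtMost_iff by linarith
      then show "\<bar>coord (x - of_coords D y) i\<bar> \<le> ?s" using i by (simp add: coord_of_coords)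
    qed
    also have "\<dots> = r" using assms by simp
    finally show "y \<in> of_coords D -` (cball x r \<inter> Rn D) \<inter> (\<Pi>\<^sub>E i\<in>{..<D}. UNIV)"
      using y by (auto simp: dist_norm PiE_def)
  qed
  have "ennreal ((2 * r / real D) ^ D) = emeasure ?L (\<Pi>\<^sub>E i\<in>{..<D}. {coord x i - ?s..coord x i + ?s})"
    using s by (subst emeasure_PiM_lborel_box) auto
  also have "\<dots> \<le> emeasure (lebesgue_Rn D) (cball x r \<inter> Rn D)"
    unfolding lebesgue_Rn_vimage[OF b]
  proof (rule emeasure_mono[OF sub])
    show "of_coords D -` (cball x r \<inter> Rn D) \<inter> (\<Pi>\<^sub>E i\<in>{..<D}. UNIV) \<in> sets ?L"
      using measurable_sets[OF measurable_of_coords b] by (simp add: space_PiM)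
  qed
  finally show ?thesis .
qed

subsection \<open>Distributions of the outlier model\<close>

locale outlier_distribution =
  fixes D d :: nat and Cd fmin fmax \<rho> \<beta> :: real and P :: "euc measure" and M :: "euc set"
  assumes model: "(P, M) \<in> outlier_model D d Cd fmin fmax \<rho> \<beta>"
    and d: "1 \<le> d" "d < D" and f: "0 < fmin" "fmin \<le> fmax" and rho: "0 < \<rho>" and beta: "0 < \<beta>" "\<beta> \<le> 1"
    and diam: "diameter_constant d Cd"
begin

abbreviation "B \<equiv> B0 D d Cd fmin \<rho>"
abbreviation "k \<equiv> K0 d Cd fmin \<rho>"
abbreviation "U \<equiv> uniform_measure (lebesgue_Rn D) B"

lemma M: "M \<in> manifolds D d \<rho>" "0 \<in> M" and sets_P: "sets P = sets borel"
  using model by (auto simp: outlier_model_def)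

sublocale reach_manifold D d M \<rho>
  using M rho by unfold_locales

definition Q :: "euc measure" where
  "Q = (SOME Q. Q \<in> manifold_distributions d fmin fmax M \<and> (\<forall>A\<in>sets borel.
        emeasure P A = ennreal \<beta> * emeasure Q A + ennreal (1 - \<beta>) * emeasure U A))"

lemma Q: "Q \<in> manifold_distributions d fmin fmax M"
  "A \<in> sets borel \<Longrightarrow> emeasure P A = ennreal \<beta> * emeasure Q A + ennreal (1 - \<beta>) * emeasure U A"
proof -
  have "\<exists>Q. Q \<in> manifold_distributions d fmin fmax M \<and> (\<forall>A\<in>sets borel.
        emeasure P A = ennreal \<beta> * emeasure Q A + ennreal (1 - \<beta>) * emeasure U A)"
    using model by (auto simp: outlier_model_def)
  then have *: "Q \<in> manifold_distributions d fmin fmax M \<and> (\<forall>A\<in>sets borel.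
        emeasure P A = ennreal \<beta> * emeasure Q A + ennreal (1 - \<beta>) * emeasure U A)"
    unfolding Q_def by (rule someI_ex)
  show "Q \<in> manifold_distributions d fmin fmax M" using * ..
  show "A \<in> sets borel \<Longrightarrow> emeasure P A = ennreal \<beta> * emeasure Q A + ennreal (1 - \<beta>) * emeasure U A"
    using conjunct2[OF *] by (rule bspec)
qed

lemmas Qb = manifold_distribution_bounds[OF Q(1) closed_M f]

sublocale Q: prob_space Q by (rule Qb(1))

lemma k_pos: "\<rho> \<le> k" "0 < k"
proof -
  have "0 < Cd / (\<rho> ^ (d - 1) * fmin)" using diam rho f by (simp add: diameter_constant_def)
  then show "\<rho> \<le> k" "0 < k" using rho by (auto simp: K0_def)
qed

lemma B_sets: "B \<in> sets borel" "B = cball 0 k \<inter> Rn D"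
  unfolding B0_def by (auto intro!: sets.Int borel_closed closed_cball closed_Rn)

lemma M_B: "M \<subseteq> B"
proof
  fix x assume x: "x \<in> M"
  have "manifold_distributions d fmin fmax M \<noteq> {}" using Q(1) by blast
  then have "diameter M \<le> Cd / (\<rho> ^ (d - 1) * fmin)"
    using diam d f rho M(1) unfolding diameter_constant_def by blast
  moreover have "dist 0 x \<le> diameter M"
    using diameter_bounded_bound[OF compact_imp_bounded[OF M_props(3)] M(2) x] .
  ultimately have "dist 0 x \<le> k" using rho by (simp add: K0_def)
  then show "x \<in> B" using x M_props(2) by (auto simp: B0_def)
qed

lemma leb_B: "ennreal ((2 * k / real D) ^ D) \<le> emeasure (lebesgue_Rn D) B" "emeasure (lebesgue_Rn D) B < \<infinity>"
proof -
  have "(0::euc) \<in> Rn D" by (simp add: Rn_def)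
  then show "ennreal ((2 * k / real D) ^ D) \<le> emeasure (lebesgue_Rn D) B"
    unfolding B_sets(2) using lebesgue_cball_ge[of k 0 D] k_pos d by simp
  have "emeasure (lebesgue_Rn D) B \<le> emeasure (lebesgue_Rn D) (cball 0 k)"
    unfolding B_sets(2) by (rule emeasure_mono) (auto simp: lebesgue_Rn_def)
  also have "\<dots> \<le> ennreal ((2 * k) ^ D)" using k_pos by (intro lebesgue_cball_le) simp
  also have "\<dots> < \<infinity>" by simp
  finally show "emeasure (lebesgue_Rn D) B < \<infinity>" .
qed

lemma leb_B_pos: "0 < (2 * k / real D) ^ D" "emeasure (lebesgue_Rn D) B \<noteq> 0"
proof -
  show p: "0 < (2 * k / real D) ^ D" using k_pos d by simp
  then have "0 < ennreal ((2 * k / real D) ^ D)" by (simp only: ennreal_less_zero_iff)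
  then show "emeasure (lebesgue_Rn D) B \<noteq> 0"
    using leb_B(1) by (metis less_le_trans less_irrefl)
qed

sublocale U: prob_space U
  using leb_B leb_B_pos by (intro prob_space_uniform_measure) auto

lemma sets_Q: "sets Q = sets borel" and sets_U: "sets U = sets borel"
  using Qb(2) by (auto simp: lebesgue_Rn_def)

lemma space_eq: "space Q = UNIV" "space U = UNIV" "space P = UNIV"
  using sets_eq_imp_space_eq[OF sets_Q] sets_eq_imp_space_eq[OF sets_U] sets_eq_imp_space_eq[OF sets_P] by auto

sublocale P: prob_space P
proof
  have "emeasure P UNIV = ennreal \<beta> * emeasure Q UNIV + ennreal (1 - \<beta>) * emeasure U UNIV" by (rule Q(2)) simp
  also have "\<dots> = ennreal \<beta> + ennreal (1 - \<beta>)"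
    using Q.emeasure_space_1 U.emeasure_space_1 unfolding space_eq by simp
  also have "\<dots> = 1" using beta by (simp add: ennreal_plus[symmetric] del: ennreal_plus)
  finally show "emeasure P (space P) = 1" by (simp add: space_eq)
qed

lemma P_eq: "A \<in> sets borel \<Longrightarrow> measure P A = \<beta> * measure Q A + (1 - \<beta>) * measure U A"
proof -
  assume A: "A \<in> sets borel"
  have "ennreal (measure P A) = ennreal \<beta> * ennreal (measure Q A) + ennreal (1 - \<beta>) * ennreal (measure U A)"
    using Q(2)[OF A] by (simp add: P.emeasure_eq_measure Q.emeasure_eq_measure U.emeasure_eq_measure)
  also have "\<dots> = ennreal (\<beta> * measure Q A + (1 - \<beta>) * measure U A)"
    using beta by (simp add: ennreal_mult[symmetric] ennreal_plus[symmetric] del: ennreal_plus)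
  finally show ?thesis using beta by (subst (asm) ennreal_inj) auto
qed

lemma M_sets: "M \<in> sets borel" using closed_M by simp

lemma Q_M: "A \<in> sets borel \<Longrightarrow> measure Q (A \<inter> M) = measure Q A" "A \<in> sets borel \<Longrightarrow> measure Q (A - M) = 0"
proof -
  assume A: "A \<in> sets borel"
  have "measure Q (A - M) \<le> measure Q (- M)"
    using A M_sets sets_Q by (intro Q.finite_measure_mono) auto
  also have "\<dots> = 0" using Qb(3) by (simp add: measure_def)
  finally show z: "measure Q (A - M) = 0" by (simp add: measure_le_0_iff)
  have "measure Q A = measure Q (A \<inter> M) + measure Q (A - M)"
    using A M_sets sets_Q Q.finite_measure_Union[of "A \<inter> M" "A - M"] by (simp add: Int_Diff_Un Int_Diff_disjoint)
  then show "measure Q (A \<inter> M) = measure Q A" using z by simp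
qed

text \<open>The constant in the bound for the noise in a ball of radius r: the cube of side 2 r
  around it against a cube of side 2 k / D inside the domain.\<close>

definition cU :: real where "cU = (real D / k) ^ D"

lemma cU_pos: "0 < cU" using d k_pos by (simp add: cU_def)

lemma U_le_cover:
  assumes A: "A \<in> sets borel" and F: "finite F" "A \<subseteq> (\<Union>y\<in>F. cball y r)" and r: "0 \<le> r"
  shows "measure U A \<le> real (card F) * (cU * r ^ D)"
proof -
  have cb: "measure U (cball y r) \<le> cU * r ^ D" for y
  proof -
    have "emeasure U (cball y r) = emeasure (lebesgue_Rn D) (B \<inter> cball y r) / emeasure (lebesgue_Rn D) B"
      by (rule emeasure_uniform_measure) (use B_sets in \<open>auto simp: lebesgue_Rn_def\<close>)
    also have "\<dots> \<le> ennreal ((2 * r) ^ D) / emeasure (lebesgue_Rn D) B"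
    proof (rule divide_right_mono_ennreal)
      have "emeasure (lebesgue_Rn D) (B \<inter> cball y r) \<le> emeasure (lebesgue_Rn D) (cball y r)"
        by (rule emeasure_mono) (auto simp: lebesgue_Rn_def)
      also have "\<dots> \<le> ennreal ((2 * r) ^ D)" by (rule lebesgue_cball_le[OF r])
      finally show "emeasure (lebesgue_Rn D) (B \<inter> cball y r) \<le> ennreal ((2 * r) ^ D)" .
    qed
    also have "\<dots> \<le> ennreal ((2 * r) ^ D / (2 * k / real D) ^ D)"
    proof -
      obtain l where l: "emeasure (lebesgue_Rn D) B = ennreal l" "0 \<le> l"
        using leb_B(2) by (cases "emeasure (lebesgue_Rn D) B") auto
      have le: "(2 * k / real D) ^ D \<le> l" using leb_B(1) l by simp
      then have "0 < l" using leb_B_pos(1) by linarith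
      then have "ennreal ((2 * r) ^ D) / ennreal l = ennreal ((2 * r) ^ D / l)" using r by (intro divide_ennreal) auto
      also have "\<dots> \<le> ennreal ((2 * r) ^ D / (2 * k / real D) ^ D)"
      proof (intro ennreal_leI divide_left_mono le)
        show "0 < l * (2 * k / real D) ^ D" using \<open>0 < l\<close> leb_B_pos(1) by (rule mult_pos_pos)
      qed (use r in simp)
      finally show ?thesis unfolding l(1) .
    qed
    also have "(2 * r) ^ D / (2 * k / real D) ^ D = cU * r ^ D"
      using k_pos d by (simp add: cU_def power_divide power_mult_distrib)
    finally show ?thesis using cU_pos r by (simp add: U.emeasure_eq_measure)
  qed
  have "measure U A \<le> measure U (\<Union>y\<in>F. cball y r)"
  proof (rule U.finite_measure_mono[OF F(2)])
    show "(\<Union>y\<in>F. cball y r) \<in> sets U"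
      unfolding sets_U by (intro borel_closed closed_UN F(1) ballI closed_cball)
  qed
  also have "\<dots> \<le> (\<Sum>y\<in>F. measure U (cball y r))"
  proof (rule U.finite_measure_subadditive_finite[OF F(1)])
    show "(\<lambda>y. cball y r) ` F \<subseteq> sets U" unfolding sets_U by (intro image_subsetI borel_closed closed_cball)
  qed
  also have "\<dots> \<le> (\<Sum>y\<in>F. cU * r ^ D)" by (rule sum_mono) (rule cb)
  finally show ?thesis by simp
qed

lemma P_outliers_le: "A \<in> sets borel \<Longrightarrow> measure P (A - M) \<le> measure U A"
proof -
  assume A: "A \<in> sets borel"
  then have "measure P (A - M) = (1 - \<beta>) * measure U (A - M)"
    using P_eq[of "A - M"] Q_M(2)[OF A] M_sets by simp
  also have "\<dots> \<le> 1 * measure U A"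
    using beta A M_sets sets_U by (intro mult_mono U.finite_measure_mono) auto
  finally show ?thesis by simp
qed

lemma Q_ball:
  assumes "x \<in> M" "0 < s" "s \<le> \<rho> / 50"
  shows "fmin * ball_lower d * s ^ d \<le> measure Q (cball x s)" "measure Q (cball x s) \<le> fmax * ball_upper d * s ^ d"
  using manifold_distribution_ball[OF Q(1) M(1) rho d(1) f assms] by auto

lemma P_ball_ge:
  assumes "x \<in> M" "0 < s" "s \<le> \<rho> / 50"
  shows "\<beta> * (fmin * ball_lower d * s ^ d) \<le> measure P (M \<inter> cball x s)"
proof -
  have "\<beta> * (fmin * ball_lower d * s ^ d) \<le> \<beta> * measure Q (M \<inter> cball x s)"
    using Q_ball(1)[OF assms] Q_M(1)[of "cball x s"] beta by (intro mult_left_mono) (auto simp: Int_commute)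
  also have "\<dots> \<le> measure P (M \<inter> cball x s)" using P_eq[of "M \<inter> cball x s"] beta M_sets by simp
  finally show ?thesis .
qed

text \<open>The noise on the piece of M is bounded by the noise in the full D-dimensional ball; the
  last hypothesis makes this negligible and holds for small s because D > d.\<close>

lemma P_ball_le:
  assumes "x \<in> M" "0 < s" "s \<le> \<rho> / 50" "cU * s ^ D \<le> \<beta> * (fmax * ball_upper d * s ^ d)"
  shows "measure P (M \<inter> cball x s) \<le> 2 * (\<beta> * (fmax * ball_upper d * s ^ d))"
proof -
  have "measure P (M \<inter> cball x s) \<le> measure P (cball x s)" using sets_P by (intro P.finite_measure_mono) auto
  also have "\<dots> \<le> \<beta> * (fmax * ball_upper d * s ^ d) + 1 * (cU * s ^ D)"
    unfolding P_eq[of "cball x s", simplified]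
    using Q_ball(2)[OF assms(1-3)] U_le_cover[of "cball x s" "{x}" s] assms(2) beta
    by (intro add_mono mult_mono) auto
  finally show ?thesis using assms(4) by simp
qed

lemma P_B: "measure P B = 1"
proof -
  have "measure Q B = 1"
  proof -
    have "measure Q UNIV = measure Q (UNIV \<inter> M)" using Q_M(1)[of UNIV] by simp
    also have "\<dots> \<le> measure Q B" using M_B B_sets(1) sets_Q by (intro Q.finite_measure_mono) auto
    finally have "1 \<le> measure Q B" using Q.prob_space space_eq by simp
    then show ?thesis using Q.prob_le_1[of B] by (intro antisym)
  qed
  moreover have "measure U B = 1"
  proof -
    have "emeasure U B = emeasure (lebesgue_Rn D) (B \<inter> B) / emeasure (lebesgue_Rn D) B"
      by (rule emeasure_uniform_measure) (use B_sets in \<open>auto simp: lebesgue_Rn_def\<close>)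
    also have "\<dots> = 1" using leb_B leb_B_pos by simp
    finally show ?thesis by (simp add: measure_def)
  qed
  ultimately show ?thesis using P_eq[OF B_sets(1)] by simp
qed

end

subsection \<open>Separated nets\<close>

text \<open>A separated set of the largest cardinality is maximal and hence a net; the bound k
  guarantees that a largest one exists.\<close>

lemma maximal_separated:
  fixes A :: "'a::metric_space set"
  assumes s: "0 \<le> s" and bnd: "\<And>F. finite F \<Longrightarrow> F \<subseteq> A \<Longrightarrow> (\<And>x y. x \<in> F \<Longrightarrow> y \<in> F \<Longrightarrow> x \<noteq> y \<Longrightarrow> s < dist x y) \<Longrightarrow> real (card F) \<le> k"
  obtains Z where "finite Z" "Z \<subseteq> A" "\<And>x y. x \<in> Z \<Longrightarrow> y \<in> Z \<Longrightarrow> x \<noteq> y \<Longrightarrow> s < dist x y"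
    "\<And>x. x \<in> A \<Longrightarrow> \<exists>z\<in>Z. dist x z \<le> s" "real (card Z) \<le> k"
proof -
  define sep where "sep F \<longleftrightarrow> finite F \<and> F \<subseteq> A \<and> (\<forall>x\<in>F. \<forall>y\<in>F. x \<noteq> y \<longrightarrow> s < dist x y)" for F
  have b: "real (card F) \<le> k" if "sep F" for F using bnd[of F] that by (auto simp: sep_def)
  have e: "sep {}" by (simp add: sep_def)
  have "\<forall>F. sep F \<longrightarrow> card F < Suc (nat \<lfloor>k\<rfloor>)"
  proof (intro allI impI)
    fix F assume "sep F"
    then have "int (card F) \<le> \<lfloor>k\<rfloor>" using b[of F] by (simp add: le_floor_iff)
    then show "card F < Suc (nat \<lfloor>k\<rfloor>)" by linarith
  qed
  then obtain Z where Z: "sep Z" "\<And>F. sep F \<Longrightarrow> card F \<le> card Z"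
    using ex_has_greatest_nat[of sep "{}" card] e by blast
  have "\<exists>z\<in>Z. dist x z \<le> s" if x: "x \<in> A" for x
  proof (rule ccontr)
    assume no: "\<not> ?thesis"
    then have "sep (insert x Z)" using Z(1) x by (auto simp: sep_def dist_commute not_le)
    moreover have "x \<notin> Z" using no s by force
    ultimately show False using Z(2)[of "insert x Z"] Z(1) by (simp add: sep_def)
  qed
  then show ?thesis using that[of Z] Z(1) b[OF Z(1)] by (auto simp: sep_def)
qed

subsection \<open>High-probability events\<close>

locale outlier_sample = outlier_distribution D d Cd fmin fmax \<rho> \<beta> P M + iid_sample P n
  for D d Cd fmin fmax \<rho> \<beta> P M n
begin

definition a where "a = fmin * ball_lower d"
definition bb where "bb = fmax * ball_upper d"

lemma a_pos: "0 < a" and bb_pos: "0 < bb"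
  using f ball_lower_pos[OF d(1)] ball_upper_pos[OF d(1)] by (auto simp: a_def bb_def)

lemma Qa: "x \<in> M \<Longrightarrow> 0 < s \<Longrightarrow> s \<le> \<rho> / 50 \<Longrightarrow> a * s ^ d \<le> measure Q (cball x s)"
  and Qbb: "x \<in> M \<Longrightarrow> 0 < s \<Longrightarrow> s \<le> \<rho> / 50 \<Longrightarrow> measure Q (cball x s) \<le> bb * s ^ d"
  using Q_ball by (auto simp: a_def bb_def)

lemma a_le_bb: "a \<le> bb"
proof -
  have "a * (\<rho> / 50) ^ d \<le> bb * (\<rho> / 50) ^ d"
    by (rule order_trans[OF Qa[OF M(2)] Qbb[OF M(2)]]) (use rho in auto)
  moreover have "0 < (\<rho> / 50) ^ d" using rho by simp
  ultimately show ?thesis by (simp only: mult_le_cancel_right_pos)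
qed

lemma cnt_disjoint_le:
  assumes "finite F" "\<And>z. z \<in> F \<Longrightarrow> A z \<in> sets borel" "disjoint_family_on A F" "\<And>z. z \<in> F \<Longrightarrow> c \<le> measure Q (A z)"
    "(\<Union>z\<in>F. A z) \<subseteq> C" "C \<in> sets borel"
  shows "real (card F) * c \<le> measure Q C"
proof -
  have "real (card F) * c = (\<Sum>z\<in>F. c)" by simp
  also have "\<dots> \<le> (\<Sum>z\<in>F. measure Q (A z))" by (rule sum_mono) (rule assms(4))
  also have "\<dots> = measure Q (\<Union>z\<in>F. A z)"
    using assms(1-3) sets_Q by (intro Q.finite_measure_finite_Union[symmetric]) auto
  also have "\<dots> \<le> measure Q C" using assms sets_Q by (intro Q.finite_measure_mono) auto
  finally show ?thesis .
qed

lemma separated_disjoint: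
  fixes F :: "euc set"
  assumes "\<And>x y. x \<in> F \<Longrightarrow> y \<in> F \<Longrightarrow> x \<noteq> y \<Longrightarrow> s < dist x y"
  shows "disjoint_family_on (\<lambda>z. cball z (s / 2)) F"
  unfolding disjoint_family_on_def
proof (intro ballI impI)
  fix x y :: euc assume xy: "x \<in> F" "y \<in> F" "x \<noteq> y"
  show "cball x (s / 2) \<inter> cball y (s / 2) = {}"
  proof (rule ccontr)
    assume "\<not> ?thesis"
    then obtain z where "dist x z \<le> s / 2" "dist y z \<le> s / 2" by auto
    then have "dist x y \<le> s" using dist_triangle2[of x y z] by simp
    then show False using assms[OF xy] by simp
  qed
qed

text \<open>Volume comparison with Q in the role of the volume of M.\<close>

lemma packing:
  assumes F: "finite F" "F \<subseteq> M \<inter> cball x r" "\<And>y z. y \<in> F \<Longrightarrow> z \<in> F \<Longrightarrow> y \<noteq> z \<Longrightarrow> s < dist y z"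
    and x: "x \<in> M" and s: "0 < s" "0 \<le> r" "r + s / 2 \<le> \<rho> / 50"
  shows "real (card F) * (a * (s / 2) ^ d) \<le> bb * (r + s / 2) ^ d"
proof -
  have "real (card F) * (a * (s / 2) ^ d) \<le> measure Q (cball x (r + s / 2))"
  proof (rule cnt_disjoint_le[OF F(1) _ separated_disjoint[OF F(3)]])
    show "a * (s / 2) ^ d \<le> measure Q (cball z (s / 2))" if "z \<in> F" for z
      using Qa[of z "s / 2"] that F(2) s by auto
    show "(\<Union>z\<in>F. cball z (s / 2)) \<subseteq> cball x (r + s / 2)"
    proof safe
      fix z q assume "z \<in> F" "q \<in> cball z (s / 2)"
      then show "q \<in> cball x (r + s / 2)" using F(2) dist_triangle[of x q z] by fastforce
    qed
  qed auto
  also have "\<dots> \<le> bb * (r + s / 2) ^ d" using s by (intro Qbb x) auto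
  finally show ?thesis .
qed

text \<open>The total mass 1 of Q bounds the number of disjoint half-balls.\<close>

lemma manifold_net:
  assumes s: "0 < s" "s \<le> \<rho> / 50"
  obtains Z where "finite Z" "Z \<subseteq> M" "\<And>x y. x \<in> Z \<Longrightarrow> y \<in> Z \<Longrightarrow> x \<noteq> y \<Longrightarrow> s < dist x y"
    "\<And>x. x \<in> M \<Longrightarrow> \<exists>z\<in>Z. dist x z \<le> s" "real (card Z) \<le> 1 / (a * (s / 2) ^ d)"
proof (rule maximal_separated[of s M "1 / (a * (s / 2) ^ d)"])
  fix F assume F: "finite F" "F \<subseteq> M" "\<And>x y. x \<in> F \<Longrightarrow> y \<in> F \<Longrightarrow> x \<noteq> y \<Longrightarrow> s < dist x y"
  have "real (card F) * (a * (s / 2) ^ d) \<le> measure Q UNIV"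
  proof (rule cnt_disjoint_le[OF F(1) _ separated_disjoint[OF F(3)]])
    show "a * (s / 2) ^ d \<le> measure Q (cball z (s / 2))" if "z \<in> F" for z
      using Qa[of z "s / 2"] that F(2) s by auto
  qed auto
  then show "real (card F) \<le> 1 / (a * (s / 2) ^ d)" using Q.prob_space space_eq a_pos s by (simp add: field_simps)
qed (use s in auto)

section \<open>Sample values against sample indices\<close>

lemma card_le_cnt: "card (X ` {..<n} \<inter> A) \<le> cnt n A X"
proof -
  have "X ` {..<n} \<inter> A = X ` {i\<in>{..<n}. X i \<in> A}" by auto
  also have "card \<dots> \<le> card {i\<in>{..<n}. X i \<in> A}" by (rule card_image_le) simp
  finally show ?thesis by (simp only: cnt_def)
qed

text \<open>The estimator sees the sample as a set, so lower bounds on index counts carry over only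
  if no value on M is repeated.\<close>

definition distinct_on :: "(nat \<Rightarrow> euc) \<Rightarrow> bool" where
  "distinct_on X \<longleftrightarrow> (\<forall>i<n. \<forall>j<n. X i \<in> M \<and> X i = X j \<longrightarrow> i = j)"

lemma card_eq_cnt:
  assumes "distinct_on X" "A \<subseteq> M" shows "card (X ` {..<n} \<inter> A) = cnt n A X"
proof -
  have "X ` {..<n} \<inter> A = X ` {i\<in>{..<n}. X i \<in> A}" by auto
  moreover have "inj_on X {i\<in>{..<n}. X i \<in> A}"
    using assms unfolding distinct_on_def by (intro inj_onI) auto
  ultimately show ?thesis unfolding cnt_def by (simp add: card_image)
qed

lemma bad_event_sets: "A \<in> sets borel \<Longrightarrow> {X\<in>space N. m \<le> real (cnt n A X)} \<in> sets N"
  "A \<in> sets borel \<Longrightarrow> {X\<in>space N. real (cnt n A X) \<le> m} \<in> sets N"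
proof -
  assume "A \<in> sets borel"
  then have [measurable]: "(\<lambda>X. real (cnt n A X)) \<in> borel_measurable N" by (intro cnt_measurable) (simp add: sets_P)
  show "{X\<in>space N. m \<le> real (cnt n A X)} \<in> sets N" "{X\<in>space N. real (cnt n A X) \<le> m} \<in> sets N" by measurable
qed

text \<open>Counts in small balls of a single radius control the counts in all larger balls.\<close>

lemma inlier_counts:
  assumes s: "0 < s" "s \<le> \<rho> / 50" "cU * s ^ D \<le> \<beta> * (bb * s ^ d)"
  shows "\<exists>E\<in>sets N. measure N E \<le> 2 / (a * (s / 2) ^ d) * exp (- (real n * (\<beta> * (a * (s / 2) ^ d)) / 4)) \<and>
    (\<forall>X\<in>space N - E. distinct_on X \<longrightarrow> (\<forall>x\<in>M. \<forall>r. 4 * s \<le> r \<and> r + 2 * s \<le> \<rho> / 50 \<longrightarrow>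
      a\<^sup>2 / (4 * 4 ^ d * bb) * (\<beta> * real n) * r ^ d \<le> real (card (X ` {..<n} \<inter> M \<inter> cball x r)) \<and>
      real (card (X ` {..<n} \<inter> M \<inter> cball x r)) \<le> 8 * 4 ^ d * bb\<^sup>2 / a * (\<beta> * real n) * r ^ d))"
proof -
  obtain Z where Z: "finite Z" "Z \<subseteq> M" "\<And>x y. x \<in> Z \<Longrightarrow> y \<in> Z \<Longrightarrow> x \<noteq> y \<Longrightarrow> s < dist x y"
    "\<And>x. x \<in> M \<Longrightarrow> \<exists>z\<in>Z. dist x z \<le> s" "real (card Z) \<le> 1 / (a * (s / 2) ^ d)"
    using manifold_net[OF s(1,2)] by metis
  \<comment> \<open>Disjoint half-balls around the net points give the lower counts, the covering
    balls of radius s the upper ones.\<close>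
  define q1 q2 where "q1 = \<beta> * (a * (s / 2) ^ d)" and "q2 = 2 * (\<beta> * (bb * s ^ d))"
  define e where "e = exp (- (real n * q1 / 4))"
  define E1 where "E1 z = {X\<in>space N. real (cnt n (M \<inter> cball z (s / 2)) X) \<le> real n * q1 / 4}" for z
  define E2 where "E2 z = {X\<in>space N. 4 * (real n * q2) \<le> real (cnt n (M \<inter> cball z s) X)}" for z
  have q1: "0 < q1" using a_pos s beta by (simp add: q1_def)
  have q12: "q1 / 4 \<le> q2"
  proof -
    have "a * (s / 2) ^ d \<le> bb * s ^ d" using a_le_bb a_pos s by (intro mult_mono power_mono) auto
    moreover have "0 \<le> bb * s ^ d" using bb_pos s by simp
    ultimately have "a * (s / 2) ^ d / 4 \<le> 2 * (bb * s ^ d)" by linarith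
    then have "\<beta> * (a * (s / 2) ^ d / 4) \<le> \<beta> * (2 * (bb * s ^ d))" using beta by (intro mult_left_mono) auto
    then show ?thesis by (simp add: q1_def q2_def mult_ac)
  qed
  have Ms: "M \<inter> cball z r \<in> sets borel" for z r using M_sets by simp
  have E1: "E1 z \<in> sets N" "measure N (E1 z) \<le> e" if z: "z \<in> Z" for z
  proof -
    show "E1 z \<in> sets N" unfolding E1_def by (rule bad_event_sets[OF Ms])
    have "q1 \<le> measure P (M \<inter> cball z (s / 2))"
      unfolding q1_def a_def using P_ball_ge[of z "s / 2"] z Z(2) s by auto
    then show "measure N (E1 z) \<le> e" unfolding E1_def e_def
      using q1 Ms sets_P by (intro cnt_lower) auto
  qed
  have E2: "E2 z \<in> sets N" "measure N (E2 z) \<le> e" if z: "z \<in> Z" for z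
  proof -
    show "E2 z \<in> sets N" unfolding E2_def by (rule bad_event_sets[OF Ms])
    have "measure P (M \<inter> cball z s) \<le> q2"
      unfolding q2_def bb_def using P_ball_le[of z s] z Z(2) s unfolding bb_def by auto
    \<comment> \<open>Chernoff with z = e at four times n q2: the exponent (e - 1 - 4) n q2 is at
      most - n q2.\<close>
    then have "measure N (E2 z) \<le> exp ((exp 1 - 1) * (real n * q2)) * exp 1 powr (- (4 * (real n * q2)))"
      unfolding E2_def using Ms sets_P by (intro cnt_upper) auto
    also have "\<dots> = exp ((exp 1 - 1) * (real n * q2) + (- (4 * (real n * q2))))"
      by (simp only: exp_add powr_def ln_exp exp_not_eq_zero if_False mult_1_right)
    also have "\<dots> \<le> exp (- (real n * q2))"
    proof -
      have "(exp 1 - 1) * (real n * q2) \<le> 3 * (real n * q2)"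
        using exp_le q12 q1 by (intro mult_right_mono) auto
      then have "(exp 1 - 1) * (real n * q2) + - (4 * (real n * q2)) \<le> - (real n * q2)" by linarith
      then show ?thesis by (simp only: exp_le_cancel_iff)
    qed
    also have "\<dots> \<le> e" unfolding e_def using mult_left_mono[OF q12, of "real n"] by simp
    finally show "measure N (E2 z) \<le> e" .
  qed
  define E where "E = (\<Union>z\<in>Z. E1 z) \<union> (\<Union>z\<in>Z. E2 z)"
  have Es: "E \<in> sets N" unfolding E_def using Z(1) E1(1) E2(1) by (intro sets.Un sets.finite_UN) auto
  have "measure N E \<le> measure N (\<Union>z\<in>Z. E1 z) + measure N (\<Union>z\<in>Z. E2 z)"
    unfolding E_def using Z(1) E1(1) E2(1) by (intro measure_Un_le sets.finite_UN) auto
  also have "\<dots> \<le> 1 / (a * (s / 2) ^ d) * e + 1 / (a * (s / 2) ^ d) * e"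
    using Z(1,5) E1 E2 by (intro add_mono union_bound) (auto simp: e_def)
  finally have mE: "measure N E \<le> 2 / (a * (s / 2) ^ d) * e" by simp
  have main: "a\<^sup>2 / (4 * 4 ^ d * bb) * (\<beta> * real n) * r ^ d \<le> real (card (X ` {..<n} \<inter> M \<inter> cball x r)) \<and>
      real (card (X ` {..<n} \<inter> M \<inter> cball x r)) \<le> 8 * 4 ^ d * bb\<^sup>2 / a * (\<beta> * real n) * r ^ d"
    if X: "X \<in> space N - E" "distinct_on X" and x: "x \<in> M" and r: "4 * s \<le> r" "r + 2 * s \<le> \<rho> / 50" for X x r
  proof -
    let ?S = "X ` {..<n}"
    have low: "real n * q1 / 4 \<le> real (card (?S \<inter> (M \<inter> cball z (s / 2))))" if "z \<in> Z" for z
      using X that unfolding card_eq_cnt[OF X(2) Int_lower1] E_def E1_def by force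
    have up: "real (card (?S \<inter> (M \<inter> cball z s))) \<le> 4 * (real n * q2)" if "z \<in> Z" for z
      using X that unfolding card_eq_cnt[OF X(2) Int_lower1] E_def E2_def by force
    define F where "F = Z \<inter> cball x (r - s / 2)"
    define F' where "F' = Z \<inter> cball x (r + s)"
    have fin: "finite F" "finite F'" using Z(1) by (auto simp: F_def F'_def)
    \<comment> \<open>The balls of radius s around F cover the part of M within r / 2 of x, which
      bounds the size of F from below.\<close>
    have "a * (r / 2) ^ d \<le> real (card F) * (bb * s ^ d)"
    proof -
      have "a * (r / 2) ^ d \<le> measure Q (cball x (r / 2))" using r s by (intro Qa x) auto
      also have "\<dots> = measure Q (cball x (r / 2) \<inter> M)" using Q_M(1) by simp
      also have "\<dots> \<le> measure Q (\<Union>z\<in>F. cball z s)"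
      proof (rule Q.finite_measure_mono)
        show "cball x (r / 2) \<inter> M \<subseteq> (\<Union>z\<in>F. cball z s)"
        proof
          fix q assume q: "q \<in> cball x (r / 2) \<inter> M"
          then obtain z where z: "z \<in> Z" "dist q z \<le> s" using Z(4) by blast
          then have "z \<in> F" using dist_triangle[of x z q] q r(1) s(1) by (simp add: F_def)
          then show "q \<in> (\<Union>z\<in>F. cball z s)" using z by (auto simp: dist_commute)
        qed
        show "(\<Union>z\<in>F. cball z s) \<in> sets Q" unfolding sets_Q by (intro borel_closed closed_UN fin ballI closed_cball)
      qed
      also have "\<dots> \<le> (\<Sum>z\<in>F. measure Q (cball z s))"
        by (rule Q.finite_measure_subadditive_finite[OF fin(1)]) (auto simp: sets_Q)
      also have "\<dots> \<le> (\<Sum>z\<in>F. bb * s ^ d)" using Z(2) s by (intro sum_mono Qbb) (auto simp: F_def)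
      finally show ?thesis by simp
    qed
    then have cF: "a * r ^ d / (2 ^ d * (bb * s ^ d)) \<le> real (card F)"
      using bb_pos s by (simp add: power_divide divide_le_eq mult_ac pos_divide_le_eq)
    have "real (card F) * (real n * q1 / 4) = (\<Sum>z\<in>F. real n * q1 / 4)" by simp
    also have "\<dots> \<le> (\<Sum>z\<in>F. real (card (?S \<inter> (M \<inter> cball z (s / 2)))))" using low by (intro sum_mono) (auto simp: F_def)
    also have "\<dots> = real (card (\<Union>z\<in>F. ?S \<inter> (M \<inter> cball z (s / 2))))"
    proof -
      have "(?S \<inter> (M \<inter> cball y (s / 2))) \<inter> (?S \<inter> (M \<inter> cball z (s / 2))) = {}" if "y \<in> F" "z \<in> F" "y \<noteq> z" for y z
        using separated_disjoint[of Z s, OF Z(3)] that unfolding disjoint_family_on_def F_def by blast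
      then show ?thesis by (subst card_UN_disjoint) (use fin in auto)
    qed
    also have "\<dots> \<le> real (card (?S \<inter> M \<inter> cball x r))"
    proof (intro of_nat_mono card_mono)
      show "(\<Union>z\<in>F. ?S \<inter> (M \<inter> cball z (s / 2))) \<subseteq> ?S \<inter> M \<inter> cball x r"
      proof safe
        fix z q assume "z \<in> F" "q \<in> cball z (s / 2)"
        then show "q \<in> cball x r" using dist_triangle[of x q z] by (simp add: F_def)
      qed auto
    qed simp
    finally have 1: "real (card F) * (real n * q1 / 4) \<le> real (card (?S \<inter> M \<inter> cball x r))" .
    have "a\<^sup>2 / (4 * 4 ^ d * bb) * (\<beta> * real n) * r ^ d = a * r ^ d / (2 ^ d * (bb * s ^ d)) * (real n * q1 / 4)"
    proof -
      have "(4::real) ^ d = 2 ^ d * 2 ^ d" by (simp flip: power_mult_distrib)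
      then show ?thesis using s bb_pos by (simp add: q1_def power_divide power2_eq_square divide_simps)
    qed
    also have "\<dots> \<le> real (card F) * (real n * q1 / 4)" using cF q1 by (intro mult_right_mono) auto
    finally have lower: "a\<^sup>2 / (4 * 4 ^ d * bb) * (\<beta> * real n) * r ^ d \<le> real (card (?S \<inter> M \<inter> cball x r))" using 1 by linarith
    have "real (card F') * (a * (s / 2) ^ d) \<le> bb * (r + s + s / 2) ^ d"
      by (rule packing[OF fin(2) _ _ x]) (use Z s r in \<open>auto simp: F'_def\<close>)
    also have "\<dots> \<le> bb * (2 * r) ^ d" using bb_pos s r by (intro mult_left_mono power_mono) auto
    finally have cF': "real (card F') \<le> bb * (2 * r) ^ d / (a * (s / 2) ^ d)" using a_pos s by (simp add: pos_le_divide_eq)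
    have "card (?S \<inter> M \<inter> cball x r) \<le> card (\<Union>z\<in>F'. ?S \<inter> (M \<inter> cball z s))"
    proof (rule card_mono)
      show "?S \<inter> M \<inter> cball x r \<subseteq> (\<Union>z\<in>F'. ?S \<inter> (M \<inter> cball z s))"
      proof
        fix q assume q: "q \<in> ?S \<inter> M \<inter> cball x r"
        then obtain z where z: "z \<in> Z" "dist q z \<le> s" using Z(4) by blast
        then have "z \<in> F'" using dist_triangle[of x z q] q by (simp add: F'_def)
        then show "q \<in> (\<Union>z\<in>F'. ?S \<inter> (M \<inter> cball z s))" using z q by (auto simp: dist_commute)
      qed
    qed (use fin in auto)
    also have "\<dots> \<le> (\<Sum>z\<in>F'. card (?S \<inter> (M \<inter> cball z s)))" by (rule card_UN_le[OF fin(2)])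
    finally have "real (card (?S \<inter> M \<inter> cball x r)) \<le> (\<Sum>z\<in>F'. real (card (?S \<inter> (M \<inter> cball z s))))"
      by (metis of_nat_mono of_nat_sum)
    also have "\<dots> \<le> (\<Sum>z\<in>F'. 4 * (real n * q2))" using up by (intro sum_mono) (auto simp: F'_def)
    also have "\<dots> = real (card F') * (4 * (real n * q2))" by simp
    also have "\<dots> \<le> bb * (2 * r) ^ d / (a * (s / 2) ^ d) * (4 * (real n * q2))"
      using cF' q12 q1 by (intro mult_right_mono) auto
    also have "\<dots> = 8 * 4 ^ d * bb\<^sup>2 / a * (\<beta> * real n) * r ^ d"
    proof -
      have "(4::real) ^ d = 2 ^ d * 2 ^ d" by (simp flip: power_mult_distrib)
      then show ?thesis using s a_pos by (simp add: q2_def power_divide power_mult_distrib power2_eq_square divide_simps)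
    qed
    finally show ?thesis using lower by blast
  qed
  show ?thesis
    by (rule bexI[OF _ Es]) (use mE main in \<open>auto simp: e_def q1_def\<close>)
qed

text \<open>The choice z = 1 / (n q) turns the Chernoff bound into e times \<open>(n q) ^ m\<close>.
  If the mean is below a negative power of n, a count m independent of n already has polynomially
  small probability.\<close>

lemma small_mean_tail:
  assumes "A \<in> sets borel" "measure P A \<le> q" "0 < real n * q" "real n * q < 1"
  shows "measure N {X\<in>space N. real m \<le> real (cnt n A X)} \<le> exp 1 * (real n * q) ^ m"
proof -
  let ?z = "1 / (real n * q)"
  have z: "1 < ?z" using assms by simp
  have "measure N {X\<in>space N. real m \<le> real (cnt n A X)} \<le> exp ((?z - 1) * (real n * q)) * ?z powr (- real m)"
    by (rule cnt_upper) (use assms z sets_P in auto)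
  also have "?z powr (- real m) = (real n * q) ^ m"
    using assms(3) by (simp add: powr_minus powr_realpow power_divide)
  also have "exp ((?z - 1) * (real n * q)) \<le> exp 1"
    using assms(3) by (simp add: algebra_simps)
  finally show ?thesis using assms(3) by (simp add: mult_right_mono)
qed

text \<open>Two equal values on M would put two indices into one ball of the net. The union bound is
  of order \<open>n\<^sup>2 * s ^ d\<close> and so small once s is a large negative power of
  n.\<close>

lemma distinct_event:
  assumes s: "0 < s" "s \<le> \<rho> / 50" "cU * s ^ D \<le> \<beta> * (bb * s ^ d)" and n: "0 < n" "real n * (2 * (\<beta> * (bb * s ^ d))) < 1"
  shows "\<exists>E\<in>sets N. measure N E \<le> 1 / (a * (s / 2) ^ d) * (exp 1 * (real n * (2 * (\<beta> * (bb * s ^ d))))\<^sup>2) \<and>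
    (\<forall>X\<in>space N - E. distinct_on X)"
proof -
  obtain Z where Z: "finite Z" "Z \<subseteq> M" "\<And>x y. x \<in> Z \<Longrightarrow> y \<in> Z \<Longrightarrow> x \<noteq> y \<Longrightarrow> s < dist x y"
    "\<And>x. x \<in> M \<Longrightarrow> \<exists>z\<in>Z. dist x z \<le> s" "real (card Z) \<le> 1 / (a * (s / 2) ^ d)"
    using manifold_net[OF s(1,2)] by metis
  define q where "q = 2 * (\<beta> * (bb * s ^ d))"
  define Ez where "Ez z = {X\<in>space N. real 2 \<le> real (cnt n (M \<inter> cball z s) X)}" for z
  have Ms: "M \<inter> cball z r \<in> sets borel" for z r using M_sets by simp
  have Es: "Ez z \<in> sets N" for z unfolding Ez_def by (rule bad_event_sets(1)[OF Ms])
  have q: "0 < real n * q" using beta bb_pos s n by (simp add: q_def)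
  have "measure N (Ez z) \<le> exp 1 * (real n * q)\<^sup>2" if z: "z \<in> Z" for z
    unfolding Ez_def
  proof (rule small_mean_tail[OF Ms])
    show "measure P (M \<inter> cball z s) \<le> q"
      unfolding q_def bb_def using P_ball_le[of z s] z Z(2) s unfolding bb_def by auto
  qed (use q n in \<open>auto simp: q_def\<close>)
  then have m: "measure N (\<Union>z\<in>Z. Ez z) \<le> 1 / (a * (s / 2) ^ d) * (exp 1 * (real n * q)\<^sup>2)"
    using Z(1,5) Es by (intro union_bound) auto
  have "distinct_on X" if X: "X \<in> space N - (\<Union>z\<in>Z. Ez z)" for X
    unfolding distinct_on_def
  proof (intro allI impI)
    fix i j assume ij: "i < n" "j < n" "X i \<in> M \<and> X i = X j"
    then obtain z where z: "z \<in> Z" "dist (X i) z \<le> s" using Z(4) by blast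
    then have lt: "cnt n (M \<inter> cball z s) X < 2" using X by (force simp: Ez_def)
    show "i = j"
    proof (rule ccontr)
      assume ne: "i \<noteq> j"
      have "{i, j} \<subseteq> {k\<in>{..<n}. X k \<in> M \<inter> cball z s}" using ij z by (auto simp: dist_commute)
      then have "card {i, j} \<le> cnt n (M \<inter> cball z s) X" unfolding cnt_def by (intro card_mono) auto
      then show False using lt ne by simp
    qed
  qed
  then show ?thesis
    using m Z(1) Es unfolding q_def
    by (intro bexI[of _ "\<Union>z\<in>Z. Ez z"] conjI sets.finite_UN) auto
qed

lemma ball_net:
  assumes g: "0 < g" "g \<le> 1"
  obtains Z where "finite Z" "Z \<subseteq> B" "\<And>x. x \<in> B \<Longrightarrow> \<exists>z\<in>Z. dist x z \<le> g" "real (card Z) \<le> (2 * real D * (k + 1) / g) ^ D"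
proof -
  let ?L = "lebesgue_Rn D"
  have D1: "1 \<le> D" using d by simp
  have card: "real (card F) \<le> (2 * real D * (k + 1) / g) ^ D"
    if F: "finite F" "F \<subseteq> B" "\<And>x y. x \<in> F \<Longrightarrow> y \<in> F \<Longrightarrow> x \<noteq> y \<Longrightarrow> g < dist x y" for F
  proof -
    have bs: "cball z (g / 2) \<inter> Rn D \<in> sets ?L" for z
      by (auto simp: lebesgue_Rn_def intro!: sets.Int borel_closed closed_Rn)
    have dj: "disjoint_family_on (\<lambda>z. cball z (g / 2) \<inter> Rn D) F"
      using separated_disjoint[OF F(3)] unfolding disjoint_family_on_def by blast
    have "ennreal (real (card F) * (g / real D) ^ D) = (\<Sum>z\<in>F. ennreal ((2 * (g / 2) / real D) ^ D))"
      using g by (simp add: ennreal_mult ennreal_of_nat_eq_real_of_nat)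
    also have "\<dots> \<le> (\<Sum>z\<in>F. emeasure ?L (cball z (g / 2) \<inter> Rn D))"
      using F(2) g D1 by (intro sum_mono lebesgue_cball_ge) (auto simp: B_sets(2))
    also have "\<dots> = emeasure ?L (\<Union>z\<in>F. cball z (g / 2) \<inter> Rn D)"
      using F(1) dj bs by (intro sum_emeasure) auto
    also have "\<dots> \<le> emeasure ?L (cball 0 (k + 1))"
    proof (rule emeasure_mono)
      show "(\<Union>z\<in>F. cball z (g / 2) \<inter> Rn D) \<subseteq> cball 0 (k + 1)"
      proof safe
        fix z q assume zq: "z \<in> F" "q \<in> cball z (g / 2)"
        then have "dist 0 z \<le> k" using F(2) by (auto simp: B_sets(2))
        then show "q \<in> cball 0 (k + 1)" using zq g dist_triangle[of 0 q z] by simp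
      qed
    qed (auto simp: lebesgue_Rn_def)
    also have "\<dots> \<le> ennreal ((2 * (k + 1)) ^ D)" using k_pos by (intro lebesgue_cball_le) simp
    finally have "real (card F) * (g / real D) ^ D \<le> (2 * (k + 1)) ^ D" using k_pos by simp
    then have "real (card F) \<le> (2 * (k + 1)) ^ D / (g / real D) ^ D" using g D1 by (simp add: pos_le_divide_eq)
    also have "\<dots> = (2 * real D * (k + 1) / g) ^ D" unfolding power_divide[symmetric] by (simp add: mult_ac)
    finally show ?thesis .
  qed
  show ?thesis
    by (rule maximal_separated[of g B, OF _ card]) (use g that in auto)
qed

text \<open>A net of the whole domain reduces all centres p to finitely many. If the ball of p
  contains an outlier, that outlier is within g of a net point z, and the ball lies in the one of
  radius 3 g about z.\<close>

lemma outlier_ball_counts: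
  assumes g: "0 < g" "g \<le> 1" and m: "0 < m"
  shows "\<exists>E\<in>sets N. measure N E \<le> (2 * real D * (k + 1) / g) ^ D * exp (2 * (real n * (cU * (3 * g) ^ D)) - m) \<and>
    (\<forall>X\<in>space N - E. X ` {..<n} \<subseteq> B \<longrightarrow> (\<forall>p. real (card ((X ` {..<n} - M) \<inter> cball p g)) \<le> m))"
proof -
  obtain Z where Z: "finite Z" "Z \<subseteq> B" "\<And>x. x \<in> B \<Longrightarrow> \<exists>z\<in>Z. dist x z \<le> g" "real (card Z) \<le> (2 * real D * (k + 1) / g) ^ D"
    using ball_net[OF g] by metis
  define q where "q = cU * (3 * g) ^ D"
  have q0: "0 \<le> q" using cU_pos g by (simp add: q_def)
  define Ez where "Ez z = {X\<in>space N. m \<le> real (cnt n (cball z (3 * g) - M) X)}" for z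
  have Ms: "cball z r - M \<in> sets borel" for z r using M_sets by simp
  have Es: "Ez z \<in> sets N" for z unfolding Ez_def by (rule bad_event_sets(1)[OF Ms])
  have "measure N (Ez z) \<le> exp (2 * (real n * q) - m)" for z
  proof -
    have "measure P (cball z (3 * g) - M) \<le> measure U (cball z (3 * g))" by (rule P_outliers_le) simp
    also have "\<dots> \<le> q" using U_le_cover[of "cball z (3 * g)" "{z}" "3 * g"] g by (simp add: q_def)
    finally have "measure N (Ez z) \<le> exp ((exp 1 - 1) * (real n * q)) * exp 1 powr (- m)"
      unfolding Ez_def using Ms sets_P by (intro cnt_upper) auto
    also have "\<dots> = exp ((exp 1 - 1) * (real n * q) + (- m))"
      by (simp only: exp_add powr_def ln_exp exp_not_eq_zero if_False mult_1_right)
    also have "\<dots> \<le> exp (2 * (real n * q) - m)"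
      using mult_right_mono[of "exp 1 - 1" 2 "real n * q"] exp_le q0 by simp
    finally show ?thesis .
  qed
  then have mE: "measure N (\<Union>z\<in>Z. Ez z) \<le> (2 * real D * (k + 1) / g) ^ D * exp (2 * (real n * q) - m)"
    using Z(1,4) Es by (intro union_bound) auto
  have "real (card ((X ` {..<n} - M) \<inter> cball p g)) \<le> m"
    if X: "X \<in> space N - (\<Union>z\<in>Z. Ez z)" "X ` {..<n} \<subseteq> B" for X p
  proof (cases "(X ` {..<n} - M) \<inter> cball p g = {}")
    case True then show ?thesis unfolding True using m by simp
  next
    case False
    then obtain q0 where "q0 \<in> (X ` {..<n} - M) \<inter> cball p g" by blast
    then have q0: "q0 \<in> X ` {..<n}" "dist p q0 \<le> g" by simp_all
    then obtain z where z: "z \<in> Z" "dist q0 z \<le> g" using Z(3) X(2) by blast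
    have "(X ` {..<n} - M) \<inter> cball p g \<subseteq> X ` {..<n} \<inter> (cball z (3 * g) - M)"
    proof
      fix q assume q: "q \<in> (X ` {..<n} - M) \<inter> cball p g"
      have "dist z q \<le> dist z q0 + dist q0 p + dist p q"
        using dist_triangle[of z q q0] dist_triangle[of q0 q p] by linarith
      then show "q \<in> X ` {..<n} \<inter> (cball z (3 * g) - M)" using q q0 z by (auto simp: dist_commute)
    qed
    then have "card ((X ` {..<n} - M) \<inter> cball p g) \<le> card (X ` {..<n} \<inter> (cball z (3 * g) - M))"
      by (intro card_mono) auto
    also have "\<dots> \<le> cnt n (cball z (3 * g) - M) X" by (rule card_le_cnt)
    finally show ?thesis using X(1) z(1) by (force simp: Ez_def)
  qed
  then show ?thesis
    using mE Z(1) Es unfolding q_def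
    by (intro bexI[of _ "\<Union>z\<in>Z. Ez z"] conjI sets.finite_UN) auto
qed

text \<open>The part of a tube of width a0 v within 3 u of a point of M is covered by about
  \<open>(u / v) ^ d\<close> balls of radius (a0 + 1) v, so its noise is of order
  \<open>u ^ d * v ^ (D - d)\<close>. For a thin tube the expected count is small, and
  \<open>small_mean_tail\<close> bounds the count by a constant.\<close>

lemma outlier_tube_counts:
  fixes u v a0 :: real and m :: nat
  defines "q \<equiv> bb * (6 * u) ^ d / (a * (v / 2) ^ d) * (cU * ((a0 + 1) * v) ^ D)"
  assumes u: "0 < v" "v \<le> u" "a0 * v \<le> u" "6 * u \<le> \<rho> / 50" and a0: "0 < a0" and n: "0 < n" "real n * q < 1"
  shows "\<exists>E\<in>sets N. measure N E \<le> 1 / (a * (u / 2) ^ d) * (exp 1 * (real n * q) ^ m) \<and>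
    (\<forall>X\<in>space N - E. \<forall>x\<in>M. real (card {q \<in> X ` {..<n} - M. dist q x \<le> 2 * u \<and> infdist q M \<le> a0 * v}) \<le> real m)"
proof -
  have u0: "0 < u" using u by simp
  obtain Z where Z: "finite Z" "Z \<subseteq> M" "\<And>x. x \<in> M \<Longrightarrow> \<exists>z\<in>Z. dist x z \<le> u" "real (card Z) \<le> 1 / (a * (u / 2) ^ d)"
  proof (rule manifold_net[OF u0])
    show "u \<le> \<rho> / 50" using u u0 by linarith
  qed auto
  obtain Y where Y: "finite Y" "Y \<subseteq> M" "\<And>x y. x \<in> Y \<Longrightarrow> y \<in> Y \<Longrightarrow> x \<noteq> y \<Longrightarrow> v < dist x y"
    "\<And>x. x \<in> M \<Longrightarrow> \<exists>z\<in>Y. dist x z \<le> v"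
  proof (rule manifold_net[of v])
    show "v \<le> \<rho> / 50" using u u0 by linarith
  qed (use u in auto)
  define A where "A z = cball z (3 * u) \<inter> {p. infdist p M \<le> a0 * v}" for z
  have cA: "closed (A z)" for z
    unfolding A_def by (intro closed_Int closed_cball closed_Collect_le continuous_intros)
  have As: "A z \<in> sets borel" "A z - M \<in> sets borel" for z using cA[of z] M_sets by auto
  have PA: "measure P (A z - M) \<le> q" if z: "z \<in> Z" for z
  proof -
    \<comment> \<open>Points of A z are within 3 u of z, their feet within a0 v \<le> u of them, and
      the net points within v \<le> u of the feet.\<close>
    define F where "F = Y \<inter> cball z (5 * u)"
    have zM: "z \<in> M" using z Z(2) by blast
    have fF: "finite F" using Y(1) by (simp add: F_def)
    have "real (card F) * (a * (v / 2) ^ d) \<le> bb * (5 * u + v / 2) ^ d"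
      by (rule packing[OF fF _ _ zM]) (use Y u u0 in \<open>auto simp: F_def\<close>)
    also have "\<dots> \<le> bb * (6 * u) ^ d" using bb_pos u u0 by (intro mult_left_mono power_mono) auto
    finally have cF: "real (card F) \<le> bb * (6 * u) ^ d / (a * (v / 2) ^ d)" using a_pos u by (simp add: pos_le_divide_eq)
    have sub: "A z \<subseteq> (\<Union>y\<in>F. cball y ((a0 + 1) * v))"
    proof
      fix p assume p: "p \<in> A z"
      obtain y where y: "y \<in> Y" "dist (near p) y \<le> v" using Y(4) near(1) by blast
      have np: "dist p (near p) \<le> a0 * v" using p near(2)[of p] by (simp add: A_def)
      have "dist z y \<le> dist z p + dist p (near p) + dist (near p) y"
        using dist_triangle[of z y p] dist_triangle[of p y "near p"] by linarith
      then have "y \<in> F" using y p np u by (simp add: F_def A_def)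
      moreover have "dist y p \<le> (a0 + 1) * v"
        using dist_triangle[of p y "near p"] np y(2) by (simp add: dist_commute algebra_simps)
      ultimately show "p \<in> (\<Union>y\<in>F. cball y ((a0 + 1) * v))" by auto
    qed
    have "measure P (A z - M) \<le> measure U (A z)" by (rule P_outliers_le[OF As(1)])
    also have "\<dots> \<le> real (card F) * (cU * ((a0 + 1) * v) ^ D)"
      by (rule U_le_cover[OF As(1) fF sub]) (use a0 u in auto)
    also have "\<dots> \<le> q" unfolding q_def using cF cU_pos a0 u by (intro mult_right_mono) auto
    finally show ?thesis .
  qed
  have q0: "0 < real n * q" using bb_pos a_pos cU_pos u u0 a0 n by (simp add: q_def)
  define Ez where "Ez z = {X\<in>space N. real m \<le> real (cnt n (A z - M) X)}" for z
  have Es: "Ez z \<in> sets N" for z unfolding Ez_def by (rule bad_event_sets(1)[OF As(2)])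
  have "measure N (Ez z) \<le> exp 1 * (real n * q) ^ m" if "z \<in> Z" for z
    unfolding Ez_def by (rule small_mean_tail[OF As(2) PA[OF that] q0 n(2)])
  then have mE: "measure N (\<Union>z\<in>Z. Ez z) \<le> 1 / (a * (u / 2) ^ d) * (exp 1 * (real n * q) ^ m)"
    using Z(1,4) Es q0 by (intro union_bound) auto
  have "real (card {q \<in> X ` {..<n} - M. dist q x \<le> 2 * u \<and> infdist q M \<le> a0 * v}) \<le> real m"
    if X: "X \<in> space N - (\<Union>z\<in>Z. Ez z)" and x: "x \<in> M" for X x
  proof -
    obtain z where z: "z \<in> Z" "dist x z \<le> u" using Z(3)[OF x] by blast
    have "{q \<in> X ` {..<n} - M. dist q x \<le> 2 * u \<and> infdist q M \<le> a0 * v} \<subseteq> X ` {..<n} \<inter> (A z - M)"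
    proof safe
      fix i assume "dist (X i) x \<le> 2 * u" "infdist (X i) M \<le> a0 * v"
      then show "X i \<in> A z" using z dist_triangle[of z "X i" x] by (simp add: A_def dist_commute)
    qed auto
    then have "card {q \<in> X ` {..<n} - M. dist q x \<le> 2 * u \<and> infdist q M \<le> a0 * v} \<le> card (X ` {..<n} \<inter> (A z - M))"
      by (intro card_mono) auto
    also have "\<dots> \<le> cnt n (A z - M) X" by (rule card_le_cnt)
    finally show ?thesis using X z(1) by (force simp: Ez_def)
  qed
  then show ?thesis
    using mE Z(1) Es
    by (intro bexI[of _ "\<Union>z\<in>Z. Ez z"] conjI sets.finite_UN) auto
qed

lemma sample_in_ball: "{X\<in>space N. X ` {..<n} \<subseteq> B} \<in> sets N" "measure N (space N - {X\<in>space N. X ` {..<n} \<subseteq> B}) = 0"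
proof -
  interpret product_sigma_finite "\<lambda>_::nat. P" by standard
  have eq: "{X\<in>space N. X ` {..<n} \<subseteq> B} = (\<Pi>\<^sub>E i\<in>{..<n}. B)"
    by (auto simp: space_PiM space_eq PiE_def Pi_def)
  show s: "{X\<in>space N. X ` {..<n} \<subseteq> B} \<in> sets N"
    unfolding eq using B_sets(1) sets_P by (intro sets_PiM_I_finite) auto
  have "emeasure N (\<Pi>\<^sub>E i\<in>{..<n}. B) = (\<Prod>i<n. emeasure P B)"
    using B_sets(1) sets_P by (intro emeasure_PiM) auto
  then have "emeasure N {X\<in>space N. X ` {..<n} \<subseteq> B} = 1"
    unfolding eq using P_B by (simp add: P.emeasure_eq_measure)
  then show "measure N (space N - {X\<in>space N. X ` {..<n} \<subseteq> B}) = 0"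
    using s by (simp add: N.emeasure_eq_measure N.prob_compl)
qed

end

subsection \<open>The estimator as a simplicial complex\<close>

lemma decluttered_subset: "decluttered D d \<beta> k1 k2 c t tse n X m \<subseteq> X ` {..<n}"
  by (induction m) (auto simp: Let_def slab_declutter_def)

lemma fps_decluttered_subset:
  assumes "is_FPS fps" "0 \<le> e"
  shows "fps (decluttered D d \<beta> k1 k2 c t tse n X m) e \<subseteq> X ` {..<n}"
proof -
  let ?P = "decluttered D d \<beta> k1 k2 c t tse n X m"
  have fin: "finite ?P" using finite_subset[OF decluttered_subset] by blast
  then have "fps_output ?P e (fps ?P e)" using assms by (auto simp: is_FPS_def)
  then show ?thesis using fps_output_props(1) fin assms(2) decluttered_subset by blast
qed

lemma M_TDC_plus_complex:
  assumes "is_FPS fps" "0 \<le> c'"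
  shows "abstract_complex (M_TDC_plus wt tse fps D d \<rho> \<beta> k1 k2 c t c' M n X)"
    "\<Union>(M_TDC_plus wt tse fps D d \<rho> \<beta> k1 k2 c t c' M n X) \<subseteq> X ` {..<n}"
proof -
  define P where "P = decluttered D d \<beta> k1 k2 c t tse n X (k_hat d \<rho> \<beta> c M n X + 2)"
  define Y where "Y = fps P (c' * h_inf d c \<beta> n)"
  have "0 \<le> c' * h_inf d c \<beta> n" using assms(2) by (simp add: h_inf_def bandwidth_def)
  then have Y: "Y \<subseteq> X ` {..<n}" unfolding Y_def P_def by (rule fps_decluttered_subset[OF assms(1)])
  have eq: "M_TDC_plus wt tse fps D d \<rho> \<beta> k1 k2 c t c' M n X =
      tangential_delaunay D Y (wt D Y (restrict (tse P (h_inf d c \<beta> n)) Y)) (tse P (h_inf d c \<beta> n))"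
    by (simp add: M_TDC_plus_def Let_def tdc_star_def Y_def P_def)
  have sub: "\<sigma> \<noteq> {} \<and> \<sigma> \<subseteq> Y" if "\<sigma> \<in> tangential_delaunay D Y w T" for \<sigma> w T
    using that unfolding tangential_delaunay_def delaunay_def by blast
  show "\<Union>(M_TDC_plus wt tse fps D d \<rho> \<beta> k1 k2 c t c' M n X) \<subseteq> X ` {..<n}"
    unfolding eq
  proof (rule Union_least)
    fix \<sigma> assume "\<sigma> \<in> tangential_delaunay D Y (wt D Y (restrict (tse P (h_inf d c \<beta> n)) Y)) (tse P (h_inf d c \<beta> n))"
    from sub[OF this] Y show "\<sigma> \<subseteq> X ` {..<n}" by (meson order_trans)
  qed
  show "abstract_complex (M_TDC_plus wt tse fps D d \<rho> \<beta> k1 k2 c t c' M n X)"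
    unfolding eq abstract_complex_def
  proof (intro ballI conjI allI impI)
    fix \<tau> \<sigma> assume t: "\<tau> \<in> tangential_delaunay D Y (wt D Y (restrict (tse P (h_inf d c \<beta> n)) Y)) (tse P (h_inf d c \<beta> n))"
    have "\<tau> \<subseteq> X ` {..<n}" using sub[OF t] Y by (meson order_trans)
    then show "finite \<tau>" by (rule finite_subset) simp
    show "\<tau> \<noteq> {}" using sub[OF t] by (rule conjunct1)
    show "\<sigma> \<in> tangential_delaunay D Y (wt D Y (restrict (tse P (h_inf d c \<beta> n)) Y)) (tse P (h_inf d c \<beta> n))"
      if "\<sigma> \<subseteq> \<tau> \<and> \<sigma> \<noteq> {}"
      using t that unfolding tangential_delaunay_def mem_Collect_eq by (meson order_trans)
  qed
qed

text \<open>Bounds the loss on the exceptional event.\<close>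

lemma hausdist_in_le_diameter:
  assumes "bounded B" "A \<subseteq> B" "S \<subseteq> B" "A \<noteq> {}"
  shows "hausdist_in B A S \<le> diameter B"
proof (cases "S = {}")
  case True then show ?thesis using assms by (simp add: hausdist_in_def)
next
  case False
  have i: "infdist x Y \<le> diameter B" if x: "x \<in> B" and Y: "Y \<subseteq> B" "Y \<noteq> {}" for x Y
  proof -
    obtain y where y: "y \<in> Y" using Y(2) by blast
    have "infdist x Y \<le> dist x y" using y by (rule infdist_le)
    also have "\<dots> \<le> diameter B" using diameter_bounded_bound[OF assms(1) x, of y] y Y(1) by blast
    finally show ?thesis .
  qed
  have "hausdist A S \<le> diameter B"
    unfolding hausdist_def using assms False by (auto intro!: cSUP_least i)
  then show ?thesis using assms False by (simp add: hausdist_in_def)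
qed

subsection \<open>Choice of the tuning constants\<close>

definition cl_const :: "nat \<Rightarrow> real \<Rightarrow> real \<Rightarrow> real" where
  "cl_const d fmin fmax = (fmin * ball_lower d)\<^sup>2 / (4 * 4 ^ d * (fmax * ball_upper d))"

text \<open>Twice the upper constant of \<open>inlier_counts\<close>, because counts are compared
  with n - 1 and n \<le> 2 (n - 1).\<close>

definition cu_const :: "nat \<Rightarrow> real \<Rightarrow> real \<Rightarrow> real" where
  "cu_const d fmin fmax = 16 * 4 ^ d * (fmax * ball_upper d)\<^sup>2 / (fmin * ball_lower d)"

text \<open>The summand 1 is the share granted to the outliers by \<open>out1_small\<close>.\<close>

definition K_const :: "nat \<Rightarrow> real \<Rightarrow> real \<Rightarrow> real" where
  "K_const d fmin fmax = 30 * 32 ^ d * (cu_const d fmin fmax / cl_const d fmin fmax) + 1"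

text \<open>Chosen so that K k1 = 1/16: the tilt of an estimated tangent space then displaces the
  slab by at most \<open>h\<^sup>2 / (16 * \<rho>)\<close>, half of its height k2
  \<open>h\<^sup>2\<close> for k2 = 1 / (8 \<rho>).\<close>

definition k1_const :: "nat \<Rightarrow> real \<Rightarrow> real \<Rightarrow> real" where
  "k1_const d fmin fmax = 1 / (16 * K_const d fmin fmax)"

text \<open>With this \<open>c\<close> the expected number of sample points in a ball of radius \<open>k\<^sub>1 h\<^sub>\<infinity> / 8\<close> is at
  least \<open>16 log n\<close>, which makes the deviation bounds summable over a net.\<close>

definition c_const :: "nat \<Rightarrow> real \<Rightarrow> real \<Rightarrow> real" where
  "c_const d fmin fmax = 16 * (8 / k1_const d fmin fmax) ^ d / (fmin * ball_lower d)"

lemma tendsto_powr_0: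
  assumes "(f \<longlongrightarrow> 0) F" "\<forall>\<^sub>F x in F. 0 < f x" "0 < (e::real)"
  shows "((\<lambda>x. f x powr e) \<longlongrightarrow> 0) F"
proof -
  have "\<forall>\<^sub>F x in F. 0 \<le> f x" using assms(2) by (rule eventually_mono) simp
  from tendsto_powr2[OF assms(1) tendsto_const this assms(3)] show ?thesis using assms(3) by simp
qed

locale tuning =
  fixes d D :: nat and Cd fmin fmax \<rho> \<beta> \<epsilon>\<^sub>d C\<^sub>d :: real and wt :: weights
  assumes d: "1 \<le> d" "d < D" and f: "0 < fmin" "fmin \<le> fmax" and diam: "diameter_constant d Cd"
    and rho: "0 < \<rho>" and beta: "0 < \<beta>" "\<beta> \<le> 1" and BG: "0 < \<epsilon>\<^sub>d" "0 < C\<^sub>d"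
    "\<And>D \<rho> \<epsilon> M P. d < D \<Longrightarrow> 0 < \<rho> \<Longrightarrow> 0 < \<epsilon> \<Longrightarrow> \<epsilon> \<le> \<epsilon>\<^sub>d * \<rho> \<Longrightarrow> M \<in> manifolds D d \<rho> \<Longrightarrow> eps_net \<epsilon> M P \<Longrightarrow>
        hausdist M (carrier_of (tdc_star wt D P (tangent_space M))) \<le> C\<^sub>d * \<epsilon>\<^sup>2 / \<rho> \<and>
        ambient_isotopic D M (carrier_of (tdc_star wt D P (tangent_space M)))"
begin

abbreviation "a \<equiv> fmin * ball_lower d"
abbreviation "bb \<equiv> fmax * ball_upper d"
abbreviation "cl \<equiv> cl_const d fmin fmax"
abbreviation "cu \<equiv> cu_const d fmin fmax"
abbreviation "K \<equiv> K_const d fmin fmax"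
abbreviation "k1 \<equiv> k1_const d fmin fmax"
abbreviation "c \<equiv> c_const d fmin fmax"
abbreviation "kk \<equiv> K0 d Cd fmin \<rho>"
abbreviation "k2 \<equiv> 1 / (8 * \<rho>)"

lemma a_pos: "0 < a" and bb_pos: "0 < bb"
  using f ball_lower_pos[OF d(1)] ball_upper_pos[OF d(1)] by auto

lemma cl_pos: "0 < cl" and cu_pos: "0 < cu"
  unfolding cl_const_def cu_const_def
  by (intro divide_pos_pos mult_pos_pos zero_less_power a_pos bb_pos; simp)+

lemma K_ge: "1 \<le> K" using cl_pos cu_pos by (simp add: K_const_def)

lemma k1: "0 < k1" "k1 \<le> 1 / 16" "K * k1 = 1 / 16"
  using K_ge by (auto simp: k1_const_def field_simps)

lemma c_pos: "0 < c" using k1 a_pos by (simp add: c_const_def)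

lemma kk_pos: "0 < kk"
proof -
  have "0 < Cd / (\<rho> ^ (d - 1) * fmin)" using diam rho f by (simp add: diameter_constant_def)
  then show ?thesis using rho by (simp add: K0_def)
qed

definition cU where "cU = (real D / kk) ^ D"
text \<open>The first summand, times log n, is at least twice the expected number of outliers in a
  tripled ball. In the second, D pays for a net of order \<open>n ^ D\<close> balls and 4 leaves
  probability of order \<open>n ^ (-4)\<close>.\<close>

definition A where "A = 2 * (cU * 3 ^ D * (2 * c / \<beta>)) + (real D + 4)"
definition K0' where "K0' = 30 * 32 ^ d * (cu / cl) / \<rho> + 60 * 16 ^ d * A / (cl * c)"
text \<open>The tube width that \<open>slab_avoids\<close> gives in the first step; being at least 1
  / \<rho>, it also covers the tubes of later steps.\<close>

definition a0 where "a0 = max (1 / \<rho>) (2 * ((1 / 8)\<^sup>2 / \<rho> + K0' * k1 + k2))"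
text \<open>Small enough for inliers to stay in the slab despite the poor first angle estimate; the
  dependence on D and \<beta> enters through \<open>K0'\<close>.\<close>

definition k0 where "k0 = min k1 (k2 / (1 / \<rho> + K0'))"
definition t where "t = \<beta> * cl * k0 ^ d"
text \<open>Each factor in \<open>small_mean_tail\<close> will gain n to the power -1 / (d + 2), so
  this many give \<open>n ^ (-5)\<close>.\<close>

definition m where "m = 5 * (d + 2)"
definition C5 where "C5 = bb * 12 ^ d * cU * (a0 + 1) ^ D / a"
definition b :: "nat \<Rightarrow> real" where "b n = c * (ln (real n) / (\<beta> * (real n - 1)))"
definition h0 where "h0 n = b n powr (1 / (real d + 1))"
text \<open>Scale for \<open>distinct_event\<close>: its d-th power is \<open>n ^ (-5)\<close>,
  which makes the union bound of order \<open>n ^ (-3)\<close>.\<close>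

definition s' where "s' n = real n powr (- (5 / real d))"
definition Cb where "Cb = 2 + (2 * real D * (kk + 1)) ^ D + 2 ^ d * exp 1 / a + 2 ^ d * exp 1 * (2 * bb)\<^sup>2 / a"

lemma cU_pos: "0 < cU" using d kk_pos by (simp add: cU_def)
lemma A_pos: "0 < A" using cU_pos c_pos beta by (auto simp: A_def intro!: add_nonneg_pos)
lemma K0'_pos: "0 < K0'" using cl_pos cu_pos c_pos rho A_pos by (auto simp: K0'_def intro!: add_pos_pos)
lemma a0_pos: "0 < a0" "1 / \<rho> \<le> a0" using rho by (auto simp: a0_def less_max_iff_disj)
lemma k0: "0 < k0" "k0 \<le> k1" "k0\<^sup>2 / (2 * \<rho>) + K0' * k0 \<le> k2"
proof -
  have p: "0 < 1 / \<rho> + K0'" using rho K0'_pos by (intro add_pos_pos) auto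
  show k: "0 < k0" "k0 \<le> k1" using k1 p rho by (auto simp: k0_def)
  have "k0 \<le> k2 / (1 / \<rho> + K0')" by (simp add: k0_def)
  then have le: "k0 * (1 / \<rho> + K0') \<le> k2" using pos_le_divide_eq[OF p] by blast
  have "k0 * k0 \<le> k0 * 2" using k k1(2) by (intro mult_left_mono) auto
  then have "k0\<^sup>2 / (2 * \<rho>) \<le> k0 * (1 / \<rho>)" using rho by (simp add: power2_eq_square field_simps)
  then show "k0\<^sup>2 / (2 * \<rho>) + K0' * k0 \<le> k2" using le by (simp add: distrib_left mult.commute)
qed
lemma t_pos: "0 < t" using beta cl_pos k0 by (simp add: t_def)
lemma C5_pos: "0 < C5" using bb_pos cU_pos a0_pos a_pos by (simp add: C5_def)
text \<open>All conditions on the sample size in one place. They involve D and \<beta>, as is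
  allowed for a statement that holds eventually in n.\<close>

definition large :: "nat \<Rightarrow> bool" where
  "large n \<longleftrightarrow> 3 \<le> n \<and> 0 < b n \<and> b n < 1 \<and> h0 n \<le> \<rho> / 300 \<and> h0 n \<le> 1 \<and> K0' * h0 n < 1 \<and> K / \<rho> * h0 n < 1 \<and>
    A * h0 n < cl * k0 ^ d * c \<and> cU * h0 n \<le> \<beta> * bb \<and> (K + 4) * h0 n / \<rho> \<le> 1 / 10 \<and> h0 n * (6 + 1280 * (K + 4)) \<le> \<epsilon>\<^sub>d * \<rho> \<and>
    a0 * b n powr (1 / (real d + 2)) \<le> 1 / 8 \<and>
    30 * 16 ^ d * real m * (a0 + 3 / \<rho>) / (cl * c) * \<rho> \<le> ln (real n) \<and> real m < cl * k0 ^ d * c * ln (real n) \<and>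
    1 \<le> c * ln (real n) \<and> 1 \<le> ln (real n) \<and> k1 * b n powr (1 / (real d * (real d + 1))) \<le> k0 \<and>
    s' n \<le> \<rho> / 50 \<and> cU * s' n \<le> \<beta> * bb \<and> s' n \<le> 1 \<and> real n * (2 * (\<beta> * (bb * s' n ^ d))) < 1 \<and>
    C5 * (real n * b n powr (1 + 2 / (real d + 2))) \<le> real n powr (- (1 / (real d + 2))) \<and> 2 * kk * Cb \<le> real n"

lemma b_tendsto: "b \<longlonglongrightarrow> 0"
proof -
  have "(\<lambda>n::nat. ln (real n) / (\<beta> * (real n - 1))) \<longlonglongrightarrow> 0" using beta by real_asymp
  then have "(\<lambda>n. c * (ln (real n) / (\<beta> * (real n - 1)))) \<longlonglongrightarrow> c * 0" by (intro tendsto_mult tendsto_const)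
  then show ?thesis by (simp add: b_def[abs_def])
qed

lemma b_pos: "2 \<le> n \<Longrightarrow> 0 < b n"
  using c_pos beta by (simp add: b_def)

lemma b_powr_tendsto: "0 < e \<Longrightarrow> (\<lambda>n. b n powr e) \<longlonglongrightarrow> 0"
  by (rule tendsto_powr_0[OF b_tendsto]) (auto intro!: eventually_sequentiallyI[of 2] b_pos)

lemma eventually_mult_le:
  fixes g :: "nat \<Rightarrow> real"
  assumes "g \<longlonglongrightarrow> 0" "0 < y"
  shows "\<forall>\<^sub>F n in sequentially. x * g n < y"
proof -
  have "(\<lambda>n. x * g n) \<longlonglongrightarrow> x * 0" by (intro tendsto_mult tendsto_const assms)
  then show ?thesis using assms(2) by (intro order_tendstoD(2)) auto
qed

text \<open>With e = 1 / (d + 2), the logarithm in b is absorbed by b \<le> n^(-(1 - e/4)), so n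
  b^(1 + 2 e) is at most n^(-3 e/2). Of this, n^(-e/2) absorbs the constant
  \<open>C5\<close>.\<close>

lemma b_power_eventually: "\<forall>\<^sub>F n in sequentially. C5 * (real n * b n powr (1 + 2 / (real d + 2))) \<le> real n powr (- (1 / (real d + 2)))"
proof -
  define e where "e = 1 / (real d + 2)"
  have e: "0 < e" "e \<le> 1 / 3" using d by (auto simp: e_def field_simps)
  have "(\<lambda>n::nat. ln (real n) / (\<beta> * (real n - 1)) * real n powr (1 - e / 4)) \<longlonglongrightarrow> 0" using beta e by real_asymp
  then have "\<forall>\<^sub>F n in sequentially. c * (ln (real n) / (\<beta> * (real n - 1)) * real n powr (1 - e / 4)) < 1"
    by (rule eventually_mult_le) simp
  moreover have "(\<lambda>n::nat. real n powr (- (e / 2))) \<longlonglongrightarrow> 0" using e by real_asymp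
  then have "\<forall>\<^sub>F n in sequentially. C5 * real n powr (- (e / 2)) < 1" by (rule eventually_mult_le) simp
  moreover have "\<forall>\<^sub>F n in sequentially. 2 \<le> n" by (rule eventually_ge_at_top)
  ultimately show ?thesis
  proof eventually_elim
    case (elim n)
    have n: "1 \<le> real n" "0 < real n" using elim by auto
    have "b n * real n powr (1 - e / 4) \<le> 1" using elim(1) by (simp add: b_def mult.assoc)
    then have "b n \<le> real n powr (- (1 - e / 4))" using n by (simp add: powr_minus field_simps)
    then have "b n powr (1 + 2 * e) \<le> (real n powr (- (1 - e / 4))) powr (1 + 2 * e)"
      using b_pos[of n] elim e by (intro powr_mono2) auto
    also have "\<dots> = real n powr (- (1 - e / 4) * (1 + 2 * e))" by (rule powr_powr)
    also have "\<dots> \<le> real n powr (- 1 - 3 / 2 * e)"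
    proof (rule powr_mono)
      have "e * e \<le> e * (1 / 3)" using e by (intro mult_left_mono) auto
      then show "- (1 - e / 4) * (1 + 2 * e) \<le> - 1 - 3 / 2 * e" using e(1) by (simp add: algebra_simps)
    qed (rule n)
    finally have bp: "b n powr (1 + 2 * e) \<le> real n powr (- 1 - 3 / 2 * e)" .
    have "C5 * (real n * b n powr (1 + 2 * e)) \<le> C5 * (real n powr 1 * real n powr (- 1 - 3 / 2 * e))"
      using bp C5_pos n by (intro mult_left_mono) auto
    also have "real n powr 1 * real n powr (- 1 - 3 / 2 * e) = real n powr (- (e / 2)) * real n powr (- e)"
      by (simp only: powr_add[symmetric]) (simp add: algebra_simps)
    also have "C5 * \<dots> = C5 * real n powr (- (e / 2)) * real n powr (- e)" by simp
    also have "\<dots> \<le> 1 * real n powr (- e)" using elim(2) by (intro mult_right_mono) auto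
    finally show ?case by (simp add: e_def)
  qed
qed

lemma eventually_large: "eventually large sequentially"
proof -
  have ln: "\<forall>\<^sub>F n in sequentially. x \<le> ln (real n)" for x
    by real_asymp
  have h0: "h0 \<longlonglongrightarrow> 0" unfolding h0_def[abs_def] by (rule b_powr_tendsto) simp
  have h: "\<forall>\<^sub>F n in sequentially. x * h0 n < y" if "0 < y" for x y by (rule eventually_mult_le[OF h0 that])
  have sl: "s' \<longlonglongrightarrow> 0" unfolding s'_def[abs_def] using d by real_asymp
  have s: "\<forall>\<^sub>F n in sequentially. x * s' n < y" if "0 < y" for x y by (rule eventually_mult_le[OF sl that])
  have s4: "\<forall>\<^sub>F n in sequentially. real n * (2 * (\<beta> * (bb * s' n ^ d))) < 1"
  proof -
    have "(\<lambda>n::nat. real n powr (- 4)) \<longlonglongrightarrow> 0" by real_asymp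
    then have "\<forall>\<^sub>F n in sequentially. (2 * \<beta> * bb) * real n powr (- 4) < 1" by (rule eventually_mult_le) simp
    moreover have "\<forall>\<^sub>F n in sequentially. 2 \<le> n" by (rule eventually_ge_at_top)
    ultimately show ?thesis
    proof eventually_elim
      case (elim n)
      have "s' n ^ d = real n powr (- 5)"
        unfolding s'_def using d elim by (simp add: powr_realpow[symmetric] powr_powr)
      moreover have "real n * real n powr (- 5) = real n powr (1 + - 5)"
        using elim by (simp only: powr_add) simp
      ultimately have "real n * s' n ^ d = real n powr (- 4)" by simp
      moreover have "real n * (2 * (\<beta> * (bb * s' n ^ d))) = (2 * \<beta> * bb) * (real n * s' n ^ d)"
        by (simp only: mult_ac)
      ultimately show ?case using elim(1) by (simp only:)
    qed
  qed
  have bp: "\<forall>\<^sub>F n in sequentially. x * b n powr e < y" if "0 < e" "0 < y" for x y e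
    by (rule eventually_mult_le[OF b_powr_tendsto[OF that(1)] that(2)])
  have b1: "\<forall>\<^sub>F n in sequentially. b n < 1" using eventually_mult_le[OF b_tendsto, of 1 1] by simp
  have "\<forall>\<^sub>F n in sequentially. (3 \<le> n \<and> b n < 1 \<and> 1 * h0 n < \<rho> / 300 \<and> 1 * h0 n < 1 \<and> K0' * h0 n < 1 \<and> K / \<rho> * h0 n < 1 \<and>
    A * h0 n < cl * k0 ^ d * c \<and> cU * h0 n < \<beta> * bb \<and> (K + 4) / \<rho> * h0 n < 1 / 10 \<and> (6 + 1280 * (K + 4)) * h0 n < \<epsilon>\<^sub>d * \<rho>) \<and>
    (a0 * b n powr (1 / (real d + 2)) < 1 / 8 \<and>
    30 * 16 ^ d * real m * (a0 + 3 / \<rho>) / (cl * c) * \<rho> \<le> ln (real n) \<and> (real m + 1) / (cl * k0 ^ d * c) \<le> ln (real n) \<and>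
    1 / c \<le> ln (real n) \<and> 1 \<le> ln (real n) \<and> k1 * b n powr (1 / (real d * (real d + 1))) < k0) \<and>
    (1 * s' n < \<rho> / 50 \<and> cU * s' n < \<beta> * bb \<and> 1 * s' n < 1 \<and> real n * (2 * (\<beta> * (bb * s' n ^ d))) < 1 \<and>
    C5 * (real n * b n powr (1 + 2 / (real d + 2))) \<le> real n powr (- (1 / (real d + 2))) \<and> nat \<lceil>2 * kk * Cb\<rceil> \<le> n)"
    using rho beta bb_pos cl_pos k0 c_pos BG d
    by (intro eventually_conj eventually_ge_at_top b1 h s ln bp s4 b_power_eventually) auto
  then show ?thesis
  proof eventually_elim
    case (elim n)
    have cp: "0 < cl * k0 ^ d * c" using cl_pos k0 c_pos by simp
    have "(real m + 1) / (cl * k0 ^ d * c) \<le> ln (real n)" using elim by blast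
    then have m1: "real m < cl * k0 ^ d * c * ln (real n)" using cp by (simp add: pos_divide_le_eq mult.commute)
    have "1 / c \<le> ln (real n)" using elim by blast
    then have c1: "1 \<le> c * ln (real n)" using c_pos by (simp add: pos_divide_le_eq mult.commute)
    have n1: "2 * kk * Cb \<le> real n" using elim by linarith
    show ?case unfolding large_def using elim m1 c1 n1 b_pos[of n]
      by (intro conjI) (auto simp: mult.commute)
  qed
qed

end

subsection \<open>Probability of a good sample\<close>

lemma measure_Un_le_add:
  "A \<in> sets M \<Longrightarrow> B \<in> sets M \<Longrightarrow> measure M A \<le> x \<Longrightarrow> measure M B \<le> y \<Longrightarrow> measure M (A \<union> B) \<le> x + y"
  using measure_Un_le[of A M B] by linarith

lemma bex_event_mono: "\<exists>E\<in>S. measure N E \<le> x \<and> Q E \<Longrightarrow> x \<le> y \<Longrightarrow> \<exists>E\<in>S. measure N E \<le> y \<and> Q E"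
  by (meson order_trans)

locale tuned_sample = tuning d D Cd fmin fmax \<rho> \<beta> \<epsilon>\<^sub>d C\<^sub>d wt + S: outlier_sample D d Cd fmin fmax \<rho> \<beta> P M n
  for d D Cd fmin fmax \<rho> \<beta> \<epsilon>\<^sub>d C\<^sub>d wt P M n +
  assumes n_large: "large n"
begin

lemma S_consts: "S.a = a" "S.bb = bb" "S.cU = cU"
  by (simp_all add: S.a_def S.bb_def S.cU_def cU_def)

lemma n3: "3 \<le> n" and b: "0 < b n" "b n < 1" and ln1: "1 \<le> ln (real n)"
  using n_large by (auto simp: large_def)

sublocale W: bandwidths d "b n"
  using d b by unfold_locales auto

lemma h_0: "W.h 0 = h0 n"
  by (simp add: W.h_def h0_def)

lemma hinf_le: "W.hinf \<le> h0 n" using W.hinf_le[of 0] by (simp add: h_0)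

lemma h0_1: "h0 n \<le> 1" "h0 n \<le> \<rho> / 300" "0 < h0 n"
  using n_large W.h_pos[of 0] by (auto simp: large_def h_0)

lemma b_n: "b n * (\<beta> * (real n - 1)) = c * ln (real n)"
  using n3 beta by (simp add: b_def)

lemma b_n_le: "real n * b n \<le> 2 * c / \<beta> * ln (real n)"
proof -
  have "real n * (b n * \<beta>) \<le> (2 * (real n - 1)) * (b n * \<beta>)" using n3 b beta by (intro mult_right_mono) auto
  also have "\<dots> = 2 * (b n * (\<beta> * (real n - 1)))" by (simp add: algebra_simps)
  finally have "real n * b n * \<beta> \<le> 2 * c * ln (real n)" unfolding b_n by (simp add: algebra_simps)
  then show ?thesis using beta by (simp add: field_simps)
qed

lemma b_ge: "1 / real n \<le> b n" "c * ln (real n) \<le> real n * (b n * \<beta>)"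
proof -
  have "b n * (\<beta> * (real n - 1)) \<le> b n * (\<beta> * real n)" using b beta by (intro mult_left_mono) auto
  then show *: "c * ln (real n) \<le> real n * (b n * \<beta>)" unfolding b_n by (simp add: algebra_simps)
  have "1 \<le> real n * (b n * \<beta>)" using * n_large by (simp add: large_def)
  also have "\<dots> \<le> real n * (b n * 1)" using b beta by (intro mult_left_mono) auto
  finally show "1 / real n \<le> b n" using n3 by (simp add: field_simps)
qed

text \<open>\<open>inlier_counts\<close> covers radii from 4 s on, and the smallest radius required
  is \<open>k1 * hinf\<close>.\<close>

definition s where "s = k1 * W.hinf / 4"

text \<open>The noise is spread over dimension D > d, which leaves a spare factor x.\<close>

lemma small_ball: "0 < x \<Longrightarrow> x \<le> 1 \<Longrightarrow> cU * x \<le> \<beta> * bb \<Longrightarrow> cU * x ^ D \<le> \<beta> * (bb * x ^ d)"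
proof -
  assume x: "0 < x" "x \<le> 1" "cU * x \<le> \<beta> * bb"
  have "x ^ D \<le> x ^ (d + 1)" using x d by (intro power_decreasing) auto
  then have "cU * x ^ D \<le> cU * x ^ (d + 1)" using cU_pos by (intro mult_left_mono) auto
  also have "\<dots> = (cU * x) * x ^ d" by simp
  also have "\<dots> \<le> (\<beta> * bb) * x ^ d" using x by (intro mult_right_mono) auto
  finally show ?thesis by (simp add: mult.assoc)
qed

lemma s_props: "0 < s" "s \<le> h0 n" "4 * s = k1 * W.hinf" "a * (s / 2) ^ d * \<beta> * real n \<ge> 16 * ln (real n)"
proof -
  show "0 < s" using k1 W.hinf_pos by (simp add: s_def)
  have "k1 * W.hinf \<le> 1 * W.hinf" using k1 W.hinf_pos by (intro mult_right_mono) auto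
  then show "s \<le> h0 n" using hinf_le h0_1 by (simp add: s_def)
  show "4 * s = k1 * W.hinf" by (simp add: s_def)
  have "s / 2 = k1 / 8 * W.hinf" by (simp add: s_def)
  then have "(s / 2) ^ d = (k1 / 8) ^ d * b n" by (simp only: power_mult_distrib W.hinf_d)
  then have "a * (s / 2) ^ d * \<beta> * real n = a * (k1 / 8) ^ d * (real n * (b n * \<beta>))" by (simp only: mult_ac)
  moreover have "a * (k1 / 8) ^ d * (c * ln (real n)) \<le> a * (k1 / 8) ^ d * (real n * (b n * \<beta>))"
    using b_ge(2) a_pos k1 by (intro mult_left_mono) auto
  moreover have "a * (k1 / 8) ^ d * c = 16"
    using ball_lower_pos[OF d(1)] f(1) k1(1) by (simp add: c_const_def power_divide)
  then have "a * (k1 / 8) ^ d * (c * ln (real n)) = 16 * ln (real n)" by (simp only: mult.assoc[symmetric])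
  ultimately show "a * (s / 2) ^ d * \<beta> * real n \<ge> 16 * ln (real n)" by linarith
qed

lemma inlier_event:
  "\<exists>E\<in>sets S.N. measure S.N E \<le> 2 / real n ^ 3 \<and> (\<forall>X\<in>space S.N - E. S.distinct_on X \<longrightarrow>
    (\<forall>x\<in>M. \<forall>r. k1 * W.hinf \<le> r \<and> r \<le> 2 * h0 n \<longrightarrow>
      cl * (\<beta> * (real n - 1)) * r ^ d \<le> real (card (X ` {..<n} \<inter> M \<inter> cball x r)) \<and>
      real (card (X ` {..<n} \<inter> M \<inter> cball x r)) \<le> cu * (\<beta> * (real n - 1)) * r ^ d))"
proof -
  have s50: "s \<le> \<rho> / 50" using s_props(2) h0_1 rho by linarith
  have "cU * s \<le> cU * h0 n" using s_props cU_pos by (intro mult_left_mono) auto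
  then have "cU * s \<le> \<beta> * bb" using n_large unfolding large_def by linarith
  then have cs: "S.cU * s ^ D \<le> \<beta> * (S.bb * s ^ d)"
    unfolding S_consts using s_props h0_1 by (intro small_ball) linarith+
  from S.inlier_counts[OF s_props(1) s50 cs, unfolded S_consts] obtain E where E: "E \<in> sets S.N"
    "measure S.N E \<le> 2 / (a * (s / 2) ^ d) * exp (- (real n * (\<beta> * (a * (s / 2) ^ d)) / 4))"
    "\<And>X x r. X \<in> space S.N - E \<Longrightarrow> S.distinct_on X \<Longrightarrow> x \<in> M \<Longrightarrow> 4 * s \<le> r \<Longrightarrow> r + 2 * s \<le> \<rho> / 50 \<Longrightarrow>
      a\<^sup>2 / (4 * 4 ^ d * bb) * (\<beta> * real n) * r ^ d \<le> real (card (X ` {..<n} \<inter> M \<inter> cball x r)) \<and>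
      real (card (X ` {..<n} \<inter> M \<inter> cball x r)) \<le> 8 * 4 ^ d * bb\<^sup>2 / a * (\<beta> * real n) * r ^ d"
    by (elim bexE conjE) meson
  define y where "y = a * (s / 2) ^ d"
  have y: "0 < y" using a_pos s_props by (simp add: y_def)
  have yb: "16 * ln (real n) \<le> y * \<beta> * real n" using s_props(4) by (simp add: y_def)
  \<comment> \<open>The choice of c makes this at most \<open>n ^ (-4)\<close> per net point, and
    the net has at most n points.\<close>
  have "exp (- (real n * (\<beta> * y) / 4)) \<le> exp (- (4 * ln (real n)))" using yb by (simp add: algebra_simps)
  also have "\<dots> = 1 / real n ^ 4" using n3 by (simp add: exp_minus exp_of_nat_mult[of 4, simplified] divide_inverse)
  finally have e: "exp (- (real n * (\<beta> * y) / 4)) \<le> 1 / real n ^ 4" .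
  have "1 \<le> y * \<beta> * real n" using yb ln1 by linarith
  also have "\<dots> \<le> y * 1 * real n" using y beta by (intro mult_right_mono mult_left_mono) auto
  finally have "1 / y \<le> real n" using y by (simp add: field_simps)
  then have "2 * (1 / y) * exp (- (real n * (\<beta> * y) / 4)) \<le> 2 * real n * (1 / real n ^ 4)"
    using e y by (intro mult_mono) auto
  also have "\<dots> = 2 / real n ^ 3" using n3 by (simp add: field_simps power_eq_if)
  finally have m: "measure S.N E \<le> 2 / real n ^ 3" using E(2) by (simp add: y_def)
  have "cl * (\<beta> * (real n - 1)) * r ^ d \<le> real (card (X ` {..<n} \<inter> M \<inter> cball x r)) \<and>
      real (card (X ` {..<n} \<inter> M \<inter> cball x r)) \<le> cu * (\<beta> * (real n - 1)) * r ^ d"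
    if X: "X \<in> space S.N - E" "S.distinct_on X" "x \<in> M" and r: "k1 * W.hinf \<le> r" "r \<le> 2 * h0 n" for X x r
  proof -
    have "r + 2 * s \<le> \<rho> / 50" using r s_props h0_1 rho by linarith
    then have "cl * (\<beta> * real n) * r ^ d \<le> real (card (X ` {..<n} \<inter> M \<inter> cball x r))"
      and 2: "real (card (X ` {..<n} \<inter> M \<inter> cball x r)) \<le> cu / 2 * (\<beta> * real n) * r ^ d"
      using E(3)[OF X, of r] r s_props(3) by (simp_all add: cl_const_def cu_const_def)
    moreover have r0: "0 \<le> r" using r k1 W.hinf_pos by (meson less_le_trans less_imp_le mult_pos_pos)
    have "cl * (\<beta> * (real n - 1)) * r ^ d \<le> cl * (\<beta> * real n) * r ^ d"
      using cl_pos beta r0 by (intro mult_right_mono mult_left_mono) auto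
    moreover have "cu * (\<beta> * (real n / 2)) * r ^ d \<le> cu * (\<beta> * (real n - 1)) * r ^ d"
      using cu_pos beta r0 n3 by (intro mult_right_mono mult_left_mono) auto
    ultimately show ?thesis by auto
  qed
  then show ?thesis using E(1) m by blast
qed

lemma distinct_event:
  "\<exists>E\<in>sets S.N. measure S.N E \<le> 2 ^ d * exp 1 * (2 * bb)\<^sup>2 / a / real n ^ 3 \<and> (\<forall>X\<in>space S.N - E. S.distinct_on X)"
proof -
  have n: "1 \<le> real n" "0 < real n" using n3 by auto
  have sp: "0 < s' n" "s' n \<le> \<rho> / 50" "cU * s' n \<le> \<beta> * bb" "s' n \<le> 1" and q: "real n * (2 * (\<beta> * (bb * s' n ^ d))) < 1"
    using n_large n by (auto simp: large_def s'_def)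
  have cs: "S.cU * s' n ^ D \<le> \<beta> * (S.bb * s' n ^ d)" unfolding S_consts by (rule small_ball[OF sp(1,4,3)])
  have sd: "s' n ^ d = 1 / real n ^ 5"
  proof -
    have "s' n ^ d = real n powr (- real 5)" unfolding s'_def using d n by (simp add: powr_realpow[symmetric] powr_powr)
    also have "\<dots> = 1 / real n ^ 5" using n by (simp only: powr_minus powr_realpow) (simp add: divide_inverse)
    finally show ?thesis .
  qed
  have "1 / (a * (s' n / 2) ^ d) * (exp 1 * (real n * (2 * (\<beta> * (bb * s' n ^ d))))\<^sup>2) =
      2 ^ d * exp 1 * (2 * bb * \<beta>)\<^sup>2 / a / real n ^ 3"
    unfolding power_divide sd using n a_pos by (simp add: field_simps power_eq_if)
  also have "\<dots> \<le> 2 ^ d * exp 1 * (2 * bb)\<^sup>2 / a / real n ^ 3"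
    using n a_pos bb_pos beta mult_left_le[of \<beta> "2 * bb"]
    by (intro divide_right_mono mult_left_mono power_mono) auto
  finally have le: "1 / (a * (s' n / 2) ^ d) * (exp 1 * (real n * (2 * (\<beta> * (bb * s' n ^ d))))\<^sup>2) \<le> \<dots>" .
  have "0 < n" using n3 by simp
  from bex_event_mono[OF S.distinct_event[OF sp(1,2) cs this, unfolded S_consts, OF q] le] show ?thesis .
qed

lemma power_rate: "W.h 1 ^ d * (W.h 0)\<^sup>2 = b n powr (1 + 2 / (real d + 2))"
proof -
  have "W.h 1 ^ d * (W.h 0)\<^sup>2 = b n powr (rate_exp d 1 * real d + rate_exp d 0 * 2)"
    unfolding W.h_def using b by (simp only: powr_add powr_powr[symmetric] powr_gt_zero powr_realpow) simp
  also have "rate_exp d 1 * real d + rate_exp d 0 * 2 = 1 + 2 / (real d + 2)"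
    by (simp add: divide_simps) (simp add: algebra_simps)
  finally show ?thesis .
qed

lemma ball_event:
  "\<exists>E\<in>sets S.N. measure S.N E \<le> (2 * real D * (kk + 1)) ^ D / real n ^ 3 \<and>
    (\<forall>X\<in>space S.N - E. X ` {..<n} \<subseteq> S.B \<longrightarrow>
      (\<forall>p. real (card ((X ` {..<n} - M) \<inter> cball p (h0 n))) \<le> A * ln (real n)))"
proof -
  have n: "1 \<le> real n" "0 < real n" using n3 by auto
  have m: "0 < A * ln (real n)" using A_pos ln1 by simp
  \<comment> \<open>As D > d and \<open>h 0 ^ (d + 1) = b\<close>, the expected number of outliers
    per ball is at most of order n b, that is log n.\<close>
  have "h0 n ^ D \<le> h0 n ^ (d + 1)" using h0_1 d by (intro power_decreasing) auto
  also have "\<dots> = b n" using W.h_0 by (simp only: h_0)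
  finally have "real n * (cU * (3 * h0 n) ^ D) \<le> cU * 3 ^ D * (real n * b n)"
    using cU_pos n by (simp add: power_mult_distrib)
  also have "\<dots> \<le> cU * 3 ^ D * (2 * c / \<beta> * ln (real n))" using cU_pos b_n_le by (intro mult_left_mono) auto
  finally have "real n * (cU * (3 * h0 n) ^ D) \<le> cU * 3 ^ D * (2 * c / \<beta> * ln (real n))" .
  moreover have AL: "A * ln (real n) = 2 * (cU * 3 ^ D * (2 * c / \<beta> * ln (real n))) + real (D + 4) * ln (real n)"
    by (simp add: A_def distrib_right)
  ultimately have "2 * (real n * (cU * (3 * h0 n) ^ D)) - A * ln (real n) \<le> - (real (D + 4) * ln (real n))"
    using AL by linarith
  then have "exp (2 * (real n * (cU * (3 * h0 n) ^ D)) - A * ln (real n)) \<le> exp (- (real (D + 4) * ln (real n)))" by simp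
  also have "\<dots> = 1 / real n ^ (D + 4)" using n unfolding exp_minus exp_of_nat_mult by (simp add: divide_inverse)
  finally have e: "exp (2 * (real n * (cU * (3 * h0 n) ^ D)) - A * ln (real n)) \<le> 1 / real n ^ (D + 4)" .
  have "1 / real n \<le> h0 n"
  proof -
    have "b n powr 1 \<le> b n powr (1 / (real d + 1))" using b by (intro powr_mono') auto
    then show ?thesis using b_ge(1) b by (simp add: h0_def)
  qed
  then have "1 / h0 n \<le> real n" using h0_1 n by (simp add: field_simps)
  then have "2 * real D * (kk + 1) * (1 / h0 n) \<le> 2 * real D * (kk + 1) * real n"
    using kk_pos by (intro mult_left_mono) auto
  then have "2 * real D * (kk + 1) / h0 n \<le> 2 * real D * (kk + 1) * real n" by simp
  then have "(2 * real D * (kk + 1) / h0 n) ^ D \<le> (2 * real D * (kk + 1) * real n) ^ D"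
    using h0_1 kk_pos by (intro power_mono) auto
  then have "(2 * real D * (kk + 1) / h0 n) ^ D * exp (2 * (real n * (cU * (3 * h0 n) ^ D)) - A * ln (real n)) \<le>
      (2 * real D * (kk + 1) * real n) ^ D * (1 / real n ^ (D + 4))"
    using e kk_pos h0_1 by (intro mult_mono) auto
  also have "\<dots> = (2 * real D * (kk + 1)) ^ D / real n ^ 4" using n by (simp add: power_mult_distrib power_add)
  also have "\<dots> \<le> (2 * real D * (kk + 1)) ^ D / real n ^ 3"
    using n kk_pos by (intro divide_left_mono power_increasing) auto
  finally show ?thesis by (rule bex_event_mono[OF S.outlier_ball_counts[OF h0_1(3) h0_1(1) m, unfolded S_consts]])
qed

lemma tube_event:
  "\<exists>E\<in>sets S.N. measure S.N E \<le> 2 ^ d * exp 1 / a / real n ^ 3 \<and>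
    (\<forall>X\<in>space S.N - E. \<forall>x\<in>M.
      real (card {q \<in> X ` {..<n} - M. dist q x \<le> 2 * W.h 1 \<and> infdist q M \<le> a0 * (W.h 0)\<^sup>2}) \<le> real m)"
proof -
  define u where "u = W.h 1"
  define v where "v = (W.h 0)\<^sup>2"
  have n: "1 \<le> real n" "0 < real n" using n3 by auto
  have u0: "0 < u" using W.h_pos by (simp add: u_def)
  have v0: "0 < v" using W.h_pos[of 0] by (simp add: v_def)
  have vle: "v \<le> b n powr (1 / (real d + 2)) * u" using W.h_square_le[of 0] by (simp add: v_def u_def)
  have "b n powr (1 / (real d + 2)) \<le> b n powr 0" using b by (intro powr_mono') auto
  then have "b n powr (1 / (real d + 2)) * u \<le> 1 * u" using b u0 by (intro mult_right_mono) auto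
  then have vu: "v \<le> u" using vle by simp
  have "a0 * v \<le> a0 * (b n powr (1 / (real d + 2)) * u)" using vle a0_pos by (intro mult_left_mono) auto
  also have "\<dots> = (a0 * b n powr (1 / (real d + 2))) * u" by simp
  also have "\<dots> \<le> 1 * u" using n_large u0 by (intro mult_right_mono) (auto simp: large_def)
  finally have av: "a0 * v \<le> u" by simp
  have "u \<le> h0 n" using W.h_antimono[of 0 1] by (simp add: u_def h_0)
  then have u50: "6 * u \<le> \<rho> / 50" and u1: "u \<le> 1" using h0_1 by linarith+
  define q where "q = bb * (6 * u) ^ d / (a * (v / 2) ^ d) * (cU * ((a0 + 1) * v) ^ D)"
  \<comment> \<open>Against the number of balls, of order \<open>(u / v) ^ d\<close>, this leaves
    noise of order \<open>u ^ d * v\<close>, which is b to a power above 1.\<close>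
  have "v ^ D \<le> v ^ (d + 1)" using v0 vu u1 d by (intro power_decreasing) auto
  then have "q \<le> bb * (6 * u) ^ d / (a * (v / 2) ^ d) * (cU * ((a0 + 1) ^ D * v ^ (d + 1)))"
    unfolding q_def power_mult_distrib[of "a0 + 1"] using bb_pos a_pos u0 v0 cU_pos a0_pos by (intro mult_left_mono) auto
  also have "\<dots> = bb * cU * (a0 + 1) ^ D / a * ((6 * u) ^ d * 2 ^ d) * v" using v0 a_pos by (simp add: power_divide field_simps)
  also have "(6 * u) ^ d * 2 ^ d = (6 * u * 2) ^ d" by (simp only: power_mult_distrib)
  also have "6 * u * 2 = 12 * u" by simp
  also have "(12 * u) ^ d = 12 ^ d * u ^ d" by (rule power_mult_distrib)
  finally have "q \<le> C5 * (u ^ d * v)" by (simp add: C5_def algebra_simps)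
  then have "real n * q \<le> C5 * (real n * b n powr (1 + 2 / (real d + 2)))"
    using n unfolding u_def v_def power_rate by (simp add: mult.left_commute)
  then have nq: "real n * q \<le> real n powr (- (1 / (real d + 2)))" using n_large unfolding large_def by linarith
  have "real n powr (- (1 / (real d + 2))) < real n powr 0" using n3 by (intro powr_less_mono) auto
  then have nq1: "real n * q < 1" using nq n by simp
  have q0: "0 \<le> q" unfolding q_def using bb_pos a_pos u0 v0 cU_pos a0_pos by simp
  \<comment> \<open>The m factors together give \<open>n ^ (-5)\<close>, to be summed over a net
    whose size is at most a multiple of n.\<close>
  have "(real n * q) ^ m \<le> (real n powr (- (1 / (real d + 2)))) ^ m" using nq q0 n by (intro power_mono) auto
  also have "\<dots> = real n powr (- (1 / (real d + 2)) * real m)" using n by (simp add: powr_realpow[symmetric] powr_powr)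
  also have "- (1 / (real d + 2)) * real m = - real 5" by (simp add: m_def add.commute divide_simps)
  also have "real n powr (- real 5) = 1 / real n ^ 5" using n by (simp only: powr_minus powr_realpow) (simp add: divide_inverse)
  finally have qm: "(real n * q) ^ m \<le> 1 / real n ^ 5" .
  have "1 / real n \<le> u ^ d" using b_ge(1) W.b_le_h[of 1] by (simp add: u_def)
  then have "1 \<le> real n * u ^ d" using n by (simp add: field_simps)
  then have "1 / (a * (u / 2) ^ d) \<le> 2 ^ d * real n / a"
    using a_pos u0 by (simp add: power_divide field_simps)
  then have "1 / (a * (u / 2) ^ d) * (exp 1 * (real n * q) ^ m) \<le> 2 ^ d * real n / a * (exp 1 * (1 / real n ^ 5))"
    using qm a_pos n q0 u0 by (intro mult_mono mult_left_mono) auto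
  also have "\<dots> = 2 ^ d * exp 1 / a / real n ^ 4" using n a_pos by (simp add: field_simps power_eq_if)
  also have "\<dots> \<le> 2 ^ d * exp 1 / a / real n ^ 3"
    using n a_pos by (intro divide_left_mono power_increasing) auto
  finally have le: "1 / (a * (u / 2) ^ d) * (exp 1 * (real n * q) ^ m) \<le> \<dots>" .
  have "0 < n" using n3 by simp
  from bex_event_mono[OF S.outlier_tube_counts[OF v0 vu av u50 a0_pos(1) this, unfolded S_consts, folded q_def, OF nq1] le]
  show ?thesis unfolding u_def v_def .
qed

end

context tuned_sample
begin

lemma good_event:
  assumes tse: "is_TSE D d tse"
  shows "\<exists>E\<in>sets S.N. measure S.N E \<le> Cb / real n ^ 3 \<and> (\<forall>X\<in>space S.N - E. X ` {..<n} \<subseteq> S.B \<and>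
    good_sample D d M \<rho> (b n) n \<beta> c X tse cl cu k1 k0 k1 k2 t K K0' a0 (A * ln (real n)) (real m))"
proof -
  from inlier_event obtain E1 where E1: "E1 \<in> sets S.N" "measure S.N E1 \<le> 2 / real n ^ 3"
    "\<And>X x r. X \<in> space S.N - E1 \<Longrightarrow> S.distinct_on X \<Longrightarrow> x \<in> M \<Longrightarrow> k1 * W.hinf \<le> r \<Longrightarrow> r \<le> 2 * h0 n \<Longrightarrow>
      cl * (\<beta> * (real n - 1)) * r ^ d \<le> real (card (X ` {..<n} \<inter> M \<inter> cball x r)) \<and>
      real (card (X ` {..<n} \<inter> M \<inter> cball x r)) \<le> cu * (\<beta> * (real n - 1)) * r ^ d"
    by (elim bexE conjE) meson
  from distinct_event obtain E2 where E2: "E2 \<in> sets S.N"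
    "measure S.N E2 \<le> 2 ^ d * exp 1 * (2 * bb)\<^sup>2 / a / real n ^ 3" "\<And>X. X \<in> space S.N - E2 \<Longrightarrow> S.distinct_on X"
    by (elim bexE conjE) meson
  from ball_event obtain E3 where E3: "E3 \<in> sets S.N"
    "measure S.N E3 \<le> (2 * real D * (kk + 1)) ^ D / real n ^ 3"
    "\<And>X p. X \<in> space S.N - E3 \<Longrightarrow> X ` {..<n} \<subseteq> S.B \<Longrightarrow> real (card ((X ` {..<n} - M) \<inter> cball p (h0 n))) \<le> A * ln (real n)"
    by (elim bexE conjE) meson
  from tube_event obtain E4 where E4: "E4 \<in> sets S.N"
    "measure S.N E4 \<le> 2 ^ d * exp 1 / a / real n ^ 3"
    "\<And>X x. X \<in> space S.N - E4 \<Longrightarrow> x \<in> M \<Longrightarrow>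
      real (card {q \<in> X ` {..<n} - M. dist q x \<le> 2 * W.h 1 \<and> infdist q M \<le> a0 * (W.h 0)\<^sup>2}) \<le> real m"
    by (elim bexE conjE) meson
  define F where "F = space S.N - {X\<in>space S.N. X ` {..<n} \<subseteq> S.B}"
  have F: "F \<in> sets S.N" "measure S.N F = 0" unfolding F_def using S.sample_in_ball by auto
  define E where "E = E1 \<union> E2 \<union> E3 \<union> E4 \<union> F"
  have Es: "E \<in> sets S.N" unfolding E_def using E1(1) E2(1) E3(1) E4(1) F(1) by (intro sets.Un)
  have "measure S.N E \<le> 2 / real n ^ 3 + 2 ^ d * exp 1 * (2 * bb)\<^sup>2 / a / real n ^ 3
      + (2 * real D * (kk + 1)) ^ D / real n ^ 3 + 2 ^ d * exp 1 / a / real n ^ 3 + 0"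
    unfolding E_def
    by (intro measure_Un_le_add sets.Un E1(1,2) E2(1,2) E3(1,2) E4(1,2) F(1)) (simp only: F(2) order_refl)
  also have "\<dots> = Cb / real n ^ 3" by (simp add: Cb_def add_divide_distrib)
  finally have m: "measure S.N E \<le> Cb / real n ^ 3" .
  have L: "0 < ln (real n)" using ln1 by linarith
  have hinf_h0: "W.hinf \<le> h0 n" by (rule hinf_le)
  have "good_sample D d M \<rho> (b n) n \<beta> c X tse cl cu k1 k0 k1 k2 t K K0' a0 (A * ln (real n)) (real m)" and "X ` {..<n} \<subseteq> S.B"
    if X: "X \<in> space S.N - E" for X
  proof -
    have Xi: "X \<in> space S.N - E1" "X \<in> space S.N - E2" "X \<in> space S.N - E3" "X \<in> space S.N - E4"
      and XB: "X ` {..<n} \<subseteq> S.B"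
      using X unfolding E_def F_def by auto
    show "X ` {..<n} \<subseteq> S.B" by (rule XB)
    have bL: "cl * k0 ^ d * c * ln (real n) = t * (real n - 1) * b n"
    proof -
      have "t * (real n - 1) * b n = cl * k0 ^ d * (b n * (\<beta> * (real n - 1)))" unfolding t_def by (simp only: mult_ac)
      then show ?thesis unfolding b_n by (simp only: mult.assoc)
    qed
    show "good_sample D d M \<rho> (b n) n \<beta> c X tse cl cu k1 k0 k1 k2 t K K0' a0 (A * ln (real n)) (real m)"
    proof (rule good_sample.intro[OF S.reach_manifold_axioms W.bandwidths_axioms], rule good_sample_axioms.intro)
      show "d \<le> D" using d by simp
      show "is_TSE D d tse" by (rule tse)
      show "b n = c * (ln (real n) / (\<beta> * (real n - 1)))" by (rule b_def)
      show "0 < \<beta>" "1 < n" "0 < cl" "0 < cu" "0 < k1" "k1 \<le> 1 / 16" "k1 \<le> k1" "0 < k2" "0 < k0" "k0 \<le> k1"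
        using beta n3 cl_pos cu_pos k1 rho k0 by auto
      show "K = 30 * 32 ^ d * (cu / cl) + 1" by (rule K_const_def)
      show "X i \<in> Rn D" if "i < n" for i using XB that S.B_sets(2) by auto
      show "cl * (\<beta> * (real n - 1)) * r ^ d \<le> real (card (X ` {..<n} \<inter> M \<inter> cball x r))"
        "real (card (X ` {..<n} \<inter> M \<inter> cball x r)) \<le> cu * (\<beta> * (real n - 1)) * r ^ d"
        if "x \<in> M" "k1 * W.hinf \<le> r" "r \<le> 2 * W.h 0" for x r
        using E1(3)[OF Xi(1) E2(3)[OF Xi(2)] that(1,2)] that(3) unfolding h_0 by auto
      show "real (card ((X ` {..<n} - M) \<inter> cball p (W.h 0))) \<le> A * ln (real n)" for p
        unfolding h_0 by (rule E3(3)[OF Xi(3) XB])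
      show "real (card {q \<in> X ` {..<n} - M. dist q x \<le> 2 * W.h 1 \<and> infdist q M \<le> a0 * (W.h 0)\<^sup>2}) \<le> real m"
        if "x \<in> M" for x by (rule E4(3)[OF Xi(4) that])
      show "1 / \<rho> \<le> a0" by (rule a0_pos(2))
      show "a0 * b n powr (1 / (real d + 2)) \<le> 1 / 8" using n_large unfolding large_def by blast
      show "W.h 0 \<le> \<rho> / 16" using h0_1 rho unfolding h_0 by linarith
      have "A * ln (real n) / (cl * (c * ln (real n))) = A / (cl * c)" using L by simp
      then have "60 * 16 ^ d * (A * ln (real n)) / (cl * (c * ln (real n))) = 60 * 16 ^ d * A / (cl * c)"
        by (metis times_divide_eq_right)
      then show "30 * 32 ^ d * (cu / cl) / \<rho> + 60 * 16 ^ d * (A * ln (real n)) / (cl * (b n * (\<beta> * (real n - 1)))) \<le> K0'"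
        unfolding b_n K0'_def by simp
      show "K0' * W.h 0 < 1" "K / \<rho> * W.h 0 < 1" using n_large unfolding large_def h_0 by blast+
      have "30 * 16 ^ d * real m * (a0 + 3 / \<rho>) / (cl * c) * \<rho> \<le> ln (real n)" using n_large unfolding large_def by blast
      then have "30 * 16 ^ d * real m * (a0 + 3 / \<rho>) / (cl * c) \<le> 1 / \<rho> * ln (real n)"
        using pos_le_divide_eq[OF rho] by simp
      then have "30 * 16 ^ d * real m * (a0 + 3 / \<rho>) / (cl * c) / ln (real n) \<le> 1 / \<rho>"
        using pos_divide_le_eq[OF L] by blast
      then show "30 * 16 ^ d * real m * (a0 + 3 / \<rho>) / (cl * (b n * (\<beta> * (real n - 1)))) \<le> 1 / \<rho>"
        unfolding b_n by (simp add: mult.assoc)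
      have "k2 * h0 n \<le> k2 * (\<rho> / 300)" using h0_1 rho by (intro mult_left_mono) auto
      also have "\<dots> = 1 / 2400" using rho by simp
      finally show "k1 + k2 * W.h 0 \<le> 1 / 8" using k1(2) unfolding h_0 by linarith
      show "2 * ((1 / 8)\<^sup>2 / \<rho> + K0' * k1 + k2) \<le> a0" by (simp add: a0_def)
      have "K / \<rho> * k1 = K * k1 / \<rho>" by simp
      then have Kk: "K / \<rho> * k1 = 1 / 16 / \<rho>" unfolding k1(3) .
      show "2 * ((1 / 8)\<^sup>2 / \<rho> + K / \<rho> * k1 + k2) \<le> 1 / \<rho>" unfolding Kk using rho by (simp add: power2_eq_square field_simps)
      have "k1 * k1 \<le> (1 / 16) * (1 / 16)" using k1 by (intro mult_mono) auto
      then have "k1\<^sup>2 / (2 * \<rho>) \<le> (1 / 256) / (2 * \<rho>)" using rho by (intro divide_right_mono) (auto simp: power2_eq_square)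
      also have "\<dots> \<le> 1 / 16 / \<rho>" using rho by (simp add: field_simps)
      finally show "k1\<^sup>2 / (2 * \<rho>) + K / \<rho> * k1 \<le> k2" unfolding Kk using rho by simp
      show "k0\<^sup>2 / (2 * \<rho>) + K0' * k0 \<le> k2" by (rule k0(3))
      show "0 < t" "t \<le> \<beta> * cl * k0 ^ d" using t_pos by (auto simp: t_def)
      \<comment> \<open>Since \<open>h0 ^ d\<close> is b / h0, the threshold is a multiple of log n
        / h0 and exceeds the A log n outliers once h0 is small.\<close>
      have "A * h0 n * ln (real n) < cl * k0 ^ d * c * ln (real n)"
        using n_large L unfolding large_def by (intro mult_strict_right_mono) auto
      also have "\<dots> = t * (real n - 1) * h0 n ^ d * h0 n"
        unfolding bL mult.assoc[of _ "h0 n ^ d"] using W.h_0 unfolding h_0 by (simp add: mult.commute)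
      finally have "(A * ln (real n)) * h0 n < (t * (real n - 1) * h0 n ^ d) * h0 n" by (simp only: mult_ac)
      then show "A * ln (real n) < t * (real n - 1) * W.h 0 ^ d"
        unfolding h_0 using h0_1(3) by (simp only: mult_less_cancel_right_pos)
      show "real m < t * (real n - 1) * W.hinf ^ d"
        unfolding W.hinf_d bL[symmetric] using n_large unfolding large_def by blast
      \<comment> \<open>With x = d this makes \<open>hinf\<close> smaller than h 0 by a fixed power
        of b, which beats the possibly small ratio k0 / k1.\<close>
      have "1 / x = 1 / (x * (x + 1)) + 1 / (x + 1)" if "0 < x" for x :: real
        using that by (simp add: divide_simps)
      from this[of "real d"] d have "W.hinf = b n powr (1 / (real d * (real d + 1))) * h0 n"
        unfolding W.hinf_def h0_def powr_add[symmetric] by simp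
      then have "k1 * W.hinf = (k1 * b n powr (1 / (real d * (real d + 1)))) * h0 n" by simp
      also have "\<dots> \<le> k0 * h0 n" using n_large h0_1(3) unfolding large_def by (intro mult_right_mono) auto
      finally show "k1 * W.hinf \<le> k0 * W.h 0" unfolding h_0 .
    qed
  qed
  then show ?thesis using Es m by blast
qed

end

subsection \<open>The rate of convergence\<close>

definition rate :: "nat \<Rightarrow> real \<Rightarrow> nat \<Rightarrow> real" where
  "rate d \<beta> n = (ln (real n) / (\<beta> * real n)) powr (2 / real d)"

text \<open>The first factor is the constant of \<open>recovery\<close>; the power of 2 c converts
  \<open>hinf\<^sup>2\<close> into the rate, the 2 coming from n \<le> 2 (n - 1).\<close>

definition C_const :: "nat \<Rightarrow> real \<Rightarrow> real \<Rightarrow> real \<Rightarrow> real \<Rightarrow> real" where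
  "C_const d fmin fmax \<rho> C = (K_const d fmin fmax + 1 + C * (6 + 1280 * (K_const d fmin fmax + 4))) / \<rho> *
    (2 * c_const d fmin fmax) powr (2 / real d)"

context tuning
begin

abbreviation "CC \<equiv> C_const d fmin fmax \<rho> C\<^sub>d"

lemma CC_pos: "0 < CC"
  unfolding C_const_def using BG K_ge rho c_pos by (intro mult_pos_pos divide_pos_pos add_pos_pos) auto

end

context tuned_sample
begin

lemma hinf_rate: "W.hinf\<^sup>2 \<le> (2 * c) powr (2 / real d) * rate d \<beta> n"
proof -
  have n: "0 < real n" using n3 by auto
  have "W.hinf\<^sup>2 = b n powr (2 / real d)"
    unfolding W.hinf_def using b by (simp add: powr_realpow[symmetric] powr_powr)
  also have "\<dots> \<le> (2 * c * (ln (real n) / (\<beta> * real n))) powr (2 / real d)"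
  proof (rule powr_mono2)
    show "b n \<le> 2 * c * (ln (real n) / (\<beta> * real n))" using b_n_le n beta by (simp add: field_simps)
  qed (use b in auto)
  also have "\<dots> = (2 * c) powr (2 / real d) * rate d \<beta> n"
    unfolding rate_def using c_pos ln1 beta n by (intro powr_mult)
  finally show ?thesis .
qed

text \<open>Lets the rate dominate the exceptional event, which contributes at most
  \<open>1 / n\<^sup>2\<close> to the expectation.\<close>

lemma rate_ge: "1 / (real n)\<^sup>2 \<le> rate d \<beta> n"
proof -
  have n: "1 \<le> real n" "0 < real n" using n3 by auto
  have "1 / (real n)\<^sup>2 = (1 / real n) powr 2" using n by (simp add: power_one_over)
  also have "\<dots> \<le> (1 / real n) powr (2 / real d)" using n d by (intro powr_mono') (auto simp: field_simps)
  also have "\<dots> \<le> rate d \<beta> n" unfolding rate_def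
  proof (rule powr_mono2)
    have "\<beta> * 1 \<le> 1 * ln (real n)" using beta ln1 by (intro mult_mono) auto
    then show "1 / real n \<le> ln (real n) / (\<beta> * real n)" using n beta by (simp add: field_simps)
  qed (use n in auto)
  finally show ?thesis .
qed

lemma convex_B: "convex S.B"
  unfolding B0_def using subspace_Rn by (intro convex_Int convex_cball subspace_imp_convex)

lemma diameter_B: "bounded S.B" "diameter S.B \<le> 2 * kk"
proof -
  show "bounded S.B" unfolding B0_def by (rule bounded_Int) simp
  have "diameter S.B \<le> diameter (cball (0::euc) kk)" unfolding B0_def by (rule diameter_subset) auto
  also have "\<dots> \<le> 2 * kk"
    by (rule diameter_le) (use kk_pos in \<open>auto intro: norm_triangle_le_diff\<close>)
  finally show "diameter S.B \<le> 2 * kk" .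
qed

lemma conclusion:
  assumes tse: "is_TSE D d tse" and fps: "is_FPS fps"
  defines "S' \<equiv> \<lambda>X. carrier_of (M_TDC_plus wt tse fps D d \<rho> \<beta> k1 k2 c t 1 M n X)"
  obtains E where "E \<in> sets S.N" "measure S.N E \<le> Cb / real n ^ 3"
    "\<And>X. X \<in> space S.N - E \<Longrightarrow> hausdist_in S.B M (S' X) \<le> CC * rate d \<beta> n \<and> ambient_isotopic D M (S' X)"
proof -
  obtain E where E: "E \<in> sets S.N" "measure S.N E \<le> Cb / real n ^ 3"
    "\<And>X. X \<in> space S.N - E \<Longrightarrow> good_sample D d M \<rho> (b n) n \<beta> c X tse cl cu k1 k0 k1 k2 t K K0' a0 (A * ln (real n)) (real m)"
    using good_event[OF tse] by (elim bexE conjE) meson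
  have s1: "(K + 4) * W.hinf / \<rho> \<le> 1 / 10"
  proof -
    have "(K + 4) * W.hinf / \<rho> \<le> (K + 4) * h0 n / \<rho>" using K_ge rho hinf_le by (intro divide_right_mono mult_left_mono) auto
    also have "\<dots> \<le> 1 / 10" using n_large unfolding large_def by blast
    finally show ?thesis .
  qed
  have s2: "W.hinf * (6 + 1280 * (K + 4)) \<le> \<epsilon>\<^sub>d * \<rho>"
  proof -
    have "W.hinf * (6 + 1280 * (K + 4)) \<le> h0 n * (6 + 1280 * (K + 4))" using K_ge hinf_le by (intro mult_right_mono) auto
    also have "\<dots> \<le> \<epsilon>\<^sub>d * \<rho>" using n_large unfolding large_def by blast
    finally show ?thesis .
  qed
  have "hausdist_in S.B M (S' X) \<le> CC * rate d \<beta> n \<and> ambient_isotopic D M (S' X)" if X: "X \<in> space S.N - E" for X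
  proof -
    have r: "hausdist M (S' X) \<le> (K + 1 + C\<^sub>d * (6 + 1280 * (K + 4))) / \<rho> * W.hinf\<^sup>2" "ambient_isotopic D M (S' X)"
      unfolding S'_def by (rule good_sample.recovery[OF E(3)[OF X] BG(3) d(2) fps s1 s2]; assumption)+
    have "S' X \<noteq> {}" using r(2) S.M_props(1) unfolding ambient_isotopic_def by blast
    then have "hausdist_in S.B M (S' X) = hausdist M (S' X)" using S.M_props(1) by (simp add: hausdist_in_def)
    also have "\<dots> \<le> (K + 1 + C\<^sub>d * (6 + 1280 * (K + 4))) / \<rho> * W.hinf\<^sup>2" by (rule r(1))
    also have "\<dots> \<le> (K + 1 + C\<^sub>d * (6 + 1280 * (K + 4))) / \<rho> * ((2 * c) powr (2 / real d) * rate d \<beta> n)"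
      using hinf_rate BG K_ge rho by (intro mult_left_mono) auto
    also have "\<dots> = CC * rate d \<beta> n" by (simp add: C_const_def)
    finally show ?thesis using r(2) by blast
  qed
  then show ?thesis using that E by blast
qed

lemma probability_bound:
  assumes tse: "is_TSE D d tse" and fps: "is_FPS fps"
  defines "S' \<equiv> \<lambda>X. carrier_of (M_TDC_plus wt tse fps D d \<rho> \<beta> k1 k2 c t 1 M n X)"
  shows "1 - Cb / real n ^ 3 \<le> inner_prob S.N
      {X\<in>space S.N. hausdist_in S.B M (S' X) \<le> CC * rate d \<beta> n \<and> ambient_isotopic D M (S' X)}"
    (is "_ \<le> inner_prob S.N ?G")
proof -
  from conclusion[OF tse fps] obtain E where E: "E \<in> sets S.N" "measure S.N E \<le> Cb / real n ^ 3"
    "\<And>X. X \<in> space S.N - E \<Longrightarrow> hausdist_in S.B M (S' X) \<le> CC * rate d \<beta> n \<and> ambient_isotopic D M (S' X)"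
    unfolding S'_def by metis
  have "1 - Cb / real n ^ 3 \<le> measure S.N (space S.N - E)" using E(1,2) by (simp add: S.N.prob_compl)
  also have "\<dots> \<le> inner_prob S.N ?G" unfolding inner_prob_def
  proof (rule cSUP_upper)
    show "space S.N - E \<in> {A \<in> sets S.N. A \<subseteq> ?G}" using E(1,3) by auto
    show "bdd_above (measure S.N ` {A \<in> sets S.N. A \<subseteq> ?G})" by (intro bdd_aboveI2[of _ _ 1]) simp
  qed
  finally show ?thesis .
qed

lemma expectation_bound:
  assumes tse: "is_TSE D d tse" and fps: "is_FPS fps"
  defines "S' \<equiv> \<lambda>X. carrier_of (M_TDC_plus wt tse fps D d \<rho> \<beta> k1 k2 c t 1 M n X)"
  shows "upper_expectation S.N (\<lambda>X. ennreal (hausdist_in S.B M (S' X))) \<le> ennreal ((CC + 1) * rate d \<beta> n)"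
proof -
  from conclusion[OF tse fps] obtain E where E: "E \<in> sets S.N" "measure S.N E \<le> Cb / real n ^ 3"
    "\<And>X. X \<in> space S.N - E \<Longrightarrow> hausdist_in S.B M (S' X) \<le> CC * rate d \<beta> n \<and> ambient_isotopic D M (S' X)"
    unfolding S'_def by metis
  define F where "F = space S.N - {X\<in>space S.N. X ` {..<n} \<subseteq> S.B}"
  have F: "F \<in> sets S.N" "emeasure S.N F = 0"
    unfolding F_def using S.sample_in_ball by (auto simp: S.N.emeasure_eq_measure)
  \<comment> \<open>On F the sample leaves the ball \<open>S.B\<close> and no bound on the loss is
    at hand; F is a null set, so the value top contributes 0. On E the complex still lies in this
    convex ball, and the loss is at most its diameter.\<close>
  define g where "g X = ennreal (CC * rate d \<beta> n) + (ennreal (2 * kk) * indicator E X + top * indicator F X)" for X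
  have le: "ennreal (hausdist_in S.B M (S' X)) \<le> g X" if X: "X \<in> space S.N" for X
  proof -
    consider "X \<in> F" | "X \<in> E" "X ` {..<n} \<subseteq> S.B" | "X \<in> space S.N - E" using X unfolding F_def by blast
    then show ?thesis
    proof cases
      case 1 then show ?thesis by (simp add: g_def)
    next
      case 2
      have "S' X \<subseteq> S.B" unfolding S'_def carrier_of_def
      proof (rule UN_least)
        fix \<tau> assume "\<tau> \<in> M_TDC_plus wt tse fps D d \<rho> \<beta> k1 k2 c t 1 M n X"
        then have "\<tau> \<subseteq> X ` {..<n}" by (intro order_trans[OF Union_upper M_TDC_plus_complex(2)[OF fps]]) auto
        then have "\<tau> \<subseteq> S.B" using 2(2) by (rule order_trans)
        then show "convex hull \<tau> \<subseteq> S.B" using convex_B by (rule hull_minimal)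
      qed
      then have "hausdist_in S.B M (S' X) \<le> diameter S.B"
        by (intro hausdist_in_le_diameter diameter_B(1) S.M_B S.M_props(1))
      then have "ennreal (hausdist_in S.B M (S' X)) \<le> ennreal (2 * kk)" using diameter_B(2) by (intro ennreal_leI) linarith
      also have "\<dots> \<le> g X" unfolding g_def using 2(1) by (simp add: add_increasing)
      finally show ?thesis .
    next
      case 3
      then have "ennreal (hausdist_in S.B M (S' X)) \<le> ennreal (CC * rate d \<beta> n)" using E(3) by (intro ennreal_leI) blast
      also have "\<dots> \<le> g X" unfolding g_def by simp
      finally show ?thesis .
    qed
  qed
  have gm: "g \<in> borel_measurable S.N" unfolding g_def[abs_def] using E(1) F(1) by measurable
  have n: "0 < real n" using n3 by auto
  have "upper_expectation S.N (\<lambda>X. ennreal (hausdist_in S.B M (S' X))) \<le> (\<integral>\<^sup>+X. g X \<partial>S.N)"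
    unfolding upper_expectation_def using gm le by (intro INF_lower) auto
  also have "\<dots> = ennreal (CC * rate d \<beta> n) + (ennreal (2 * kk) * emeasure S.N E + top * emeasure S.N F)"
    unfolding g_def using E(1) F(1)
    by (simp add: nn_integral_add nn_integral_cmult S.N.emeasure_space_1)
  also have "\<dots> = ennreal (CC * rate d \<beta> n) + ennreal (2 * kk * measure S.N E)"
    using kk_pos F(2) by (simp add: S.N.emeasure_eq_measure ennreal_mult)
  also have "\<dots> = ennreal (CC * rate d \<beta> n + 2 * kk * measure S.N E)"
    using CC_pos kk_pos by (intro ennreal_plus[symmetric]) (auto simp: rate_def)
  also have "\<dots> \<le> ennreal ((CC + 1) * rate d \<beta> n)"
  proof (rule ennreal_leI)
    have "2 * kk * measure S.N E \<le> 2 * kk * (Cb / real n ^ 3)" using E(2) kk_pos by (intro mult_left_mono) auto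
    also have "\<dots> = 2 * kk * Cb / real n ^ 3" by simp
    also have "\<dots> \<le> real n / real n ^ 3" using n_large n unfolding large_def by (intro divide_right_mono) auto
    also have "\<dots> = 1 / (real n)\<^sup>2" using n by (simp add: power2_eq_square power3_eq_cube)
    also have "\<dots> \<le> rate d \<beta> n" by (rule rate_ge)
    finally show "CC * rate d \<beta> n + 2 * kk * measure S.N E \<le> (CC + 1) * rate d \<beta> n" by (simp add: distrib_right)
  qed
  finally show ?thesis .
qed

end

section \<open>Uniformity over the model and passage to the limit\<close>

context tuning
begin

lemma tuned_sampleI:
  assumes "(P, M) \<in> outlier_model D d Cd fmin fmax \<rho> \<beta>" "large n"
  shows "tuned_sample d D Cd fmin fmax \<rho> \<beta> \<epsilon>\<^sub>d C\<^sub>d wt P M n"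
proof -
  interpret O: outlier_distribution D d Cd fmin fmax \<rho> \<beta> P M
    by (rule outlier_distribution.intro) (fact assms d f rho beta diam)+
  show ?thesis
    by (intro tuned_sample.intro tuning_axioms outlier_sample.intro O.outlier_distribution_axioms iid_sample.intro
        O.P.prob_space_axioms tuned_sample_axioms.intro assms(2))
qed

lemma probability_limit:
  assumes model: "(P, M) \<in> outlier_model D d Cd fmin fmax \<rho> \<beta>" and tse: "is_TSE D d tse" and fps: "is_FPS fps"
  shows "(\<lambda>n. inner_prob (sample_measure P n) {X\<in>space (sample_measure P n).
      hausdist_in (B0 D d Cd fmin \<rho>) M (carrier_of (M_TDC_plus wt tse fps D d \<rho> \<beta> k1 k2 c t 1 M n X)) \<le> CC * rate d \<beta> n \<and>
      ambient_isotopic D M (carrier_of (M_TDC_plus wt tse fps D d \<rho> \<beta> k1 k2 c t 1 M n X))}) \<longlonglongrightarrow> 1"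
    (is "(\<lambda>n. inner_prob _ (?G n)) \<longlonglongrightarrow> 1")
proof (rule tendsto_sandwich)
  show "(\<lambda>n. 1 - Cb / real n ^ 3) \<longlonglongrightarrow> 1" by real_asymp
  show "\<forall>\<^sub>F n in sequentially. 1 - Cb / real n ^ 3 \<le> inner_prob (sample_measure P n) (?G n)"
    using eventually_large
  proof eventually_elim
    case (elim n)
    interpret tuned_sample d D Cd fmin fmax \<rho> \<beta> \<epsilon>\<^sub>d C\<^sub>d wt P M n by (rule tuned_sampleI[OF model elim])
    show ?case by (rule probability_bound[OF tse fps])
  qed
  show "\<forall>\<^sub>F n in sequentially. inner_prob (sample_measure P n) (?G n) \<le> 1"
    using eventually_large
  proof eventually_elim
    case (elim n)
    interpret tuned_sample d D Cd fmin fmax \<rho> \<beta> \<epsilon>\<^sub>d C\<^sub>d wt P M n by (rule tuned_sampleI[OF model elim])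
    show ?case unfolding inner_prob_def by (rule cSUP_least) auto
  qed
qed simp

lemma expectation_eventually:
  assumes tse: "is_TSE D d tse" and fps: "is_FPS fps"
  shows "\<forall>\<^sub>F n in sequentially. (SUP (P, M)\<in>outlier_model D d Cd fmin fmax \<rho> \<beta>. upper_expectation (sample_measure P n)
      (\<lambda>X. ennreal (hausdist_in (B0 D d Cd fmin \<rho>) M (carrier_of (M_TDC_plus wt tse fps D d \<rho> \<beta> k1 k2 c t 1 M n X)))))
      \<le> ennreal ((CC + 1) * rate d \<beta> n)"
  using eventually_large
proof eventually_elim
  case (elim n)
  have "upper_expectation (sample_measure P n)
      (\<lambda>X. ennreal (hausdist_in (B0 D d Cd fmin \<rho>) M (carrier_of (M_TDC_plus wt tse fps D d \<rho> \<beta> k1 k2 c t 1 M n X))))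
      \<le> ennreal ((CC + 1) * rate d \<beta> n)" if "(P, M) \<in> outlier_model D d Cd fmin fmax \<rho> \<beta>" for P M
    by (rule tuned_sample.expectation_bound[OF tuned_sampleI[OF that elim] tse fps])
  then show ?case by (intro SUP_least) auto
qed

end

theorem theorem9:
  fixes d :: nat and Cd fmin fmax :: real and wt :: weights
  assumes "1 \<le> d" and "0 < fmin" and "fmin \<le> fmax"
    and "diameter_constant d Cd" and "boissonnat_ghosh_weights d wt"
  shows "\<exists>c'>0. \<forall>\<rho>>0. \<exists>c>0. \<exists>C>0. \<exists>C'>0. \<forall>D>d. \<forall>\<beta>. 0 < \<beta> \<and> \<beta> \<le> 1 \<longrightarrow>
    (\<exists>k1>0. \<exists>k2>0. \<exists>t>0. \<forall>tse fps. is_TSE D d tse \<and> is_FPS fps \<longrightarrow>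
      (let Mhat = M_TDC_plus wt tse fps D d \<rho> \<beta> k1 k2 c t c';
           model = outlier_model D d Cd fmin fmax \<rho> \<beta>;
           d\<^sub>H = hausdist_in (B0 D d Cd fmin \<rho>);
           rate = (\<lambda>n. (ln (real n) / (\<beta> * real n)) powr (2 / real d))
       in (\<forall>M n X. abstract_complex (Mhat M n X) \<and> \<Union>(Mhat M n X) \<subseteq> X ` {..<n}) \<and>
          (\<forall>(P, M)\<in>model.
            (\<lambda>n. inner_prob (sample_measure P n)
              {X\<in>space (sample_measure P n).
                d\<^sub>H M (carrier_of (Mhat M n X)) \<le> C * rate n \<and>
                ambient_isotopic D M (carrier_of (Mhat M n X))}) \<longlonglongrightarrow> 1) \<and>
          (\<forall>\<^sub>F n in sequentially.
            (SUP (P, M)\<in>model. upper_expectation (sample_measure P n)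
              (\<lambda>X. ennreal (d\<^sub>H M (carrier_of (Mhat M n X))))) \<le> ennreal (C' * rate n))))"
  proof -
  from conjunct2[OF assms(5)[unfolded boissonnat_ghosh_weights_def]] obtain \<epsilon>\<^sub>d C\<^sub>d where BG: "0 < \<epsilon>\<^sub>d" "0 < C\<^sub>d"
    and "\<forall>D>d. \<forall>\<rho>>0. \<forall>\<epsilon>>0. \<epsilon> \<le> \<epsilon>\<^sub>d * \<rho> \<longrightarrow> (\<forall>M\<in>manifolds D d \<rho>. \<forall>P. eps_net \<epsilon> M P \<longrightarrow>
      hausdist M (carrier_of (tdc_star wt D P (tangent_space M))) \<le> C\<^sub>d * \<epsilon>\<^sup>2 / \<rho> \<and>
      ambient_isotopic D M (carrier_of (tdc_star wt D P (tangent_space M))))"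
    by (elim exE conjE) (rule that)
  note BG = BG this[rule_format]
  have tun: "tuning d D Cd fmin fmax \<rho> \<beta> \<epsilon>\<^sub>d C\<^sub>d wt" if "0 < \<rho>" "d < D" "0 < \<beta>" "\<beta> \<le> 1" for \<rho> D \<beta>
    by (rule tuning.intro) (fact assms that BG)+
  show ?thesis
  proof (rule exI[of _ 1], intro conjI zero_less_one allI impI, goal_cases)
    case (1 \<rho>)
    \<comment> \<open>The constants c, C and C' do not involve D and \<beta>, so their positivity
      may be read off from the instance D = d + 1, \<beta> = 1 before D and \<beta> are
      introduced.\<close>
    then interpret T: tuning d "Suc d" Cd fmin fmax \<rho> 1 \<epsilon>\<^sub>d C\<^sub>d wt by (rule tun) auto
    show ?case
    proof (rule exI[of _ "c_const d fmin fmax"], intro conjI T.c_pos, rule exI[of _ T.CC], intro conjI T.CC_pos,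
        rule exI[of _ "T.CC + 1"], intro conjI allI impI, goal_cases)
      case 1
      show ?case using T.CC_pos by simp
    next
      case (2 D \<beta>)
      then interpret tuning d D Cd fmin fmax \<rho> \<beta> \<epsilon>\<^sub>d C\<^sub>d wt by (intro tun T.rho) auto
      have k2_pos: "0 < 1 / (8 * \<rho>)" using rho by simp
      show ?case
      proof (rule exI[of _ "k1_const d fmin fmax"], intro conjI k1(1), rule exI[of _ "1 / (8 * \<rho>)"], intro conjI k2_pos,
          rule exI[of _ t], intro conjI t_pos allI impI, unfold Let_def, fold rate_def, intro conjI, goal_cases)
        case (1 tse fps)
        show ?case by (intro allI conjI M_TDC_plus_complex[OF conjunct2[OF 1] zero_le_one])
      next
        case (2 tse fps)
        show ?case by clarify (rule probability_limit[OF _ conjunct1[OF 2] conjunct2[OF 2]])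
      next
        case (3 tse fps)
        show ?case by (rule expectation_eventually[OF conjunct1[OF 3] conjunct2[OF 3]])
      qed
    qed
  qed
qed

end
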